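(* Let $\mathcal{B}$ be a small category. For a weight $\phi:\mathcal{B}^{op}\to\mathcal{V}$, the following conditions are equivalent: (i) $\phi$ is a small projective; (ii) $\phi*-:[\mathcal{B},\mathcal{V}]\to\mathcal{V}$ is representable; (iii) $\phi*-:[\mathcal{B},\mathcal{V}]\to\mathcal{V}$ is continuous; (iv) $\phi*-:[\mathcal{B},\mathcal{V}]\to\mathcal{V}$ preserves the limit $\{\phi,Y'\}$ of the Yoneda embedding $Y':\mathcal{B}^{op}\to[\mathcal{B},\mathcal{V}]$ weighted by $\phi$.
   Context: Throughout, $\mathcal{V}$ is a symmetric monoidal closed category whose underlying ordinary category is locally small, complete and cocomplete. "Category", "functor", "natural transformation" mean $\mathcal{V}$-category, $\mathcal{V}$-functor, $\mathcal{V}$-natural transformation. A category is small if its set of isomorphism classes of objects is small; $[\mathcal{X},\mathcal{Y}]$ denotes the functor $\mathcal{V}$-category. A weight is a functor $\phi:\mathcal{K}^{op}\to\mathcal{V}$ with $\mathcal{K}$ small. The $\phi$-weighted limit $\{\phi,T\}$ of $T:\mathcal{K}^{op}\to\mathcal{A}$ is defined by $\mathcal{A}(a,\{\phi,T\})\cong[\mathcal{K}^{op},\mathcal{V}](\phi,\mathcal{A}(a,T-))$, and the $\phi$-weighted colimit $\phi*S$ of $S:\mathcal{K}\to\mathcal{A}$ by $\mathcal{A}(\phi*S,a)\cong[\mathcal{K}^{op},\mathcal{V}](\phi,\mathcal{A}(S-,a))$, naturally in $a$. A functor is continuous (cocontinuous) if it preserves all small weighted limits (colimits), i.e. those for all weights.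 A weight $\phi:\mathcal{B}^{op}\to\mathcal{V}$ is a small projective if the representable functor $\{\phi,-\}=[\mathcal{B}^{op},\mathcal{V}](\phi,-):[\mathcal{B}^{op},\mathcal{V}]\to\mathcal{V}$ preserves all small (weighted) colimits. *)

theory Defs
  imports "HOL-Library.Equipollence"
begin

section \<open>Smallness\<close>

text \<open>
  A set is small if it is strictly smaller than a fixed set \<open>U\<close> whose cardinality is infinite,
  regular and a strong limit, i.e. if it is equipollent to an element of a Grothendieck universe.
  The countable case (small = finite) is not excluded, so such \<open>U\<close> provably exist in HOL.
  The type \<open>'u\<close> may be much larger than \<open>U\<close>: it is the type of all objects that categories
  \<open>\<K>\<close> and \<open>\<B>\<close> may have, and only \<open>U\<close> measures size.
\<close>

definition smallness_universe :: "'u set \<Rightarrow> bool" where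
  "smallness_universe U \<longleftrightarrow>
     infinite U \<and>
     (\<forall>X. X \<subseteq> U \<and> X \<prec> U \<longrightarrow> Pow X \<prec> U) \<and>
     (\<forall>I X. I \<subseteq> U \<and> I \<prec> U \<and> (\<forall>i\<in>I. X i \<subseteq> U \<and> X i \<prec> U) \<longrightarrow> (\<Union>i\<in>I. (X i :: 'u set)) \<prec> U)"

section \<open>Ordinary categories\<close>

record ('o, 'a) category =
  Ob :: "'o set"
  Arr :: "'a set"
  Dom :: "'a \<Rightarrow> 'o"
  Cod :: "'a \<Rightarrow> 'o"
  ident :: "'o \<Rightarrow> 'a"  ("\<one>\<index>")
  comp :: "'a \<Rightarrow> 'a \<Rightarrow> 'a"  (infixr "\<cdot>\<index>" 55)

definition hom :: "('o, 'a, 'm) category_scheme \<Rightarrow> 'o \<Rightarrow> 'o \<Rightarrow> 'a set" where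
  "hom C x y = {f \<in> Arr C. Dom C f = x \<and> Cod C f = y}"

locale category =
  fixes C :: "('o, 'a, 'm) category_scheme" (structure)
  assumes Dom_Ob: "f \<in> Arr C \<Longrightarrow> Dom C f \<in> Ob C"
    and Cod_Ob: "f \<in> Arr C \<Longrightarrow> Cod C f \<in> Ob C"
    and ident_hom: "x \<in> Ob C \<Longrightarrow> \<one> x \<in> hom C x x"
    and comp_hom: "\<lbrakk>f \<in> hom C x y; g \<in> hom C y z\<rbrakk> \<Longrightarrow> g \<cdot> f \<in> hom C x z"
    and comp_ident_right: "f \<in> hom C x y \<Longrightarrow> f \<cdot> \<one> x = f"
    and comp_ident_left: "f \<in> hom C x y \<Longrightarrow> \<one> y \<cdot> f = f"
    and comp_assoc: "\<lbrakk>f \<in> hom C w x; g \<in> hom C x y; h \<in> hom C y z\<rbrakk> \<Longrightarrow> (h \<cdot> g) \<cdot> f = h \<cdot> (g \<cdot> f)"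

definition inverse_arrows ::
    "('o, 'a, 'm) category_scheme \<Rightarrow> 'o \<Rightarrow> 'o \<Rightarrow> 'a \<Rightarrow> 'a \<Rightarrow> bool" where
  "inverse_arrows C x y f g \<longleftrightarrow>
     f \<in> hom C x y \<and> g \<in> hom C y x \<and> g \<cdot> f = \<one> x \<and> f \<cdot> g = \<one> y"
  for C (structure)

definition iso_arrow :: "('o, 'a, 'm) category_scheme \<Rightarrow> 'o \<Rightarrow> 'o \<Rightarrow> 'a \<Rightarrow> bool" where
  "iso_arrow C x y f \<longleftrightarrow> (\<exists>g. inverse_arrows C x y f g)"

definition inverse_of :: "('o, 'a, 'm) category_scheme \<Rightarrow> 'a \<Rightarrow> 'a" where
  "inverse_of C f = (THE g. inverse_arrows C (Dom C f) (Cod C f) f g)"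

definition is_functor ::
    "('j, 'k, 'm) category_scheme \<Rightarrow> ('o, 'a, 'n) category_scheme \<Rightarrow> ('j \<Rightarrow> 'o) \<Rightarrow> ('k \<Rightarrow> 'a) \<Rightarrow> bool" where
  "is_functor J C D E \<longleftrightarrow>
     (\<forall>j\<in>Ob J. D j \<in> Ob C) \<and>
     (\<forall>i\<in>Ob J. \<forall>j\<in>Ob J. \<forall>u\<in>hom J i j. E u \<in> hom C (D i) (D j)) \<and>
     (\<forall>j\<in>Ob J. E (ident J j) = ident C (D j)) \<and>
     (\<forall>i\<in>Ob J. \<forall>j\<in>Ob J. \<forall>k\<in>Ob J. \<forall>u\<in>hom J i j. \<forall>v\<in>hom J j k.
        E (comp J v u) = comp C (E v) (E u))"

definition is_cone ::
    "('j, 'k, 'm) category_scheme \<Rightarrow> ('o, 'a, 'n) category_scheme \<Rightarrow> ('j \<Rightarrow> 'o) \<Rightarrow> ('k \<Rightarrow> 'a) \<Rightarrow>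
     'o \<Rightarrow> ('j \<Rightarrow> 'a) \<Rightarrow> bool" where
  "is_cone J C D E x p \<longleftrightarrow>
     x \<in> Ob C \<and> (\<forall>j\<in>Ob J. p j \<in> hom C x (D j)) \<and>
     (\<forall>u\<in>Arr J. comp C (E u) (p (Dom J u)) = p (Cod J u))"

definition is_cocone ::
    "('j, 'k, 'm) category_scheme \<Rightarrow> ('o, 'a, 'n) category_scheme \<Rightarrow> ('j \<Rightarrow> 'o) \<Rightarrow> ('k \<Rightarrow> 'a) \<Rightarrow>
     'o \<Rightarrow> ('j \<Rightarrow> 'a) \<Rightarrow> bool" where
  "is_cocone J C D E x p \<longleftrightarrow>
     x \<in> Ob C \<and> (\<forall>j\<in>Ob J. p j \<in> hom C (D j) x) \<and>
     (\<forall>u\<in>Arr J. comp C (p (Cod J u)) (E u) = p (Dom J u))"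

definition has_ordinary_limit ::
    "('j, 'k, 'm) category_scheme \<Rightarrow> ('o, 'a, 'n) category_scheme \<Rightarrow> ('j \<Rightarrow> 'o) \<Rightarrow> ('k \<Rightarrow> 'a) \<Rightarrow> bool" where
  "has_ordinary_limit J C D E \<longleftrightarrow>
     (\<exists>x p. is_cone J C D E x p \<and>
        (\<forall>y q. is_cone J C D E y q \<longrightarrow> (\<exists>!h. h \<in> hom C y x \<and> (\<forall>j\<in>Ob J. comp C (p j) h = q j))))"

definition has_ordinary_colimit ::
    "('j, 'k, 'm) category_scheme \<Rightarrow> ('o, 'a, 'n) category_scheme \<Rightarrow> ('j \<Rightarrow> 'o) \<Rightarrow> ('k \<Rightarrow> 'a) \<Rightarrow> bool" where
  "has_ordinary_colimit J C D E \<longleftrightarrow>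
     (\<exists>x p. is_cocone J C D E x p \<and>
        (\<forall>y q. is_cocone J C D E y q \<longrightarrow> (\<exists>!h. h \<in> hom C x y \<and> (\<forall>j\<in>Ob J. comp C h (p j) = q j))))"

text \<open>
  Every small ordinary category is isomorphic to one whose objects and arrows are elements of \<open>U\<close>,
  so indexing by categories over the type \<open>'u\<close> loses nothing.
\<close>

definition small_complete :: "'u set \<Rightarrow> ('o, 'a, 'm) category_scheme \<Rightarrow> bool" where
  "small_complete U C \<longleftrightarrow>
     (\<forall>(J :: ('u, 'u) category) D E.
        category J \<and> Ob J \<prec> U \<and> Arr J \<prec> U \<and> is_functor J C D E \<longrightarrow> has_ordinary_limit J C D E)"

definition small_cocomplete :: "'u set \<Rightarrow> ('o, 'a, 'm) category_scheme \<Rightarrow> bool" where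
  "small_cocomplete U C \<longleftrightarrow>
     (\<forall>(J :: ('u, 'u) category) D E.
        category J \<and> Ob J \<prec> U \<and> Arr J \<prec> U \<and> is_functor J C D E \<longrightarrow> has_ordinary_colimit J C D E)"

definition locally_small :: "'u set \<Rightarrow> ('o, 'a, 'm) category_scheme \<Rightarrow> bool" where
  "locally_small U C \<longleftrightarrow> (\<forall>x\<in>Ob C. \<forall>y\<in>Ob C. hom C x y \<prec> U)"

section \<open>Symmetric monoidal closed categories\<close>

text \<open>\<open>ihom x y\<close> is the internal hom \<open>[x,y]\<close> and \<open>ev x y : [x,y] \<otimes> x \<rightarrow> y\<close> its evaluation.\<close>

record ('o, 'a) smc = "('o, 'a) category" +
  tens :: "'o \<Rightarrow> 'o \<Rightarrow> 'o"  (infixr "\<odot>\<index>" 60)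
  tensA :: "'a \<Rightarrow> 'a \<Rightarrow> 'a"  (infixr "\<otimes>\<index>" 60)
  unit :: "'o"  ("\<I>\<index>")
  assoc :: "'o \<Rightarrow> 'o \<Rightarrow> 'o \<Rightarrow> 'a"
  lunit :: "'o \<Rightarrow> 'a"
  runit :: "'o \<Rightarrow> 'a"
  symm :: "'o \<Rightarrow> 'o \<Rightarrow> 'a"
  ihom :: "'o \<Rightarrow> 'o \<Rightarrow> 'o"
  ev :: "'o \<Rightarrow> 'o \<Rightarrow> 'a"

locale smcc = category V for V :: "('o, 'a) smc" (structure) +
  assumes tens_Ob: "\<lbrakk>x \<in> Ob V; y \<in> Ob V\<rbrakk> \<Longrightarrow> x \<odot> y \<in> Ob V"
    and tensA_hom: "\<lbrakk>f \<in> hom V x x'; g \<in> hom V y y'\<rbrakk> \<Longrightarrow> f \<otimes> g \<in> hom V (x \<odot> y) (x' \<odot> y')"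
    and tensA_ident: "\<lbrakk>x \<in> Ob V; y \<in> Ob V\<rbrakk> \<Longrightarrow> \<one> x \<otimes> \<one> y = \<one> (x \<odot> y)"
    and tensA_comp:
      "\<lbrakk>f \<in> hom V x x'; f' \<in> hom V x' x''; g \<in> hom V y y'; g' \<in> hom V y' y''\<rbrakk>
        \<Longrightarrow> (f' \<cdot> f) \<otimes> (g' \<cdot> g) = (f' \<otimes> g') \<cdot> (f \<otimes> g)"
    and unit_Ob: "\<I> \<in> Ob V"
    and assoc_iso: "\<lbrakk>x \<in> Ob V; y \<in> Ob V; z \<in> Ob V\<rbrakk>
        \<Longrightarrow> iso_arrow V ((x \<odot> y) \<odot> z) (x \<odot> (y \<odot> z)) (assoc V x y z)"
    and lunit_iso: "x \<in> Ob V \<Longrightarrow> iso_arrow V (\<I> \<odot> x) x (lunit V x)"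
    and runit_iso: "x \<in> Ob V \<Longrightarrow> iso_arrow V (x \<odot> \<I>) x (runit V x)"
    and symm_hom: "\<lbrakk>x \<in> Ob V; y \<in> Ob V\<rbrakk> \<Longrightarrow> symm V x y \<in> hom V (x \<odot> y) (y \<odot> x)"
    and assoc_natural: "\<lbrakk>f \<in> hom V x x'; g \<in> hom V y y'; h \<in> hom V z z'\<rbrakk>
        \<Longrightarrow> assoc V x' y' z' \<cdot> ((f \<otimes> g) \<otimes> h) = (f \<otimes> (g \<otimes> h)) \<cdot> assoc V x y z"
    and lunit_natural: "f \<in> hom V x y \<Longrightarrow> lunit V y \<cdot> (\<one> \<I> \<otimes> f) = f \<cdot> lunit V x"
    and runit_natural: "f \<in> hom V x y \<Longrightarrow> runit V y \<cdot> (f \<otimes> \<one> \<I>) = f \<cdot> runit V x"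
    and symm_natural: "\<lbrakk>f \<in> hom V x x'; g \<in> hom V y y'\<rbrakk>
        \<Longrightarrow> symm V x' y' \<cdot> (f \<otimes> g) = (g \<otimes> f) \<cdot> symm V x y"
    and pentagon: "\<lbrakk>w \<in> Ob V; x \<in> Ob V; y \<in> Ob V; z \<in> Ob V\<rbrakk>
        \<Longrightarrow> assoc V w x (y \<odot> z) \<cdot> assoc V (w \<odot> x) y z
          = (\<one> w \<otimes> assoc V x y z) \<cdot> assoc V w (x \<odot> y) z \<cdot> (assoc V w x y \<otimes> \<one> z)"
    and triangle: "\<lbrakk>x \<in> Ob V; y \<in> Ob V\<rbrakk>
        \<Longrightarrow> (\<one> x \<otimes> lunit V y) \<cdot> assoc V x \<I> y = runit V x \<otimes> \<one> y"
    and hexagon: "\<lbrakk>x \<in> Ob V; y \<in> Ob V; z \<in> Ob V\<rbrakk>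
        \<Longrightarrow> assoc V y z x \<cdot> symm V x (y \<odot> z) \<cdot> assoc V x y z
          = (\<one> y \<otimes> symm V x z) \<cdot> assoc V y x z \<cdot> (symm V x y \<otimes> \<one> z)"
    and symmetry: "\<lbrakk>x \<in> Ob V; y \<in> Ob V\<rbrakk> \<Longrightarrow> symm V y x \<cdot> symm V x y = \<one> (x \<odot> y)"
    and ihom_Ob: "\<lbrakk>x \<in> Ob V; y \<in> Ob V\<rbrakk> \<Longrightarrow> ihom V x y \<in> Ob V"
    and ev_hom: "\<lbrakk>x \<in> Ob V; y \<in> Ob V\<rbrakk> \<Longrightarrow> ev V x y \<in> hom V (ihom V x y \<odot> x) y"
    and closed: "\<lbrakk>x \<in> Ob V; y \<in> Ob V; z \<in> Ob V; f \<in> hom V (z \<odot> x) y\<rbrakk>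
        \<Longrightarrow> \<exists>!g. g \<in> hom V z (ihom V x y) \<and> ev V x y \<cdot> (g \<otimes> \<one> x) = f"

text \<open>The transpose \<open>z \<rightarrow> [x,y]\<close> of \<open>f : z \<otimes> x \<rightarrow> y\<close>.\<close>

definition transp :: "('o, 'a) smc \<Rightarrow> 'o \<Rightarrow> 'o \<Rightarrow> 'o \<Rightarrow> 'a \<Rightarrow> 'a" where
  "transp V z x y f = (THE g. g \<in> hom V z (ihom V x y) \<and> ev V x y \<cdot> (g \<otimes> \<one> x) = f)"
  for V (structure)

text \<open>The arrow \<open>x \<rightarrow> y\<close> named by an element \<open>f : I \<rightarrow> [x,y]\<close>.\<close>

definition unname :: "('o, 'a) smc \<Rightarrow> 'o \<Rightarrow> 'o \<Rightarrow> 'a \<Rightarrow> 'a" where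
  "unname V x y f = ev V x y \<cdot> (f \<otimes> \<one> x) \<cdot> inverse_of V (lunit V x)"
  for V (structure)

section \<open>Enriched categories, functors and natural transformations\<close>

text \<open>
  \<open>VId A a : I \<rightarrow> A(a,a)\<close> and \<open>VComp A a b c : A(b,c) \<otimes> A(a,b) \<rightarrow> A(a,c)\<close>.
\<close>

record ('c, 'o, 'a) vcat =
  VOb :: "'c set"
  VHom :: "'c \<Rightarrow> 'c \<Rightarrow> 'o"
  VId :: "'c \<Rightarrow> 'a"
  VComp :: "'c \<Rightarrow> 'c \<Rightarrow> 'c \<Rightarrow> 'a"

locale vcategory = smcc V for V :: "('o, 'a) smc" (structure) +
  fixes A :: "('c, 'o, 'a) vcat"
  assumes VHom_Ob: "\<lbrakk>a \<in> VOb A; b \<in> VOb A\<rbrakk> \<Longrightarrow> VHom A a b \<in> Ob V"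
    and VId_hom: "a \<in> VOb A \<Longrightarrow> VId A a \<in> hom V \<I> (VHom A a a)"
    and VComp_hom: "\<lbrakk>a \<in> VOb A; b \<in> VOb A; c \<in> VOb A\<rbrakk>
        \<Longrightarrow> VComp A a b c \<in> hom V (VHom A b c \<odot> VHom A a b) (VHom A a c)"
    and VComp_assoc: "\<lbrakk>a \<in> VOb A; b \<in> VOb A; c \<in> VOb A; d \<in> VOb A\<rbrakk>
        \<Longrightarrow> VComp A a b d \<cdot> (VComp A b c d \<otimes> \<one> (VHom A a b))
          = VComp A a c d \<cdot> (\<one> (VHom A c d) \<otimes> VComp A a b c)
              \<cdot> assoc V (VHom A c d) (VHom A b c) (VHom A a b)"
    and VComp_VId_left: "\<lbrakk>a \<in> VOb A; b \<in> VOb A\<rbrakk>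
        \<Longrightarrow> VComp A a b b \<cdot> (VId A b \<otimes> \<one> (VHom A a b)) = lunit V (VHom A a b)"
    and VComp_VId_right: "\<lbrakk>a \<in> VOb A; b \<in> VOb A\<rbrakk>
        \<Longrightarrow> VComp A a a b \<cdot> (\<one> (VHom A a b) \<otimes> VId A a) = runit V (VHom A a b)"

definition opp :: "('o, 'a) smc \<Rightarrow> ('c, 'o, 'a) vcat \<Rightarrow> ('c, 'o, 'a) vcat" where
  "opp V A = \<lparr>VOb = VOb A, VHom = (\<lambda>a b. VHom A b a), VId = VId A,
     VComp = (\<lambda>a b c. VComp A c b a \<cdot> symm V (VHom A c b) (VHom A b a))\<rparr>"
  for V (structure)

text \<open>\<open>V\<close> as a category enriched in itself.\<close>

definition self_enriched :: "('o, 'a) smc \<Rightarrow> ('o, 'o, 'a) vcat" where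
  "self_enriched V = \<lparr>VOb = Ob V, VHom = ihom V,
     VId = (\<lambda>x. transp V \<I> x x (lunit V x)),
     VComp = (\<lambda>x y z. transp V (ihom V y z \<odot> ihom V x y) x z
        (ev V y z \<cdot> (\<one> (ihom V y z) \<otimes> ev V x y) \<cdot> assoc V (ihom V y z) (ihom V x y) x))\<rparr>"
  for V (structure)

text \<open>The composite of \<open>f : I \<rightarrow> A(a,b)\<close> and \<open>g : I \<rightarrow> A(b,c)\<close> in the underlying category of \<open>A\<close>.\<close>

definition ucomp :: "('o, 'a) smc \<Rightarrow> ('c, 'o, 'a) vcat \<Rightarrow> 'c \<Rightarrow> 'c \<Rightarrow> 'c \<Rightarrow> 'a \<Rightarrow> 'a \<Rightarrow> 'a" where
  "ucomp V A a b c g f = VComp A a b c \<cdot> (g \<otimes> f) \<cdot> inverse_of V (lunit V \<I>)"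
  for V (structure)

definition viso :: "('o, 'a) smc \<Rightarrow> ('c, 'o, 'a) vcat \<Rightarrow> 'c \<Rightarrow> 'c \<Rightarrow> 'a \<Rightarrow> bool" where
  "viso V A a b f \<longleftrightarrow> f \<in> hom V \<I> (VHom A a b) \<and>
     (\<exists>g \<in> hom V \<I> (VHom A b a). ucomp V A a b a g f = VId A a \<and> ucomp V A b a b f g = VId A b)"
  for V (structure)

definition iso_class :: "('o, 'a) smc \<Rightarrow> ('c, 'o, 'a) vcat \<Rightarrow> 'c \<Rightarrow> 'c set" where
  "iso_class V A a = {b \<in> VOb A. \<exists>f. viso V A a b f}"

definition small_vcat :: "'u set \<Rightarrow> ('o, 'a) smc \<Rightarrow> ('c, 'o, 'a) vcat \<Rightarrow> bool" where
  "small_vcat U V A \<longleftrightarrow> iso_class V A ` VOb A \<prec> U"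

text \<open>
  Functors are recorded with value \<open>undefined\<close> off the objects of the source, so that
  equality of records is equality of functors.
\<close>

record ('c, 'd, 'a) vfun =
  FOb :: "'c \<Rightarrow> 'd"
  FHom :: "'c \<Rightarrow> 'c \<Rightarrow> 'a"

locale vfunctor = source: vcategory V A + target: vcategory V B
  for V :: "('o, 'a) smc" (structure) and A :: "('c, 'o, 'a) vcat" and B :: "('d, 'o, 'a) vcat" +
  fixes F :: "('c, 'd, 'a) vfun"
  assumes FOb_VOb: "a \<in> VOb A \<Longrightarrow> FOb F a \<in> VOb B"
    and FHom_hom: "\<lbrakk>a \<in> VOb A; b \<in> VOb A\<rbrakk>
        \<Longrightarrow> FHom F a b \<in> hom V (VHom A a b) (VHom B (FOb F a) (FOb F b))"
    and FHom_VId: "a \<in> VOb A \<Longrightarrow> FHom F a a \<cdot> VId A a = VId B (FOb F a)"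
    and FHom_VComp: "\<lbrakk>a \<in> VOb A; b \<in> VOb A; c \<in> VOb A\<rbrakk>
        \<Longrightarrow> FHom F a c \<cdot> VComp A a b c
          = VComp B (FOb F a) (FOb F b) (FOb F c) \<cdot> (FHom F b c \<otimes> FHom F a b)"
    and FOb_undefined: "a \<notin> VOb A \<Longrightarrow> FOb F a = undefined"
    and FHom_undefined: "a \<notin> VOb A \<or> b \<notin> VOb A \<Longrightarrow> FHom F a b = undefined"

definition mk_vfun ::
    "('c, 'o, 'a) vcat \<Rightarrow> ('c \<Rightarrow> 'd) \<Rightarrow> ('c \<Rightarrow> 'c \<Rightarrow> 'a) \<Rightarrow> ('c, 'd, 'a) vfun" where
  "mk_vfun A f h = \<lparr>FOb = (\<lambda>a. if a \<in> VOb A then f a else undefined),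
     FHom = (\<lambda>a b. if a \<in> VOb A \<and> b \<in> VOb A then h a b else undefined)\<rparr>"

definition id_vfun :: "('o, 'a) smc \<Rightarrow> ('c, 'o, 'a) vcat \<Rightarrow> ('c, 'c, 'a) vfun" where
  "id_vfun V A = mk_vfun A (\<lambda>a. a) (\<lambda>a b. ident V (VHom A a b))"

definition comp_vfun ::
    "('o, 'a) smc \<Rightarrow> ('c, 'o, 'a) vcat \<Rightarrow> ('d, 'e, 'a) vfun \<Rightarrow> ('c, 'd, 'a) vfun \<Rightarrow> ('c, 'e, 'a) vfun" where
  "comp_vfun V A G F = mk_vfun A (\<lambda>a. FOb G (FOb F a))
     (\<lambda>a b. FHom G (FOb F a) (FOb F b) \<cdot> FHom F a b)"
  for V (structure)

definition op_vfun :: "('c, 'd, 'a) vfun \<Rightarrow> ('c, 'd, 'a) vfun" where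
  "op_vfun F = \<lparr>FOb = FOb F, FHom = (\<lambda>a b. FHom F b a)\<rparr>"

definition vnat ::
    "('o, 'a) smc \<Rightarrow> ('c, 'o, 'a) vcat \<Rightarrow> ('d, 'o, 'a) vcat \<Rightarrow>
     ('c, 'd, 'a) vfun \<Rightarrow> ('c, 'd, 'a) vfun \<Rightarrow> ('c \<Rightarrow> 'a) \<Rightarrow> bool" where
  "vnat V A B F G \<alpha> \<longleftrightarrow>
     (\<forall>a\<in>VOb A. \<alpha> a \<in> hom V \<I> (VHom B (FOb F a) (FOb G a))) \<and>
     (\<forall>a\<in>VOb A. \<forall>b\<in>VOb A.
        VComp B (FOb F a) (FOb F b) (FOb G b) \<cdot> (\<alpha> b \<otimes> FHom F a b) \<cdot> inverse_of V (lunit V (VHom A a b))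
      = VComp B (FOb F a) (FOb G a) (FOb G b) \<cdot> (FHom G a b \<otimes> \<alpha> a) \<cdot> inverse_of V (runit V (VHom A a b)))"
  for V (structure)

definition vnat_iso ::
    "('o, 'a) smc \<Rightarrow> ('c, 'o, 'a) vcat \<Rightarrow> ('d, 'o, 'a) vcat \<Rightarrow>
     ('c, 'd, 'a) vfun \<Rightarrow> ('c, 'd, 'a) vfun \<Rightarrow> ('c \<Rightarrow> 'a) \<Rightarrow> bool" where
  "vnat_iso V A B F G \<alpha> \<longleftrightarrow>
     vnat V A B F G \<alpha> \<and> (\<forall>a\<in>VOb A. viso V B (FOb F a) (FOb G a) (\<alpha> a))"

section \<open>Functor categories\<close>

text \<open>
  The hom-object \<open>[A,B](F,G)\<close> is a chosen end of \<open>B(Fa,Ga)\<close> with its projections.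
  The wedge condition is stated in the untransposed form, as an equality of maps
  \<open>x \<otimes> A(a,b) \<rightarrow> B(Fa,Gb)\<close>, which makes sense for every \<open>B\<close>.
\<close>

definition is_wedge ::
    "('o, 'a) smc \<Rightarrow> ('c, 'o, 'a) vcat \<Rightarrow> ('d, 'o, 'a) vcat \<Rightarrow>
     ('c, 'd, 'a) vfun \<Rightarrow> ('c, 'd, 'a) vfun \<Rightarrow> 'o \<Rightarrow> ('c \<Rightarrow> 'a) \<Rightarrow> bool" where
  "is_wedge V A B F G x \<tau> \<longleftrightarrow>
     x \<in> Ob V \<and>
     (\<forall>a\<in>VOb A. \<tau> a \<in> hom V x (VHom B (FOb F a) (FOb G a))) \<and>
     (\<forall>a\<in>VOb A. \<forall>b\<in>VOb A.
        VComp B (FOb F a) (FOb F b) (FOb G b) \<cdot> (\<tau> b \<otimes> FHom F a b)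
      = VComp B (FOb F a) (FOb G a) (FOb G b) \<cdot> (FHom G a b \<otimes> \<tau> a) \<cdot> symm V x (VHom A a b))"
  for V (structure)

definition is_end ::
    "('o, 'a) smc \<Rightarrow> ('c, 'o, 'a) vcat \<Rightarrow> ('d, 'o, 'a) vcat \<Rightarrow>
     ('c, 'd, 'a) vfun \<Rightarrow> ('c, 'd, 'a) vfun \<Rightarrow> 'o \<Rightarrow> ('c \<Rightarrow> 'a) \<Rightarrow> bool" where
  "is_end V A B F G e \<pi> \<longleftrightarrow>
     is_wedge V A B F G e \<pi> \<and>
     (\<forall>x \<tau>. is_wedge V A B F G x \<tau> \<longrightarrow>
        (\<exists>!h. h \<in> hom V x e \<and> (\<forall>a\<in>VOb A. comp V (\<pi> a) h = \<tau> a)))"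

definition chosen_end ::
    "('o, 'a) smc \<Rightarrow> ('c, 'o, 'a) vcat \<Rightarrow> ('d, 'o, 'a) vcat \<Rightarrow>
     ('c, 'd, 'a) vfun \<Rightarrow> ('c, 'd, 'a) vfun \<Rightarrow> 'o \<times> ('c \<Rightarrow> 'a)" where
  "chosen_end V A B F G = (SOME (e, \<pi>). is_end V A B F G e \<pi>)"

abbreviation Nat_ob ::
    "('o, 'a) smc \<Rightarrow> ('c, 'o, 'a) vcat \<Rightarrow> ('d, 'o, 'a) vcat \<Rightarrow>
     ('c, 'd, 'a) vfun \<Rightarrow> ('c, 'd, 'a) vfun \<Rightarrow> 'o" where
  "Nat_ob V A B F G \<equiv> fst (chosen_end V A B F G)"

abbreviation Nat_proj ::
    "('o, 'a) smc \<Rightarrow> ('c, 'o, 'a) vcat \<Rightarrow> ('d, 'o, 'a) vcat \<Rightarrow>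
     ('c, 'd, 'a) vfun \<Rightarrow> ('c, 'd, 'a) vfun \<Rightarrow> 'c \<Rightarrow> 'a" where
  "Nat_proj V A B F G \<equiv> snd (chosen_end V A B F G)"

text \<open>The map \<open>x \<rightarrow> [A,B](F,G)\<close> with components \<open>\<tau> a : x \<rightarrow> B(Fa,Ga)\<close>.\<close>

definition into_Nat ::
    "('o, 'a) smc \<Rightarrow> ('c, 'o, 'a) vcat \<Rightarrow> ('d, 'o, 'a) vcat \<Rightarrow>
     ('c, 'd, 'a) vfun \<Rightarrow> ('c, 'd, 'a) vfun \<Rightarrow> 'o \<Rightarrow> ('c \<Rightarrow> 'a) \<Rightarrow> 'a" where
  "into_Nat V A B F G x \<tau> =
     (THE h. h \<in> hom V x (Nat_ob V A B F G) \<and>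
        (\<forall>a\<in>VOb A. comp V (Nat_proj V A B F G a) h = \<tau> a))"

definition functor_cat ::
    "('o, 'a) smc \<Rightarrow> ('c, 'o, 'a) vcat \<Rightarrow> ('d, 'o, 'a) vcat \<Rightarrow> (('c, 'd, 'a) vfun, 'o, 'a) vcat" where
  "functor_cat V A B = \<lparr>
     VOb = {F. vfunctor V A B F},
     VHom = Nat_ob V A B,
     VId = (\<lambda>F. into_Nat V A B F F \<I> (\<lambda>a. VId B (FOb F a))),
     VComp = (\<lambda>F G H. into_Nat V A B F H (Nat_ob V A B G H \<odot> Nat_ob V A B F G)
        (\<lambda>a. VComp B (FOb F a) (FOb G a) (FOb H a) \<cdot> (Nat_proj V A B G H a \<otimes> Nat_proj V A B F G a)))\<rparr>"
  for V (structure)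

section \<open>Representable functors\<close>

text \<open>\<open>A(a,-) : A \<rightarrow> V\<close> and \<open>A(-,a) : A\<^sup>o\<^sup>p \<rightarrow> V\<close>.\<close>

definition cov_hom :: "('o, 'a) smc \<Rightarrow> ('c, 'o, 'a) vcat \<Rightarrow> 'c \<Rightarrow> ('c, 'o, 'a) vfun" where
  "cov_hom V A a = mk_vfun A (\<lambda>b. VHom A a b)
     (\<lambda>b c. transp V (VHom A b c) (VHom A a b) (VHom A a c) (VComp A a b c))"

definition contra_hom :: "('o, 'a) smc \<Rightarrow> ('c, 'o, 'a) vcat \<Rightarrow> 'c \<Rightarrow> ('c, 'o, 'a) vfun" where
  "contra_hom V A a = mk_vfun (opp V A) (\<lambda>b. VHom A b a)
     (\<lambda>b c. transp V (VHom A c b) (VHom A b a) (VHom A c a)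
        (VComp A c b a \<cdot> symm V (VHom A c b) (VHom A b a)))"
  for V (structure)

definition v_representable :: "('o, 'a) smc \<Rightarrow> ('c, 'o, 'a) vcat \<Rightarrow> ('c, 'o, 'a) vfun \<Rightarrow> bool" where
  "v_representable V A F \<longleftrightarrow> (\<exists>a\<in>VOb A. \<exists>\<theta>. vnat_iso V A (self_enriched V) (cov_hom V A a) F \<theta>)"

text \<open>
  For \<open>T : X \<rightarrow> A\<close>, the functor \<open>a \<mapsto> A(a,T-)\<close> from \<open>A\<^sup>o\<^sup>p\<close> to \<open>[X,V]\<close>;
  for \<open>S : K \<rightarrow> A\<close>, the functor \<open>a \<mapsto> A(S-,a)\<close> from \<open>A\<close> to \<open>[K\<^sup>o\<^sup>p,V]\<close>.
\<close>

definition hom_into ::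
    "('o, 'a) smc \<Rightarrow> ('x, 'o, 'a) vcat \<Rightarrow> ('c, 'o, 'a) vcat \<Rightarrow> ('x, 'c, 'a) vfun \<Rightarrow>
     'c \<Rightarrow> ('x, 'o, 'a) vfun" where
  "hom_into V X A T a = comp_vfun V X (cov_hom V A a) T"

definition hom_into_functor ::
    "('o, 'a) smc \<Rightarrow> ('x, 'o, 'a) vcat \<Rightarrow> ('c, 'o, 'a) vcat \<Rightarrow> ('x, 'c, 'a) vfun \<Rightarrow>
     ('c, ('x, 'o, 'a) vfun, 'a) vfun" where
  "hom_into_functor V X A T = mk_vfun (opp V A) (hom_into V X A T)
     (\<lambda>a b. into_Nat V X (self_enriched V) (hom_into V X A T a) (hom_into V X A T b) (VHom A b a)
        (\<lambda>x. FHom (contra_hom V A (FOb T x)) a b))"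

definition hom_from ::
    "('o, 'a) smc \<Rightarrow> ('k, 'o, 'a) vcat \<Rightarrow> ('c, 'o, 'a) vcat \<Rightarrow> ('k, 'c, 'a) vfun \<Rightarrow>
     'c \<Rightarrow> ('k, 'o, 'a) vfun" where
  "hom_from V K A S a = comp_vfun V (opp V K) (contra_hom V A a) (op_vfun S)"

definition hom_from_functor ::
    "('o, 'a) smc \<Rightarrow> ('k, 'o, 'a) vcat \<Rightarrow> ('c, 'o, 'a) vcat \<Rightarrow> ('k, 'c, 'a) vfun \<Rightarrow>
     ('c, ('k, 'o, 'a) vfun, 'a) vfun" where
  "hom_from_functor V K A S = mk_vfun A (hom_from V K A S)
     (\<lambda>a b. into_Nat V (opp V K) (self_enriched V) (hom_from V K A S a) (hom_from V K A S b) (VHom A a b)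
        (\<lambda>k. FHom (cov_hom V A (FOb S k)) a b))"

text \<open>The Yoneda embedding \<open>b \<mapsto> B(b,-)\<close> from \<open>B\<^sup>o\<^sup>p\<close> to \<open>[B,V]\<close>.\<close>

definition yoneda' ::
    "('o, 'a) smc \<Rightarrow> ('c, 'o, 'a) vcat \<Rightarrow> ('c, ('c, 'o, 'a) vfun, 'a) vfun" where
  "yoneda' V B = hom_into_functor V B B (id_vfun V B)"

section \<open>Weighted limits and colimits\<close>

definition is_weight :: "('o, 'a) smc \<Rightarrow> ('k, 'o, 'a) vcat \<Rightarrow> ('k, 'o, 'a) vfun \<Rightarrow> bool" where
  "is_weight V K \<phi> \<longleftrightarrow> vfunctor V (opp V K) (self_enriched V) \<phi>"

abbreviation presheaves :: "('o, 'a) smc \<Rightarrow> ('k, 'o, 'a) vcat \<Rightarrow> (('k, 'o, 'a) vfun, 'o, 'a) vcat" where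
  "presheaves V K \<equiv> functor_cat V (opp V K) (self_enriched V)"

text \<open>
  A limit of \<open>T : K\<^sup>o\<^sup>p \<rightarrow> A\<close> weighted by \<open>\<phi>\<close> is an object \<open>L\<close> with an isomorphism
  \<open>\<theta> a : A(a,L) \<cong> [K\<^sup>o\<^sup>p,V](\<phi>, A(a,T-))\<close> in \<open>V\<close>, enriched-natural in \<open>a \<in> A\<^sup>o\<^sup>p\<close>.
  Dually, \<open>A(C,a) \<cong> [K\<^sup>o\<^sup>p,V](\<phi>, A(S-,a))\<close> for a colimit \<open>C\<close> of \<open>S : K \<rightarrow> A\<close>.
\<close>

definition is_wlimit ::
    "('o, 'a) smc \<Rightarrow> ('c, 'o, 'a) vcat \<Rightarrow> ('k, 'o, 'a) vcat \<Rightarrow> ('k, 'o, 'a) vfun \<Rightarrow>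
     ('k, 'c, 'a) vfun \<Rightarrow> 'c \<Rightarrow> ('c \<Rightarrow> 'a) \<Rightarrow> bool" where
  "is_wlimit V A K \<phi> T L \<theta> \<longleftrightarrow>
     L \<in> VOb A \<and>
     vnat_iso V (opp V A) (self_enriched V) (contra_hom V A L)
       (comp_vfun V (opp V A) (cov_hom V (presheaves V K) \<phi>) (hom_into_functor V (opp V K) A T)) \<theta>"

definition is_wcolimit ::
    "('o, 'a) smc \<Rightarrow> ('c, 'o, 'a) vcat \<Rightarrow> ('k, 'o, 'a) vcat \<Rightarrow> ('k, 'o, 'a) vfun \<Rightarrow>
     ('k, 'c, 'a) vfun \<Rightarrow> 'c \<Rightarrow> ('c \<Rightarrow> 'a) \<Rightarrow> bool" where
  "is_wcolimit V A K \<phi> S C \<theta> \<longleftrightarrow>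
     C \<in> VOb A \<and>
     vnat_iso V A (self_enriched V) (cov_hom V A C)
       (comp_vfun V A (cov_hom V (presheaves V K) \<phi>) (hom_from_functor V K A S)) \<theta>"

text \<open>
  The image of the identity under the representing isomorphism, as a natural transformation
  with components \<open>\<phi> k \<rightarrow> A(L, T k)\<close>, respectively \<open>\<phi> k \<rightarrow> A(S k, C)\<close>: the element
  \<open>I \<rightarrow> A(L,L) \<rightarrow> [K\<^sup>o\<^sup>p,V](\<phi>, A(L,T-))\<close> is projected to \<open>[\<phi> k, A(L,T k)]\<close> and unnamed.
\<close>

definition wlimit_unit ::
    "('o, 'a) smc \<Rightarrow> ('c, 'o, 'a) vcat \<Rightarrow> ('k, 'o, 'a) vcat \<Rightarrow> ('k, 'o, 'a) vfun \<Rightarrow>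
     ('k, 'c, 'a) vfun \<Rightarrow> 'c \<Rightarrow> ('c \<Rightarrow> 'a) \<Rightarrow> 'k \<Rightarrow> 'a" where
  "wlimit_unit V A K \<phi> T L \<theta> k =
     unname V (FOb \<phi> k) (VHom A L (FOb T k))
       (Nat_proj V (opp V K) (self_enriched V) \<phi> (hom_into V (opp V K) A T L) k
        \<cdot> unname V (VHom A L L) (Nat_ob V (opp V K) (self_enriched V) \<phi> (hom_into V (opp V K) A T L)) (\<theta> L)
        \<cdot> VId A L)"
  for V (structure)

definition wcolimit_unit ::
    "('o, 'a) smc \<Rightarrow> ('c, 'o, 'a) vcat \<Rightarrow> ('k, 'o, 'a) vcat \<Rightarrow> ('k, 'o, 'a) vfun \<Rightarrow>
     ('k, 'c, 'a) vfun \<Rightarrow> 'c \<Rightarrow> ('c \<Rightarrow> 'a) \<Rightarrow> 'k \<Rightarrow> 'a" where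
  "wcolimit_unit V A K \<phi> S C \<theta> k =
     unname V (FOb \<phi> k) (VHom A (FOb S k) C)
       (Nat_proj V (opp V K) (self_enriched V) \<phi> (hom_from V K A S C) k
        \<cdot> unname V (VHom A C C) (Nat_ob V (opp V K) (self_enriched V) \<phi> (hom_from V K A S C)) (\<theta> C)
        \<cdot> VId A C)"
  for V (structure)

text \<open>
  \<open>F : A \<rightarrow> A'\<close> preserves a (co)limit if, whenever \<open>L\<close> is one with unit \<open>\<eta>\<close>, the object \<open>F L\<close>
  is one of the composite diagram with unit \<open>F \<eta>\<close>.
\<close>

definition preserves_wlimit ::
    "('o, 'a) smc \<Rightarrow> ('c, 'o, 'a) vcat \<Rightarrow> ('d, 'o, 'a) vcat \<Rightarrow> ('c, 'd, 'a) vfun \<Rightarrow>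
     ('k, 'o, 'a) vcat \<Rightarrow> ('k, 'o, 'a) vfun \<Rightarrow> ('k, 'c, 'a) vfun \<Rightarrow> bool" where
  "preserves_wlimit V A A' F K \<phi> T \<longleftrightarrow>
     (\<forall>L \<theta>. is_wlimit V A K \<phi> T L \<theta> \<longrightarrow>
        (\<exists>\<theta>'. is_wlimit V A' K \<phi> (comp_vfun V (opp V K) F T) (FOb F L) \<theta>' \<and>
           (\<forall>k\<in>VOb K. wlimit_unit V A' K \<phi> (comp_vfun V (opp V K) F T) (FOb F L) \<theta>' k
              = FHom F L (FOb T k) \<cdot> wlimit_unit V A K \<phi> T L \<theta> k)))"
  for V (structure)

definition preserves_wcolimit ::
    "('o, 'a) smc \<Rightarrow> ('c, 'o, 'a) vcat \<Rightarrow> ('d, 'o, 'a) vcat \<Rightarrow> ('c, 'd, 'a) vfun \<Rightarrow>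
     ('k, 'o, 'a) vcat \<Rightarrow> ('k, 'o, 'a) vfun \<Rightarrow> ('k, 'c, 'a) vfun \<Rightarrow> bool" where
  "preserves_wcolimit V A A' F K \<phi> S \<longleftrightarrow>
     (\<forall>C \<theta>. is_wcolimit V A K \<phi> S C \<theta> \<longrightarrow>
        (\<exists>\<theta>'. is_wcolimit V A' K \<phi> (comp_vfun V K F S) (FOb F C) \<theta>' \<and>
           (\<forall>k\<in>VOb K. wcolimit_unit V A' K \<phi> (comp_vfun V K F S) (FOb F C) \<theta>' k
              = FHom F (FOb S k) C \<cdot> wcolimit_unit V A K \<phi> S C \<theta> k)))"
  for V (structure)

text \<open>
  Since \<open>'u\<close> contains \<open>U\<close>, every small category is equivalent to one with objects in \<open>'u\<close>.
\<close>

definition v_continuous ::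
    "'u set \<Rightarrow> ('o, 'a) smc \<Rightarrow> ('c, 'o, 'a) vcat \<Rightarrow> ('d, 'o, 'a) vcat \<Rightarrow> ('c, 'd, 'a) vfun \<Rightarrow> bool" where
  "v_continuous U V A A' F \<longleftrightarrow>
     (\<forall>(K :: ('u, 'o, 'a) vcat) \<phi> T.
        vcategory V K \<and> small_vcat U V K \<and> is_weight V K \<phi> \<and> vfunctor V (opp V K) A T
        \<longrightarrow> preserves_wlimit V A A' F K \<phi> T)"

definition v_cocontinuous ::
    "'u set \<Rightarrow> ('o, 'a) smc \<Rightarrow> ('c, 'o, 'a) vcat \<Rightarrow> ('d, 'o, 'a) vcat \<Rightarrow> ('c, 'd, 'a) vfun \<Rightarrow> bool" where
  "v_cocontinuous U V A A' F \<longleftrightarrow>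
     (\<forall>(K :: ('u, 'o, 'a) vcat) \<phi> S.
        vcategory V K \<and> small_vcat U V K \<and> is_weight V K \<phi> \<and> vfunctor V K A S
        \<longrightarrow> preserves_wcolimit V A A' F K \<phi> S)"

definition small_projective ::
    "'u set \<Rightarrow> ('o, 'a) smc \<Rightarrow> ('b, 'o, 'a) vcat \<Rightarrow> ('b, 'o, 'a) vfun \<Rightarrow> bool" where
  "small_projective U V B \<phi> \<longleftrightarrow>
     v_cocontinuous U V (presheaves V B) (self_enriched V) (cov_hom V (presheaves V B) \<phi>)"

section \<open>The functor \<open>\<phi> * -\<close>\<close>

definition chosen_wcolimit ::
    "('o, 'a) smc \<Rightarrow> ('c, 'o, 'a) vcat \<Rightarrow> ('k, 'o, 'a) vcat \<Rightarrow> ('k, 'o, 'a) vfun \<Rightarrow>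
     ('k, 'c, 'a) vfun \<Rightarrow> 'c \<times> ('c \<Rightarrow> 'a)" where
  "chosen_wcolimit V A K \<phi> S = (SOME (C, \<theta>). is_wcolimit V A K \<phi> S C \<theta>)"

definition wcolim :: "('o, 'a) smc \<Rightarrow> ('b, 'o, 'a) vcat \<Rightarrow> ('b, 'o, 'a) vfun \<Rightarrow> ('b, 'o, 'a) vfun \<Rightarrow> 'o" where
  "wcolim V B \<phi> S = fst (chosen_wcolimit V (self_enriched V) B \<phi> S)"

definition wcolim_unit ::
    "('o, 'a) smc \<Rightarrow> ('b, 'o, 'a) vcat \<Rightarrow> ('b, 'o, 'a) vfun \<Rightarrow> ('b, 'o, 'a) vfun \<Rightarrow> 'b \<Rightarrow> 'a" where
  "wcolim_unit V B \<phi> S =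
     wcolimit_unit V (self_enriched V) B \<phi> S (wcolim V B \<phi> S) (snd (chosen_wcolimit V (self_enriched V) B \<phi> S))"

text \<open>
  On homs, \<open>[B,V](S,S') \<rightarrow> [\<phi> * S, \<phi> * S']\<close> is the unique map for which the units
  \<open>\<phi> b \<rightarrow> [S b, \<phi> * S]\<close> are natural in \<open>S\<close>; both sides of the equation are maps
  \<open>[B,V](S,S') \<otimes> \<phi> b \<rightarrow> [S b, \<phi> * S']\<close>.
\<close>

definition wcolim_functor ::
    "('o, 'a) smc \<Rightarrow> ('b, 'o, 'a) vcat \<Rightarrow> ('b, 'o, 'a) vfun \<Rightarrow> (('b, 'o, 'a) vfun, 'o, 'a) vfun" where
  "wcolim_functor V B \<phi> = mk_vfun (functor_cat V B (self_enriched V)) (wcolim V B \<phi>)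
     (\<lambda>S S'. THE g. g \<in> hom V (Nat_ob V B (self_enriched V) S S') (ihom V (wcolim V B \<phi> S) (wcolim V B \<phi> S')) \<and>
        (\<forall>b\<in>VOb B.
           VComp (self_enriched V) (FOb S b) (wcolim V B \<phi> S) (wcolim V B \<phi> S') \<cdot> (g \<otimes> wcolim_unit V B \<phi> S b)
         = VComp (self_enriched V) (FOb S b) (FOb S' b) (wcolim V B \<phi> S')
             \<cdot> (wcolim_unit V B \<phi> S' b \<otimes> Nat_proj V B (self_enriched V) S S' b)
             \<cdot> symm V (Nat_ob V B (self_enriched V) S S') (FOb \<phi> b)))"
  for V (structure)

end

theory Submission
  imports Defs
begin

text \<open>
  All computations take place in a linear internal language of \<open>V\<close>, whose terms are arrows out of
  tensor products of typed variables, so that structural isomorphisms disappear from sight.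

  Let \<open>\<psi> c = [B\<^sup>o\<^sup>p,V](\<phi>, B(-,c))\<close>; this is the limit \<open>{\<phi>,Y'}\<close>. There is a comparison
  \<open>\<phi> * \<psi> \<rightarrow> [B\<^sup>o\<^sup>p,V](\<phi>, \<phi>)\<close> sending \<open>q \<otimes> r\<close> to \<open>p \<mapsto> q \<cdot> (r p)\<close>, and each of the four conditions is
  equivalent to the existence of a point \<open>u : I \<rightarrow> \<phi> * \<psi>\<close> over the identity of \<open>\<phi>\<close> (a dual basis).
  Such a point makes \<open>t \<mapsto> (\<phi> * t) u\<close> an isomorphism \<open>[B,V](\<psi>, S) \<cong> \<phi> * S\<close>, so that \<open>\<psi>\<close> represents
  \<open>\<phi> * -\<close>, and makes \<open>[\<psi> -, y]\<close> the value at \<open>y\<close> of a right adjoint of \<open>[B\<^sup>o\<^sup>p,V](\<phi>, -)\<close>, so that the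
  latter is cocontinuous. Conversely, if \<open>[B\<^sup>o\<^sup>p,V](\<phi>, -)\<close> preserves the colimit \<open>\<phi> = \<phi> * Y\<close>, then
  the comparison is invertible; and if \<open>\<phi> * -\<close> preserves the limit \<open>\<psi>\<close>, then \<open>u\<close> is obtained
  from the compatible family of points \<open>p \<otimes> 1\<^sub>b\<close> of \<open>\<phi> * B(b,-)\<close>.
\<close>

section \<open>Coherence\<close>

text \<open>Seen as a module out of the unit category, a weight \<phi> has \<psi> as its only
  candidate for a right adjoint, with evaluation as counit. What may be missing is the unit of the
  adjunction; that is why four conditions of different shape reduce to one arrow \<open>u\<close>,
  and why one triangle identity is imposed on it.

  The obstacle is that \<open>V\<close> is not strict: with associators, unitors and symmetries
  written out, even associativity of composition in a functor category is a large diagram. Coherence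
  is proved once, for tensor products of finite sets of numbered variables; afterwards an equation
  of arrows is checked by evaluating both sides on generic elements and simplifying.

  Limits and colimits are defined by natural isomorphisms of chosen ends, which are awkward to
  transport. They are replaced by universal cylinders, in which a context object \<open>x\<close>
  makes a plain existence and uniqueness statement carry the enriched universal property. Smallness
  serves only to provide ends and the objects \<phi> * S, and stays out of sight until the last
  sections.\<close>

lemma hom_iff: "f \<in> hom C x y \<longleftrightarrow> f \<in> Arr C \<and> Dom C f = x \<and> Cod C f = y"
  by (simp add: hom_def)

section \<open>Composition and cancellation in an ordinary category\<close>

context category
begin

lemma comp_typing [simp]:
  assumes "f \<in> Arr C" "g \<in> Arr C" "Dom C g = Cod C f"
  shows "g \<cdot> f \<in> Arr C" "Dom C (g \<cdot> f) = Dom C f" "Cod C (g \<cdot> f) = Cod C g"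
  using comp_hom[of f "Dom C f" "Cod C f" g "Cod C g"] assms by (auto simp: hom_iff)

lemma ident_typing [simp]:
  assumes "x \<in> Ob C"
  shows "\<one> x \<in> Arr C" "Dom C (\<one> x) = x" "Cod C (\<one> x) = x"
  using ident_hom[OF assms] by (auto simp: hom_iff)

lemma Dom_Cod_Ob [simp]:
  assumes "f \<in> Arr C"
  shows "Dom C f \<in> Ob C" "Cod C f \<in> Ob C"
  using assms by (auto simp: Dom_Ob Cod_Ob)

lemma comp_one [simp]:
  assumes "f \<in> Arr C"
  shows "Dom C f = x \<Longrightarrow> f \<cdot> \<one> x = f" "Cod C f = x \<Longrightarrow> \<one> x \<cdot> f = f"
  using assms by (auto simp: hom_iff intro: comp_ident_left comp_ident_right)

lemma assoc_comp [simp]: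
  assumes "f \<in> Arr C" "g \<in> Arr C" "h \<in> Arr C" "Dom C g = Cod C f" "Dom C h = Cod C g"
  shows "(h \<cdot> g) \<cdot> f = h \<cdot> (g \<cdot> f)"
  using assms comp_assoc[of f "Dom C f" "Cod C f" g "Cod C g" h "Cod C h"] by (auto simp: hom_iff)

text \<open>Composites are normalised to the right, so an equation for \<open>g \<cdot> f\<close>
  does not match inside \<open>g \<cdot> (f \<cdot> h)\<close>; this is its usable form
  there.\<close>

lemma comp_reassoc:
  assumes "g \<cdot> f = k" "f \<in> Arr C" "g \<in> Arr C" "h \<in> Arr C" "Dom C f = Cod C h" "Dom C g = Cod C f"
  shows "g \<cdot> (f \<cdot> h) = k \<cdot> h"
  using assms by (metis assoc_comp)

lemma inverse_arrows_unique:
  assumes "inverse_arrows C x y f g" "inverse_arrows C x y f g'"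
  shows "g = g'"
proof -
  have "g = g \<cdot> (f \<cdot> g')"
    using assms by (auto simp: inverse_arrows_def hom_iff)
  also have "\<dots> = (g \<cdot> f) \<cdot> g'"
    using assms by (subst assoc_comp) (auto simp: inverse_arrows_def hom_iff)
  also have "\<dots> = g'"
    using assms by (auto simp: inverse_arrows_def hom_iff)
  finally show ?thesis .
qed

lemma inverse_of_eq: "inverse_arrows C x y f g \<Longrightarrow> inverse_of C f = g"
  unfolding inverse_of_def
  by (rule the_equality) (auto intro: inverse_arrows_unique simp: inverse_arrows_def hom_iff)

lemma iso_arrow_inverse:
  assumes "iso_arrow C x y f"
  shows "f \<in> Arr C" "Dom C f = x" "Cod C f = y"
    "inverse_of C f \<in> Arr C" "Dom C (inverse_of C f) = y" "Cod C (inverse_of C f) = x"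
    "inverse_of C f \<cdot> f = \<one> x" "f \<cdot> inverse_of C f = \<one> y"
proof -
  obtain g where g: "inverse_arrows C x y f g" using assms by (auto simp: iso_arrow_def)
  have "inverse_of C f = g" using g by (rule inverse_of_eq)
  then show "f \<in> Arr C" "Dom C f = x" "Cod C f = y"
    "inverse_of C f \<in> Arr C" "Dom C (inverse_of C f) = y" "Cod C (inverse_of C f) = x"
    "inverse_of C f \<cdot> f = \<one> x" "f \<cdot> inverse_of C f = \<one> y"
    using g by (auto simp: inverse_arrows_def hom_iff)
qed

lemma section_cancel:
  assumes "g \<cdot> f = \<one> (Dom C f)" "f \<in> Arr C" "g \<in> Arr C" "Dom C g = Cod C f"
    and "h \<in> Arr C" "k \<in> Arr C" "Cod C h = Dom C f" "Cod C k = Dom C f"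
    and "f \<cdot> h = f \<cdot> k"
  shows "h = k"
proof -
  have "h = (g \<cdot> f) \<cdot> h" using assms(1-8) by simp
  also have "\<dots> = g \<cdot> (f \<cdot> h)" using assms(2-8) by (intro assoc_comp) auto
  also have "\<dots> = g \<cdot> (f \<cdot> k)" by (simp only: assms(9))
  also have "\<dots> = (g \<cdot> f) \<cdot> k" using assms(2-8) by (intro assoc_comp[symmetric]) auto
  also have "\<dots> = k" using assms(1-8) by simp
  finally show ?thesis .
qed

lemma retraction_cancel:
  assumes "f \<cdot> g = \<one> (Cod C f)" "f \<in> Arr C" "g \<in> Arr C" "Dom C f = Cod C g"
    and "h \<in> Arr C" "k \<in> Arr C" "Dom C h = Cod C f" "Dom C k = Cod C f"
    and "h \<cdot> f = k \<cdot> f"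
  shows "h = k"
proof -
  have "h = h \<cdot> (f \<cdot> g)" using assms(1-8) by simp
  also have "\<dots> = (h \<cdot> f) \<cdot> g" using assms(2-8) by (intro assoc_comp[symmetric]) auto
  also have "\<dots> = (k \<cdot> f) \<cdot> g" by (simp only: assms(9))
  also have "\<dots> = k \<cdot> (f \<cdot> g)" using assms(2-8) by (intro assoc_comp) auto
  also have "\<dots> = k" using assms(1-8) by simp
  finally show ?thesis .
qed

end

section \<open>Coherence of units, associativity and symmetry\<close>

context smcc
begin

lemma tens_typing [simp]:
  assumes "f \<in> Arr V" "g \<in> Arr V"
  shows "f \<otimes> g \<in> Arr V" "Dom V (f \<otimes> g) = Dom V f \<odot> Dom V g" "Cod V (f \<otimes> g) = Cod V f \<odot> Cod V g"
  using assms tensA_hom[of f "Dom V f" "Cod V f" g "Dom V g" "Cod V g"] by (auto simp: hom_iff)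

lemma tens_comp [simp]:
  assumes "f \<in> Arr V" "g \<in> Arr V" "f' \<in> Arr V" "g' \<in> Arr V" "Dom V f' = Cod V f" "Dom V g' = Cod V g"
  shows "(f' \<otimes> g') \<cdot> (f \<otimes> g) = (f' \<cdot> f) \<otimes> (g' \<cdot> g)"
  using assms tensA_comp[of f "Dom V f" "Cod V f" f' "Cod V f'" g "Dom V g" "Cod V g" g' "Cod V g'"]
  by (auto simp: hom_iff)

lemma tens_comp2 [simp]:
  assumes "f \<in> Arr V" "g \<in> Arr V" "f' \<in> Arr V" "g' \<in> Arr V" "Dom V f' = Cod V f" "Dom V g' = Cod V g"
    "k \<in> Arr V" "Cod V k = Dom V f \<odot> Dom V g"
  shows "(f' \<otimes> g') \<cdot> ((f \<otimes> g) \<cdot> k) = ((f' \<cdot> f) \<otimes> (g' \<cdot> g)) \<cdot> k"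
  using assms by (intro comp_reassoc) auto

declare tens_Ob [simp] unit_Ob [simp] ihom_Ob [simp] tensA_ident [simp]

abbreviation "linv x \<equiv> inverse_of V (lunit V x)"
abbreviation "rinv x \<equiv> inverse_of V (runit V x)"
abbreviation "ainv x y z \<equiv> inverse_of V (assoc V x y z)"

lemma structure_typing [simp]:
  assumes "x \<in> Ob V"
  shows "lunit V x \<in> Arr V" "Dom V (lunit V x) = \<I> \<odot> x" "Cod V (lunit V x) = x"
    "linv x \<in> Arr V" "Dom V (linv x) = x" "Cod V (linv x) = \<I> \<odot> x"
    "linv x \<cdot> lunit V x = \<one> (\<I> \<odot> x)" "lunit V x \<cdot> linv x = \<one> x"
    "runit V x \<in> Arr V" "Dom V (runit V x) = x \<odot> \<I>" "Cod V (runit V x) = x"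
    "rinv x \<in> Arr V" "Dom V (rinv x) = x" "Cod V (rinv x) = x \<odot> \<I>"
    "rinv x \<cdot> runit V x = \<one> (x \<odot> \<I>)" "runit V x \<cdot> rinv x = \<one> x"
  using iso_arrow_inverse[OF lunit_iso[OF assms]] iso_arrow_inverse[OF runit_iso[OF assms]] by auto

lemma assoc_typing [simp]:
  assumes "x \<in> Ob V" "y \<in> Ob V" "z \<in> Ob V"
  shows "assoc V x y z \<in> Arr V" "Dom V (assoc V x y z) = (x \<odot> y) \<odot> z"
    "Cod V (assoc V x y z) = x \<odot> (y \<odot> z)"
    "ainv x y z \<in> Arr V" "Dom V (ainv x y z) = x \<odot> (y \<odot> z)" "Cod V (ainv x y z) = (x \<odot> y) \<odot> z"
    "ainv x y z \<cdot> assoc V x y z = \<one> ((x \<odot> y) \<odot> z)"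
    "assoc V x y z \<cdot> ainv x y z = \<one> (x \<odot> (y \<odot> z))"
  using iso_arrow_inverse[OF assoc_iso[OF assms]] by auto

lemma symm_typing [simp]:
  assumes "x \<in> Ob V" "y \<in> Ob V"
  shows "symm V x y \<in> Arr V" "Dom V (symm V x y) = x \<odot> y" "Cod V (symm V x y) = y \<odot> x"
    "symm V y x \<cdot> symm V x y = \<one> (x \<odot> y)"
  using symm_hom[OF assms] symmetry[OF assms] by (auto simp: hom_iff)

lemma ev_typing [simp]:
  assumes "x \<in> Ob V" "y \<in> Ob V"
  shows "ev V x y \<in> Arr V" "Dom V (ev V x y) = ihom V x y \<odot> x" "Cod V (ev V x y) = y"
  using ev_hom[OF assms] by (auto simp: hom_iff)

lemma symm_symm_comp [simp]:
  "\<lbrakk>x \<in> Ob V; y \<in> Ob V; f \<in> Arr V; Cod V f = x \<odot> y\<rbrakk> \<Longrightarrow> symm V y x \<cdot> symm V x y \<cdot> f = f"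
  using comp_reassoc[OF symmetry, of x y f] by simp

lemma assoc_ainv_comp [simp]:
  "\<lbrakk>x \<in> Ob V; y \<in> Ob V; z \<in> Ob V; f \<in> Arr V; Cod V f = x \<odot> (y \<odot> z)\<rbrakk> \<Longrightarrow> assoc V x y z \<cdot> ainv x y z \<cdot> f = f"
  using comp_reassoc[OF assoc_typing(8), of x y z f] by simp

lemma assoc_nat:
  "\<lbrakk>f \<in> Arr V; g \<in> Arr V; h \<in> Arr V\<rbrakk> \<Longrightarrow>
    assoc V (Cod V f) (Cod V g) (Cod V h) \<cdot> ((f \<otimes> g) \<otimes> h)
      = (f \<otimes> (g \<otimes> h)) \<cdot> assoc V (Dom V f) (Dom V g) (Dom V h)"
  by (rule assoc_natural) (auto simp: hom_iff)

lemma symm_nat: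
  "\<lbrakk>f \<in> Arr V; g \<in> Arr V\<rbrakk> \<Longrightarrow>
    symm V (Cod V f) (Cod V g) \<cdot> (f \<otimes> g) = (g \<otimes> f) \<cdot> symm V (Dom V f) (Dom V g)"
  by (rule symm_natural) (auto simp: hom_iff)

lemma lunit_nat: "f \<in> Arr V \<Longrightarrow> lunit V (Cod V f) \<cdot> (\<one> \<I> \<otimes> f) = f \<cdot> lunit V (Dom V f)"
  by (rule lunit_natural) (auto simp: hom_iff)

lemma runit_nat: "f \<in> Arr V \<Longrightarrow> runit V (Cod V f) \<cdot> (f \<otimes> \<one> \<I>) = f \<cdot> runit V (Dom V f)"
  by (rule runit_natural) (auto simp: hom_iff)

text \<open>Naturality of \<open>lunit\<close> conjugates \<open>\<one> \<I> \<otimes> f\<close> to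
  \<open>f\<close>, so tensoring with the unit loses nothing. Coherence equations can thus be proved
  after adding a factor \<open>\<I>\<close> that makes an axiom applicable.\<close>

lemma unit_tens_faithful:
  assumes "f \<in> Arr V" "g \<in> Arr V" "Dom V f = Dom V g" "Cod V f = Cod V g" "\<one> \<I> \<otimes> f = \<one> \<I> \<otimes> g"
  shows "f = g"
proof (rule retraction_cancel)
  show "f \<cdot> lunit V (Dom V f) = g \<cdot> lunit V (Dom V f)"
    using assms lunit_nat[of f] lunit_nat[of g] by simp
  show "lunit V (Dom V f) \<cdot> linv (Dom V f) = \<one> (Cod V (lunit V (Dom V f)))" using assms by simp
qed (use assms in auto)

lemma tens_unit_faithful:
  assumes "f \<in> Arr V" "g \<in> Arr V" "Dom V f = Dom V g" "Cod V f = Cod V g" "f \<otimes> \<one> \<I> = g \<otimes> \<one> \<I>"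
  shows "f = g"
proof (rule retraction_cancel)
  show "f \<cdot> runit V (Dom V f) = g \<cdot> runit V (Dom V f)"
    using assms runit_nat[of f] runit_nat[of g] by simp
  show "runit V (Dom V f) \<cdot> rinv (Dom V f) = \<one> (Cod V (runit V (Dom V f)))" using assms by simp
qed (use assms in auto)

lemma assoc_cancel_right:
  assumes "x \<in> Ob V" "y \<in> Ob V" "z \<in> Ob V" "h \<in> Arr V" "k \<in> Arr V"
    "Dom V h = x \<odot> (y \<odot> z)" "Dom V k = x \<odot> (y \<odot> z)"
    "h \<cdot> assoc V x y z = k \<cdot> assoc V x y z"
  shows "h = k"
  by (rule retraction_cancel[of "assoc V x y z" "ainv x y z"]) (use assms in auto)

text \<open>The triangle speaks only of a unit in the middle. A second unit on the left makes the
  pentagon at \<open>\<I>\<close>, \<open>\<I>\<close>, \<open>x\<close>, \<open>y\<close>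
  applicable, and two triangles turn it into the claim tensored with \<open>\<I>\<close>;
  \<open>unit_tens_faithful\<close> removes the extra factor.\<close>

lemma lunit_assoc:
  assumes x: "x \<in> Ob V" and y: "y \<in> Ob V"
  shows "lunit V (x \<odot> y) \<cdot> assoc V \<I> x y = lunit V x \<otimes> \<one> y"
proof (rule unit_tens_faithful)
  let ?a = "assoc V"
  let ?L = "\<one> \<I> \<otimes> (lunit V (x \<odot> y) \<cdot> ?a \<I> x y)"
  let ?R = "\<one> \<I> \<otimes> (lunit V x \<otimes> \<one> y)"
  let ?P = "?a \<I> (\<I> \<odot> x) y \<cdot> (?a \<I> \<I> x \<otimes> \<one> y)"
  have "?L \<cdot> ?P = (\<one> \<I> \<otimes> lunit V (x \<odot> y)) \<cdot> ((\<one> \<I> \<otimes> ?a \<I> x y) \<cdot> ?a \<I> (\<I> \<odot> x) y \<cdot> (?a \<I> \<I> x \<otimes> \<one> y))"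
    using x y by simp
  also have "\<dots> = (\<one> \<I> \<otimes> lunit V (x \<odot> y)) \<cdot> (?a \<I> \<I> (x \<odot> y) \<cdot> ?a (\<I> \<odot> \<I>) x y)"
    using x y pentagon[of \<I> \<I> x y] by simp
  also have "\<dots> = ((\<one> \<I> \<otimes> lunit V (x \<odot> y)) \<cdot> ?a \<I> \<I> (x \<odot> y)) \<cdot> ?a (\<I> \<odot> \<I>) x y"
    using x y by simp
  also have "\<dots> = (runit V \<I> \<otimes> (\<one> x \<otimes> \<one> y)) \<cdot> ?a (\<I> \<odot> \<I>) x y"
    using x y triangle[of \<I> "x \<odot> y"] by simp
  also have "\<dots> = ?a \<I> x y \<cdot> ((runit V \<I> \<otimes> \<one> x) \<otimes> \<one> y)"
    using x y assoc_nat[of "runit V \<I>" "\<one> x" "\<one> y"] by (simp del: tensA_ident)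
  also have "\<dots> = ?a \<I> x y \<cdot> (((\<one> \<I> \<otimes> lunit V x) \<otimes> \<one> y) \<cdot> (?a \<I> \<I> x \<otimes> \<one> y))"
    using x y triangle[of \<I> x] by simp
  also have "\<dots> = (?a \<I> x y \<cdot> ((\<one> \<I> \<otimes> lunit V x) \<otimes> \<one> y)) \<cdot> (?a \<I> \<I> x \<otimes> \<one> y)"
    using x y by (subst assoc_comp) simp_all
  also have "\<dots> = ?R \<cdot> ?P"
    using x y assoc_nat[of "\<one> \<I>" "lunit V x" "\<one> y"] by simp
  finally have eq: "?L \<cdot> ?P = ?R \<cdot> ?P" .
  have sect: "?P \<cdot> ((ainv \<I> \<I> x \<otimes> \<one> y) \<cdot> ainv \<I> (\<I> \<odot> x) y) = \<one> (Cod V ?P)"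
    using x y by simp
  show "?L = ?R"
    by (rule retraction_cancel[OF sect _ _ _ _ _ _ _ eq]) (use x y in simp_all)
qed (use x y in simp_all)

text \<open>Naturality of \<open>lunit\<close> at \<open>lunit V \<I>\<close> gives \<open>lunit V
  (\<I> \<odot> \<I>) = \<one> \<I> \<otimes> lunit V \<I>\<close>; after that the triangle and
  \<open>lunit_assoc\<close> have the same left-hand side.\<close>

lemma lunit_unit_eq_runit: "lunit V \<I> = runit V \<I>"
proof (rule tens_unit_faithful)
  have 1: "lunit V (\<I> \<odot> \<I>) = \<one> \<I> \<otimes> lunit V \<I>"
  proof (rule section_cancel)
    show "lunit V \<I> \<cdot> lunit V (\<I> \<odot> \<I>) = lunit V \<I> \<cdot> (\<one> \<I> \<otimes> lunit V \<I>)"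
      using lunit_nat[of "lunit V \<I>"] by simp
    show "linv \<I> \<cdot> lunit V \<I> = \<one> (Dom V (lunit V \<I>))" by simp
  qed simp_all
  show "lunit V \<I> \<otimes> \<one> \<I> = runit V \<I> \<otimes> \<one> \<I>"
    using triangle[of \<I> \<I>] lunit_assoc[of \<I> \<I>] 1 by simp
qed simp_all

text \<open>Both sides of the hexagon at \<open>x\<close>, \<open>\<I>\<close>, \<open>\<I>\<close>
  are followed by \<open>lunit V (\<I> \<odot> x)\<close>. Up to a common invertible factor
  \<open>symm V x \<I>\<close>, one becomes \<open>runit V x \<otimes> \<one> \<I>\<close> and the
  other \<open>(lunit V x \<cdot> symm V x \<I>) \<otimes> \<one> \<I>\<close>.\<close>

lemma lunit_symm:
  assumes x: "x \<in> Ob V"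
  shows "lunit V x \<cdot> symm V x \<I> = runit V x"
proof (rule tens_unit_faithful)
  let ?a = "assoc V" and ?s = "symm V"
  have "lunit V (\<I> \<odot> x) \<cdot> (?a \<I> \<I> x \<cdot> ?s x (\<I> \<odot> \<I>) \<cdot> ?a x \<I> \<I>)
      = (lunit V (\<I> \<odot> x) \<cdot> ?a \<I> \<I> x) \<cdot> ?s x (\<I> \<odot> \<I>) \<cdot> ?a x \<I> \<I>"
    using x by simp
  also have "\<dots> = (lunit V \<I> \<otimes> \<one> x) \<cdot> (?s x (\<I> \<odot> \<I>) \<cdot> ?a x \<I> \<I>)"
    using x lunit_assoc[of \<I> x] by simp
  also have "\<dots> = ((lunit V \<I> \<otimes> \<one> x) \<cdot> ?s x (\<I> \<odot> \<I>)) \<cdot> ?a x \<I> \<I>"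
    using x by simp
  also have "\<dots> = ?s x \<I> \<cdot> ((\<one> x \<otimes> lunit V \<I>) \<cdot> ?a x \<I> \<I>)"
    using x symm_nat[of "\<one> x" "lunit V \<I>", symmetric] by simp
  also have "\<dots> = ?s x \<I> \<cdot> (runit V x \<otimes> \<one> \<I>)"
    using x triangle[of x \<I>] by simp
  finally have L: "lunit V (\<I> \<odot> x) \<cdot> (?a \<I> \<I> x \<cdot> ?s x (\<I> \<odot> \<I>) \<cdot> ?a x \<I> \<I>) = \<dots>" .
  have "lunit V (\<I> \<odot> x) \<cdot> ((\<one> \<I> \<otimes> ?s x \<I>) \<cdot> ?a \<I> x \<I> \<cdot> (?s x \<I> \<otimes> \<one> \<I>))
      = (lunit V (\<I> \<odot> x) \<cdot> (\<one> \<I> \<otimes> ?s x \<I>)) \<cdot> ?a \<I> x \<I> \<cdot> (?s x \<I> \<otimes> \<one> \<I>)"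
    using x by simp
  also have "\<dots> = ?s x \<I> \<cdot> ((lunit V (x \<odot> \<I>) \<cdot> ?a \<I> x \<I>) \<cdot> (?s x \<I> \<otimes> \<one> \<I>))"
    using x lunit_nat[of "?s x \<I>"] by simp
  also have "\<dots> = ?s x \<I> \<cdot> ((lunit V x \<cdot> ?s x \<I>) \<otimes> \<one> \<I>)"
    using x lunit_assoc[of x \<I>] by simp
  finally have R: "lunit V (\<I> \<odot> x) \<cdot> ((\<one> \<I> \<otimes> ?s x \<I>) \<cdot> ?a \<I> x \<I> \<cdot> (?s x \<I> \<otimes> \<one> \<I>)) = \<dots>" .
  have eq: "?s x \<I> \<cdot> ((lunit V x \<cdot> ?s x \<I>) \<otimes> \<one> \<I>) = ?s x \<I> \<cdot> (runit V x \<otimes> \<one> \<I>)"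
    using L R hexagon[of x \<I> \<I>] x by simp
  have sect: "?s \<I> x \<cdot> ?s x \<I> = \<one> (Dom V (?s x \<I>))" using x by simp
  show "(lunit V x \<cdot> ?s x \<I>) \<otimes> \<one> \<I> = runit V x \<otimes> \<one> \<I>"
    by (rule section_cancel[OF sect _ _ _ _ _ _ _ eq]) (use x in simp_all)
qed (use x in simp_all)

text \<open>The two unitors of \<open>\<I>\<close> agree, so the symmetry disappears when followed
  by the invertible \<open>lunit V \<I>\<close>. This is the case of two empty contexts in
  \<open>shuffle_comm\<close>.\<close>

lemma symm_unit_unit: "symm V \<I> \<I> = \<one> (\<I> \<odot> \<I>)"
proof (rule section_cancel)
  show "lunit V \<I> \<cdot> symm V \<I> \<I> = lunit V \<I> \<cdot> \<one> (\<I> \<odot> \<I>)"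
    using lunit_symm[of \<I>] lunit_unit_eq_runit by simp
  show "linv \<I> \<cdot> lunit V \<I> = \<one> (Dom V (lunit V \<I>))" by simp
qed simp_all

end

section \<open>Closure properties of isomorphisms\<close>

context category
begin

lemma iso_arrow_comp:
  assumes "iso_arrow C x y f" "iso_arrow C y z g"
  shows "iso_arrow C x z (g \<cdot> f)"
proof -
  note f = iso_arrow_inverse[OF assms(1)] and g = iso_arrow_inverse[OF assms(2)]
  have "(inverse_of C f \<cdot> inverse_of C g) \<cdot> (g \<cdot> f) = \<one> x"
    using f g comp_reassoc[OF g(7), of f] by simp
  moreover have "(g \<cdot> f) \<cdot> (inverse_of C f \<cdot> inverse_of C g) = \<one> z"
    using f g comp_reassoc[OF f(8), of "inverse_of C g"] by simp
  ultimately show ?thesis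
    using f g unfolding iso_arrow_def inverse_arrows_def hom_iff
    by (intro exI[of _ "inverse_of C f \<cdot> inverse_of C g"]) simp
qed

lemma iso_arrow_ident: "x \<in> Ob C \<Longrightarrow> iso_arrow C x x (\<one> x)"
  unfolding iso_arrow_def inverse_arrows_def hom_iff by (intro exI[of _ "\<one> x"]) simp

lemma iso_arrow_inverse_of: "iso_arrow C x y f \<Longrightarrow> iso_arrow C y x (inverse_of C f)"
  using iso_arrow_inverse[of x y f] unfolding iso_arrow_def[of C y x] inverse_arrows_def hom_iff by blast

end

context smcc
begin

lemma iso_arrow_tens:
  assumes "iso_arrow V x y f" "iso_arrow V x' y' g"
  shows "iso_arrow V (x \<odot> x') (y \<odot> y') (f \<otimes> g)"
proof -
  note f = iso_arrow_inverse[OF assms(1)] and g = iso_arrow_inverse[OF assms(2)]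
  have "x \<in> Ob V" "y \<in> Ob V" "x' \<in> Ob V" "y' \<in> Ob V" using f g by (metis Dom_Cod_Ob)+
  then show ?thesis
    using f g unfolding iso_arrow_def inverse_arrows_def hom_iff
    by (intro exI[of _ "inverse_of V f \<otimes> inverse_of V g"]) simp
qed

lemma symm_iso: "\<lbrakk>x \<in> Ob V; y \<in> Ob V\<rbrakk> \<Longrightarrow> iso_arrow V (x \<odot> y) (y \<odot> x) (symm V x y)"
  unfolding iso_arrow_def inverse_arrows_def hom_iff by (intro exI[of _ "symm V y x"]) simp

text \<open>
  A context is a finite map from variables (natural numbers) to objects. The first \<open>n\<close> variables
  of a context are tensored in increasing order, so that the disjoint union of contexts is strictly
  associative and commutative; \<open>shuffle\<close> is the canonical isomorphism.
\<close>

primrec ctx_tensor :: "nat \<Rightarrow> (nat \<rightharpoonup> 'o) \<Rightarrow> 'o" where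
  "ctx_tensor 0 M = \<I>"
| "ctx_tensor (Suc n) M = (case M n of None \<Rightarrow> ctx_tensor n M | Some x \<Rightarrow> ctx_tensor n M \<odot> x)"

text \<open>Needed when the last variable belongs to the left of two contexts: the tensor product of
  the right context stands between it and its destination.\<close>

definition swap_last :: "'o \<Rightarrow> 'o \<Rightarrow> 'o \<Rightarrow> 'a" where
  "swap_last x y z = ainv x z y \<cdot> (\<one> x \<otimes> symm V y z) \<cdot> assoc V x y z"

primrec shuffle :: "nat \<Rightarrow> (nat \<rightharpoonup> 'o) \<Rightarrow> (nat \<rightharpoonup> 'o) \<Rightarrow> 'a" where
  "shuffle 0 M N = linv \<I>"
| "shuffle (Suc n) M N =
    (case N n of
       Some x \<Rightarrow> assoc V (ctx_tensor n M) (ctx_tensor n N) x \<cdot> (shuffle n M N \<otimes> \<one> x)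
     | None \<Rightarrow> (case M n of
         Some x \<Rightarrow> swap_last (ctx_tensor n M) (ctx_tensor n N) x \<cdot> (shuffle n M N \<otimes> \<one> x)
       | None \<Rightarrow> shuffle n M N))"

definition ctx_objects :: "(nat \<rightharpoonup> 'o) \<Rightarrow> bool" where
  "ctx_objects M \<longleftrightarrow> ran M \<subseteq> Ob V"

lemma ctx_objectsD: "ctx_objects M \<Longrightarrow> M n = Some x \<Longrightarrow> x \<in> Ob V"
  by (auto simp: ctx_objects_def ran_def)

lemma ctx_objects_add [simp]:
  "ctx_objects M \<Longrightarrow> ctx_objects N \<Longrightarrow> ctx_objects (M ++ N)"
  unfolding ctx_objects_def ran_def by (fastforce simp: map_add_Some_iff)

lemma map_add_at [simp]:
  "N n = None \<Longrightarrow> (M ++ N) n = M n" "N n = Some x \<Longrightarrow> (M ++ N) n = Some x"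
  by (simp_all add: map_add_def)

lemma ctx_objects_empty [simp]: "ctx_objects Map.empty"
  by (simp add: ctx_objects_def)

lemma ctx_tensor_Ob [simp]: "ctx_objects M \<Longrightarrow> ctx_tensor n M \<in> Ob V"
  by (induction n) (auto split: option.split dest: ctx_objectsD)

lemma swap_last_iso:
  assumes "x \<in> Ob V" "y \<in> Ob V" "z \<in> Ob V"
  shows "iso_arrow V ((x \<odot> y) \<odot> z) ((x \<odot> z) \<odot> y) (swap_last x y z)"
  unfolding swap_last_def using assms
  by (intro iso_arrow_comp[OF iso_arrow_comp[OF assoc_iso iso_arrow_tens[OF iso_arrow_ident symm_iso]]
      iso_arrow_inverse_of[OF assoc_iso]]) simp_all

definition disjoint_ctx :: "(nat \<rightharpoonup> 'o) \<Rightarrow> (nat \<rightharpoonup> 'o) \<Rightarrow> bool" where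
  "disjoint_ctx M N \<longleftrightarrow> dom M \<inter> dom N = {}"

lemma disjoint_ctx_comm: "disjoint_ctx M N \<Longrightarrow> disjoint_ctx N M"
  by (auto simp: disjoint_ctx_def)

lemma disjoint_ctxD: "disjoint_ctx M N \<Longrightarrow> M n = Some x \<Longrightarrow> N n = None"
  by (fastforce simp: disjoint_ctx_def dom_def disjoint_iff)

lemma disjoint_ctxD2: "disjoint_ctx M N \<Longrightarrow> N n = Some x \<Longrightarrow> M n = None"
  using disjoint_ctxD[OF disjoint_ctx_comm] by blast

lemma disjoint_ctx_add [simp]:
  "disjoint_ctx (M ++ M') N \<longleftrightarrow> disjoint_ctx M N \<and> disjoint_ctx M' N"
  "disjoint_ctx N (M ++ M') \<longleftrightarrow> disjoint_ctx N M \<and> disjoint_ctx N M'"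
  by (auto simp: disjoint_ctx_def)

lemma disjoint_ctx_empty [simp]: "disjoint_ctx Map.empty M" "disjoint_ctx M Map.empty"
  by (auto simp: disjoint_ctx_def)

lemma disjoint_ctx_add_comm: "disjoint_ctx M N \<Longrightarrow> M ++ N = N ++ M"
  by (rule map_add_comm) (simp add: disjoint_ctx_def)

lemma shuffle_iso:
  assumes "ctx_objects M" "ctx_objects N" "disjoint_ctx M N"
  shows "iso_arrow V (ctx_tensor n (M ++ N)) (ctx_tensor n M \<odot> ctx_tensor n N) (shuffle n M N)"
proof (induction n)
  case 0
  show ?case using iso_arrow_inverse_of[OF lunit_iso[OF unit_Ob]] by simp
next
  case (Suc n)
  consider (none) "M n = None" "N n = None" | (left) x where "M n = Some x" "N n = None" "x \<in> Ob V"
    | (right) x where "M n = None" "N n = Some x" "x \<in> Ob V"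
    using assms by (metis ctx_objectsD disjoint_ctxD disjoint_ctxD2 not_None_eq)
  then show ?case
  proof cases
    case none
    then show ?thesis using Suc by simp
  next
    case left
    then show ?thesis using assms
      by (auto intro!: iso_arrow_comp[OF iso_arrow_tens[OF Suc iso_arrow_ident] swap_last_iso])
  next
    case right
    then show ?thesis using assms
      by (auto intro!: iso_arrow_comp[OF iso_arrow_tens[OF Suc iso_arrow_ident] assoc_iso])
  qed
qed

lemma shuffle_typing [simp]:
  assumes "ctx_objects M" "ctx_objects N" "disjoint_ctx M N"
  shows "shuffle n M N \<in> Arr V" "Dom V (shuffle n M N) = ctx_tensor n (M ++ N)"
    "Cod V (shuffle n M N) = ctx_tensor n M \<odot> ctx_tensor n N"
  using iso_arrow_inverse[OF shuffle_iso[OF assms]] by auto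

text \<open>The new variable enters one splitting through an associator and the other through
  \<open>swap_last\<close>. The hexagon for the two truncated contexts and \<open>x\<close> relates
  them, after an invertible associator has been cancelled.\<close>

lemma shuffle_comm_right:
  assumes M: "ctx_objects M" and N: "ctx_objects N" and MN: "disjoint_ctx M N" and x: "N n = Some x"
    and IH: "symm V (ctx_tensor n M) (ctx_tensor n N) \<cdot> shuffle n M N = shuffle n N M"
  shows "symm V (ctx_tensor (Suc n) M) (ctx_tensor (Suc n) N) \<cdot> shuffle (Suc n) M N = shuffle (Suc n) N M"
proof -
  let ?M = "ctx_tensor n M" and ?N = "ctx_tensor n N" and ?s = "shuffle n M N \<otimes> \<one> x"
  have [simp]: "M n = None" using MN x disjoint_ctxD2 by blast
  have [simp]: "x \<in> Ob V" using N x ctx_objectsD by blast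
  have [simp]: "ctx_tensor n (N ++ M) = ctx_tensor n (M ++ N)" using MN disjoint_ctx_add_comm by metis
  have [simp]: "disjoint_ctx N M" using MN disjoint_ctx_comm by blast
  have "assoc V ?N x ?M \<cdot> (symm V ?M (?N \<odot> x) \<cdot> assoc V ?M ?N x \<cdot> ?s)
      = (assoc V ?N x ?M \<cdot> symm V ?M (?N \<odot> x) \<cdot> assoc V ?M ?N x) \<cdot> ?s"
    using assms by simp
  also have "\<dots> = (\<one> ?N \<otimes> symm V ?M x) \<cdot> assoc V ?N ?M x \<cdot> ((symm V ?M ?N \<otimes> \<one> x) \<cdot> ?s)"
    using assms hexagon[of ?M ?N x] by simp
  also have "\<dots> = (\<one> ?N \<otimes> symm V ?M x) \<cdot> assoc V ?N ?M x \<cdot> (shuffle n N M \<otimes> \<one> x)"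
    using assms by simp
  also have "\<dots> = assoc V ?N x ?M \<cdot> (swap_last ?N ?M x \<cdot> (shuffle n N M \<otimes> \<one> x))"
    using assms by (simp add: swap_last_def)
  finally have eq: "assoc V ?N x ?M \<cdot> (symm V ?M (?N \<odot> x) \<cdot> assoc V ?M ?N x \<cdot> ?s) = \<dots>" .
  have sect: "ainv ?N x ?M \<cdot> assoc V ?N x ?M = \<one> (Dom V (assoc V ?N x ?M))" using assms by simp
  have "symm V ?M (?N \<odot> x) \<cdot> assoc V ?M ?N x \<cdot> ?s = swap_last ?N ?M x \<cdot> (shuffle n N M \<otimes> \<one> x)"
    by (rule section_cancel[OF sect _ _ _ _ _ _ _ eq])
      (use assms iso_arrow_inverse[OF swap_last_iso, of ?N ?M x] in simp_all)
  then show ?thesis using x by simp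
qed

text \<open>Only a last variable in the right context needs the hexagon. One in the left context is
  the same statement with the roles exchanged, since the two symmetries are inverse to each
  other.\<close>

lemma shuffle_comm:
  assumes "ctx_objects M" "ctx_objects N" "disjoint_ctx M N"
  shows "symm V (ctx_tensor n M) (ctx_tensor n N) \<cdot> shuffle n M N = shuffle n N M"
proof (induction n)
  case 0
  show ?case using symm_unit_unit by simp
next
  case (Suc n)
  have NM: "disjoint_ctx N M" using assms disjoint_ctx_comm by blast
  consider (none) "M n = None" "N n = None" | (left) x where "M n = Some x" | (right) x where "N n = Some x"
    by (cases "M n"; cases "N n") auto
  then show ?case
  proof cases
    case none
    then show ?thesis using Suc by simp
  next
    case left
    have sw: "symm V (ctx_tensor m N) (ctx_tensor m M) \<cdot> shuffle m N M = shuffle m M N"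
      if "symm V (ctx_tensor m M) (ctx_tensor m N) \<cdot> shuffle m M N = shuffle m N M" for m
      using assms NM that[symmetric] by simp
    have "symm V (ctx_tensor (Suc n) N) (ctx_tensor (Suc n) M) \<cdot> shuffle (Suc n) N M = shuffle (Suc n) M N"
      using shuffle_comm_right[OF assms(2,1) NM left sw[OF Suc]] .
    from this[symmetric] show ?thesis using assms NM by (simp del: ctx_tensor.simps shuffle.simps)
  next
    case right
    then show ?thesis using shuffle_comm_right[OF assms _ Suc] by blast
  qed
qed

section \<open>Associativity of splitting a context into three\<close>

definition left_shuffle where
  "left_shuffle n M N P = (shuffle n M N \<otimes> \<one> (ctx_tensor n P)) \<cdot> shuffle n (M ++ N) P"

definition right_shuffle where
  "right_shuffle n M N P = (\<one> (ctx_tensor n M) \<otimes> shuffle n N P) \<cdot> shuffle n M (N ++ P)"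

text \<open>Kept as a predicate on three contexts because the induction uses the equation for
  several of their permutations at the same stage.\<close>

definition shuffle_assoc where
  "shuffle_assoc n M N P \<longleftrightarrow>
     assoc V (ctx_tensor n M) (ctx_tensor n N) (ctx_tensor n P) \<cdot> left_shuffle n M N P = right_shuffle n M N P"

context
  fixes M N P :: "nat \<rightharpoonup> 'o"
  assumes M [simp]: "ctx_objects M" and N [simp]: "ctx_objects N" and P [simp]: "ctx_objects P"
    and MN [simp]: "disjoint_ctx M N" and MP [simp]: "disjoint_ctx M P" and NP [simp]: "disjoint_ctx N P"
begin

lemma disjoint_ctx_sym [simp]: "disjoint_ctx N M" "disjoint_ctx P M" "disjoint_ctx P N"
  using MN MP NP disjoint_ctx_comm by blast+

lemma left_shuffle_typing [simp]:
  "left_shuffle n M N P \<in> Arr V" "Dom V (left_shuffle n M N P) = ctx_tensor n (M ++ (N ++ P))"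
  "Cod V (left_shuffle n M N P) = (ctx_tensor n M \<odot> ctx_tensor n N) \<odot> ctx_tensor n P"
  by (simp_all add: left_shuffle_def)

lemma right_shuffle_typing [simp]:
  "right_shuffle n M N P \<in> Arr V" "Dom V (right_shuffle n M N P) = ctx_tensor n (M ++ (N ++ P))"
  "Cod V (right_shuffle n M N P) = ctx_tensor n M \<odot> (ctx_tensor n N \<odot> ctx_tensor n P)"
  by (simp_all add: right_shuffle_def)

lemma symm_left_shuffle:
  "symm V (ctx_tensor n M \<odot> ctx_tensor n N) (ctx_tensor n P) \<cdot> left_shuffle n M N P = right_shuffle n P M N"
proof -
  have "symm V (ctx_tensor n M \<odot> ctx_tensor n N) (ctx_tensor n P) \<cdot> left_shuffle n M N P
     = (symm V (ctx_tensor n M \<odot> ctx_tensor n N) (ctx_tensor n P) \<cdot> (shuffle n M N \<otimes> \<one> (ctx_tensor n P)))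
        \<cdot> shuffle n (M ++ N) P"
    by (simp add: left_shuffle_def)
  also have "\<dots> = (\<one> (ctx_tensor n P) \<otimes> shuffle n M N) \<cdot>
       (symm V (ctx_tensor n (M ++ N)) (ctx_tensor n P) \<cdot> shuffle n (M ++ N) P)"
    using symm_nat[of "shuffle n M N" "\<one> (ctx_tensor n P)"] by simp
  also have "\<dots> = right_shuffle n P M N"
    by (simp add: right_shuffle_def shuffle_comm)
  finally show ?thesis .
qed

lemma left_shuffle_swap:
  "(symm V (ctx_tensor n M) (ctx_tensor n N) \<otimes> \<one> (ctx_tensor n P)) \<cdot> left_shuffle n M N P = left_shuffle n N M P"
  by (simp add: left_shuffle_def shuffle_comm disjoint_ctx_add_comm[of N M])

lemma right_shuffle_swap:
  "(\<one> (ctx_tensor n M) \<otimes> symm V (ctx_tensor n N) (ctx_tensor n P)) \<cdot> right_shuffle n M N P = right_shuffle n M P N"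
  by (simp add: right_shuffle_def shuffle_comm disjoint_ctx_add_comm[of P N])

end

lemmas shuffle3_simps =
  left_shuffle_typing right_shuffle_typing symm_left_shuffle left_shuffle_swap right_shuffle_swap

text \<open>The hexagon moves \<open>M\<close> past \<open>N\<close> and then past \<open>P\<close>.
  When the splitting is associative for the order \<open>N\<close>, \<open>M\<close>,
  \<open>P\<close>, its right-hand side collapses to a single splitting.\<close>

lemma hexagon_shuffle:
  assumes "ctx_objects M" "ctx_objects N" "ctx_objects P"
    "disjoint_ctx M N" "disjoint_ctx M P" "disjoint_ctx N P"
    and NMP: "shuffle_assoc n N M P"
  shows "assoc V (ctx_tensor n N) (ctx_tensor n P) (ctx_tensor n M)
      \<cdot> symm V (ctx_tensor n M) (ctx_tensor n N \<odot> ctx_tensor n P)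
      \<cdot> assoc V (ctx_tensor n M) (ctx_tensor n N) (ctx_tensor n P) \<cdot> left_shuffle n M N P
     = right_shuffle n N P M"
proof -
  let ?M = "ctx_tensor n M" and ?N = "ctx_tensor n N" and ?P = "ctx_tensor n P"
  have [simp]: "disjoint_ctx N M" "disjoint_ctx P M" "disjoint_ctx P N" using assms disjoint_ctx_comm by blast+
  note [simp] = assms(1-6)
  have "assoc V ?N ?P ?M \<cdot> symm V ?M (?N \<odot> ?P) \<cdot> assoc V ?M ?N ?P \<cdot> left_shuffle n M N P
      = (assoc V ?N ?P ?M \<cdot> symm V ?M (?N \<odot> ?P) \<cdot> assoc V ?M ?N ?P) \<cdot> left_shuffle n M N P"
    by (simp add: shuffle3_simps)
  also have "\<dots> = (\<one> ?N \<otimes> symm V ?M ?P) \<cdot> assoc V ?N ?M ?P \<cdot> ((symm V ?M ?N \<otimes> \<one> ?P) \<cdot> left_shuffle n M N P)"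
    by (subst hexagon) (simp_all add: shuffle3_simps)
  also have "\<dots> = (\<one> ?N \<otimes> symm V ?M ?P) \<cdot> right_shuffle n N M P"
    using NMP by (simp add: left_shuffle_swap shuffle_assoc_def)
  finally show ?thesis by (simp add: right_shuffle_swap)
qed

text \<open>In \<open>hexagon_shuffle\<close>, associativity for \<open>M\<close>, \<open>N\<close>,
  \<open>P\<close> rewrites the inner associator, and the symmetry carries the result to the left
  splitting for \<open>N\<close>, \<open>P\<close>, \<open>M\<close>.\<close>

lemma shuffle_assoc_rotate:
  assumes "ctx_objects M" "ctx_objects N" "ctx_objects P"
    "disjoint_ctx M N" "disjoint_ctx M P" "disjoint_ctx N P"
    and "shuffle_assoc n N M P" "shuffle_assoc n M N P"
  shows "shuffle_assoc n N P M"
proof -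
  have [simp]: "disjoint_ctx N M" "disjoint_ctx P M" "disjoint_ctx P N" using assms disjoint_ctx_comm by blast+
  note [simp] = assms(1-6)
  have r: "right_shuffle n M N P = symm V (ctx_tensor n N \<odot> ctx_tensor n P) (ctx_tensor n M) \<cdot> left_shuffle n N P M"
    by (simp add: symm_left_shuffle)
  have "symm V (ctx_tensor n M) (ctx_tensor n N \<odot> ctx_tensor n P) \<cdot> right_shuffle n M N P = left_shuffle n N P M"
    unfolding r by (simp add: left_shuffle_typing)
  then show ?thesis
    using hexagon_shuffle[OF assms(1-7)] assms(8) by (simp add: shuffle_assoc_def)
qed

text \<open>The same hexagon read in the other direction: here the outer associator is the known
  one, and being invertible it is cancelled.\<close>

lemma shuffle_assoc_rotate':
  assumes "ctx_objects M" "ctx_objects N" "ctx_objects P"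
    "disjoint_ctx M N" "disjoint_ctx M P" "disjoint_ctx N P"
    and "shuffle_assoc n N M P" "shuffle_assoc n N P M"
  shows "shuffle_assoc n M N P"
proof -
  let ?M = "ctx_tensor n M" and ?N = "ctx_tensor n N" and ?P = "ctx_tensor n P"
  have [simp]: "disjoint_ctx N M" "disjoint_ctx P M" "disjoint_ctx P N" using assms disjoint_ctx_comm by blast+
  note [simp] = assms(1-6)
  have eq: "assoc V ?N ?P ?M \<cdot> (symm V ?M (?N \<odot> ?P) \<cdot> assoc V ?M ?N ?P \<cdot> left_shuffle n M N P)
     = assoc V ?N ?P ?M \<cdot> left_shuffle n N P M"
    using hexagon_shuffle[OF assms(1-7)] assms(8) by (simp add: shuffle_assoc_def)
  have sect: "ainv ?N ?P ?M \<cdot> assoc V ?N ?P ?M = \<one> (Dom V (assoc V ?N ?P ?M))" by simp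
  have "symm V ?M (?N \<odot> ?P) \<cdot> assoc V ?M ?N ?P \<cdot> left_shuffle n M N P = left_shuffle n N P M"
    by (rule section_cancel[OF sect _ _ _ _ _ _ _ eq]) (simp_all add: shuffle3_simps)
  from this[symmetric] have "symm V (?N \<odot> ?P) ?M \<cdot> left_shuffle n N P M = assoc V ?M ?N ?P \<cdot> left_shuffle n M N P"
    by (simp add: shuffle3_simps)
  then show ?thesis by (simp add: symm_left_shuffle shuffle_assoc_def)
qed

text \<open>A new variable in the third context enters through associators alone, and the pentagon
  reduces its case to the previous stage.\<close>

lemma shuffle_assoc_last:
  assumes "ctx_objects M" "ctx_objects N" "ctx_objects P"
    "disjoint_ctx M N" "disjoint_ctx M P" "disjoint_ctx N P"
    and IH: "shuffle_assoc n M N P" and x: "P n = Some x"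
  shows "shuffle_assoc (Suc n) M N P"
proof -
  let ?M = "ctx_tensor n M" and ?N = "ctx_tensor n N" and ?P = "ctx_tensor n P"
  note [simp] = assms(1-6) x
  have [simp]: "M n = None" "N n = None" using assms disjoint_ctxD2 by blast+
  have [simp]: "x \<in> Ob V" using assms ctx_objectsD by blast
  have "assoc V ?M ?N (?P \<odot> x) \<cdot> (shuffle n M N \<otimes> \<one> (?P \<odot> x)) \<cdot> assoc V (ctx_tensor n (M ++ N)) ?P x
          \<cdot> (shuffle n (M ++ N) P \<otimes> \<one> x)
      = assoc V ?M ?N (?P \<odot> x) \<cdot> ((shuffle n M N \<otimes> (\<one> ?P \<otimes> \<one> x)) \<cdot> assoc V (ctx_tensor n (M ++ N)) ?P x)
          \<cdot> (shuffle n (M ++ N) P \<otimes> \<one> x)"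
    by simp
  also have "\<dots> = assoc V ?M ?N (?P \<odot> x) \<cdot> (assoc V (?M \<odot> ?N) ?P x \<cdot> ((shuffle n M N \<otimes> \<one> ?P) \<otimes> \<one> x))
          \<cdot> (shuffle n (M ++ N) P \<otimes> \<one> x)"
    using assoc_nat[of "shuffle n M N" "\<one> ?P" "\<one> x"] by simp
  also have "\<dots> = (assoc V ?M ?N (?P \<odot> x) \<cdot> assoc V (?M \<odot> ?N) ?P x) \<cdot> (left_shuffle n M N P \<otimes> \<one> x)"
    by (simp add: left_shuffle_def)
  also have "\<dots> = (\<one> ?M \<otimes> assoc V ?N ?P x) \<cdot> assoc V ?M (?N \<odot> ?P) x \<cdot> ((assoc V ?M ?N ?P \<otimes> \<one> x) \<cdot> (left_shuffle n M N P \<otimes> \<one> x))"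
    by (subst pentagon) simp_all
  also have "\<dots> = (\<one> ?M \<otimes> assoc V ?N ?P x) \<cdot> assoc V ?M (?N \<odot> ?P) x \<cdot> (right_shuffle n M N P \<otimes> \<one> x)"
    using IH by (simp add: shuffle_assoc_def)
  also have "\<dots> = (\<one> ?M \<otimes> assoc V ?N ?P x) \<cdot> (assoc V ?M (?N \<odot> ?P) x \<cdot> ((\<one> ?M \<otimes> shuffle n N P) \<otimes> \<one> x))
        \<cdot> (shuffle n M (N ++ P) \<otimes> \<one> x)"
    by (simp add: right_shuffle_def)
  also have "\<dots> = (\<one> ?M \<otimes> assoc V ?N ?P x) \<cdot> ((\<one> ?M \<otimes> (shuffle n N P \<otimes> \<one> x)) \<cdot> assoc V ?M (ctx_tensor n (N ++ P)) x)
        \<cdot> (shuffle n M (N ++ P) \<otimes> \<one> x)"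
    using assoc_nat[of "\<one> ?M" "shuffle n N P" "\<one> x"] by simp
  finally show ?thesis
    by (simp add: shuffle_assoc_def left_shuffle_def right_shuffle_def)
qed

lemma shuffle_assoc_zero: "shuffle_assoc 0 M N P"
proof -
  have "assoc V \<I> \<I> \<I> \<cdot> (linv \<I> \<otimes> \<one> \<I>) \<cdot> linv \<I> = (\<one> \<I> \<otimes> linv \<I>) \<cdot> linv \<I>"
  proof -
    have 1: "(\<one> \<I> \<otimes> lunit V \<I>) \<cdot> (assoc V \<I> \<I> \<I> \<cdot> (linv \<I> \<otimes> \<one> \<I>)) = \<one> (\<I> \<odot> \<I>)"
      using comp_reassoc[OF triangle[of \<I> \<I>], of "linv \<I> \<otimes> \<one> \<I>"] by (simp add: lunit_unit_eq_runit[symmetric])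
    have sect: "(\<one> \<I> \<otimes> linv \<I>) \<cdot> (\<one> \<I> \<otimes> lunit V \<I>) = \<one> (Dom V (\<one> \<I> \<otimes> lunit V \<I>))" by simp
    have "assoc V \<I> \<I> \<I> \<cdot> (linv \<I> \<otimes> \<one> \<I>) = \<one> \<I> \<otimes> linv \<I>"
      by (rule section_cancel[OF sect]) (use 1 in simp_all)
    then show ?thesis using comp_reassoc[of "assoc V \<I> \<I> \<I>" "linv \<I> \<otimes> \<one> \<I>"] by simp
  qed
  then show ?thesis by (simp add: shuffle_assoc_def left_shuffle_def right_shuffle_def)
qed

text \<open>The pentagon handles a last variable in the third context. For one in the second or
  first context the three contexts are rotated by the hexagon: \<open>mid\<close> comes from two
  instances of \<open>last\<close>, and \<open>first\<close> from one of \<open>mid\<close> and one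
  of \<open>last\<close>.\<close>

lemma shuffle_assoc:
  assumes "ctx_objects M" "ctx_objects N" "ctx_objects P"
    "disjoint_ctx M N" "disjoint_ctx M P" "disjoint_ctx N P"
  shows "shuffle_assoc n M N P"
  using assms
proof (induction n arbitrary: M N P)
  case 0
  show ?case by (rule shuffle_assoc_zero)
next
  case (Suc n)
  have last: "shuffle_assoc (Suc n) K L Q"
    if "ctx_objects K" "ctx_objects L" "ctx_objects Q" "disjoint_ctx K L" "disjoint_ctx K Q" "disjoint_ctx L Q"
      "Q n = Some x" for K L Q x
    using shuffle_assoc_last[OF that(1-6) Suc.IH[OF that(1-6)] that(7)] .
  have mid: "shuffle_assoc (Suc n) K L Q"
    if "ctx_objects K" "ctx_objects L" "ctx_objects Q" "disjoint_ctx K L" "disjoint_ctx K Q" "disjoint_ctx L Q"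
      "L n = Some x" for K L Q x
    proof -
    note c = that(4-6)[THEN disjoint_ctx_comm]
    show ?thesis
      by (rule shuffle_assoc_rotate[OF that(3,1,2) c(2,3) that(4)
          last[OF that(1,3,2) that(5,4) c(3) that(7)] last[OF that(3,1,2) c(2,3) that(4,7)]])
  qed
  have first: "shuffle_assoc (Suc n) K L Q"
    if "ctx_objects K" "ctx_objects L" "ctx_objects Q" "disjoint_ctx K L" "disjoint_ctx K Q" "disjoint_ctx L Q"
      "K n = Some x" for K L Q x
    proof -
    note c = that(4-6)[THEN disjoint_ctx_comm]
    show ?thesis
      by (rule shuffle_assoc_rotate'[OF that(1-6)
          mid[OF that(2,1,3) c(1) that(6,5,7)] last[OF that(2,3,1) that(6) c(1,2) that(7)]])
  qed
  show ?case
  proof (cases "M n = None \<and> N n = None \<and> P n = None")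
    case True
    then show ?thesis using Suc.IH[OF Suc.prems]
      by (simp add: shuffle_assoc_def left_shuffle_def right_shuffle_def)
  next
    case False
    then show ?thesis using first[OF Suc.prems] mid[OF Suc.prems] last[OF Suc.prems] by auto
  qed
qed

text \<open>An empty left context contributes a unit, which \<open>lunit\<close> absorbs; for each
  further variable \<open>lunit_assoc\<close> carries the unitor past the associator.\<close>

lemma shuffle_empty:
  assumes "ctx_objects M"
  shows "lunit V (ctx_tensor n M) \<cdot> shuffle n Map.empty M = \<one> (ctx_tensor n M)"
proof (induction n)
  case 0
  show ?case by simp
next
  case (Suc n)
  have E: "ctx_tensor n Map.empty = \<I>" by (induction n) auto
  show ?case
  proof (cases "M n")
    case None
    then show ?thesis using Suc by simp
  next
    case (Some x)
    then have [simp]: "x \<in> Ob V" using assms ctx_objectsD by blast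
    have "lunit V (ctx_tensor n M \<odot> x) \<cdot> (assoc V \<I> (ctx_tensor n M) x \<cdot> (shuffle n Map.empty M \<otimes> \<one> x))
      = (lunit V (ctx_tensor n M) \<otimes> \<one> x) \<cdot> (shuffle n Map.empty M \<otimes> \<one> x)"
      by (rule comp_reassoc[OF lunit_assoc]) (use assms E in simp_all)
    then show ?thesis using Suc Some assms by (simp add: E)
  qed
qed

lemma ctx_tensor_stable:
  assumes "dom M \<subseteq> {..<n}" "n \<le> m"
  shows "ctx_tensor m M = ctx_tensor n M"
  using assms(2)
proof (induction rule: dec_induct)
  case (step k)
  then have "M k = None" using assms(1) by (auto simp: domIff subset_iff)
  then show ?case using step by simp
qed simp

lemma shuffle_stable:
  assumes "dom M \<subseteq> {..<n}" "dom N \<subseteq> {..<n}" "n \<le> m"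
  shows "shuffle m M N = shuffle n M N"
  using assms(3)
proof (induction rule: dec_induct)
  case (step k)
  then have "M k = None" "N k = None" using assms(1,2) by (auto simp: domIff subset_iff)
  then show ?case using step by simp
qed simp

end

section \<open>Elements\<close>

text \<open>The context is stored with the arrow because the tensor product of a context does not
  determine it, while the splitting used for a pair depends on which variables occur on which
  side.\<close>

datatype ('o, 'a) element = Element (ectx: "nat \<rightharpoonup> 'o") (earr: 'a)

lemma element_eq_iff: "a = b \<longleftrightarrow> ectx a = ectx b \<and> earr a = earr b"
  by (cases a; cases b) simp

context smcc
begin

section \<open>Contexts without an explicit bound on their variables\<close>

definition ctx_bound :: "(nat \<rightharpoonup> 'o) \<Rightarrow> nat" where
  "ctx_bound M = (LEAST n. dom M \<subseteq> {..<n})"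

definition tensor_of :: "(nat \<rightharpoonup> 'o) \<Rightarrow> 'o" where
  "tensor_of M = ctx_tensor (ctx_bound M) M"

definition split_ctx :: "(nat \<rightharpoonup> 'o) \<Rightarrow> (nat \<rightharpoonup> 'o) \<Rightarrow> 'a" where
  "split_ctx M N = shuffle (ctx_bound (M ++ N)) M N"

definition context_ok :: "(nat \<rightharpoonup> 'o) \<Rightarrow> bool" where
  "context_ok M \<longleftrightarrow> finite (dom M) \<and> ctx_objects M"

lemma context_ok_add [simp]: "context_ok M \<Longrightarrow> context_ok N \<Longrightarrow> context_ok (M ++ N)"
  by (simp add: context_ok_def)

lemma context_ok_empty [simp]: "context_ok Map.empty"
  by (simp add: context_ok_def)

lemma context_ok_objects [simp]: "context_ok M \<Longrightarrow> ctx_objects M"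
  by (simp add: context_ok_def)

lemma ctx_bound: "context_ok M \<Longrightarrow> dom M \<subseteq> {..<ctx_bound M}"
  unfolding ctx_bound_def context_ok_def
  by (rule LeastI_ex) (metis finite_nat_iff_bounded)

lemma ctx_bound_add: "context_ok M \<Longrightarrow> context_ok N \<Longrightarrow> dom M \<union> dom N \<subseteq> {..<ctx_bound (M ++ N)}"
  using ctx_bound[of "M ++ N"] by auto

lemma ctx_tensor_eq:
  assumes "context_ok M" "dom M \<subseteq> {..<n}"
  shows "ctx_tensor n M = tensor_of M"
proof -
  have "ctx_bound M \<le> n" unfolding ctx_bound_def using assms(2) by (rule Least_le)
  then show ?thesis unfolding tensor_of_def by (rule ctx_tensor_stable[OF ctx_bound[OF assms(1)]])
qed

lemma shuffle_eq:
  assumes "context_ok M" "context_ok N" "dom M \<subseteq> {..<n}" "dom N \<subseteq> {..<n}"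
  shows "shuffle n M N = split_ctx M N"
proof -
  have "ctx_bound (M ++ N) \<le> n" unfolding ctx_bound_def using assms(3,4) by (intro Least_le) auto
  then show ?thesis unfolding split_ctx_def
    using ctx_bound_add[OF assms(1,2)] by (intro shuffle_stable) auto
qed

lemma tensor_of_Ob [simp]: "context_ok M \<Longrightarrow> tensor_of M \<in> Ob V"
  by (simp add: tensor_of_def)

lemma split_ctx_iso:
  assumes "context_ok M" "context_ok N" "disjoint_ctx M N"
  shows "iso_arrow V (tensor_of (M ++ N)) (tensor_of M \<odot> tensor_of N) (split_ctx M N)"
  using shuffle_iso[of M N "ctx_bound (M ++ N)"] ctx_bound_add[of M N] assms
  by (simp add: split_ctx_def ctx_tensor_eq)

lemma split_ctx_typing [simp]:
  assumes "context_ok M" "context_ok N" "disjoint_ctx M N"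
  shows "split_ctx M N \<in> Arr V" "Dom V (split_ctx M N) = tensor_of (M ++ N)"
    "Cod V (split_ctx M N) = tensor_of M \<odot> tensor_of N"
  using iso_arrow_inverse[OF split_ctx_iso[OF assms]] by auto

lemma split_ctx_comm:
  assumes "context_ok M" "context_ok N" "disjoint_ctx M N"
  shows "symm V (tensor_of M) (tensor_of N) \<cdot> split_ctx M N = split_ctx N M"
  using shuffle_comm[of M N "ctx_bound (M ++ N)"] ctx_bound_add[of M N] assms disjoint_ctx_add_comm[of M N]
  by (simp add: split_ctx_def ctx_tensor_eq)

lemma split_ctx_assoc:
  assumes "context_ok M" "context_ok N" "context_ok P"
    "disjoint_ctx M N" "disjoint_ctx M P" "disjoint_ctx N P"
  shows "assoc V (tensor_of M) (tensor_of N) (tensor_of P) \<cdot> (split_ctx M N \<otimes> \<one> (tensor_of P)) \<cdot> split_ctx (M ++ N) P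
    = (\<one> (tensor_of M) \<otimes> split_ctx N P) \<cdot> split_ctx M (N ++ P)"
  using shuffle_assoc[of M N P "ctx_bound (M ++ (N ++ P))"] ctx_bound_add[of M "N ++ P"] assms
  by (simp add: shuffle_assoc_def left_shuffle_def right_shuffle_def shuffle_eq ctx_tensor_eq)

lemma tensor_of_empty [simp]: "tensor_of Map.empty = \<I>"
  by (simp add: tensor_of_def ctx_bound_def)

lemma split_ctx_empty:
  assumes "context_ok M"
  shows "lunit V (tensor_of M) \<cdot> split_ctx Map.empty M = \<one> (tensor_of M)"
  using shuffle_empty[of M "ctx_bound M"] ctx_bound[of M] assms
  by (simp add: shuffle_eq ctx_tensor_eq)

text \<open>
  An element of \<open>y\<close> in context \<open>M\<close> is an arrow from the tensor product of \<open>M\<close> to \<open>y\<close>, recorded with \<open>M\<close>.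
  Elements are a linear internal language for \<open>V\<close>: pairs are formed in disjoint contexts, and on
  pairs the structural isomorphisms act as the corresponding rearrangements.
\<close>

definition el :: "('o, 'a) element \<Rightarrow> bool" where
  "el e \<longleftrightarrow> context_ok (ectx e) \<and> earr e \<in> Arr V \<and> Dom V (earr e) = tensor_of (ectx e)"

definition ty :: "('o, 'a) element \<Rightarrow> 'o" where
  "ty e = Cod V (earr e)"

definition app :: "'a \<Rightarrow> ('o, 'a) element \<Rightarrow> ('o, 'a) element"  (infixr "\<bullet>" 70) where
  "f \<bullet> e = Element (ectx e) (f \<cdot> earr e)"

definition pair :: "('o, 'a) element \<Rightarrow> ('o, 'a) element \<Rightarrow> ('o, 'a) element"  ("\<langle>_,/ _\<rangle>") where
  "\<langle>a, b\<rangle> = Element (ectx a ++ ectx b) ((earr a \<otimes> earr b) \<cdot> split_ctx (ectx a) (ectx b))"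

definition star :: "('o, 'a) element" where
  "star = Element Map.empty (\<one> \<I>)"

definition apart :: "('o, 'a) element \<Rightarrow> ('o, 'a) element \<Rightarrow> bool"  (infix "\<sharp>" 50) where
  "a \<sharp> b \<longleftrightarrow> disjoint_ctx (ectx a) (ectx b)"

abbreviation evl where "evl x y h a \<equiv> ev V x y \<bullet> \<langle>h, a\<rangle>"
abbreviation act where "act F a b f s \<equiv> ev V (FOb F a) (FOb F b) \<bullet> \<langle>FHom F a b \<bullet> f, s\<rangle>"
abbreviation cmp where "cmp A a b c g f \<equiv> VComp A a b c \<bullet> \<langle>g, f\<rangle>"

lemma apart_sym: "a \<sharp> b \<Longrightarrow> b \<sharp> a"
  by (auto simp: apart_def intro: disjoint_ctx_comm)

lemma apart_simps [simp]:
  "f \<bullet> a \<sharp> c \<longleftrightarrow> a \<sharp> c" "c \<sharp> f \<bullet> a \<longleftrightarrow> c \<sharp> a"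
  "\<langle>a, b\<rangle> \<sharp> c \<longleftrightarrow> a \<sharp> c \<and> b \<sharp> c" "c \<sharp> \<langle>a, b\<rangle> \<longleftrightarrow> c \<sharp> a \<and> c \<sharp> b"
  "star \<sharp> c" "c \<sharp> star"
  by (auto simp: apart_def app_def pair_def star_def)

lemma ectx_simps [simp]:
  "ectx (f \<bullet> e) = ectx e" "ectx \<langle>a, b\<rangle> = ectx a ++ ectx b" "ectx star = Map.empty"
  by (auto simp: app_def pair_def star_def)

lemma ectx_add_comm: "a \<sharp> b \<Longrightarrow> ectx b ++ ectx a = ectx a ++ ectx b"
  by (rule disjoint_ctx_add_comm) (simp add: apart_def disjoint_ctx_comm)

lemma ty_Ob [simp]: "el e \<Longrightarrow> ty e \<in> Ob V"
  by (simp add: el_def ty_def)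

lemma el_app [simp]:
  assumes "el e" "f \<in> Arr V" "Dom V f = ty e"
  shows "el (f \<bullet> e)" "ty (f \<bullet> e) = Cod V f"
  using assms by (auto simp: el_def ty_def app_def)

lemma el_pair [simp]:
  assumes "el a" "el b" "a \<sharp> b"
  shows "el \<langle>a, b\<rangle>" "ty \<langle>a, b\<rangle> = ty a \<odot> ty b"
  using assms by (auto simp: el_def ty_def pair_def apart_def)

lemma el_star [simp]: "el star" "ty star = \<I>"
  by (auto simp: el_def ty_def star_def)

lemma app_comp [simp]:
  assumes "el e" "f \<in> Arr V" "g \<in> Arr V" "Dom V f = ty e" "Dom V g = Cod V f"
  shows "(g \<cdot> f) \<bullet> e = g \<bullet> f \<bullet> e"
  using assms by (auto simp: el_def ty_def app_def)

lemma app_one [simp]: "el e \<Longrightarrow> ty e = x \<Longrightarrow> \<one> x \<bullet> e = e"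
  by (auto simp: el_def ty_def app_def element_eq_iff)

lemma app_tens [simp]:
  assumes "el a" "el b" "a \<sharp> b" "f \<in> Arr V" "g \<in> Arr V" "Dom V f = ty a" "Dom V g = ty b"
  shows "(f \<otimes> g) \<bullet> \<langle>a, b\<rangle> = \<langle>f \<bullet> a, g \<bullet> b\<rangle>"
  using assms by (auto simp: el_def ty_def app_def pair_def apart_def)

text \<open>The union of disjoint contexts is strictly commutative, so both sides live in the same
  context; what changes is the splitting, by \<open>split_ctx_comm\<close>. In
  \<open>app_assoc\<close> the union is strictly associative and \<open>split_ctx_assoc\<close>
  plays the same part.\<close>

lemma app_symm [simp]:
  assumes "el a" "el b" "a \<sharp> b" "ty a = x" "ty b = y"
  shows "symm V x y \<bullet> \<langle>a, b\<rangle> = \<langle>b, a\<rangle>"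
proof -
  have c: "disjoint_ctx (ectx a) (ectx b)" "disjoint_ctx (ectx b) (ectx a)"
    using assms disjoint_ctx_comm by (auto simp: apart_def)
  have "symm V x y \<cdot> (earr a \<otimes> earr b) \<cdot> split_ctx (ectx a) (ectx b)
     = (symm V x y \<cdot> (earr a \<otimes> earr b)) \<cdot> split_ctx (ectx a) (ectx b)"
    using assms c by (auto simp: el_def ty_def)
  also have "\<dots> = (earr b \<otimes> earr a) \<cdot> (symm V (tensor_of (ectx a)) (tensor_of (ectx b)) \<cdot> split_ctx (ectx a) (ectx b))"
    using assms c symm_nat[of "earr a" "earr b"] by (auto simp: el_def ty_def)
  also have "\<dots> = (earr b \<otimes> earr a) \<cdot> split_ctx (ectx b) (ectx a)"
    using assms c by (auto simp: split_ctx_comm el_def)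
  finally show ?thesis
    using c by (auto simp: app_def pair_def disjoint_ctx_add_comm)
qed

lemma app_assoc [simp]:
  assumes "el a" "el b" "el c" "a \<sharp> b" "a \<sharp> c" "b \<sharp> c" "ty a = x" "ty b = y" "ty c = z"
  shows "assoc V x y z \<bullet> \<langle>\<langle>a, b\<rangle>, c\<rangle> = \<langle>a, \<langle>b, c\<rangle>\<rangle>"
proof -
  let ?A = "tensor_of (ectx a)" and ?B = "tensor_of (ectx b)" and ?C = "tensor_of (ectx c)"
  have d: "disjoint_ctx (ectx a) (ectx b)" "disjoint_ctx (ectx a) (ectx c)" "disjoint_ctx (ectx b) (ectx c)"
    using assms by (auto simp: apart_def)
  have t: "context_ok (ectx a)" "context_ok (ectx b)" "context_ok (ectx c)"
    "earr a \<in> Arr V" "earr b \<in> Arr V" "earr c \<in> Arr V"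
    "Dom V (earr a) = ?A" "Dom V (earr b) = ?B" "Dom V (earr c) = ?C"
    "Cod V (earr a) = x" "Cod V (earr b) = y" "Cod V (earr c) = z"
    using assms by (auto simp: el_def ty_def)
  have [simp]: "x \<in> Ob V" "y \<in> Ob V" "z \<in> Ob V" using assms by auto
  have "assoc V x y z \<cdot> (((earr a \<otimes> earr b) \<cdot> split_ctx (ectx a) (ectx b)) \<otimes> earr c) \<cdot> split_ctx (ectx a ++ ectx b) (ectx c)
     = (assoc V x y z \<cdot> ((earr a \<otimes> earr b) \<otimes> earr c)) \<cdot> (split_ctx (ectx a) (ectx b) \<otimes> \<one> ?C) \<cdot> split_ctx (ectx a ++ ectx b) (ectx c)"
    using d t by simp
  also have "\<dots> = (earr a \<otimes> (earr b \<otimes> earr c)) \<cdot> (assoc V ?A ?B ?C \<cdot> (split_ctx (ectx a) (ectx b) \<otimes> \<one> ?C) \<cdot> split_ctx (ectx a ++ ectx b) (ectx c))"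
    using d t assoc_nat[of "earr a" "earr b" "earr c"] by simp
  also have "\<dots> = (earr a \<otimes> ((earr b \<otimes> earr c) \<cdot> split_ctx (ectx b) (ectx c))) \<cdot> split_ctx (ectx a) (ectx b ++ ectx c)"
    using d t by (simp add: split_ctx_assoc)
  finally show ?thesis by (simp add: app_def pair_def)
qed

lemma app_lunit [simp]:
  assumes "el a" "ty a = x"
  shows "lunit V x \<bullet> \<langle>star, a\<rangle> = a"
proof -
  have t: "context_ok (ectx a)" "earr a \<in> Arr V" "Dom V (earr a) = tensor_of (ectx a)" "Cod V (earr a) = x" "x \<in> Ob V"
    using assms by (auto simp: el_def ty_def)
  have "lunit V x \<cdot> (\<one> \<I> \<otimes> earr a) \<cdot> split_ctx Map.empty (ectx a)
    = (lunit V x \<cdot> (\<one> \<I> \<otimes> earr a)) \<cdot> split_ctx Map.empty (ectx a)"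
    using t by simp
  also have "\<dots> = earr a \<cdot> (lunit V (tensor_of (ectx a)) \<cdot> split_ctx Map.empty (ectx a))"
    using t lunit_nat[of "earr a"] by simp
  also have "\<dots> = earr a" using t by (simp add: split_ctx_empty)
  finally show ?thesis by (simp add: app_def pair_def star_def)
qed

lemma app_runit [simp]:
  assumes "el a" "ty a = x"
  shows "runit V x \<bullet> \<langle>a, star\<rangle> = a"
proof -
  have "x \<in> Ob V" using assms by auto
  then show ?thesis using assms lunit_symm[symmetric, of x] by simp
qed

lemma app_left_inverse:
  assumes "iso_arrow V x y f" "el a" "ty a = x" "f \<bullet> a = b"
  shows "inverse_of V f \<bullet> b = a"
proof -
  note f = iso_arrow_inverse[OF assms(1)]
  have "inverse_of V f \<bullet> f \<bullet> a = (inverse_of V f \<cdot> f) \<bullet> a"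
    using f(1-6) assms by (intro app_comp[symmetric]) auto
  then show ?thesis using f assms by simp
qed

lemma app_inverses [simp]:
  assumes "el a" "ty a = x"
  shows "linv x \<bullet> a = \<langle>star, a\<rangle>" "rinv x \<bullet> a = \<langle>a, star\<rangle>"
  using assms by (auto intro!: app_left_inverse[OF lunit_iso] app_left_inverse[OF runit_iso])

lemma app_ainv [simp]:
  assumes "el a" "el b" "el c" "a \<sharp> b" "a \<sharp> c" "b \<sharp> c" "ty a = x" "ty b = y" "ty c = z"
  shows "ainv x y z \<bullet> \<langle>a, \<langle>b, c\<rangle>\<rangle> = \<langle>\<langle>a, b\<rangle>, c\<rangle>"
  using assms by (auto intro!: app_left_inverse[OF assoc_iso])

text \<open>A generic element: its arrow is invertible, so two arrows that agree on it are equal.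
  Fresh variables, and pairs of generic elements in disjoint contexts, are generic.\<close>

definition iso_el :: "('o, 'a) element \<Rightarrow> bool" where
  "iso_el e \<longleftrightarrow> el e \<and> iso_arrow V (tensor_of (ectx e)) (ty e) (earr e)"

lemma iso_el_el [simp]: "iso_el e \<Longrightarrow> el e"
  by (simp add: iso_el_def)

lemma iso_el_pair:
  assumes "iso_el a" "iso_el b" "a \<sharp> b"
  shows "iso_el \<langle>a, b\<rangle>"
proof -
  have "iso_arrow V (tensor_of (ectx a ++ ectx b)) (ty a \<odot> ty b) ((earr a \<otimes> earr b) \<cdot> split_ctx (ectx a) (ectx b))"
    using assms by (intro iso_arrow_comp[OF split_ctx_iso iso_arrow_tens]) (auto simp: iso_el_def el_def apart_def)
  then show ?thesis using assms by (simp add: iso_el_def) (simp add: pair_def)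
qed

lemma iso_el_star: "iso_el star"
  by (simp add: iso_el_def) (simp add: star_def iso_arrow_ident)

lemma iso_el_cancel:
  assumes "iso_el e" "f \<in> Arr V" "g \<in> Arr V" "Dom V f = ty e" "Dom V g = ty e" "f \<bullet> e = g \<bullet> e"
  shows "f = g"
proof -
  note i = iso_arrow_inverse[of "tensor_of (ectx e)" "ty e" "earr e"]
  show ?thesis
    by (rule retraction_cancel[of "earr e" "inverse_of V (earr e)"])
      (use i assms in \<open>auto simp: iso_el_def app_def\<close>)
qed

lemma fresh_iso_el:
  assumes "x \<in> Ob V" "context_ok M"
  obtains a where "iso_el a" "ty a = x" "disjoint_ctx (ectx a) M"
proof -
  define i where "i = ctx_bound M"
  have Mi: "M i = None" using ctx_bound[OF assms(2)] by (auto simp: i_def)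
  have ok: "context_ok [i \<mapsto> x]" using assms by (simp add: context_ok_def ctx_objects_def)
  \<comment> \<open>The tensor product of a context starts from \<open>\<I>\<close>, so a single
    variable yields \<open>\<I> \<odot> x\<close>; this is why the generic element of
    \<open>x\<close> is \<open>lunit V x\<close> and not an identity.\<close>
  have "ctx_tensor n (\<lambda>a. if a = i then Some x else None) = \<I>" if "n \<le> i" for n
    using that by (induction n) auto
  then have "ctx_tensor (Suc i) [i \<mapsto> x] = \<I> \<odot> x" by (simp add: fun_upd_def)
  moreover have "ctx_tensor (Suc i) [i \<mapsto> x] = tensor_of [i \<mapsto> x]"
    by (rule ctx_tensor_eq[OF ok]) auto
  ultimately have T: "tensor_of [i \<mapsto> x] = \<I> \<odot> x" by simp
  show ?thesis
  proof (rule that[of "Element [i \<mapsto> x] (lunit V x)"])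
    show "iso_el (Element [i \<mapsto> x] (lunit V x))"
      using assms(1) ok T lunit_iso by (auto simp: iso_el_def el_def ty_def)
    show "ty (Element [i \<mapsto> x] (lunit V x)) = x" using assms(1) by (simp add: ty_def)
    show "disjoint_ctx (ectx (Element [i \<mapsto> x] (lunit V x))) M" using Mi by (auto simp: disjoint_ctx_def)
  qed
qed

lemma fresh_apart:
  assumes "x \<in> Ob V" "el e"
  obtains a where "iso_el a" "ty a = x" "a \<sharp> e" "e \<sharp> a"
  using fresh_iso_el[OF assms(1), of "ectx e"] assms(2) apart_sym unfolding el_def apart_def
  by (metis disjoint_ctx_comm)

text \<open>One generic element decides the equality. The assumption ranges over all elements so
  that \<open>a\<close> can be treated as a variable when it is verified.\<close>

lemma arrow_ext:
  assumes "f \<in> Arr V" "g \<in> Arr V" "Dom V f = x" "Dom V g = x"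
    and "\<And>a. \<lbrakk>el a; ty a = x\<rbrakk> \<Longrightarrow> f \<bullet> a = g \<bullet> a"
  shows "f = g"
proof -
  have "x \<in> Ob V" using assms(1,3) by auto
  then obtain a where "iso_el a" "ty a = x" using fresh_apart[OF _ el_star(1), of x] by blast
  then show ?thesis using assms by (intro iso_el_cancel[of a]) auto
qed

text \<open>A pair of generic elements in disjoint contexts is generic, so testing on pairs
  suffices, although an element of \<open>x \<odot> y\<close> need not be a pair.\<close>

lemma arrow_ext2:
  assumes "f \<in> Arr V" "g \<in> Arr V" "Dom V f = x \<odot> y" "Dom V g = x \<odot> y" and x: "x \<in> Ob V" and y: "y \<in> Ob V"
    and eq: "\<And>a b. \<lbrakk>el a; ty a = x; el b; ty b = y; a \<sharp> b; b \<sharp> a\<rbrakk> \<Longrightarrow> f \<bullet> \<langle>a, b\<rangle> = g \<bullet> \<langle>a, b\<rangle>"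
  shows "f = g"
proof -
  obtain a where a: "iso_el a" "ty a = x" using fresh_apart[OF x el_star(1)] by blast
  moreover obtain b where b: "iso_el b" "ty b = y" "b \<sharp> a" "a \<sharp> b" using fresh_apart[OF y, of a] a by auto
  ultimately show ?thesis using assms by (intro iso_el_cancel[OF iso_el_pair[OF a(1) b(1,4)]]) auto
qed

lemma arrow_ext3:
  assumes "f \<in> Arr V" "g \<in> Arr V" "Dom V f = (x \<odot> y) \<odot> z" "Dom V g = (x \<odot> y) \<odot> z"
    and x: "x \<in> Ob V" and y: "y \<in> Ob V" and z: "z \<in> Ob V"
    and eq: "\<And>a b c. \<lbrakk>el a; ty a = x; el b; ty b = y; el c; ty c = z;
      a \<sharp> b; b \<sharp> a; a \<sharp> c; c \<sharp> a; b \<sharp> c; c \<sharp> b\<rbrakk> \<Longrightarrow> f \<bullet> \<langle>\<langle>a, b\<rangle>, c\<rangle> = g \<bullet> \<langle>\<langle>a, b\<rangle>, c\<rangle>"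
  shows "f = g"
proof -
  obtain a where a: "iso_el a" "ty a = x" using fresh_apart[OF x el_star(1)] by blast
  obtain b where b: "iso_el b" "ty b = y" "b \<sharp> a" "a \<sharp> b" using fresh_apart[OF y, of a] a by auto
  have ab: "iso_el \<langle>a, b\<rangle>" using iso_el_pair a b by blast
  obtain c where c: "iso_el c" "ty c = z" "c \<sharp> \<langle>a, b\<rangle>" "\<langle>a, b\<rangle> \<sharp> c" using fresh_apart[OF z, of "\<langle>a, b\<rangle>"] ab by auto
  show ?thesis
    by (rule iso_el_cancel[OF iso_el_pair[OF ab c(1,4)]]) (use a b c ab assms in auto)
qed

lemma arrow_ext4:
  assumes "f \<in> Arr V" "g \<in> Arr V" "Dom V f = ((x \<odot> y) \<odot> z) \<odot> w" "Dom V g = ((x \<odot> y) \<odot> z) \<odot> w"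
    and x: "x \<in> Ob V" and y: "y \<in> Ob V" and z: "z \<in> Ob V" and w: "w \<in> Ob V"
    and eq: "\<And>a b c d. \<lbrakk>el a; ty a = x; el b; ty b = y; el c; ty c = z; el d; ty d = w;
      a \<sharp> b; b \<sharp> a; a \<sharp> c; c \<sharp> a; b \<sharp> c; c \<sharp> b; a \<sharp> d; d \<sharp> a; b \<sharp> d; d \<sharp> b; c \<sharp> d; d \<sharp> c\<rbrakk>
      \<Longrightarrow> f \<bullet> \<langle>\<langle>\<langle>a, b\<rangle>, c\<rangle>, d\<rangle> = g \<bullet> \<langle>\<langle>\<langle>a, b\<rangle>, c\<rangle>, d\<rangle>"
  shows "f = g"
proof -
  obtain a where a: "iso_el a" "ty a = x" using fresh_apart[OF x el_star(1)] by blast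
  obtain b where b: "iso_el b" "ty b = y" "b \<sharp> a" "a \<sharp> b" using fresh_apart[OF y, of a] a by auto
  have ab: "iso_el \<langle>a, b\<rangle>" using iso_el_pair a b by blast
  obtain c where c: "iso_el c" "ty c = z" "c \<sharp> \<langle>a, b\<rangle>" "\<langle>a, b\<rangle> \<sharp> c" using fresh_apart[OF z, of "\<langle>a, b\<rangle>"] ab by auto
  have abc: "iso_el \<langle>\<langle>a, b\<rangle>, c\<rangle>" using iso_el_pair ab c by blast
  obtain d where d: "iso_el d" "ty d = w" "d \<sharp> \<langle>\<langle>a, b\<rangle>, c\<rangle>" "\<langle>\<langle>a, b\<rangle>, c\<rangle> \<sharp> d"
    using fresh_apart[OF w, of "\<langle>\<langle>a, b\<rangle>, c\<rangle>"] abc by auto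
  show ?thesis
    by (rule iso_el_cancel[OF iso_el_pair[OF abc d(1,4)]]) (use a b c d ab abc assms in auto)
qed

lemma unit_ext:
  assumes "f \<in> Arr V" "g \<in> Arr V" "Dom V f = \<I>" "Dom V g = \<I>" "f \<bullet> star = g \<bullet> star"
  shows "f = g"
  using assms iso_el_cancel[OF iso_el_star] by simp

section \<open>The closed structure in terms of elements\<close>

lemma transp_typing [simp]:
  assumes "x \<in> Ob V" "z \<in> Ob V" "f \<in> Arr V" "Dom V f = z \<odot> x" "Cod V f = y"
  shows "transp V z x y f \<in> Arr V" "Dom V (transp V z x y f) = z" "Cod V (transp V z x y f) = ihom V x y"
    "ev V x y \<cdot> (transp V z x y f \<otimes> \<one> x) = f"
proof -
  have "\<exists>!g. g \<in> hom V z (ihom V x y) \<and> ev V x y \<cdot> (g \<otimes> \<one> x) = f"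
    using assms by (intro closed) (auto simp: hom_iff)
  from theI'[OF this] show "transp V z x y f \<in> Arr V" "Dom V (transp V z x y f) = z"
    "Cod V (transp V z x y f) = ihom V x y" "ev V x y \<cdot> (transp V z x y f \<otimes> \<one> x) = f"
    unfolding transp_def by (auto simp: hom_iff)
qed

lemma eval_transp [simp]:
  assumes "el e" "ty e = z" "el a" "ty a = x" "e \<sharp> a" "f \<in> Arr V" "Dom V f = z \<odot> x" "Cod V f = y"
  shows "evl x y (transp V z x y f \<bullet> e) a = f \<bullet> \<langle>e, a\<rangle>"
proof -
  have [simp]: "x \<in> Ob V" "z \<in> Ob V" "y \<in> Ob V" using assms by auto
  have "f \<bullet> \<langle>e, a\<rangle> = (ev V x y \<cdot> (transp V z x y f \<otimes> \<one> x)) \<bullet> \<langle>e, a\<rangle>" using assms by simp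
  also have "\<dots> = evl x y (transp V z x y f \<bullet> e) a" using assms by (simp del: transp_typing(4))
  finally show ?thesis by simp
qed

text \<open>Elements of an internal hom behave as functions: \<open>a\<close> may be a fresh
  variable, and an arrow is determined by its transpose. The contexts have to agree beforehand
  because they are part of the elements.\<close>

lemma eval_ext:
  assumes h: "el h" "ty h = ihom V x y" and h': "el h'" "ty h' = ihom V x y" and c: "ectx h = ectx h'"
    and x: "x \<in> Ob V" and y: "y \<in> Ob V"
    and eq: "\<And>a. \<lbrakk>el a; ty a = x; h \<sharp> a; a \<sharp> h; h' \<sharp> a; a \<sharp> h'\<rbrakk> \<Longrightarrow> evl x y h a = evl x y h' a"
  shows "h = h'"
proof -
  obtain a where a: "iso_el a" "ty a = x" "a \<sharp> h" "h \<sharp> a" using fresh_apart[OF x h(1)] by blast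
  have a': "a \<sharp> h'" "h' \<sharp> a" using a c by (auto simp: apart_def)
  let ?M = "tensor_of (ectx h)"
  let ?i = "(\<one> ?M \<otimes> earr a) \<cdot> split_ctx (ectx h) (ectx a)"
  have t: "earr h \<in> Arr V" "earr h' \<in> Arr V" "earr a \<in> Arr V" "context_ok (ectx h)" "context_ok (ectx a)"
    "Dom V (earr h) = ?M" "Dom V (earr h') = ?M" "Dom V (earr a) = tensor_of (ectx a)" "Cod V (earr a) = x"
    "Cod V (earr h) = ihom V x y" "Cod V (earr h') = ihom V x y" "disjoint_ctx (ectx h) (ectx a)"
    using h h' a c by (auto simp: el_def ty_def iso_el_def apart_def)
  have iso: "iso_arrow V (tensor_of (ectx h ++ ectx a)) (?M \<odot> x) ?i"
    using a t by (intro iso_arrow_comp[OF split_ctx_iso iso_arrow_tens] iso_arrow_ident) (auto simp: iso_el_def)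
  note i = iso_arrow_inverse[OF iso]
  have "evl x y h a = evl x y h' a" using a a' by (intro eq) auto
  then have eq2: "(ev V x y \<cdot> (earr h \<otimes> \<one> x)) \<cdot> ?i = (ev V x y \<cdot> (earr h' \<otimes> \<one> x)) \<cdot> ?i"
    using t x y c by (simp add: app_def pair_def)
  have "ev V x y \<cdot> (earr h \<otimes> \<one> x) = ev V x y \<cdot> (earr h' \<otimes> \<one> x)"
    by (rule retraction_cancel[OF _ _ _ _ _ _ _ _ eq2, of "inverse_of V ?i"])
      (use i t x y in \<open>simp_all del: assoc_comp tens_comp tens_comp2\<close>)
  moreover have "\<exists>!g. g \<in> hom V ?M (ihom V x y) \<and> ev V x y \<cdot> (g \<otimes> \<one> x) = ev V x y \<cdot> (earr h' \<otimes> \<one> x)"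
    using t x y by (intro closed) (auto simp: hom_iff)
  ultimately have "earr h = earr h'" using t by (auto simp: hom_iff)
  then show ?thesis using c by (simp add: element_eq_iff)
qed

lemma app_transp_ext:
  assumes "f \<in> Arr V" "g \<in> Arr V" "Dom V f = z" "Dom V g = z" "Cod V f = ihom V x y" "Cod V g = ihom V x y"
    and "x \<in> Ob V" "y \<in> Ob V"
    and eq: "\<And>e a. \<lbrakk>el e; ty e = z; el a; ty a = x; e \<sharp> a; a \<sharp> e\<rbrakk> \<Longrightarrow> evl x y (f \<bullet> e) a = evl x y (g \<bullet> e) a"
  shows "f = g"
proof (rule arrow_ext)
  fix e assume e: "el e" "ty e = z"
  show "f \<bullet> e = g \<bullet> e"
    by (rule eval_ext[of _ x y]) (use assms e in auto)
qed (use assms in auto)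

lemma app_unname [simp]:
  assumes "f \<in> Arr V" "Dom V f = \<I>" "Cod V f = ihom V x y" "x \<in> Ob V" "y \<in> Ob V" "el a" "ty a = x"
  shows "unname V x y f \<bullet> a = evl x y (f \<bullet> star) a"
  using assms by (simp add: unname_def)

lemma unname_typing [simp]:
  assumes "f \<in> Arr V" "Dom V f = \<I>" "Cod V f = ihom V x y" "x \<in> Ob V" "y \<in> Ob V"
  shows "unname V x y f \<in> Arr V" "Dom V (unname V x y f) = x" "Cod V (unname V x y f) = y"
  using assms by (simp_all add: unname_def)

end

section \<open>Enriched categories and functors in terms of elements\<close>

context smcc
begin

lemma vcat_typing [simp]:
  assumes "vcategory V A" "a \<in> VOb A"
  shows "b \<in> VOb A \<Longrightarrow> VHom A a b \<in> Ob V"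
    "VId A a \<in> Arr V" "Dom V (VId A a) = \<I>" "Cod V (VId A a) = VHom A a a"
  using vcategory.VHom_Ob[OF assms] vcategory.VId_hom[OF assms] by (auto simp: hom_iff)

lemma VComp_typing [simp]:
  assumes "vcategory V A" "a \<in> VOb A" "b \<in> VOb A" "c \<in> VOb A"
  shows "VComp A a b c \<in> Arr V" "Dom V (VComp A a b c) = VHom A b c \<odot> VHom A a b"
    "Cod V (VComp A a b c) = VHom A a c"
  using vcategory.VComp_hom[OF assms] by (auto simp: hom_iff)

lemma VComp_assoc_el [simp]:
  assumes A: "vcategory V A" "a \<in> VOb A" "b \<in> VOb A" "c \<in> VOb A" "d \<in> VOb A"
    and "el h" "ty h = VHom A c d" "el g" "ty g = VHom A b c" "el f" "ty f = VHom A a b"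
      "h \<sharp> g" "h \<sharp> f" "g \<sharp> f"
  shows "cmp A a b d (cmp A b c d h g) f = cmp A a c d h (cmp A a b c g f)"
proof -
  have "(VComp A a b d \<cdot> (VComp A b c d \<otimes> \<one> (VHom A a b))) \<bullet> \<langle>\<langle>h, g\<rangle>, f\<rangle>
      = (VComp A a c d \<cdot> (\<one> (VHom A c d) \<otimes> VComp A a b c)
              \<cdot> assoc V (VHom A c d) (VHom A b c) (VHom A a b)) \<bullet> \<langle>\<langle>h, g\<rangle>, f\<rangle>"
    using vcategory.VComp_assoc[OF A] by simp
  then show ?thesis using assms by simp
qed

lemma VComp_VId_el [simp]:
  assumes A: "vcategory V A" "a \<in> VOb A" "b \<in> VOb A" and "el f" "ty f = VHom A a b"
  shows "cmp A a b b (VId A b \<bullet> star) f = f" "cmp A a a b f (VId A a \<bullet> star) = f"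
proof -
  have "(VComp A a b b \<cdot> (VId A b \<otimes> \<one> (VHom A a b))) \<bullet> \<langle>star, f\<rangle> = lunit V (VHom A a b) \<bullet> \<langle>star, f\<rangle>"
    using vcategory.VComp_VId_left[OF A] by simp
  then show "cmp A a b b (VId A b \<bullet> star) f = f" using assms by simp
  have "(VComp A a a b \<cdot> (\<one> (VHom A a b) \<otimes> VId A a)) \<bullet> \<langle>f, star\<rangle> = runit V (VHom A a b) \<bullet> \<langle>f, star\<rangle>"
    using vcategory.VComp_VId_right[OF A] by simp
  then show "cmp A a a b f (VId A a \<bullet> star) = f" using assms by simp
qed

lemma vcategoryI:
  assumes [simp]: "\<And>a b. \<lbrakk>a \<in> VOb A; b \<in> VOb A\<rbrakk> \<Longrightarrow> VHom A a b \<in> Ob V"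
    and [simp]: "\<And>a. a \<in> VOb A \<Longrightarrow> VId A a \<in> Arr V" "\<And>a. a \<in> VOb A \<Longrightarrow> Dom V (VId A a) = \<I>"
      "\<And>a. a \<in> VOb A \<Longrightarrow> Cod V (VId A a) = VHom A a a"
    and [simp]: "\<And>a b c. \<lbrakk>a \<in> VOb A; b \<in> VOb A; c \<in> VOb A\<rbrakk> \<Longrightarrow> VComp A a b c \<in> Arr V"
      "\<And>a b c. \<lbrakk>a \<in> VOb A; b \<in> VOb A; c \<in> VOb A\<rbrakk> \<Longrightarrow> Dom V (VComp A a b c) = VHom A b c \<odot> VHom A a b"
      "\<And>a b c. \<lbrakk>a \<in> VOb A; b \<in> VOb A; c \<in> VOb A\<rbrakk> \<Longrightarrow> Cod V (VComp A a b c) = VHom A a c"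
    and assoc: "\<And>a b c d h g f. \<lbrakk>a \<in> VOb A; b \<in> VOb A; c \<in> VOb A; d \<in> VOb A;
      el h; ty h = VHom A c d; el g; ty g = VHom A b c; el f; ty f = VHom A a b;
      h \<sharp> g; g \<sharp> h; h \<sharp> f; f \<sharp> h; g \<sharp> f; f \<sharp> g\<rbrakk>
      \<Longrightarrow> cmp A a b d (cmp A b c d h g) f = cmp A a c d h (cmp A a b c g f)"
    and left: "\<And>a b f. \<lbrakk>a \<in> VOb A; b \<in> VOb A; el f; ty f = VHom A a b\<rbrakk>
      \<Longrightarrow> cmp A a b b (VId A b \<bullet> star) f = f"
    and right: "\<And>a b f. \<lbrakk>a \<in> VOb A; b \<in> VOb A; el f; ty f = VHom A a b\<rbrakk>
      \<Longrightarrow> cmp A a a b f (VId A a \<bullet> star) = f"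
  shows "vcategory V A"
proof unfold_locales
  fix a b assume [simp]: "a \<in> VOb A" "b \<in> VOb A"
  show "VHom A a b \<in> Ob V" by simp
  show "VId A a \<in> hom V \<I> (VHom A a a)" by (simp add: hom_iff)
  show "VComp A a b b \<cdot> (VId A b \<otimes> \<one> (VHom A a b)) = lunit V (VHom A a b)"
  proof -
    \<comment> \<open>An element of type \<open>\<I>\<close> need not be \<open>star\<close>.
      Precomposing with \<open>linv\<close> leaves an arrow out of the hom-object alone, and there
      the unit appears only as \<open>star\<close>.\<close>
    have "VComp A a b b \<cdot> (VId A b \<otimes> \<one> (VHom A a b)) \<cdot> linv (VHom A a b) = \<one> (VHom A a b)"
      by (rule arrow_ext[of _ _ "VHom A a b"]) (simp_all add: left)
    then have "(VComp A a b b \<cdot> (VId A b \<otimes> \<one> (VHom A a b)) \<cdot> linv (VHom A a b)) \<cdot> lunit V (VHom A a b) = lunit V (VHom A a b)"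
      by simp
    then show ?thesis by simp
  qed
  show "VComp A a a b \<cdot> (\<one> (VHom A a b) \<otimes> VId A a) = runit V (VHom A a b)"
  proof -
    have "VComp A a a b \<cdot> (\<one> (VHom A a b) \<otimes> VId A a) \<cdot> rinv (VHom A a b) = \<one> (VHom A a b)"
      by (rule arrow_ext[of _ _ "VHom A a b"]) (simp_all add: right)
    then have "(VComp A a a b \<cdot> (\<one> (VHom A a b) \<otimes> VId A a) \<cdot> rinv (VHom A a b)) \<cdot> runit V (VHom A a b) = runit V (VHom A a b)"
      by simp
    then show ?thesis by simp
  qed
next
  fix a b c assume [simp]: "a \<in> VOb A" "b \<in> VOb A" "c \<in> VOb A"
  show "VComp A a b c \<in> hom V (VHom A b c \<odot> VHom A a b) (VHom A a c)" by (simp add: hom_iff)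
next
  fix a b c d assume [simp]: "a \<in> VOb A" "b \<in> VOb A" "c \<in> VOb A" "d \<in> VOb A"
  show "VComp A a b d \<cdot> (VComp A b c d \<otimes> \<one> (VHom A a b))
          = VComp A a c d \<cdot> (\<one> (VHom A c d) \<otimes> VComp A a b c)
              \<cdot> assoc V (VHom A c d) (VHom A b c) (VHom A a b)"
    by (rule arrow_ext3[of _ _ "VHom A c d" "VHom A b c" "VHom A a b"]) (simp_all add: assoc)
qed

section \<open>The base as a category enriched in itself\<close>

abbreviation "VV \<equiv> self_enriched V"

lemma self_enriched_simps [simp]: "VOb VV = Ob V" "VHom VV = ihom V"
  by (simp_all add: self_enriched_def)

lemma self_enriched_VId_eval [simp]:
  assumes "el a" "ty a = x"
  shows "evl x x (VId VV x \<bullet> star) a = a"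
proof -
  have "x \<in> Ob V" using assms by auto
  then show ?thesis using assms by (simp add: self_enriched_def)
qed

lemma self_enriched_VComp_eval [simp]:
  assumes "el g" "ty g = ihom V y z" "el f" "ty f = ihom V x y" "el a" "ty a = x" "g \<sharp> f" "g \<sharp> a" "f \<sharp> a"
    "y \<in> Ob V" "z \<in> Ob V"
  shows "evl x z (cmp VV x y z g f) a = evl y z g (evl x y f a)"
proof -
  have "x \<in> Ob V" using assms by auto
  then show ?thesis using assms by (simp add: self_enriched_def)
qed

text \<open>Read off from the definitions, because the typing rules for enriched categories apply to
  \<open>VV\<close> only after it is known to be one.\<close>

lemma self_enriched_raw_typing:
  assumes "x \<in> Ob V" "y \<in> Ob V" "z \<in> Ob V"
  shows "VId VV x \<in> Arr V" "Dom V (VId VV x) = \<I>" "Cod V (VId VV x) = ihom V x x"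
    "VComp VV x y z \<in> Arr V" "Dom V (VComp VV x y z) = ihom V y z \<odot> ihom V x y"
    "Cod V (VComp VV x y z) = ihom V x z"
  using assms by (simp_all add: self_enriched_def)

lemma vcategory_self_enriched [simp]: "vcategory V VV"
proof (rule vcategoryI)
  fix a b c d h g f
  assume "a \<in> VOb VV" "b \<in> VOb VV" "c \<in> VOb VV" "d \<in> VOb VV"
      "el h" "ty h = VHom VV c d" "el g" "ty g = VHom VV b c" "el f" "ty f = VHom VV a b"
      "h \<sharp> g" "g \<sharp> h" "h \<sharp> f" "f \<sharp> h" "g \<sharp> f" "f \<sharp> g"
  then show "cmp VV a b d (cmp VV b c d h g) f = cmp VV a c d h (cmp VV a b c g f)"
    by - (rule eval_ext[of _ a d], simp_all add: self_enriched_raw_typing)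
next
  fix a b f assume "a \<in> VOb VV" "b \<in> VOb VV" "el f" "ty f = VHom VV a b"
  then show "cmp VV a b b (VId VV b \<bullet> star) f = f" "cmp VV a a b f (VId VV a \<bullet> star) = f"
    by - (rule eval_ext[of _ a b]; simp add: self_enriched_raw_typing)+
qed (simp_all add: self_enriched_raw_typing)

section \<open>Opposite categories\<close>

lemma opp_simps [simp]: "VOb (opp V A) = VOb A" "VHom (opp V A) a b = VHom A b a" "VId (opp V A) = VId A"
  by (simp_all add: opp_def)

lemma VComp_opp_el [simp]:
  assumes "vcategory V A" "a \<in> VOb A" "b \<in> VOb A" "c \<in> VOb A"
    "el g" "ty g = VHom A c b" "el f" "ty f = VHom A b a" "g \<sharp> f"
  shows "cmp (opp V A) a b c g f = cmp A c b a f g"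
  using assms by (simp add: opp_def)

lemma VComp_opp_typing [simp]:
  assumes "vcategory V A" "a \<in> VOb A" "b \<in> VOb A" "c \<in> VOb A"
  shows "VComp (opp V A) a b c \<in> Arr V" "Dom V (VComp (opp V A) a b c) = VHom A c b \<odot> VHom A b a"
    "Cod V (VComp (opp V A) a b c) = VHom A c a"
  using assms by (simp_all add: opp_def)

lemma vcategory_opp [simp]:
  assumes A: "vcategory V A"
  shows "vcategory V (opp V A)"
  by (rule vcategoryI) (use A in simp_all)

section \<open>Functors, their composites and opposites\<close>

lemma vfunctor_typing [simp]:
  assumes "vfunctor V A B F" "a \<in> VOb A"
  shows "FOb F a \<in> VOb B"
    and "b \<in> VOb A \<Longrightarrow> FHom F a b \<in> Arr V"
    and "b \<in> VOb A \<Longrightarrow> Dom V (FHom F a b) = VHom A a b"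
    and "b \<in> VOb A \<Longrightarrow> Cod V (FHom F a b) = VHom B (FOb F a) (FOb F b)"
  using vfunctor.FOb_VOb[OF assms] vfunctor.FHom_hom[OF assms] by (auto simp: hom_iff)

lemma vfunctor_self_Ob [simp]: "vfunctor V A VV F \<Longrightarrow> a \<in> VOb A \<Longrightarrow> FOb F a \<in> Ob V"
  using vfunctor_typing(1)[of A VV F a] by simp

lemma vfunctor_vcategory:
  assumes "vfunctor V A B F"
  shows "vcategory V A" "vcategory V B"
  using assms by (auto simp: vfunctor_def)

lemma FHom_VId_el [simp]:
  assumes "vfunctor V A B F" "a \<in> VOb A"
  shows "FHom F a a \<bullet> VId A a \<bullet> star = VId B (FOb F a) \<bullet> star"
  using vfunctor.FHom_VId[OF assms] vfunctor_vcategory[OF assms(1)] assms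
  by (subst app_comp[symmetric]) simp_all

lemma FHom_VComp_el [simp]:
  assumes F: "vfunctor V A B F" "a \<in> VOb A" "b \<in> VOb A" "c \<in> VOb A"
    and "el g" "ty g = VHom A b c" "el f" "ty f = VHom A a b" "g \<sharp> f"
  shows "FHom F a c \<bullet> cmp A a b c g f
    = cmp B (FOb F a) (FOb F b) (FOb F c) (FHom F b c \<bullet> g) (FHom F a b \<bullet> f)"
proof -
  have "(FHom F a c \<cdot> VComp A a b c) \<bullet> \<langle>g, f\<rangle>
    = (VComp B (FOb F a) (FOb F b) (FOb F c) \<cdot> (FHom F b c \<otimes> FHom F a b)) \<bullet> \<langle>g, f\<rangle>"
    using vfunctor.FHom_VComp[OF F] by simp
  then show ?thesis using assms vfunctor_vcategory[OF F(1)] by simp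
qed

lemmas vfunctor_rules = vfunctor_typing FHom_VId_el FHom_VComp_el

lemma vfunctorI:
  assumes A [simp]: "vcategory V A" and B [simp]: "vcategory V B"
    and [simp]: "\<And>a. a \<in> VOb A \<Longrightarrow> FOb F a \<in> VOb B"
    and [simp]: "\<And>a b. \<lbrakk>a \<in> VOb A; b \<in> VOb A\<rbrakk> \<Longrightarrow> FHom F a b \<in> Arr V"
      "\<And>a b. \<lbrakk>a \<in> VOb A; b \<in> VOb A\<rbrakk> \<Longrightarrow> Dom V (FHom F a b) = VHom A a b"
      "\<And>a b. \<lbrakk>a \<in> VOb A; b \<in> VOb A\<rbrakk> \<Longrightarrow> Cod V (FHom F a b) = VHom B (FOb F a) (FOb F b)"
    and VId: "\<And>a. a \<in> VOb A \<Longrightarrow> FHom F a a \<bullet> VId A a \<bullet> star = VId B (FOb F a) \<bullet> star"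
    and VComp: "\<And>a b c g f. \<lbrakk>a \<in> VOb A; b \<in> VOb A; c \<in> VOb A;
      el g; ty g = VHom A b c; el f; ty f = VHom A a b; g \<sharp> f; f \<sharp> g\<rbrakk> \<Longrightarrow>
      FHom F a c \<bullet> cmp A a b c g f
        = cmp B (FOb F a) (FOb F b) (FOb F c) (FHom F b c \<bullet> g) (FHom F a b \<bullet> f)"
    and undefined: "\<And>a. a \<notin> VOb A \<Longrightarrow> FOb F a = undefined"
      "\<And>a b. a \<notin> VOb A \<or> b \<notin> VOb A \<Longrightarrow> FHom F a b = undefined"
  shows "vfunctor V A B F"
proof -
  interpret A: vcategory V A by (rule A)
  interpret B: vcategory V B by (rule B)
  show ?thesis
  proof
    fix a assume [simp]: "a \<in> VOb A"
    show "FOb F a \<in> VOb B" by simp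
    show "FHom F a a \<cdot> VId A a = VId B (FOb F a)"
      by (rule unit_ext) (simp_all add: VId)
    fix b assume [simp]: "b \<in> VOb A"
    show "FHom F a b \<in> hom V (VHom A a b) (VHom B (FOb F a) (FOb F b))" by (simp add: hom_iff)
    fix c assume [simp]: "c \<in> VOb A"
    show "FHom F a c \<cdot> VComp A a b c = VComp B (FOb F a) (FOb F b) (FOb F c) \<cdot> (FHom F b c \<otimes> FHom F a b)"
      by (rule arrow_ext2[of _ _ "VHom A b c" "VHom A a b"]) (simp_all add: VComp)
  qed (use undefined in auto)
qed

lemma mk_vfun_simps [simp]:
  "a \<in> VOb A \<Longrightarrow> FOb (mk_vfun A f h) a = f a"
  "a \<in> VOb A \<Longrightarrow> b \<in> VOb A \<Longrightarrow> FHom (mk_vfun A f h) a b = h a b"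
  by (simp_all add: mk_vfun_def)

lemma mk_vfun_undefined:
  "a \<notin> VOb A \<Longrightarrow> FOb (mk_vfun A f h) a = undefined"
  "a \<notin> VOb A \<or> b \<notin> VOb A \<Longrightarrow> FHom (mk_vfun A f h) a b = undefined"
  by (auto simp: mk_vfun_def)

lemma vfunctor_id: "vcategory V A \<Longrightarrow> vfunctor V A A (id_vfun V A)"
  unfolding id_vfun_def by (rule vfunctorI) (simp_all add: mk_vfun_undefined)

lemma vfunctor_comp:
  assumes F: "vfunctor V A B F" and G: "vfunctor V B C G"
  shows "vfunctor V A C (comp_vfun V A G F)"
proof -
  note [simp] = F G vfunctor_vcategory[OF F] vfunctor_vcategory[OF G] vfunctor_rules[OF F] vfunctor_rules[OF G]
  show ?thesis
    unfolding comp_vfun_def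
  proof (rule vfunctorI, goal_cases)
    case (7 a)
    then show ?case using FHom_VId_el[OF F] FHom_VId_el[OF G] by simp
  next
    case (8 a b c g f)
    then show ?case using FHom_VComp_el[OF F] FHom_VComp_el[OF G] by simp
  qed (simp_all add: mk_vfun_undefined)
qed

lemma comp_vfun_simps [simp]:
  "a \<in> VOb A \<Longrightarrow> FOb (comp_vfun V A G F) a = FOb G (FOb F a)"
  "a \<in> VOb A \<Longrightarrow> b \<in> VOb A \<Longrightarrow>
    FHom (comp_vfun V A G F) a b = FHom G (FOb F a) (FOb F b) \<cdot> FHom F a b"
  by (simp_all add: comp_vfun_def)

lemma op_vfun_simps [simp]: "FOb (op_vfun F) = FOb F" "FHom (op_vfun F) a b = FHom F b a"
  by (simp_all add: op_vfun_def)

lemma vfunctor_op: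
  assumes F: "vfunctor V A B F"
  shows "vfunctor V (opp V A) (opp V B) (op_vfun F)"
proof -
  note [simp] = F vfunctor_vcategory[OF F] vfunctor_rules[OF F]
  show ?thesis
    by (rule vfunctorI)
      (simp_all add: FHom_VComp_el[OF F] FHom_VId_el[OF F] vfunctor.FOb_undefined[OF F] vfunctor.FHom_undefined[OF F] disj_commute)
qed

text \<open>Composition in \<open>opp V (opp V A)\<close> carries two symmetries. They cancel
  between objects of \<open>A\<close> but nothing is known elsewhere, so the two records need not be
  equal and functors have to be transferred.\<close>

lemma vfunctor_opp_oppD:
  assumes A [simp]: "vcategory V A" and F: "vfunctor V (opp V (opp V A)) B F"
  shows "vfunctor V A B F"
proof -
  note [simp] = F vfunctor_vcategory[OF F] vfunctor_rules[OF F]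
  note t [simp] = vfunctor_typing[OF F, simplified]
  show ?thesis
  proof (rule vfunctorI, goal_cases)
    case (8 a b c g f)
    then show ?case using FHom_VComp_el[OF F, of a b c g f] by simp
  qed (use FHom_VId_el[OF F] vfunctor.FOb_undefined[OF F] vfunctor.FHom_undefined[OF F] in simp_all)
qed

section \<open>Ends and functor categories\<close>

text \<open>The wedge condition for values in the base, transposed and evaluated: it says that
  \<open>e\<close> acts as a natural transformation. It refers only to the objects and hom-objects
  of \<open>A\<close>, so it also makes sense for \<open>A\<close> restricted to a set of
  objects.\<close>

definition wedge where
  "wedge A F G x \<tau> \<longleftrightarrow> x \<in> Ob V \<and>
    (\<forall>a\<in>VOb A. \<tau> a \<in> Arr V \<and> Dom V (\<tau> a) = x \<and> Cod V (\<tau> a) = ihom V (FOb F a) (FOb G a)) \<and>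
    (\<forall>a\<in>VOb A. \<forall>b\<in>VOb A. \<forall>e f s.
      el e \<and> ty e = x \<and> el f \<and> ty f = VHom A a b \<and> el s \<and> ty s = FOb F a \<and>
      e \<sharp> f \<and> f \<sharp> e \<and> e \<sharp> s \<and> s \<sharp> e \<and> f \<sharp> s \<and> s \<sharp> f \<longrightarrow>
      evl (FOb F b) (FOb G b) (\<tau> b \<bullet> e) (act F a b f s)
      = act G a b f (evl (FOb F a) (FOb G a) (\<tau> a \<bullet> e) s))"

lemma wedgeI:
  assumes "x \<in> Ob V"
    and "\<And>a. a \<in> VOb A \<Longrightarrow> \<tau> a \<in> Arr V" "\<And>a. a \<in> VOb A \<Longrightarrow> Dom V (\<tau> a) = x"
      "\<And>a. a \<in> VOb A \<Longrightarrow> Cod V (\<tau> a) = ihom V (FOb F a) (FOb G a)"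
    and "\<And>a b e f s. \<lbrakk>a \<in> VOb A; b \<in> VOb A;
      el e; ty e = x; el f; ty f = VHom A a b; el s; ty s = FOb F a;
      e \<sharp> f; f \<sharp> e; e \<sharp> s; s \<sharp> e; f \<sharp> s; s \<sharp> f\<rbrakk> \<Longrightarrow>
      evl (FOb F b) (FOb G b) (\<tau> b \<bullet> e) (act F a b f s)
      = act G a b f (evl (FOb F a) (FOb G a) (\<tau> a \<bullet> e) s)"
  shows "wedge A F G x \<tau>"
  unfolding wedge_def using assms by blast

lemma wedge_iff:
  assumes F: "vfunctor V A VV F" and G: "vfunctor V A VV G"
  shows "is_wedge V A VV F G x \<tau> \<longleftrightarrow> wedge A F G x \<tau>"
proof
  note [simp] = F G vfunctor_vcategory[OF F] vfunctor_vcategory[OF G]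
    vfunctor_rules[OF F] vfunctor_rules[OF G] vfunctor_self_Ob[OF F] vfunctor_self_Ob[OF G]
  show "wedge A F G x \<tau>" if w: "is_wedge V A VV F G x \<tau>"
  proof (rule wedgeI)
    show x [simp]: "x \<in> Ob V" using w by (simp add: is_wedge_def)
    show t [simp]: "\<And>a. a \<in> VOb A \<Longrightarrow> \<tau> a \<in> Arr V" "\<And>a. a \<in> VOb A \<Longrightarrow> Dom V (\<tau> a) = x"
      "\<And>a. a \<in> VOb A \<Longrightarrow> Cod V (\<tau> a) = ihom V (FOb F a) (FOb G a)"
      using w by (auto simp: is_wedge_def hom_iff)
    fix a b e f s
    assume h [simp]: "a \<in> VOb A" "b \<in> VOb A"
      "el e" "ty e = x" "el f" "ty f = VHom A a b" "el s" "ty s = FOb F a"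
      "e \<sharp> f" "f \<sharp> e" "e \<sharp> s" "s \<sharp> e" "f \<sharp> s" "s \<sharp> f"
    have "(VComp VV (FOb F a) (FOb F b) (FOb G b) \<cdot> (\<tau> b \<otimes> FHom F a b)) \<bullet> \<langle>e, f\<rangle>
      = (VComp VV (FOb F a) (FOb G a) (FOb G b) \<cdot> (FHom G a b \<otimes> \<tau> a) \<cdot> symm V x (VHom A a b)) \<bullet> \<langle>e, f\<rangle>"
      using w h(1,2) by (simp add: is_wedge_def)
    then have "evl (FOb F a) (FOb G b) (cmp VV (FOb F a) (FOb F b) (FOb G b) (\<tau> b \<bullet> e) (FHom F a b \<bullet> f)) s
      = evl (FOb F a) (FOb G b) (cmp VV (FOb F a) (FOb G a) (FOb G b) (FHom G a b \<bullet> f) (\<tau> a \<bullet> e)) s"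
      by simp
    then show "evl (FOb F b) (FOb G b) (\<tau> b \<bullet> e) (act F a b f s)
      = act G a b f (evl (FOb F a) (FOb G a) (\<tau> a \<bullet> e) s)"
      by simp
  qed
  show "is_wedge V A VV F G x \<tau>" if w: "wedge A F G x \<tau>"
    unfolding is_wedge_def
  proof (intro conjI ballI)
    show [simp]: "x \<in> Ob V" using w by (simp add: wedge_def)
    have t [simp]: "\<And>a. a \<in> VOb A \<Longrightarrow> \<tau> a \<in> Arr V" "\<And>a. a \<in> VOb A \<Longrightarrow> Dom V (\<tau> a) = x"
      "\<And>a. a \<in> VOb A \<Longrightarrow> Cod V (\<tau> a) = ihom V (FOb F a) (FOb G a)"
      using w by (auto simp: wedge_def)
    show "\<tau> a \<in> hom V x (VHom VV (FOb F a) (FOb G a))" if "a \<in> VOb A" for a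
      using that by (simp add: hom_iff)
    fix a b assume [simp]: "a \<in> VOb A" "b \<in> VOb A"
    show "VComp VV (FOb F a) (FOb F b) (FOb G b) \<cdot> (\<tau> b \<otimes> FHom F a b)
      = VComp VV (FOb F a) (FOb G a) (FOb G b) \<cdot> (FHom G a b \<otimes> \<tau> a) \<cdot> symm V x (VHom A a b)"
    proof (rule arrow_ext2[of _ _ x "VHom A a b"])
      fix e f assume [simp]: "el e" "ty e = x" "el f" "ty f = VHom A a b" "e \<sharp> f" "f \<sharp> e"
      have "cmp VV (FOb F a) (FOb F b) (FOb G b) (\<tau> b \<bullet> e) (FHom F a b \<bullet> f)
        = cmp VV (FOb F a) (FOb G a) (FOb G b) (FHom G a b \<bullet> f) (\<tau> a \<bullet> e)"
        by (rule eval_ext[of _ "FOb F a" "FOb G b"])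
          (use w in \<open>simp_all add: wedge_def ectx_add_comm\<close>)
      then show "(VComp VV (FOb F a) (FOb F b) (FOb G b) \<cdot> (\<tau> b \<otimes> FHom F a b)) \<bullet> \<langle>e, f\<rangle>
        = (VComp VV (FOb F a) (FOb G a) (FOb G b) \<cdot> (FHom G a b \<otimes> \<tau> a) \<cdot> symm V x (VHom A a b)) \<bullet> \<langle>e, f\<rangle>"
        by simp
    qed simp_all
  qed
qed

text \<open>Isolates what functor categories use of completeness and smallness; it is established
  for small categories and their opposites at the end.\<close>

definition ends_exist :: "('c, 'o, 'a) vcat \<Rightarrow> bool" where
  "ends_exist A \<longleftrightarrow> vcategory V A \<and>
     (\<forall>F G. vfunctor V A VV F \<longrightarrow> vfunctor V A VV G \<longrightarrow> (\<exists>e \<pi>. is_end V A VV F G e \<pi>))"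

lemma ends_exist_vcategory [simp]: "ends_exist A \<Longrightarrow> vcategory V A"
  by (simp add: ends_exist_def)

abbreviation "NT A F G \<equiv> Nat_ob V A VV F G"
abbreviation "pr A F G \<equiv> Nat_proj V A VV F G"
abbreviation cpt where
  "cpt A F G a t s \<equiv> ev V (FOb F a) (FOb G a) \<bullet> \<langle>pr A F G a \<bullet> t, s\<rangle>"

lemma Nat_is_end:
  assumes "ends_exist A" "vfunctor V A VV F" "vfunctor V A VV G"
  shows "is_end V A VV F G (NT A F G) (pr A F G)"
proof -
  have "\<exists>p. case p of (e, \<pi>) \<Rightarrow> is_end V A VV F G e \<pi>" using assms by (auto simp: ends_exist_def)
  from someI_ex[OF this] have "case chosen_end V A VV F G of (e, \<pi>) \<Rightarrow> is_end V A VV F G e \<pi>"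
    unfolding chosen_end_def .
  then show ?thesis by (simp add: case_prod_beta)
qed

lemma Nat_wedge:
  assumes "ends_exist A" "vfunctor V A VV F" "vfunctor V A VV G"
  shows "wedge A F G (NT A F G) (pr A F G)"
  using Nat_is_end[OF assms] wedge_iff[OF assms(2,3)] by (simp add: is_end_def)

lemma Nat_typing [simp]:
  assumes "ends_exist A" "vfunctor V A VV F" "vfunctor V A VV G"
  shows "NT A F G \<in> Ob V"
    and "a \<in> VOb A \<Longrightarrow> pr A F G a \<in> Arr V"
    and "a \<in> VOb A \<Longrightarrow> Dom V (pr A F G a) = NT A F G"
    and "a \<in> VOb A \<Longrightarrow> Cod V (pr A F G a) = ihom V (FOb F a) (FOb G a)"
  using Nat_wedge[OF assms] by (auto simp: wedge_def)

lemma Nat_natural [simp]: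
  assumes "ends_exist A" "vfunctor V A VV F" "vfunctor V A VV G" "a \<in> VOb A" "b \<in> VOb A"
    "el e" "ty e = NT A F G" "el f" "ty f = VHom A a b" "el s" "ty s = FOb F a"
    "e \<sharp> f" "e \<sharp> s" "f \<sharp> s"
  shows "cpt A F G b e (act F a b f s)
      = act G a b f (cpt A F G a e s)"
proof -
  have "f \<sharp> e" "s \<sharp> e" "s \<sharp> f" using assms(12-14) by (auto intro: apart_sym)
  then show ?thesis using Nat_wedge[OF assms(1-3)] assms(4-) unfolding wedge_def by simp
qed

lemma end_universal:
  assumes "ends_exist A" "vfunctor V A VV F" "vfunctor V A VV G" "wedge A F G x \<tau>"
  shows "\<exists>!h. h \<in> hom V x (NT A F G) \<and> (\<forall>a\<in>VOb A. pr A F G a \<cdot> h = \<tau> a)"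
proof -
  have "is_wedge V A VV F G x \<tau>" using assms(4) wedge_iff[OF assms(2,3)] by simp
  then show ?thesis
    by (rule Nat_is_end[OF assms(1-3), unfolded is_end_def, THEN conjunct2, rule_format])
qed

lemma into_Nat:
  assumes "ends_exist A" "vfunctor V A VV F" "vfunctor V A VV G" "wedge A F G x \<tau>"
  shows into_Nat_typing: "into_Nat V A VV F G x \<tau> \<in> Arr V" "Dom V (into_Nat V A VV F G x \<tau>) = x"
    "Cod V (into_Nat V A VV F G x \<tau>) = NT A F G"
    and proj_into_Nat: "a \<in> VOb A \<Longrightarrow> pr A F G a \<cdot> into_Nat V A VV F G x \<tau> = \<tau> a"
proof -
  have "\<exists>!h. h \<in> hom V x (NT A F G) \<and> (\<forall>a\<in>VOb A. pr A F G a \<cdot> h = \<tau> a)"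
    by (rule end_universal[OF assms])
  from theI'[OF this] show "into_Nat V A VV F G x \<tau> \<in> Arr V" "Dom V (into_Nat V A VV F G x \<tau>) = x"
    "Cod V (into_Nat V A VV F G x \<tau>) = NT A F G"
    "a \<in> VOb A \<Longrightarrow> pr A F G a \<cdot> into_Nat V A VV F G x \<tau> = \<tau> a"
    unfolding into_Nat_def by (auto simp: hom_iff)
qed

lemma proj_into_Nat_el:
  assumes "ends_exist A" "vfunctor V A VV F" "vfunctor V A VV G" "wedge A F G x \<tau>"
    "a \<in> VOb A" "el e" "ty e = x"
  shows "pr A F G a \<bullet> into_Nat V A VV F G x \<tau> \<bullet> e = \<tau> a \<bullet> e"
proof -
  have "(pr A F G a \<cdot> into_Nat V A VV F G x \<tau>) \<bullet> e = \<tau> a \<bullet> e"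
    using proj_into_Nat[OF assms(1-5)] by simp
  then show ?thesis using assms into_Nat[OF assms(1-4)] by (subst (asm) app_comp) simp_all
qed

text \<open>Composing \<open>h\<close> with the projections gives a wedge, through which both arrows
  factor.\<close>

lemma Nat_arrow_ext:
  assumes "ends_exist A" "vfunctor V A VV F" "vfunctor V A VV G"
    and h: "h \<in> Arr V" "Cod V h = NT A F G" and k: "k \<in> Arr V" "Cod V k = NT A F G" "Dom V h = Dom V k"
    and eq: "\<And>a. a \<in> VOb A \<Longrightarrow> pr A F G a \<cdot> h = pr A F G a \<cdot> k"
  shows "h = k"
proof -
  have w: "wedge A F G (Dom V h) (\<lambda>a. pr A F G a \<cdot> h)"
  proof (rule wedgeI)
    fix a b e f s
    assume "a \<in> VOb A" "b \<in> VOb A" "el e" "ty e = Dom V h" "el f" "ty f = VHom A a b" "el s" "ty s = FOb F a"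
      "e \<sharp> f" "f \<sharp> e" "e \<sharp> s" "s \<sharp> e" "f \<sharp> s" "s \<sharp> f"
    then show "evl (FOb F b) (FOb G b) ((pr A F G b \<cdot> h) \<bullet> e) (act F a b f s)
      = act G a b f (evl (FOb F a) (FOb G a) ((pr A F G a \<cdot> h) \<bullet> e) s)"
      using assms(1-3) h by simp
  qed (use assms(1-3) h in simp_all)
  from end_universal[OF assms(1-3) w] have
    "\<exists>!h'. h' \<in> hom V (Dom V h) (NT A F G) \<and> (\<forall>a\<in>VOb A. pr A F G a \<cdot> h' = pr A F G a \<cdot> h)" .
  then show ?thesis using h k eq unfolding hom_iff by metis
qed

lemma Nat_el_ext:
  assumes "ends_exist A" "vfunctor V A VV F" "vfunctor V A VV G"
    and t: "el t" "ty t = NT A F G" and t': "el t'" "ty t' = NT A F G" and c: "ectx t = ectx t'"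
    and eq: "\<And>a s. \<lbrakk>a \<in> VOb A; el s; ty s = FOb F a; t \<sharp> s; s \<sharp> t; t' \<sharp> s; s \<sharp> t'\<rbrakk>
       \<Longrightarrow> cpt A F G a t s = cpt A F G a t' s"
  shows "t = t'"
proof -
  have "pr A F G a \<bullet> t = pr A F G a \<bullet> t'" if "a \<in> VOb A" for a
    by (rule eval_ext[of _ "FOb F a" "FOb G a"]) (use assms that in simp_all)
  then have "pr A F G a \<cdot> earr t = pr A F G a \<cdot> earr t'" if "a \<in> VOb A" for a
    using that by (simp add: app_def)
  moreover have "earr t \<in> Arr V" "earr t' \<in> Arr V" "Dom V (earr t) = Dom V (earr t')"
    "Cod V (earr t) = NT A F G" "Cod V (earr t') = NT A F G"
    using t t' c by (simp_all add: el_def ty_def)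
  ultimately have "earr t = earr t'"
    by - (rule Nat_arrow_ext[OF assms(1-3)])
  then show ?thesis using c by (simp add: element_eq_iff)
qed

section \<open>Functor categories with values in the base\<close>

abbreviation "Fun A \<equiv> functor_cat V A VV"

lemma Fun_simps [simp]: "F \<in> VOb (Fun A) \<longleftrightarrow> vfunctor V A VV F" "VHom (Fun A) = Nat_ob V A VV"
  by (simp_all add: functor_cat_def)

lemma arrow_ext_unit:
  assumes "f \<in> Arr V" "g \<in> Arr V" "Dom V f = \<I> \<odot> x" "Dom V g = \<I> \<odot> x" and x: "x \<in> Ob V"
    and eq: "\<And>a. \<lbrakk>el a; ty a = x\<rbrakk> \<Longrightarrow> f \<bullet> \<langle>star, a\<rangle> = g \<bullet> \<langle>star, a\<rangle>"
  shows "f = g"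
proof -
  obtain a where a: "iso_el a" "ty a = x" using fresh_apart[OF x el_star(1)] by blast
  show ?thesis
    by (rule iso_el_cancel[OF iso_el_pair[OF iso_el_star a(1)]]) (use assms a in auto)
qed

text \<open>An arbitrary element of type \<open>\<I>\<close> is reduced to \<open>star\<close> by
  cancelling the invertible \<open>linv\<close>, so in the unit context naturality may be checked
  without a context.\<close>

lemma wedge_unitI:
  assumes F: "vfunctor V A VV F" and G: "vfunctor V A VV G"
    and t: "\<And>a. a \<in> VOb A \<Longrightarrow> \<tau> a \<in> Arr V" "\<And>a. a \<in> VOb A \<Longrightarrow> Dom V (\<tau> a) = \<I>"
      "\<And>a. a \<in> VOb A \<Longrightarrow> Cod V (\<tau> a) = ihom V (FOb F a) (FOb G a)"
    and eq: "\<And>a b f s. \<lbrakk>a \<in> VOb A; b \<in> VOb A; el f; ty f = VHom A a b; el s; ty s = FOb F a; f \<sharp> s; s \<sharp> f\<rbrakk> \<Longrightarrow>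
      evl (FOb F b) (FOb G b) (\<tau> b \<bullet> star) (act F a b f s)
      = act G a b f (evl (FOb F a) (FOb G a) (\<tau> a \<bullet> star) s)"
  shows "wedge A F G \<I> \<tau>"
proof (rule wedgeI)
  note [simp] = F G t vfunctor_vcategory[OF F] vfunctor_rules[OF F] vfunctor_rules[OF G]
    vfunctor_self_Ob[OF F] vfunctor_self_Ob[OF G]
  fix a b e f s
  assume [simp]: "a \<in> VOb A" "b \<in> VOb A" "el e" "ty e = \<I>" "el f" "ty f = VHom A a b" "el s" "ty s = FOb F a"
    "e \<sharp> f" "f \<sharp> e" "e \<sharp> s" "s \<sharp> e" "f \<sharp> s" "s \<sharp> f"
  let ?H = "VHom A a b"
  let ?l = "ev V (FOb F b) (FOb G b) \<cdot> (\<tau> b \<otimes> (ev V (FOb F a) (FOb F b) \<cdot> (FHom F a b \<otimes> \<one> (FOb F a))))"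
  let ?r = "ev V (FOb G a) (FOb G b) \<cdot> (FHom G a b \<otimes> (ev V (FOb F a) (FOb G a) \<cdot> (\<tau> a \<otimes> \<one> (FOb F a))))
    \<cdot> assoc V ?H \<I> (FOb F a) \<cdot> (symm V \<I> ?H \<otimes> \<one> (FOb F a)) \<cdot> ainv \<I> ?H (FOb F a)"
  have "(?l \<cdot> assoc V \<I> ?H (FOb F a)) \<cdot> (linv ?H \<otimes> \<one> (FOb F a)) = (?r \<cdot> assoc V \<I> ?H (FOb F a)) \<cdot> (linv ?H \<otimes> \<one> (FOb F a))"
    by (rule arrow_ext2[of _ _ ?H "FOb F a"]) (simp_all add: eq)
  then have "?l \<cdot> assoc V \<I> ?H (FOb F a) = ?r \<cdot> assoc V \<I> ?H (FOb F a)"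
    by - (rule retraction_cancel[of "linv ?H \<otimes> \<one> (FOb F a)" "lunit V ?H \<otimes> \<one> (FOb F a)"], simp_all)
  then have "?l = ?r"
    by - (rule assoc_cancel_right[of \<I> ?H "FOb F a"], simp_all)
  then have "?l \<bullet> \<langle>e, \<langle>f, s\<rangle>\<rangle> = ?r \<bullet> \<langle>e, \<langle>f, s\<rangle>\<rangle>" by simp
  then show "evl (FOb F b) (FOb G b) (\<tau> b \<bullet> e) (act F a b f s)
      = act G a b f (evl (FOb F a) (FOb G a) (\<tau> a \<bullet> e) s)"
    by simp
qed (use t in simp_all)

lemma Fun_VId:
  assumes "ends_exist A" "vfunctor V A VV F"
  shows "VId (Fun A) F \<in> Arr V" "Dom V (VId (Fun A) F) = \<I>" "Cod V (VId (Fun A) F) = NT A F F"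
    and "a \<in> VOb A \<Longrightarrow> pr A F F a \<bullet> VId (Fun A) F \<bullet> star = VId VV (FOb F a) \<bullet> star"
proof -
  note [simp] = assms vfunctor_rules[OF assms(2)] vfunctor_self_Ob[OF assms(2)]
  have w: "wedge A F F \<I> (\<lambda>a. VId VV (FOb F a))"
    by (rule wedge_unitI[OF assms(2) assms(2)]) simp_all
  show "VId (Fun A) F \<in> Arr V" "Dom V (VId (Fun A) F) = \<I>" "Cod V (VId (Fun A) F) = NT A F F"
    "a \<in> VOb A \<Longrightarrow> pr A F F a \<bullet> VId (Fun A) F \<bullet> star = VId VV (FOb F a) \<bullet> star"
    using into_Nat[OF assms assms(2) w] proj_into_Nat_el[OF assms assms(2) w, of a star]
    by (simp_all add: functor_cat_def)
qed

lemma Fun_VComp: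
  assumes "ends_exist A" "vfunctor V A VV F" "vfunctor V A VV G" "vfunctor V A VV H"
  shows "VComp (Fun A) F G H \<in> Arr V" "Dom V (VComp (Fun A) F G H) = NT A G H \<odot> NT A F G"
    "Cod V (VComp (Fun A) F G H) = NT A F H"
    and "\<lbrakk>a \<in> VOb A; el t; ty t = NT A G H; el s; ty s = NT A F G; t \<sharp> s\<rbrakk> \<Longrightarrow>
      pr A F H a \<bullet> cmp (Fun A) F G H t s
        = cmp VV (FOb F a) (FOb G a) (FOb H a) (pr A G H a \<bullet> t) (pr A F G a \<bullet> s)"
proof -
  note [simp] = assms vfunctor_rules[OF assms(2)] vfunctor_self_Ob[OF assms(2)]
    vfunctor_rules[OF assms(3)] vfunctor_self_Ob[OF assms(3)] vfunctor_rules[OF assms(4)] vfunctor_self_Ob[OF assms(4)]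
  let ?\<tau> = "\<lambda>a. VComp VV (FOb F a) (FOb G a) (FOb H a) \<cdot> (pr A G H a \<otimes> pr A F G a)"
  have w: "wedge A F H (NT A G H \<odot> NT A F G) ?\<tau>"
  proof (rule wedgeI)
    fix a b e f s
    assume [simp]: "a \<in> VOb A" "b \<in> VOb A" "el e" "ty e = NT A G H \<odot> NT A F G" "el f" "ty f = VHom A a b"
      "el s" "ty s = FOb F a" "e \<sharp> f" "f \<sharp> e" "e \<sharp> s" "s \<sharp> e" "f \<sharp> s" "s \<sharp> f"
    \<comment> \<open>A wedge is tested on an arbitrary element \<open>e\<close> of the tensor
      product, which need not be a pair. The condition is therefore restated as
      \<open>?l = ?r\<close> between arrows, and that equation is checked on pairs.\<close>
    let ?x = "NT A G H" and ?y = "NT A F G" and ?z = "VHom A a b \<odot> FOb F a"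
    let ?l = "ev V (FOb F b) (FOb H b) \<cdot> (?\<tau> b \<otimes> (ev V (FOb F a) (FOb F b) \<cdot> (FHom F a b \<otimes> \<one> (FOb F a))))"
    let ?r = "ev V (FOb H a) (FOb H b) \<cdot> (FHom H a b \<otimes> (ev V (FOb F a) (FOb H a) \<cdot> (?\<tau> a \<otimes> \<one> (FOb F a))))
      \<cdot> assoc V (VHom A a b) (?x \<odot> ?y) (FOb F a) \<cdot> (symm V (?x \<odot> ?y) (VHom A a b) \<otimes> \<one> (FOb F a))
      \<cdot> ainv (?x \<odot> ?y) (VHom A a b) (FOb F a)"
    have "?l \<cdot> assoc V (?x \<odot> ?y) (VHom A a b) (FOb F a) = ?r \<cdot> assoc V (?x \<odot> ?y) (VHom A a b) (FOb F a)"
      by (rule arrow_ext4[of _ _ ?x ?y "VHom A a b" "FOb F a"]) simp_all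
    then have "?l = ?r"
      by - (rule assoc_cancel_right[of "?x \<odot> ?y" "VHom A a b" "FOb F a"], simp_all)
    then have "?l \<bullet> \<langle>e, \<langle>f, s\<rangle>\<rangle> = ?r \<bullet> \<langle>e, \<langle>f, s\<rangle>\<rangle>" by simp
    then show "evl (FOb F b) (FOb H b) (?\<tau> b \<bullet> e) (act F a b f s)
      = act H a b f (evl (FOb F a) (FOb H a) (?\<tau> a \<bullet> e) s)"
      by simp
  qed simp_all
  show "VComp (Fun A) F G H \<in> Arr V" "Dom V (VComp (Fun A) F G H) = NT A G H \<odot> NT A F G"
    "Cod V (VComp (Fun A) F G H) = NT A F H"
    using into_Nat[OF assms(1,2,4) w] by (simp_all add: functor_cat_def)
  show "pr A F H a \<bullet> cmp (Fun A) F G H t s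
        = cmp VV (FOb F a) (FOb G a) (FOb H a) (pr A G H a \<bullet> t) (pr A F G a \<bullet> s)"
    if "a \<in> VOb A" "el t" "ty t = NT A G H" "el s" "ty s = NT A F G" "t \<sharp> s"
    using proj_into_Nat_el[OF assms(1,2,4) w, of a "\<langle>t, s\<rangle>"] that by (simp add: functor_cat_def)
qed

declare Fun_VId(4) [simp] Fun_VComp(4) [simp]

lemma vcategory_Fun [simp]:
  assumes A: "ends_exist A"
  shows "vcategory V (Fun A)"
proof (rule vcategoryI)
  fix F G H K h g f
  assume obs: "F \<in> VOb (Fun A)" "G \<in> VOb (Fun A)" "H \<in> VOb (Fun A)" "K \<in> VOb (Fun A)"
    and [simp]: "el h" "ty h = VHom (Fun A) H K" "el g" "ty g = VHom (Fun A) G H" "el f" "ty f = VHom (Fun A) F G"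
      "h \<sharp> g" "g \<sharp> h" "h \<sharp> f" "f \<sharp> h" "g \<sharp> f" "f \<sharp> g"
  have F: "vfunctor V A VV F" and G: "vfunctor V A VV G" and H: "vfunctor V A VV H" and K: "vfunctor V A VV K"
    using obs by simp_all
  note [simp] = A F G H K vfunctor_self_Ob[OF F] vfunctor_self_Ob[OF G] vfunctor_self_Ob[OF H] vfunctor_self_Ob[OF K]
  note [simp] = Fun_VComp(1-3)[OF A]
  show "cmp (Fun A) F G K (cmp (Fun A) G H K h g) f = cmp (Fun A) F H K h (cmp (Fun A) F G H g f)"
    by (rule Nat_el_ext[OF A, of F K]) simp_all
next
  fix F G f
  assume obs: "F \<in> VOb (Fun A)" "G \<in> VOb (Fun A)" and [simp]: "el f" "ty f = VHom (Fun A) F G"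
  have F: "vfunctor V A VV F" and G: "vfunctor V A VV G" using obs by simp_all
  note [simp] = A F G vfunctor_self_Ob[OF F] vfunctor_self_Ob[OF G]
  note [simp] = Fun_VComp(1-3)[OF A] Fun_VId(1-3)[OF A]
  show "cmp (Fun A) F G G (VId (Fun A) G \<bullet> star) f = f"
    by (rule Nat_el_ext[OF A, of F G]) simp_all
  show "cmp (Fun A) F F G f (VId (Fun A) F \<bullet> star) = f"
    by (rule Nat_el_ext[OF A, of F G]) simp_all
qed (use A Fun_VComp(1-3)[OF A] Fun_VId(1-3)[OF A] in simp_all)

section \<open>Representable functors and the functors induced by a diagram\<close>

lemma cov_hom_typing [simp]:
  assumes "vcategory V A" "a \<in> VOb A" "b \<in> VOb A"
  shows "FOb (cov_hom V A a) b = VHom A a b"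
    and "c \<in> VOb A \<Longrightarrow> FHom (cov_hom V A a) b c \<in> Arr V"
    and "c \<in> VOb A \<Longrightarrow> Dom V (FHom (cov_hom V A a) b c) = VHom A b c"
    and "c \<in> VOb A \<Longrightarrow> Cod V (FHom (cov_hom V A a) b c) = ihom V (VHom A a b) (VHom A a c)"
  using assms by (simp_all add: cov_hom_def)

lemma cov_hom_eval [simp]:
  assumes "vcategory V A" "a \<in> VOb A" "b \<in> VOb A" "c \<in> VOb A"
    "el g" "ty g = VHom A b c" "el f" "ty f = VHom A a b" "g \<sharp> f"
  shows "evl (VHom A a b) (VHom A a c) (FHom (cov_hom V A a) b c \<bullet> g) f = cmp A a b c g f"
  using assms by (simp add: cov_hom_def)

lemma vfunctor_cov_hom:
  assumes A [simp]: "vcategory V A" and a [simp]: "a \<in> VOb A"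
  shows "vfunctor V A VV (cov_hom V A a)"
proof (rule vfunctorI)
  fix b assume [simp]: "b \<in> VOb A"
  show "FHom (cov_hom V A a) b b \<bullet> VId A b \<bullet> star = VId VV (FOb (cov_hom V A a) b) \<bullet> star"
    by (rule eval_ext[of _ "VHom A a b" "VHom A a b"]) simp_all
next
  fix b c d g f
  assume [simp]: "b \<in> VOb A" "c \<in> VOb A" "d \<in> VOb A"
    "el g" "ty g = VHom A c d" "el f" "ty f = VHom A b c" "g \<sharp> f" "f \<sharp> g"
  show "FHom (cov_hom V A a) b d \<bullet> cmp A b c d g f
      = cmp VV (FOb (cov_hom V A a) b) (FOb (cov_hom V A a) c) (FOb (cov_hom V A a) d) (FHom (cov_hom V A a) c d \<bullet> g) (FHom (cov_hom V A a) b c \<bullet> f)"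
    by (rule eval_ext[of _ "VHom A a b" "VHom A a d"]) simp_all
qed (simp_all add: cov_hom_def mk_vfun_undefined)

lemma contra_hom_eq: "contra_hom V A a = cov_hom V (opp V A) a"
  by (simp add: contra_hom_def cov_hom_def opp_def)

lemma vfunctor_contra_hom:
  assumes "vcategory V A" and "a \<in> VOb A"
  shows "vfunctor V (opp V A) VV (contra_hom V A a)"
  unfolding contra_hom_eq by (rule vfunctor_cov_hom) (use assms in simp_all)

lemma contra_hom_typing [simp]:
  assumes "vcategory V A" "a \<in> VOb A" "b \<in> VOb A"
  shows "FOb (contra_hom V A a) b = VHom A b a"
    and "c \<in> VOb A \<Longrightarrow> FHom (contra_hom V A a) b c \<in> Arr V"
    and "c \<in> VOb A \<Longrightarrow> Dom V (FHom (contra_hom V A a) b c) = VHom A c b"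
    and "c \<in> VOb A \<Longrightarrow> Cod V (FHom (contra_hom V A a) b c) = ihom V (VHom A b a) (VHom A c a)"
  using assms by (simp_all add: contra_hom_eq)

lemma contra_hom_eval [simp]:
  assumes "vcategory V A" "a \<in> VOb A" "b \<in> VOb A" "c \<in> VOb A"
    "el g" "ty g = VHom A c b" "el f" "ty f = VHom A b a" "g \<sharp> f"
  shows "evl (VHom A b a) (VHom A c a) (FHom (contra_hom V A a) b c \<bullet> g) f = cmp A c b a f g"
  using assms cov_hom_eval[of "opp V A" a b c g f] by (simp add: contra_hom_eq)

lemma vfunctor_hom_into:
  assumes "vfunctor V X A T" "a \<in> VOb A"
  shows "vfunctor V X VV (hom_into V X A T a)"
  unfolding hom_into_def using assms vfunctor_vcategory[OF assms(1)]
  by (blast intro: vfunctor_comp[OF _ vfunctor_cov_hom])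

lemma hom_into_typing:
  assumes "vfunctor V X A T" "a \<in> VOb A" "x \<in> VOb X"
  shows "FOb (hom_into V X A T a) x = VHom A a (FOb T x)"
    and "y \<in> VOb X \<Longrightarrow> FHom (hom_into V X A T a) x y \<in> Arr V"
    and "y \<in> VOb X \<Longrightarrow> Dom V (FHom (hom_into V X A T a) x y) = VHom X x y"
    and "y \<in> VOb X \<Longrightarrow> Cod V (FHom (hom_into V X A T a) x y) = ihom V (VHom A a (FOb T x)) (VHom A a (FOb T y))"
  using assms vfunctor_vcategory[OF assms(1)] vfunctor_rules[OF assms(1)] by (simp_all add: hom_into_def)

lemma hom_into_eval:
  assumes "vfunctor V X A T" "a \<in> VOb A" "x \<in> VOb X" "y \<in> VOb X"
    "el u" "ty u = VHom X x y" "el f" "ty f = VHom A a (FOb T x)" "u \<sharp> f"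
  shows "evl (VHom A a (FOb T x)) (VHom A a (FOb T y)) (FHom (hom_into V X A T a) x y \<bullet> u) f
    = cmp A a (FOb T x) (FOb T y) (FHom T x y \<bullet> u) f"
  using assms vfunctor_vcategory[OF assms(1)] vfunctor_rules[OF assms(1)] by (simp add: hom_into_def)

lemmas hom_into_rules = vfunctor_hom_into hom_into_typing hom_into_eval

lemma hom_into_functor_wedge:
  assumes T: "vfunctor V X A T" and [simp]: "a \<in> VOb A" "b \<in> VOb A"
  shows "wedge X (hom_into V X A T a) (hom_into V X A T b) (VHom A b a) (\<lambda>x. FHom (contra_hom V A (FOb T x)) a b)"
proof -
  note [simp] = T vfunctor_vcategory[OF T] vfunctor_rules[OF T] hom_into_rules[OF T]
  show ?thesis by (rule wedgeI) simp_all
qed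

lemma hom_into_functor_typing:
  assumes T: "vfunctor V X A T" and X: "ends_exist X" and ob: "a \<in> VOb A"
  shows "FOb (hom_into_functor V X A T) a = hom_into V X A T a"
    and "b \<in> VOb A \<Longrightarrow> FHom (hom_into_functor V X A T) a b \<in> Arr V"
    and "b \<in> VOb A \<Longrightarrow> Dom V (FHom (hom_into_functor V X A T) a b) = VHom A b a"
    and "b \<in> VOb A \<Longrightarrow> Cod V (FHom (hom_into_functor V X A T) a b) = NT X (hom_into V X A T a) (hom_into V X A T b)"
    and "\<lbrakk>b \<in> VOb A; x \<in> VOb X; el g; ty g = VHom A b a; el f; ty f = VHom A a (FOb T x); g \<sharp> f\<rbrakk> \<Longrightarrow>
      evl (VHom A a (FOb T x)) (VHom A b (FOb T x)) (pr X (hom_into V X A T a) (hom_into V X A T b) x \<bullet> FHom (hom_into_functor V X A T) a b \<bullet> g) f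
      = cmp A b a (FOb T x) f g"
proof -
  note [simp] = T X vfunctor_vcategory[OF T] vfunctor_rules[OF T] hom_into_rules[OF T] ob
  show "FOb (hom_into_functor V X A T) a = hom_into V X A T a"
    by (simp add: hom_into_functor_def)
  assume b [simp]: "b \<in> VOb A"
  note w = hom_into_functor_wedge[OF T ob b]
  note N = into_Nat[OF X vfunctor_hom_into[OF T ob] vfunctor_hom_into[OF T b] w]
    proj_into_Nat_el[OF X vfunctor_hom_into[OF T ob] vfunctor_hom_into[OF T b] w]
  show "FHom (hom_into_functor V X A T) a b \<in> Arr V" "Dom V (FHom (hom_into_functor V X A T) a b) = VHom A b a"
    "Cod V (FHom (hom_into_functor V X A T) a b) = NT X (hom_into V X A T a) (hom_into V X A T b)"
    using N by (simp_all add: hom_into_functor_def)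
  assume "x \<in> VOb X" "el g" "ty g = VHom A b a" "el f" "ty f = VHom A a (FOb T x)" "g \<sharp> f"
  then show "evl (VHom A a (FOb T x)) (VHom A b (FOb T x)) (pr X (hom_into V X A T a) (hom_into V X A T b) x \<bullet> FHom (hom_into_functor V X A T) a b \<bullet> g) f
      = cmp A b a (FOb T x) f g"
    using N by (simp add: hom_into_functor_def)
qed

lemma Fun_VId_typing [simp]:
  assumes "ends_exist A" "vfunctor V A VV F"
  shows "VId (Fun A) F \<in> Arr V" "Dom V (VId (Fun A) F) = \<I>" "Cod V (VId (Fun A) F) = NT A F F"
  using Fun_VId[OF assms] by auto

lemma Fun_VComp_typing [simp]:
  assumes "ends_exist A" "vfunctor V A VV F" "vfunctor V A VV G" "vfunctor V A VV H"
  shows "VComp (Fun A) F G H \<in> Arr V" "Dom V (VComp (Fun A) F G H) = NT A G H \<odot> NT A F G"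
    "Cod V (VComp (Fun A) F G H) = NT A F H"
  using Fun_VComp[OF assms] by auto

lemma vfunctor_hom_into_functor:
  assumes T: "vfunctor V X A T" and X: "ends_exist X"
  shows "vfunctor V (opp V A) (Fun X) (hom_into_functor V X A T)"
proof -
  note [simp] = T X vfunctor_vcategory[OF T] vfunctor_rules[OF T] hom_into_rules[OF T] hom_into_functor_typing[OF T X]
  show ?thesis
  proof (rule vfunctorI)
    fix a assume "a \<in> VOb (opp V A)"
    then have [simp]: "a \<in> VOb A" by simp
    show "FHom (hom_into_functor V X A T) a a \<bullet> VId (opp V A) a \<bullet> star = VId (Fun X) (FOb (hom_into_functor V X A T) a) \<bullet> star"
      by (rule Nat_el_ext[of X "hom_into V X A T a" "hom_into V X A T a"]) simp_all
  next
    fix a b c g f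
    assume "a \<in> VOb (opp V A)" "b \<in> VOb (opp V A)" "c \<in> VOb (opp V A)"
      "el g" "ty g = VHom (opp V A) b c" "el f" "ty f = VHom (opp V A) a b" "g \<sharp> f" "f \<sharp> g"
    then have [simp]: "a \<in> VOb A" "b \<in> VOb A" "c \<in> VOb A"
      "el g" "ty g = VHom A c b" "el f" "ty f = VHom A b a" "g \<sharp> f" "f \<sharp> g" by simp_all
    show "FHom (hom_into_functor V X A T) a c \<bullet> cmp (opp V A) a b c g f
      = cmp (Fun X) (FOb (hom_into_functor V X A T) a) (FOb (hom_into_functor V X A T) b) (FOb (hom_into_functor V X A T) c) (FHom (hom_into_functor V X A T) b c \<bullet> g) (FHom (hom_into_functor V X A T) a b \<bullet> f)"
      by (rule Nat_el_ext[of X "hom_into V X A T a" "hom_into V X A T c"]) (simp_all add: ectx_add_comm)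
  qed (simp_all, simp_all add: hom_into_functor_def mk_vfun_undefined)
qed

section \<open>Natural isomorphisms with values in the base\<close>

definition name :: "'o \<Rightarrow> 'o \<Rightarrow> 'a \<Rightarrow> 'a" where
  "name x y f = transp V \<I> x y (f \<cdot> lunit V x)"

lemma name_typing [simp]:
  assumes "f \<in> Arr V" "Dom V f = x" "Cod V f = y"
  shows "name x y f \<in> Arr V" "Dom V (name x y f) = \<I>" "Cod V (name x y f) = ihom V x y"
proof -
  have "x \<in> Ob V" using assms by auto
  then show "name x y f \<in> Arr V" "Dom V (name x y f) = \<I>" "Cod V (name x y f) = ihom V x y"
    using assms by (simp_all add: name_def)
qed

lemma eval_name [simp]:
  assumes "f \<in> Arr V" "Dom V f = x" "Cod V f = y" "el a" "ty a = x"
  shows "evl x y (name x y f \<bullet> star) a = f \<bullet> a"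
proof -
  have "x \<in> Ob V" using assms by auto
  then show ?thesis using assms by (simp add: name_def)
qed

lemma unname_name [simp]:
  assumes "f \<in> Arr V" "Dom V f = x" "Cod V f = y"
  shows "unname V x y (name x y f) = f"
proof -
  have "x \<in> Ob V" "y \<in> Ob V" using assms by auto
  then show ?thesis using assms by (intro arrow_ext[of _ _ x]) simp_all
qed

lemma name_unname [simp]:
  assumes "f \<in> Arr V" "Dom V f = \<I>" "Cod V f = ihom V x y" "x \<in> Ob V" "y \<in> Ob V"
  shows "name x y (unname V x y f) = f"
  using assms by - (rule unit_ext, simp_all, rule eval_ext[of _ x y], simp_all)

lemma ucomp_VV_eval:
  assumes "f \<in> hom V \<I> (ihom V x y)" "g \<in> hom V \<I> (ihom V y z)" "x \<in> Ob V" "y \<in> Ob V" "z \<in> Ob V"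
  shows "ucomp V VV x y z g f \<in> hom V \<I> (ihom V x z)"
    "unname V x z (ucomp V VV x y z g f) = unname V y z g \<cdot> unname V x y f"
proof -
  have [simp]: "f \<in> Arr V" "Dom V f = \<I>" "Cod V f = ihom V x y" "g \<in> Arr V" "Dom V g = \<I>" "Cod V g = ihom V y z"
    using assms by (auto simp: hom_iff)
  note [simp] = assms(3-)
  show u: "ucomp V VV x y z g f \<in> hom V \<I> (ihom V x z)" by (simp add: ucomp_def hom_iff)
  show "unname V x z (ucomp V VV x y z g f) = unname V y z g \<cdot> unname V x y f"
    by (rule arrow_ext[of _ _ x]) (simp_all add: ucomp_def)
qed

lemma unname_VId: "x \<in> Ob V \<Longrightarrow> unname V x x (VId VV x) = \<one> x"
  by (rule arrow_ext[of _ _ x]) simp_all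

text \<open>\<open>name\<close> and \<open>unname\<close> identify the underlying category of
  \<open>VV\<close> with \<open>V\<close>, and \<open>ucomp\<close> becomes composition.\<close>

lemma viso_VV_iff:
  assumes [simp]: "x \<in> Ob V" "y \<in> Ob V"
  shows "viso V VV x y f \<longleftrightarrow> f \<in> hom V \<I> (ihom V x y) \<and> iso_arrow V x y (unname V x y f)"
proof
  assume f: "viso V VV x y f"
  then obtain g where g: "g \<in> hom V \<I> (ihom V y x)"
    and gf: "ucomp V VV x y x g f = VId VV x" "ucomp V VV y x y f g = VId VV y" by (auto simp: viso_def)
  have fh: "f \<in> hom V \<I> (ihom V x y)" using f by (simp add: viso_def)
  have "inverse_arrows V x y (unname V x y f) (unname V y x g)"
    unfolding inverse_arrows_def
    using fh g ucomp_VV_eval(2)[OF fh g] ucomp_VV_eval(2)[OF g fh] gf unname_VId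
    by (auto simp: hom_iff)
  then show "f \<in> hom V \<I> (ihom V x y) \<and> iso_arrow V x y (unname V x y f)"
    using fh by (auto simp: iso_arrow_def)
next
  assume f: "f \<in> hom V \<I> (ihom V x y) \<and> iso_arrow V x y (unname V x y f)"
  then have fh: "f \<in> hom V \<I> (ihom V x y)" by simp
  note i = iso_arrow_inverse[OF f[THEN conjunct2]]
  define g where "g = name y x (inverse_of V (unname V x y f))"
  have g: "g \<in> hom V \<I> (ihom V y x)" using i by (simp add: g_def hom_iff)
  have gu: "unname V y x g = inverse_of V (unname V x y f)" using i by (simp add: g_def)
  have "ucomp V VV x y x g f = name x x (unname V x x (ucomp V VV x y x g f))"
    using ucomp_VV_eval(1)[OF fh g] by (simp add: hom_iff)
  also have "\<dots> = name x x (unname V x x (VId VV x))"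
    using ucomp_VV_eval(2)[OF fh g] gu i by (simp add: unname_VId)
  also have "\<dots> = VId VV x" by (rule name_unname) simp_all
  finally have 1: "ucomp V VV x y x g f = VId VV x" .
  have "ucomp V VV y x y f g = name y y (unname V y y (ucomp V VV y x y f g))"
    using ucomp_VV_eval(1)[OF g fh] by (simp add: hom_iff)
  also have "\<dots> = name y y (unname V y y (VId VV y))"
    using ucomp_VV_eval(2)[OF g fh] gu i by (simp add: unname_VId)
  also have "\<dots> = VId VV y" by (rule name_unname) simp_all
  finally have 2: "ucomp V VV y x y f g = VId VV y" .
  show "viso V VV x y f" unfolding viso_def using fh g 1 2 by auto
qed

definition natural where
  "natural A F G t \<longleftrightarrow>
    (\<forall>a\<in>VOb A. t a \<in> Arr V \<and> Dom V (t a) = FOb F a \<and> Cod V (t a) = FOb G a) \<and>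
    (\<forall>a\<in>VOb A. \<forall>b\<in>VOb A. \<forall>f s. el f \<and> ty f = VHom A a b \<and> el s \<and> ty s = FOb F a \<and> f \<sharp> s \<and> s \<sharp> f \<longrightarrow>
      t b \<bullet> act F a b f s = act G a b f (t a \<bullet> s))"

lemma naturalI:
  assumes "\<And>a. a \<in> VOb A \<Longrightarrow> t a \<in> Arr V" "\<And>a. a \<in> VOb A \<Longrightarrow> Dom V (t a) = FOb F a"
    "\<And>a. a \<in> VOb A \<Longrightarrow> Cod V (t a) = FOb G a"
    "\<And>a b f s. \<lbrakk>a \<in> VOb A; b \<in> VOb A; el f; ty f = VHom A a b; el s; ty s = FOb F a; f \<sharp> s; s \<sharp> f\<rbrakk> \<Longrightarrow>
      t b \<bullet> act F a b f s = act G a b f (t a \<bullet> s)"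
  shows "natural A F G t"
  using assms by (simp add: natural_def)

lemma naturalD:
  assumes "natural A F G t" "a \<in> VOb A"
  shows "t a \<in> Arr V" "Dom V (t a) = FOb F a" "Cod V (t a) = FOb G a"
  and "\<lbrakk>b \<in> VOb A; el f; ty f = VHom A a b; el s; ty s = FOb F a; f \<sharp> s\<rbrakk> \<Longrightarrow>
      t b \<bullet> act F a b f s = act G a b f (t a \<bullet> s)"
  using assms apart_sym[of f s] by (simp_all add: natural_def)

text \<open>Both sides of the condition in \<open>vnat\<close> are arrows into an internal hom, so
  they are compared by evaluation; the inverse unitors in it merely insert
  \<open>star\<close>.\<close>

lemma vnat_iff:
  assumes F: "vfunctor V A VV F" and G: "vfunctor V A VV G"
  shows "vnat V A VV F G \<theta> \<longleftrightarrow>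
    (\<forall>a\<in>VOb A. \<theta> a \<in> hom V \<I> (ihom V (FOb F a) (FOb G a))) \<and>
    natural A F G (\<lambda>a. unname V (FOb F a) (FOb G a) (\<theta> a))"
proof (cases "\<forall>a\<in>VOb A. \<theta> a \<in> hom V \<I> (ihom V (FOb F a) (FOb G a))")
  case True
  note [simp] = F G vfunctor_vcategory[OF F] vfunctor_rules[OF F] vfunctor_rules[OF G]
    vfunctor_self_Ob[OF F] vfunctor_self_Ob[OF G]
  have [simp]: "\<theta> a \<in> Arr V" "Dom V (\<theta> a) = \<I>" "Cod V (\<theta> a) = ihom V (FOb F a) (FOb G a)" if "a \<in> VOb A" for a
    using True that by (auto simp: hom_iff)
  let ?l = "\<lambda>a b. VComp VV (FOb F a) (FOb F b) (FOb G b) \<cdot> (\<theta> b \<otimes> FHom F a b) \<cdot> linv (VHom A a b)"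
  let ?r = "\<lambda>a b. VComp VV (FOb F a) (FOb G a) (FOb G b) \<cdot> (FHom G a b \<otimes> \<theta> a) \<cdot> rinv (VHom A a b)"
  have "?l a b = ?r a b \<longleftrightarrow> (\<forall>f s. el f \<and> ty f = VHom A a b \<and> el s \<and> ty s = FOb F a \<and> f \<sharp> s \<and> s \<sharp> f \<longrightarrow>
      unname V (FOb F b) (FOb G b) (\<theta> b) \<bullet> act F a b f s
       = act G a b f (unname V (FOb F a) (FOb G a) (\<theta> a) \<bullet> s))"
    (is "_ \<longleftrightarrow> ?R") if ab [simp]: "a \<in> VOb A" "b \<in> VOb A" for a b
  proof
    assume eq: "?l a b = ?r a b"
    show ?R
    proof (intro allI impI, elim conjE)
      fix f s assume [simp]: "el f" "ty f = VHom A a b" "el s" "ty s = FOb F a" "f \<sharp> s" "s \<sharp> f"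
      have "evl (FOb F a) (FOb G b) (?l a b \<bullet> f) s = evl (FOb F a) (FOb G b) (?r a b \<bullet> f) s"
        unfolding eq ..
      then show "unname V (FOb F b) (FOb G b) (\<theta> b) \<bullet> act F a b f s
       = act G a b f (unname V (FOb F a) (FOb G a) (\<theta> a) \<bullet> s)"
        by simp
    qed
  next
    assume R: ?R
    show "?l a b = ?r a b"
      by (rule app_transp_ext[of _ _ "VHom A a b" "FOb F a" "FOb G b"]) (use R in simp_all)
  qed
  then show ?thesis using True unfolding vnat_def natural_def by simp
next
  case False
  then show ?thesis by (auto simp: vnat_def)
qed

lemma vnat_iso_iff:
  assumes F: "vfunctor V A VV F" and G: "vfunctor V A VV G"
  shows "vnat_iso V A VV F G \<theta> \<longleftrightarrow>
    (\<forall>a\<in>VOb A. \<theta> a \<in> hom V \<I> (ihom V (FOb F a) (FOb G a))) \<and>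
    natural A F G (\<lambda>a. unname V (FOb F a) (FOb G a) (\<theta> a)) \<and>
    (\<forall>a\<in>VOb A. iso_arrow V (FOb F a) (FOb G a) (unname V (FOb F a) (FOb G a) (\<theta> a)))"
  using vfunctor_self_Ob[OF F] vfunctor_self_Ob[OF G]
  unfolding vnat_iso_def vnat_iff[OF F G] by (auto simp: viso_VV_iff)

section \<open>Weighted limits by universal cylinders\<close>

text \<open>
  A family in context \<open>x\<close> is a natural family \<open>x \<otimes> \<phi> k \<rightarrow> A(a, T k)\<close>; with \<open>x\<close> arbitrary, the
  universal property below is the enriched one.
\<close>

definition family where
  "family A X \<phi> T a x \<sigma> \<longleftrightarrow>
    (\<forall>k\<in>VOb X. \<sigma> k \<in> Arr V \<and> Dom V (\<sigma> k) = x \<odot> FOb \<phi> k \<and> Cod V (\<sigma> k) = VHom A a (FOb T k)) \<and>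
    (\<forall>k\<in>VOb X. \<forall>l\<in>VOb X. \<forall>e u p. el e \<and> ty e = x \<and> el u \<and> ty u = VHom X k l \<and> el p \<and> ty p = FOb \<phi> k \<and>
       e \<sharp> u \<and> u \<sharp> e \<and> e \<sharp> p \<and> p \<sharp> e \<and> u \<sharp> p \<and> p \<sharp> u \<longrightarrow>
       \<sigma> l \<bullet> \<langle>e, act \<phi> k l u p\<rangle>
       = cmp A a (FOb T k) (FOb T l) (FHom T k l \<bullet> u) (\<sigma> k \<bullet> \<langle>e, p\<rangle>))"

lemma familyI:
  assumes "\<And>k. k \<in> VOb X \<Longrightarrow> \<sigma> k \<in> Arr V" "\<And>k. k \<in> VOb X \<Longrightarrow> Dom V (\<sigma> k) = x \<odot> FOb \<phi> k"
    "\<And>k. k \<in> VOb X \<Longrightarrow> Cod V (\<sigma> k) = VHom A a (FOb T k)"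
    and "\<And>k l e u p. \<lbrakk>k \<in> VOb X; l \<in> VOb X; el e; ty e = x; el u; ty u = VHom X k l; el p; ty p = FOb \<phi> k;
       e \<sharp> u; u \<sharp> e; e \<sharp> p; p \<sharp> e; u \<sharp> p; p \<sharp> u\<rbrakk> \<Longrightarrow>
       \<sigma> l \<bullet> \<langle>e, act \<phi> k l u p\<rangle>
       = cmp A a (FOb T k) (FOb T l) (FHom T k l \<bullet> u) (\<sigma> k \<bullet> \<langle>e, p\<rangle>)"
  shows "family A X \<phi> T a x \<sigma>"
  unfolding family_def using assms by simp

lemma familyD:
  assumes "family A X \<phi> T a x \<sigma>" "k \<in> VOb X"
  shows "\<sigma> k \<in> Arr V" "Dom V (\<sigma> k) = x \<odot> FOb \<phi> k" "Cod V (\<sigma> k) = VHom A a (FOb T k)"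
    and "\<lbrakk>l \<in> VOb X; el e; ty e = x; el u; ty u = VHom X k l; el p; ty p = FOb \<phi> k;
       e \<sharp> u; e \<sharp> p; u \<sharp> p\<rbrakk> \<Longrightarrow>
       \<sigma> l \<bullet> \<langle>e, act \<phi> k l u p\<rangle>
       = cmp A a (FOb T k) (FOb T l) (FHom T k l \<bullet> u) (\<sigma> k \<bullet> \<langle>e, p\<rangle>)"
  using assms apart_sym[of e u] apart_sym[of e p] apart_sym[of u p] by (simp_all add: family_def)

text \<open>A family in the unit context with the unit left out, so that no unitor appears in the
  universal cylinder.\<close>

definition cylinder where
  "cylinder A X \<phi> T a \<eta> \<longleftrightarrow>
    (\<forall>k\<in>VOb X. \<eta> k \<in> Arr V \<and> Dom V (\<eta> k) = FOb \<phi> k \<and> Cod V (\<eta> k) = VHom A a (FOb T k)) \<and>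
    (\<forall>k\<in>VOb X. \<forall>l\<in>VOb X. \<forall>u p. el u \<and> ty u = VHom X k l \<and> el p \<and> ty p = FOb \<phi> k \<and>
       u \<sharp> p \<and> p \<sharp> u \<longrightarrow>
       \<eta> l \<bullet> act \<phi> k l u p
       = cmp A a (FOb T k) (FOb T l) (FHom T k l \<bullet> u) (\<eta> k \<bullet> p))"

lemma cylinderI:
  assumes "\<And>k. k \<in> VOb X \<Longrightarrow> \<eta> k \<in> Arr V" "\<And>k. k \<in> VOb X \<Longrightarrow> Dom V (\<eta> k) = FOb \<phi> k"
    "\<And>k. k \<in> VOb X \<Longrightarrow> Cod V (\<eta> k) = VHom A a (FOb T k)"
    and "\<And>k l u p. \<lbrakk>k \<in> VOb X; l \<in> VOb X; el u; ty u = VHom X k l; el p; ty p = FOb \<phi> k; u \<sharp> p; p \<sharp> u\<rbrakk> \<Longrightarrow>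
       \<eta> l \<bullet> act \<phi> k l u p
       = cmp A a (FOb T k) (FOb T l) (FHom T k l \<bullet> u) (\<eta> k \<bullet> p)"
  shows "cylinder A X \<phi> T a \<eta>"
  unfolding cylinder_def using assms by simp

lemma cylinderD:
  assumes "cylinder A X \<phi> T a \<eta>" "k \<in> VOb X"
  shows "\<eta> k \<in> Arr V" "Dom V (\<eta> k) = FOb \<phi> k" "Cod V (\<eta> k) = VHom A a (FOb T k)"
    and "\<lbrakk>l \<in> VOb X; el u; ty u = VHom X k l; el p; ty p = FOb \<phi> k; u \<sharp> p\<rbrakk> \<Longrightarrow>
       \<eta> l \<bullet> act \<phi> k l u p
       = cmp A a (FOb T k) (FOb T l) (FHom T k l \<bullet> u) (\<eta> k \<bullet> p)"
  using assms apart_sym[of u p] by (simp_all add: cylinder_def)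

definition factors where
  "factors A X \<phi> T L \<eta> a x \<sigma> h \<longleftrightarrow> h \<in> Arr V \<and> Dom V h = x \<and> Cod V h = VHom A a L \<and>
     (\<forall>k\<in>VOb X. \<forall>e p. el e \<and> ty e = x \<and> el p \<and> ty p = FOb \<phi> k \<and> e \<sharp> p \<and> p \<sharp> e \<longrightarrow>
       cmp A a L (FOb T k) (\<eta> k \<bullet> p) (h \<bullet> e) = \<sigma> k \<bullet> \<langle>e, p\<rangle>)"

lemma factorsI:
  assumes "h \<in> Arr V" "Dom V h = x" "Cod V h = VHom A a L"
    and "\<And>k e p. \<lbrakk>k \<in> VOb X; el e; ty e = x; el p; ty p = FOb \<phi> k; e \<sharp> p; p \<sharp> e\<rbrakk> \<Longrightarrow>
       cmp A a L (FOb T k) (\<eta> k \<bullet> p) (h \<bullet> e) = \<sigma> k \<bullet> \<langle>e, p\<rangle>"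
  shows "factors A X \<phi> T L \<eta> a x \<sigma> h"
  unfolding factors_def using assms by simp

lemma factorsD:
  assumes "factors A X \<phi> T L \<eta> a x \<sigma> h"
  shows "h \<in> Arr V" "Dom V h = x" "Cod V h = VHom A a L"
    and "\<lbrakk>k \<in> VOb X; el e; ty e = x; el p; ty p = FOb \<phi> k; e \<sharp> p\<rbrakk> \<Longrightarrow>
       cmp A a L (FOb T k) (\<eta> k \<bullet> p) (h \<bullet> e) = \<sigma> k \<bullet> \<langle>e, p\<rangle>"
  using assms apart_sym[of e p] by (simp_all add: factors_def)

definition wlim where
  "wlim A X \<phi> T L \<eta> \<longleftrightarrow> L \<in> VOb A \<and> cylinder A X \<phi> T L \<eta> \<and>
    (\<forall>a\<in>VOb A. \<forall>x\<in>Ob V. \<forall>\<sigma>. family A X \<phi> T a x \<sigma> \<longrightarrow> (\<exists>!h. factors A X \<phi> T L \<eta> a x \<sigma> h))"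

lemma wlimI:
  assumes "L \<in> VOb A" "cylinder A X \<phi> T L \<eta>"
    and "\<And>a x \<sigma>. \<lbrakk>a \<in> VOb A; x \<in> Ob V; family A X \<phi> T a x \<sigma>\<rbrakk> \<Longrightarrow> \<exists>h. factors A X \<phi> T L \<eta> a x \<sigma> h"
    and "\<And>a x \<sigma> h h'. \<lbrakk>a \<in> VOb A; x \<in> Ob V; factors A X \<phi> T L \<eta> a x \<sigma> h; factors A X \<phi> T L \<eta> a x \<sigma> h'\<rbrakk> \<Longrightarrow> h = h'"
  shows "wlim A X \<phi> T L \<eta>"
  unfolding wlim_def using assms by blast

lemma wlimD:
  assumes "wlim A X \<phi> T L \<eta>"
  shows "L \<in> VOb A" "cylinder A X \<phi> T L \<eta>"
    and "\<lbrakk>a \<in> VOb A; x \<in> Ob V; family A X \<phi> T a x \<sigma>\<rbrakk> \<Longrightarrow> \<exists>!h. factors A X \<phi> T L \<eta> a x \<sigma> h"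
  using assms by (auto simp: wlim_def)

text \<open>Composing the cylinder with \<open>h'\<close> gives a family through which both arrows
  factor, so uniqueness of factorisations applies.\<close>

lemma wlim_ext:
  assumes w: "wlim A X \<phi> T L \<eta>" and T: "vfunctor V X A T" and \<phi>: "vfunctor V X VV \<phi>"
    and a: "a \<in> VOb A"
    and h: "h \<in> Arr V" "Cod V h = VHom A a L" and h': "h' \<in> Arr V" "Cod V h' = VHom A a L" and d: "Dom V h = Dom V h'"
    and eq: "\<And>k e p. \<lbrakk>k \<in> VOb X; el e; ty e = Dom V h'; el p; ty p = FOb \<phi> k; e \<sharp> p; p \<sharp> e\<rbrakk> \<Longrightarrow>
       cmp A a L (FOb T k) (\<eta> k \<bullet> p) (h \<bullet> e) = cmp A a L (FOb T k) (\<eta> k \<bullet> p) (h' \<bullet> e)"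
  shows "h = h'"
proof -
  note [simp] = T vfunctor_vcategory[OF T] vfunctor_rules[OF T] vfunctor_rules[OF \<phi>] vfunctor_self_Ob[OF \<phi>]
    wlimD(1)[OF w] a h h' d cylinderD[OF wlimD(2)[OF w]]
  let ?\<sigma> = "\<lambda>k. VComp A a L (FOb T k) \<cdot> (\<eta> k \<otimes> h') \<cdot> symm V (Dom V h') (FOb \<phi> k)"
  have "family A X \<phi> T a (Dom V h') ?\<sigma>"
    by (rule familyI) simp_all
  from wlimD(3)[OF w a _ this] have "\<exists>!h. factors A X \<phi> T L \<eta> a (Dom V h') ?\<sigma> h" by simp
  moreover have "factors A X \<phi> T L \<eta> a (Dom V h') ?\<sigma> h" by (rule factorsI) (simp_all add: eq)
  moreover have "factors A X \<phi> T L \<eta> a (Dom V h') ?\<sigma> h'" by (rule factorsI) simp_all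
  ultimately show ?thesis by blast
qed

lemma family_wedge:
  assumes T: "vfunctor V X A T" and \<phi>: "vfunctor V X VV \<phi>" and a: "a \<in> VOb A" and x: "x \<in> Ob V"
    and \<sigma>: "family A X \<phi> T a x \<sigma>"
  shows "wedge X \<phi> (hom_into V X A T a) x (\<lambda>k. transp V x (FOb \<phi> k) (VHom A a (FOb T k)) (\<sigma> k))"
proof -
  note [simp] = T vfunctor_vcategory[OF T] vfunctor_rules[OF T] vfunctor_rules[OF \<phi>] vfunctor_self_Ob[OF \<phi>]
    a x hom_into_rules[OF T a] familyD[OF \<sigma>]
  show ?thesis by (rule wedgeI) simp_all
qed

lemma Nat_hom_into_natural:
  assumes T: "vfunctor V X A T" and \<phi>: "vfunctor V X VV \<phi>" and X: "ends_exist X" and a: "a \<in> VOb A"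
    and "k \<in> VOb X" "l \<in> VOb X" "el e" "ty e = NT X \<phi> (hom_into V X A T a)" "el u" "ty u = VHom X k l" "el p" "ty p = FOb \<phi> k"
        "e \<sharp> u" "e \<sharp> p" "u \<sharp> p"
  shows "evl (FOb \<phi> l) (VHom A a (FOb T l)) (pr X \<phi> (hom_into V X A T a) l \<bullet> e) (act \<phi> k l u p)
      = cmp A a (FOb T k) (FOb T l) (FHom T k l \<bullet> u) (evl (FOb \<phi> k) (VHom A a (FOb T k)) (pr X \<phi> (hom_into V X A T a) k \<bullet> e) p)"
proof -
  note [simp] = X vfunctor_vcategory[OF T] vfunctor_rules[OF T] vfunctor_rules[OF \<phi>] vfunctor_self_Ob[OF \<phi>]
    hom_into_rules[OF T] a apart_sym[OF \<open>e \<sharp> u\<close>]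
  show ?thesis
    using Nat_natural[OF X \<phi> vfunctor_hom_into[OF T a], of k l e u p] assms \<phi> by simp
qed

text \<open>The presheaf \<open>a \<mapsto> [X,V](\<phi>, A(a,T-))\<close> on \<open>A\<close> that
  a limit represents.\<close>

definition limit_functor where
  "limit_functor A X \<phi> T = comp_vfun V (opp V A) (cov_hom V (Fun X) \<phi>) (hom_into_functor V X A T)"

lemma limit_functor_rules:
  assumes T: "vfunctor V X A T" and \<phi>: "vfunctor V X VV \<phi>" and X: "ends_exist X"
  shows "vfunctor V (opp V A) VV (limit_functor A X \<phi> T)"
    and "a \<in> VOb A \<Longrightarrow> FOb (limit_functor A X \<phi> T) a = NT X \<phi> (hom_into V X A T a)"
    and "\<lbrakk>a \<in> VOb A; b \<in> VOb A\<rbrakk> \<Longrightarrow> FHom (limit_functor A X \<phi> T) a b \<in> Arr V"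
    and "\<lbrakk>a \<in> VOb A; b \<in> VOb A\<rbrakk> \<Longrightarrow> Dom V (FHom (limit_functor A X \<phi> T) a b) = VHom A b a"
    and "\<lbrakk>a \<in> VOb A; b \<in> VOb A\<rbrakk> \<Longrightarrow> Cod V (FHom (limit_functor A X \<phi> T) a b)
      = ihom V (NT X \<phi> (hom_into V X A T a)) (NT X \<phi> (hom_into V X A T b))"
    and "\<lbrakk>a \<in> VOb A; b \<in> VOb A; k \<in> VOb X; el g; ty g = VHom A b a; el t; ty t = NT X \<phi> (hom_into V X A T a);
       el p; ty p = FOb \<phi> k; g \<sharp> t; g \<sharp> p; t \<sharp> p\<rbrakk> \<Longrightarrow>
      evl (FOb \<phi> k) (VHom A b (FOb T k)) (pr X \<phi> (hom_into V X A T b) k \<bullet>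
        evl (NT X \<phi> (hom_into V X A T a)) (NT X \<phi> (hom_into V X A T b)) (FHom (limit_functor A X \<phi> T) a b \<bullet> g) t) p
      = cmp A b a (FOb T k) (evl (FOb \<phi> k) (VHom A a (FOb T k)) (pr X \<phi> (hom_into V X A T a) k \<bullet> t) p) g"
proof -
  note [simp] = T X \<phi> vfunctor_vcategory[OF T] vfunctor_rules[OF T] vfunctor_rules[OF \<phi>] vfunctor_self_Ob[OF \<phi>]
    hom_into_rules[OF T] hom_into_functor_typing[OF T X]
  show F: "vfunctor V (opp V A) VV (limit_functor A X \<phi> T)"
    unfolding limit_functor_def by (rule vfunctor_comp[OF vfunctor_hom_into_functor[OF T X] vfunctor_cov_hom]) simp_all
  show ob: "FOb (limit_functor A X \<phi> T) a = NT X \<phi> (hom_into V X A T a)" if "a \<in> VOb A" for a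
    using that by (simp add: limit_functor_def)
  show "FHom (limit_functor A X \<phi> T) a b \<in> Arr V" "Dom V (FHom (limit_functor A X \<phi> T) a b) = VHom A b a"
    "Cod V (FHom (limit_functor A X \<phi> T) a b) = ihom V (NT X \<phi> (hom_into V X A T a)) (NT X \<phi> (hom_into V X A T b))"
    if "a \<in> VOb A" "b \<in> VOb A"
    using vfunctor_typing(2-4)[OF F, of a b] ob that by simp_all
  assume ab [simp]: "a \<in> VOb A" "b \<in> VOb A" "k \<in> VOb X"
    and [simp]: "el g" "ty g = VHom A b a" "el t" "ty t = NT X \<phi> (hom_into V X A T a)"
       "el p" "ty p = FOb \<phi> k" "g \<sharp> t" "g \<sharp> p" "t \<sharp> p"
  have 1: "evl (NT X \<phi> (hom_into V X A T a)) (NT X \<phi> (hom_into V X A T b)) (FHom (limit_functor A X \<phi> T) a b \<bullet> g) t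
    = cmp (Fun X) \<phi> (hom_into V X A T a) (hom_into V X A T b) (FHom (hom_into_functor V X A T) a b \<bullet> g) t"
    using cov_hom_eval[of "Fun X" \<phi> "hom_into V X A T a" "hom_into V X A T b" "FHom (hom_into_functor V X A T) a b \<bullet> g" t]
      cov_hom_typing(1)[of "Fun X" \<phi> "hom_into V X A T a"] cov_hom_typing(1)[of "Fun X" \<phi> "hom_into V X A T b"]
      cov_hom_typing(2-4)[of "Fun X" \<phi> "hom_into V X A T a" "hom_into V X A T b"]
    by (simp add: limit_functor_def)
  have 2: "pr X \<phi> (hom_into V X A T b) k \<bullet> cmp (Fun X) \<phi> (hom_into V X A T a) (hom_into V X A T b) (FHom (hom_into_functor V X A T) a b \<bullet> g) t
      = cmp VV (FOb \<phi> k) (VHom A a (FOb T k)) (VHom A b (FOb T k)) (pr X (hom_into V X A T a) (hom_into V X A T b) k \<bullet> FHom (hom_into_functor V X A T) a b \<bullet> g) (pr X \<phi> (hom_into V X A T a) k \<bullet> t)"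
    using Fun_VComp(4)[OF X \<phi> vfunctor_hom_into[OF T ab(1)] vfunctor_hom_into[OF T ab(2)], of k
      "FHom (hom_into_functor V X A T) a b \<bullet> g" t] by simp
  show "evl (FOb \<phi> k) (VHom A b (FOb T k)) (pr X \<phi> (hom_into V X A T b) k \<bullet>
        evl (NT X \<phi> (hom_into V X A T a)) (NT X \<phi> (hom_into V X A T b)) (FHom (limit_functor A X \<phi> T) a b \<bullet> g) t) p
      = cmp A b a (FOb T k) (evl (FOb \<phi> k) (VHom A a (FOb T k)) (pr X \<phi> (hom_into V X A T a) k \<bullet> t) p) g"
    unfolding 1 2 by simp
qed

text \<open>\<open>X\<close> stands for \<open>opp V K\<close> but is kept as a variable, so that
  simplification does not turn its hom-objects into those of \<open>K\<close>.\<close>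

context
  fixes A :: "('c, 'o, 'a) vcat" and K :: "('k, 'o, 'a) vcat" and X \<phi> and T :: "('k, 'c, 'a) vfun"
  assumes X_def: "X = opp V K"
    and T: "vfunctor V X A T" and \<phi>: "vfunctor V X VV \<phi>" and X: "ends_exist X"
begin

lemma is_wlimit_iff:
  "is_wlimit V A K \<phi> T L \<theta> \<longleftrightarrow> L \<in> VOb A \<and>
     (\<forall>a\<in>VOb A. \<theta> a \<in> hom V \<I> (ihom V (VHom A a L) (NT X \<phi> (hom_into V X A T a)))) \<and>
     natural (opp V A) (contra_hom V A L) (limit_functor A X \<phi> T)
       (\<lambda>a. unname V (FOb (contra_hom V A L) a) (FOb (limit_functor A X \<phi> T) a) (\<theta> a)) \<and>
     (\<forall>a\<in>VOb A. iso_arrow V (VHom A a L) (NT X \<phi> (hom_into V X A T a))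
        (unname V (VHom A a L) (NT X \<phi> (hom_into V X A T a)) (\<theta> a)))"
proof (cases "L \<in> VOb A")
  case True
  note A = vfunctor_vcategory(2)[OF T]
  show ?thesis
    unfolding is_wlimit_def X_def[symmetric] limit_functor_def[symmetric]
      vnat_iso_iff[OF vfunctor_contra_hom[OF A True] limit_functor_rules(1)[OF T \<phi> X]]
    using True A limit_functor_rules(2)[OF T \<phi> X] by simp
next
  case False
  then show ?thesis by (simp add: is_wlimit_def)
qed

text \<open>Yoneda: a transformation out of \<open>A(-,L)\<close> is composition with the image of
  the identity, which is the unit. Factorisations through the unit are then preimages under the
  invertible components.\<close>

lemma is_wlimit_wlim:
  assumes w: "is_wlimit V A K \<phi> T L \<theta>"
  shows "wlim A X \<phi> T L (wlimit_unit V A K \<phi> T L \<theta>)"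
proof -
  let ?N = "\<lambda>a. NT X \<phi> (hom_into V X A T a)" and ?\<eta> = "wlimit_unit V A K \<phi> T L \<theta>"
  have L [simp]: "L \<in> VOb A" using w is_wlimit_iff by simp
  note [simp] = T X \<phi> vfunctor_vcategory[OF T] vfunctor_rules[OF T] vfunctor_rules[OF \<phi>] vfunctor_self_Ob[OF \<phi>]
    hom_into_rules[OF T] limit_functor_rules(2-)[OF T \<phi> X]
  define t where "t = (\<lambda>a. unname V (VHom A a L) (?N a) (\<theta> a))"
  have \<theta> [simp]: "\<theta> a \<in> Arr V" "Dom V (\<theta> a) = \<I>" "Cod V (\<theta> a) = ihom V (VHom A a L) (?N a)" if "a \<in> VOb A" for a
    using w that unfolding is_wlimit_iff by (simp_all add: hom_iff)
  have t [simp]: "t a \<in> Arr V" "Dom V (t a) = VHom A a L" "Cod V (t a) = ?N a" if "a \<in> VOb A" for a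
    unfolding t_def by (rule unname_typing; (simp add: that)?)+
  have tnat: "t b \<bullet> cmp A b a L s f
      = evl (?N a) (?N b) (FHom (limit_functor A X \<phi> T) a b \<bullet> f) (t a \<bullet> s)"
    if ab: "a \<in> VOb A" "b \<in> VOb A" and el: "el f" "ty f = VHom A b a" "el s" "ty s = VHom A a L" "f \<sharp> s" for a b f s
  proof -
    have n: "natural (opp V A) (contra_hom V A L) (limit_functor A X \<phi> T)
       (\<lambda>a. unname V (FOb (contra_hom V A L) a) (FOb (limit_functor A X \<phi> T) a) (\<theta> a))"
      using w is_wlimit_iff by simp
    show ?thesis
      using naturalD(4)[OF n, of a b f s] ab el by (simp add: t_def del: app_unname)
  qed
  have tiso: "iso_arrow V (VHom A a L) (?N a) (t a)" if "a \<in> VOb A" for a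
    using w that unfolding is_wlimit_iff t_def by simp
  have \<eta>_def: "?\<eta> k = unname V (FOb \<phi> k) (VHom A L (FOb T k)) (pr X \<phi> (hom_into V X A T L) k \<cdot> t L \<cdot> VId A L)" for k
    unfolding wlimit_unit_def X_def t_def ..
  have \<eta> [simp]: "?\<eta> k \<in> Arr V" "Dom V (?\<eta> k) = FOb \<phi> k" "Cod V (?\<eta> k) = VHom A L (FOb T k)" if "k \<in> VOb X" for k
    unfolding \<eta>_def by (rule unname_typing; (simp add: that)?)+
  have \<eta>_el: "?\<eta> k \<bullet> p = evl (FOb \<phi> k) (VHom A L (FOb T k)) (pr X \<phi> (hom_into V X A T L) k \<bullet> t L \<bullet> VId A L \<bullet> star) p"
    if "k \<in> VOb X" "el p" "ty p = FOb \<phi> k" for k p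
    using that by (simp add: \<eta>_def)
  \<comment> \<open>Naturality at the identity of \<open>L\<close> recovers the component
    \<open>t a\<close> from the unit.\<close>
  have comp: "cmp A a L (FOb T k) (?\<eta> k \<bullet> p) f
      = evl (FOb \<phi> k) (VHom A a (FOb T k)) (pr X \<phi> (hom_into V X A T a) k \<bullet> t a \<bullet> f) p"
    if "a \<in> VOb A" "k \<in> VOb X" "el p" "ty p = FOb \<phi> k" "el f" "ty f = VHom A a L" "f \<sharp> p" for a k f p
    using tnat[of L a f "VId A L \<bullet> star"] that apart_sym[of f p] by (simp add: \<eta>_el)
  show ?thesis
  proof (rule wlimI[OF L])
    show "cylinder A X \<phi> T L ?\<eta>"
      by (rule cylinderI) (simp_all add: \<eta>_el Nat_hom_into_natural[OF T \<phi> X L])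
  next
    fix a x \<sigma> assume a [simp]: "a \<in> VOb A" and x [simp]: "x \<in> Ob V" and \<sigma>: "family A X \<phi> T a x \<sigma>"
    note [simp] = familyD(1-3)[OF \<sigma>]
    note W = family_wedge[OF T \<phi> a x \<sigma>]
    note N = into_Nat[OF X \<phi> vfunctor_hom_into[OF T a] W]
      proj_into_Nat_el[OF X \<phi> vfunctor_hom_into[OF T a] W]
    note i = iso_arrow_inverse[OF tiso[OF a]]
    let ?s = "into_Nat V X VV \<phi> (hom_into V X A T a) x (\<lambda>k. transp V x (FOb \<phi> k) (VHom A a (FOb T k)) (\<sigma> k))"
    have "factors A X \<phi> T L ?\<eta> a x \<sigma> (inverse_of V (t a) \<cdot> ?s)"
    proof (rule factorsI)
      fix k e p assume h [simp]: "k \<in> VOb X" "el e" "ty e = x" "el p" "ty p = FOb \<phi> k" "e \<sharp> p" "p \<sharp> e"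
      have "t a \<bullet> inverse_of V (t a) \<bullet> ?s \<bullet> e = (t a \<cdot> inverse_of V (t a)) \<bullet> ?s \<bullet> e"
        using N(1-3) i(1-6) by (intro app_comp[symmetric]) simp_all
      then have "t a \<bullet> inverse_of V (t a) \<bullet> ?s \<bullet> e = ?s \<bullet> e" using N i by simp
      then show "cmp A a L (FOb T k) (?\<eta> k \<bullet> p) ((inverse_of V (t a) \<cdot> ?s) \<bullet> e) = \<sigma> k \<bullet> \<langle>e, p\<rangle>"
        using N i by (simp add: comp)
    qed (use N i in simp_all)
    then show "\<exists>h. factors A X \<phi> T L ?\<eta> a x \<sigma> h" ..
  next
    fix a x \<sigma> h h' assume a [simp]: "a \<in> VOb A" and x [simp]: "x \<in> Ob V"
      and f: "factors A X \<phi> T L ?\<eta> a x \<sigma> h" and f': "factors A X \<phi> T L ?\<eta> a x \<sigma> h'"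
    note [simp] = factorsD(1-3)[OF f] factorsD(1-3)[OF f']
    have "t a \<cdot> h = t a \<cdot> h'"
    proof (rule arrow_ext[of _ _ x])
      fix e assume e [simp]: "el e" "ty e = x"
      show "(t a \<cdot> h) \<bullet> e = (t a \<cdot> h') \<bullet> e"
      proof (rule Nat_el_ext[OF X \<phi> vfunctor_hom_into[OF T a]])
        fix k p assume "k \<in> VOb X" "el p" "ty p = FOb \<phi> k" "(t a \<cdot> h) \<bullet> e \<sharp> p" "p \<sharp> (t a \<cdot> h) \<bullet> e"
        then have [simp]: "k \<in> VOb X" "el p" "ty p = FOb \<phi> k" "e \<sharp> p" "p \<sharp> e" by simp_all
        show "cpt X \<phi> (hom_into V X A T a) k ((t a \<cdot> h) \<bullet> e) p
          = cpt X \<phi> (hom_into V X A T a) k ((t a \<cdot> h') \<bullet> e) p"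
          using factorsD(4)[OF f, of k e p] factorsD(4)[OF f', of k e p] by (simp add: comp)
      qed simp_all
    qed simp_all
    then show "h = h'"
      using iso_arrow_inverse[OF tiso[OF a]] by - (rule section_cancel[of "inverse_of V (t a)" "t a"], simp_all)
  qed
qed

lemma wlim_is_wlimit:
  assumes w: "wlim A X \<phi> T L \<eta>"
  obtains \<theta> where "is_wlimit V A K \<phi> T L \<theta>" "\<And>k. k \<in> VOb K \<Longrightarrow> wlimit_unit V A K \<phi> T L \<theta> k = \<eta> k"
proof -
  let ?N = "\<lambda>a. NT X \<phi> (hom_into V X A T a)"
  note L = wlimD(1)[OF w]
  note [simp] = L T X \<phi> vfunctor_vcategory[OF T] vfunctor_rules[OF T] vfunctor_rules[OF \<phi>] vfunctor_self_Ob[OF \<phi>]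
    hom_into_rules[OF T] limit_functor_rules(2-)[OF T \<phi> X] cylinderD[OF wlimD(2)[OF w]]
  \<comment> \<open>Composition with the cylinder, as a family in the context \<open>A(a,L)\<close>;
    it induces the component \<open>t a\<close> of the isomorphism.\<close>
  define \<tau> where "\<tau> = (\<lambda>a k. VComp A a L (FOb T k) \<cdot> (\<eta> k \<otimes> \<one> (VHom A a L)) \<cdot> symm V (VHom A a L) (FOb \<phi> k))"
  have \<tau>: "family A X \<phi> T a (VHom A a L) (\<tau> a)" if "a \<in> VOb A" for a
    unfolding \<tau>_def by (rule familyI) (simp_all add: that)
  have \<tau>_el: "\<tau> a k \<bullet> \<langle>f, p\<rangle> = cmp A a L (FOb T k) (\<eta> k \<bullet> p) f"
    if "a \<in> VOb A" "k \<in> VOb X" "el f" "ty f = VHom A a L" "el p" "ty p = FOb \<phi> k" "f \<sharp> p" for a k f p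
    using that apart_sym[of f p] by (simp add: \<tau>_def)
  define t where "t = (\<lambda>a. into_Nat V X VV \<phi> (hom_into V X A T a) (VHom A a L)
     (\<lambda>k. transp V (VHom A a L) (FOb \<phi> k) (VHom A a (FOb T k)) (\<tau> a k)))"
  have t [simp]: "t a \<in> Arr V" "Dom V (t a) = VHom A a L" "Cod V (t a) = ?N a"
    and t_el: "\<lbrakk>k \<in> VOb X; el f; ty f = VHom A a L; el p; ty p = FOb \<phi> k; f \<sharp> p\<rbrakk> \<Longrightarrow>
      evl (FOb \<phi> k) (VHom A a (FOb T k)) (pr X \<phi> (hom_into V X A T a) k \<bullet> t a \<bullet> f) p
      = cmp A a L (FOb T k) (\<eta> k \<bullet> p) f" if a [simp]: "a \<in> VOb A" for a k f p
  proof -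
    have v: "VHom A a L \<in> Ob V" by simp
    note W = family_wedge[OF T \<phi> a v \<tau>[OF a]]
    note N = into_Nat[OF X \<phi> vfunctor_hom_into[OF T a] W]
      proj_into_Nat_el[OF X \<phi> vfunctor_hom_into[OF T a] W]
    show "t a \<in> Arr V" "Dom V (t a) = VHom A a L" "Cod V (t a) = ?N a" using N by (simp_all add: t_def)
    assume "k \<in> VOb X" "el f" "ty f = VHom A a L" "el p" "ty p = FOb \<phi> k" "f \<sharp> p"
    then show "evl (FOb \<phi> k) (VHom A a (FOb T k)) (pr X \<phi> (hom_into V X A T a) k \<bullet> t a \<bullet> f) p
      = cmp A a L (FOb T k) (\<eta> k \<bullet> p) f"
      using N familyD(1-3)[OF \<tau>[OF a]] by (simp add: t_def \<tau>_el)
  qed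
  have tiso: "iso_arrow V (VHom A a L) (?N a) (t a)" if a [simp]: "a \<in> VOb A" for a
  proof -
    \<comment> \<open>The tautological family, whose context is the end itself; its factorisation is
      the inverse of \<open>t a\<close>.\<close>
    let ?\<rho> = "\<lambda>k. ev V (FOb \<phi> k) (VHom A a (FOb T k)) \<cdot> (pr X \<phi> (hom_into V X A T a) k \<otimes> \<one> (FOb \<phi> k))"
    have "family A X \<phi> T a (?N a) ?\<rho>"
      by (rule familyI) (simp_all add: Nat_hom_into_natural[OF T \<phi> X a])
    from wlimD(3)[OF w a _ this] obtain d where d: "factors A X \<phi> T L \<eta> a (?N a) ?\<rho> d" by auto
    note [simp] = factorsD(1-3)[OF d]
    have d_el: "cmp A a L (FOb T k) (\<eta> k \<bullet> p) (d \<bullet> s)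
       = evl (FOb \<phi> k) (VHom A a (FOb T k)) (pr X \<phi> (hom_into V X A T a) k \<bullet> s) p"
      if "k \<in> VOb X" "el s" "ty s = ?N a" "el p" "ty p = FOb \<phi> k" "s \<sharp> p" for k s p
      using factorsD(4)[OF d, of k s p] that by simp
    have "d \<cdot> t a = \<one> (VHom A a L)"
      by (rule wlim_ext[OF w T \<phi> a]) (simp_all add: d_el t_el)
    moreover have "t a \<cdot> d = \<one> (?N a)"
    proof (rule arrow_ext[of _ _ "?N a"])
      fix e assume [simp]: "el e" "ty e = ?N a"
      show "(t a \<cdot> d) \<bullet> e = \<one> (?N a) \<bullet> e"
        by (rule Nat_el_ext[OF X \<phi> vfunctor_hom_into[OF T a]]) (simp_all add: d_el t_el)
    qed simp_all
    ultimately show ?thesis by (auto simp: iso_arrow_def inverse_arrows_def hom_iff intro!: exI[of _ d])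
  qed
  define \<theta> where "\<theta> = (\<lambda>a. name (VHom A a L) (?N a) (t a))"
  have un: "unname V (VHom A a L) (?N a) (\<theta> a) = t a" if "a \<in> VOb A" for a
    using that by (simp add: \<theta>_def)
  have "is_wlimit V A K \<phi> T L \<theta>"
    unfolding is_wlimit_iff
  proof (intro conjI ballI)
    fix a assume [simp]: "a \<in> VOb A"
    show "\<theta> a \<in> hom V \<I> (ihom V (VHom A a L) (?N a))" by (simp add: hom_iff \<theta>_def)
    show "iso_arrow V (VHom A a L) (?N a) (unname V (VHom A a L) (?N a) (\<theta> a))" by (simp add: un tiso)
  next
    show "natural (opp V A) (contra_hom V A L) (limit_functor A X \<phi> T)
       (\<lambda>a. unname V (FOb (contra_hom V A L) a) (FOb (limit_functor A X \<phi> T) a) (\<theta> a))"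
    proof (rule naturalI)
      fix a b f s assume "a \<in> VOb (opp V A)" "b \<in> VOb (opp V A)" "el f" "ty f = VHom (opp V A) a b"
        "el s" "ty s = FOb (contra_hom V A L) a" "f \<sharp> s" "s \<sharp> f"
      then have [simp]: "a \<in> VOb A" "b \<in> VOb A" "el f" "ty f = VHom A b a"
        "el s" "ty s = VHom A a L" "f \<sharp> s" "s \<sharp> f" by simp_all
      have "t b \<bullet> cmp A b a L s f
        = evl (?N a) (?N b) (FHom (limit_functor A X \<phi> T) a b \<bullet> f) (t a \<bullet> s)"
        by (rule Nat_el_ext[OF X \<phi> vfunctor_hom_into[OF T \<open>b \<in> VOb A\<close>]])
          (simp_all add: t_el ectx_add_comm)
      then show "unname V (FOb (contra_hom V A L) b) (FOb (limit_functor A X \<phi> T) b) (\<theta> b) \<bullet>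
          act (contra_hom V A L) a b f s
        = act (limit_functor A X \<phi> T) a b f (unname V (FOb (contra_hom V A L) a) (FOb (limit_functor A X \<phi> T) a) (\<theta> a) \<bullet> s)"
        by (simp add: un)
    qed (simp_all add: un)
  qed simp
  moreover have "wlimit_unit V A K \<phi> T L \<theta> k = \<eta> k" if "k \<in> VOb K" for k
  proof -
    have [simp]: "k \<in> VOb X" using that X_def by simp
    have "wlimit_unit V A K \<phi> T L \<theta> k
      = unname V (FOb \<phi> k) (VHom A L (FOb T k)) (pr X \<phi> (hom_into V X A T L) k \<cdot> t L \<cdot> VId A L)"
      unfolding wlimit_unit_def X_def[symmetric] using un[OF L] by simp
    also have "\<dots> = \<eta> k"
      by (rule arrow_ext[of _ _ "FOb \<phi> k"]) (simp_all add: t_el)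
    finally show ?thesis .
  qed
  ultimately show ?thesis by (rule that)
qed

end

section \<open>Colimits as limits in the opposite category\<close>

lemma mk_vfun_cong:
  assumes "VOb A = VOb A'" "\<And>a. a \<in> VOb A \<Longrightarrow> f a = f' a"
    "\<And>a b. a \<in> VOb A \<Longrightarrow> b \<in> VOb A \<Longrightarrow> h a b = h' a b"
  shows "mk_vfun A f h = mk_vfun A' f' h'"
  unfolding mk_vfun_def using assms by (auto intro!: ext)

text \<open>The two symmetries introduced by \<open>opp\<close> cancel between objects of
  \<open>A\<close>, and \<open>mk_vfun\<close> discards everything else, so these functors are equal
  even though the categories need not be.\<close>

lemma cov_hom_opp_opp:
  assumes A: "vcategory V A" and a: "a \<in> VOb A"
  shows "cov_hom V (opp V (opp V A)) a = cov_hom V A a"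
  unfolding cov_hom_def
  by (rule mk_vfun_cong) (use A a in \<open>simp_all add: opp_def\<close>)

lemma contra_hom_opp:
  assumes "vcategory V A" "a \<in> VOb A"
  shows "contra_hom V (opp V A) a = cov_hom V A a"
  using cov_hom_opp_opp[OF assms] by (simp add: contra_hom_eq)

lemma hom_from_eq: "hom_from V K A S = hom_into V (opp V K) (opp V A) (op_vfun S)"
  by (rule ext) (simp add: hom_from_def hom_into_def contra_hom_eq)

lemma into_Nat_cong:
  "(\<And>a. a \<in> VOb A \<Longrightarrow> \<tau> a = \<tau>' a) \<Longrightarrow> into_Nat V A B F G x \<tau> = into_Nat V A B F G x \<tau>'"
  unfolding into_Nat_def by simp

lemma hom_from_functor_eq:
  assumes S: "vfunctor V K A S"
  shows "hom_from_functor V K A S = hom_into_functor V (opp V K) (opp V A) (op_vfun S)"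
  unfolding hom_from_functor_def hom_into_functor_def hom_from_eq
proof (rule mk_vfun_cong, goal_cases)
  case (3 a b)
  show ?case
    unfolding opp_simps
    by (rule into_Nat_cong) (use vfunctor_vcategory[OF S] vfunctor_typing(1)[OF S] in \<open>simp add: contra_hom_opp\<close>)
qed simp_all

text \<open>After rewriting, the two definitions differ only in \<open>opp V (opp V A)\<close>
  against \<open>A\<close>, and a natural transformation looks only at the objects and hom-objects
  of its source.\<close>

lemma is_wcolimit_eq:
  assumes S: "vfunctor V K A S"
  shows "is_wcolimit V A K \<phi> S C \<theta> \<longleftrightarrow> is_wlimit V (opp V A) K \<phi> (op_vfun S) C \<theta>"
proof (cases "C \<in> VOb A")
  case True
  have "comp_vfun V (opp V (opp V A)) G F = comp_vfun V A G F" for G :: "('x, 'y, 'a) vfun" and F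
    unfolding comp_vfun_def by (rule mk_vfun_cong) simp_all
  then show ?thesis
    unfolding is_wcolimit_def is_wlimit_def hom_from_functor_eq[OF S]
    using True contra_hom_opp[OF vfunctor_vcategory(2)[OF S] True]
    by (simp add: vnat_iso_def vnat_def)
qed (simp add: is_wcolimit_def is_wlimit_def)

lemma wcolimit_unit_eq: "wcolimit_unit V A K \<phi> S C \<theta> = wlimit_unit V (opp V A) K \<phi> (op_vfun S) C \<theta>"
  by (rule ext) (simp add: wcolimit_unit_def wlimit_unit_def hom_from_eq)

lemma comp_op_vfun: "comp_vfun V (opp V K) (op_vfun F) (op_vfun S) = op_vfun (comp_vfun V K F S)"
  unfolding comp_vfun_def mk_vfun_def op_vfun_def by (auto intro!: ext)

lemma preserves_wcolimit_eq:
  assumes S: "vfunctor V K A S" and F: "vfunctor V A A' F"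
  shows "preserves_wcolimit V A A' F K \<phi> S \<longleftrightarrow>
    preserves_wlimit V (opp V A) (opp V A') (op_vfun F) K \<phi> (op_vfun S)"
  unfolding preserves_wcolimit_def preserves_wlimit_def comp_op_vfun wcolimit_unit_eq
    is_wcolimit_eq[OF S] is_wcolimit_eq[OF vfunctor_comp[OF S F]]
  by simp

lemma family_cong: "(\<And>k. k \<in> VOb X \<Longrightarrow> \<sigma> k = \<sigma>' k) \<Longrightarrow> family A X \<phi> T a x \<sigma> = family A X \<phi> T a x \<sigma>'"
  unfolding family_def by simp

lemma wlim_cong:
  assumes "\<And>k. k \<in> VOb X \<Longrightarrow> \<eta> k = \<eta>' k"
  shows "wlim A X \<phi> T L \<eta> \<longleftrightarrow> wlim A X \<phi> T L \<eta>'"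
proof -
  have "cylinder A X \<phi> T L \<eta> = cylinder A X \<phi> T L \<eta>'" using assms by (simp add: cylinder_def)
  moreover have "factors A X \<phi> T L \<eta> a x \<sigma> h = factors A X \<phi> T L \<eta>' a x \<sigma> h" for a x \<sigma> h
    using assms by (simp add: factors_def)
  ultimately show ?thesis by (simp add: wlim_def)
qed

text \<open>Units of representing isomorphisms and universal cylinders are the same thing, so the
  quantifiers over isomorphisms disappear and preservation speaks of cylinders alone.\<close>

lemma preserves_wlimit_iff:
  assumes T: "vfunctor V (opp V K) A T" and \<phi>: "is_weight V K \<phi>" and F: "vfunctor V A A' F"
    and X: "ends_exist (opp V K)"
  shows "preserves_wlimit V A A' F K \<phi> T \<longleftrightarrow>
    (\<forall>L \<eta>. wlim A (opp V K) \<phi> T L \<eta> \<longrightarrow>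
       wlim A' (opp V K) \<phi> (comp_vfun V (opp V K) F T) (FOb F L) (\<lambda>k. FHom F L (FOb T k) \<cdot> \<eta> k))"
    (is "?P \<longleftrightarrow> ?Q")
proof
  note \<phi>' = \<phi>[unfolded is_weight_def]
  note FT = vfunctor_comp[OF T F]
  show ?Q if p: ?P
  proof (intro allI impI)
    fix L \<eta> assume "wlim A (opp V K) \<phi> T L \<eta>"
    from wlim_is_wlimit[OF refl T \<phi>' X this] obtain \<theta>
      where \<theta>: "is_wlimit V A K \<phi> T L \<theta>" "\<And>k. k \<in> VOb K \<Longrightarrow> wlimit_unit V A K \<phi> T L \<theta> k = \<eta> k" by blast
    with p obtain \<theta>' where \<theta>': "is_wlimit V A' K \<phi> (comp_vfun V (opp V K) F T) (FOb F L) \<theta>'"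
      "\<forall>k\<in>VOb K. wlimit_unit V A' K \<phi> (comp_vfun V (opp V K) F T) (FOb F L) \<theta>' k
         = FHom F L (FOb T k) \<cdot> wlimit_unit V A K \<phi> T L \<theta> k"
      unfolding preserves_wlimit_def by blast
    have "wlim A' (opp V K) \<phi> (comp_vfun V (opp V K) F T) (FOb F L)
       (wlimit_unit V A' K \<phi> (comp_vfun V (opp V K) F T) (FOb F L) \<theta>')"
      by (rule is_wlimit_wlim[OF refl FT \<phi>' X \<theta>'(1)])
    then show "wlim A' (opp V K) \<phi> (comp_vfun V (opp V K) F T) (FOb F L) (\<lambda>k. FHom F L (FOb T k) \<cdot> \<eta> k)"
      by (subst wlim_cong[where \<eta>' = "wlimit_unit V A' K \<phi> (comp_vfun V (opp V K) F T) (FOb F L) \<theta>'"]) (use \<theta>(2) \<theta>'(2) in simp_all)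
  qed
  show ?P if q: ?Q
    unfolding preserves_wlimit_def
  proof (intro allI impI)
    fix L \<theta> assume "is_wlimit V A K \<phi> T L \<theta>"
    from is_wlimit_wlim[OF refl T \<phi>' X this] q
    have "wlim A' (opp V K) \<phi> (comp_vfun V (opp V K) F T) (FOb F L) (\<lambda>k. FHom F L (FOb T k) \<cdot> wlimit_unit V A K \<phi> T L \<theta> k)"
      by blast
    then show "\<exists>\<theta>'. is_wlimit V A' K \<phi> (comp_vfun V (opp V K) F T) (FOb F L) \<theta>' \<and>
       (\<forall>k\<in>VOb K. wlimit_unit V A' K \<phi> (comp_vfun V (opp V K) F T) (FOb F L) \<theta>' k = FHom F L (FOb T k) \<cdot> wlimit_unit V A K \<phi> T L \<theta> k)"
    proof (rule wlim_is_wlimit[OF refl FT \<phi>' X])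
      fix \<theta>' assume "is_wlimit V A' K \<phi> (comp_vfun V (opp V K) F T) (FOb F L) \<theta>'"
        "\<And>k. k \<in> VOb K \<Longrightarrow> wlimit_unit V A' K \<phi> (comp_vfun V (opp V K) F T) (FOb F L) \<theta>' k = FHom F L (FOb T k) \<cdot> wlimit_unit V A K \<phi> T L \<theta> k"
      then show ?thesis by (intro exI[of _ \<theta>'] conjI ballI)
    qed
  qed
qed

section \<open>Weighted colimits in the base\<close>

lemma ex1_transfer:
  assumes "\<And>h. P h \<Longrightarrow> Q (f h) \<and> g (f h) = h" "\<And>k. Q k \<Longrightarrow> P (g k) \<and> f (g k) = k"
  shows "(\<exists>!h. P h) \<longleftrightarrow> (\<exists>!k. Q k)"
  using assms by metis

lemma transp_eval:
  assumes "h \<in> Arr V" "Dom V h = x" "Cod V h = ihom V y z" "y \<in> Ob V" "z \<in> Ob V"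
  shows "transp V x y z (ev V y z \<cdot> (h \<otimes> \<one> y)) = h"
proof -
  have "x \<in> Ob V" using assms by auto
  then show ?thesis using assms by - (rule app_transp_ext[of _ _ x y z], simp_all)
qed

lemma ectx_add_right_comm: "a \<sharp> b \<Longrightarrow> m ++ ectx b ++ ectx a = m ++ ectx a ++ ectx b"
  using ectx_add_comm[of a b] by (metis map_add_assoc)

lemmas ectx_ac = ectx_add_comm ectx_add_right_comm

text \<open>
  In \<open>V\<close> a colimit cocone \<open>\<phi> b \<rightarrow> [S b, C]\<close> is transposed to \<open>\<phi> b \<otimes> S b \<rightarrow> C\<close>.
\<close>

definition balanced where
  "balanced B \<phi> S x y \<sigma> \<longleftrightarrow>
    (\<forall>b\<in>VOb B. \<sigma> b \<in> Arr V \<and> Dom V (\<sigma> b) = (x \<odot> FOb \<phi> b) \<odot> FOb S b \<and> Cod V (\<sigma> b) = y) \<and>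
    (\<forall>b\<in>VOb B. \<forall>c\<in>VOb B. \<forall>e q f s. el e \<and> ty e = x \<and> el q \<and> ty q = FOb \<phi> c \<and> el f \<and> ty f = VHom B b c \<and>
       el s \<and> ty s = FOb S b \<and> e \<sharp> q \<and> q \<sharp> e \<and> e \<sharp> f \<and> f \<sharp> e \<and> e \<sharp> s \<and> s \<sharp> e \<and> q \<sharp> f \<and> f \<sharp> q \<and> q \<sharp> s \<and> s \<sharp> q \<and> f \<sharp> s \<and> s \<sharp> f \<longrightarrow>
       \<sigma> b \<bullet> \<langle>\<langle>e, act \<phi> c b f q\<rangle>, s\<rangle>
       = \<sigma> c \<bullet> \<langle>\<langle>e, q\<rangle>, act S b c f s\<rangle>)"

lemma balancedI:
  assumes "\<And>b. b \<in> VOb B \<Longrightarrow> \<sigma> b \<in> Arr V" "\<And>b. b \<in> VOb B \<Longrightarrow> Dom V (\<sigma> b) = (x \<odot> FOb \<phi> b) \<odot> FOb S b"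
    "\<And>b. b \<in> VOb B \<Longrightarrow> Cod V (\<sigma> b) = y"
    and "\<And>b c e q f s. \<lbrakk>b \<in> VOb B; c \<in> VOb B; el e; ty e = x; el q; ty q = FOb \<phi> c; el f; ty f = VHom B b c;
       el s; ty s = FOb S b; e \<sharp> q; q \<sharp> e; e \<sharp> f; f \<sharp> e; e \<sharp> s; s \<sharp> e; q \<sharp> f; f \<sharp> q; q \<sharp> s; s \<sharp> q; f \<sharp> s; s \<sharp> f\<rbrakk> \<Longrightarrow>
       \<sigma> b \<bullet> \<langle>\<langle>e, act \<phi> c b f q\<rangle>, s\<rangle>
       = \<sigma> c \<bullet> \<langle>\<langle>e, q\<rangle>, act S b c f s\<rangle>"
  shows "balanced B \<phi> S x y \<sigma>"
  unfolding balanced_def using assms by simp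

lemma balancedD:
  assumes "balanced B \<phi> S x y \<sigma>" "b \<in> VOb B"
  shows "\<sigma> b \<in> Arr V" "Dom V (\<sigma> b) = (x \<odot> FOb \<phi> b) \<odot> FOb S b" "Cod V (\<sigma> b) = y"
    and "\<lbrakk>c \<in> VOb B; el e; ty e = x; el q; ty q = FOb \<phi> c; el f; ty f = VHom B b c;
       el s; ty s = FOb S b; e \<sharp> q; e \<sharp> f; e \<sharp> s; q \<sharp> f; q \<sharp> s; f \<sharp> s\<rbrakk> \<Longrightarrow>
       \<sigma> b \<bullet> \<langle>\<langle>e, act \<phi> c b f q\<rangle>, s\<rangle>
       = \<sigma> c \<bullet> \<langle>\<langle>e, q\<rangle>, act S b c f s\<rangle>"
  using assms apart_sym[of e q] apart_sym[of e f] apart_sym[of e s] apart_sym[of q f] apart_sym[of q s] apart_sym[of f s]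
  by (simp_all add: balanced_def)

text \<open>The counterpart of \<open>factors\<close>, with an arrow from \<open>x\<close> into
  \<open>[C,y]\<close> uncurried to one out of \<open>x \<odot> C\<close>.\<close>

definition extends where
  "extends B \<phi> S C \<beta> x y \<sigma> h \<longleftrightarrow> h \<in> Arr V \<and> Dom V h = x \<odot> C \<and> Cod V h = y \<and>
    (\<forall>b\<in>VOb B. \<forall>e q s. el e \<and> ty e = x \<and> el q \<and> ty q = FOb \<phi> b \<and> el s \<and> ty s = FOb S b \<and>
       e \<sharp> q \<and> q \<sharp> e \<and> e \<sharp> s \<and> s \<sharp> e \<and> q \<sharp> s \<and> s \<sharp> q \<longrightarrow>
       h \<bullet> \<langle>e, \<beta> b \<bullet> \<langle>q, s\<rangle>\<rangle> = \<sigma> b \<bullet> \<langle>\<langle>e, q\<rangle>, s\<rangle>)"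

lemma extendsI:
  assumes "h \<in> Arr V" "Dom V h = x \<odot> C" "Cod V h = y"
    and "\<And>b e q s. \<lbrakk>b \<in> VOb B; el e; ty e = x; el q; ty q = FOb \<phi> b; el s; ty s = FOb S b;
       e \<sharp> q; q \<sharp> e; e \<sharp> s; s \<sharp> e; q \<sharp> s; s \<sharp> q\<rbrakk> \<Longrightarrow> h \<bullet> \<langle>e, \<beta> b \<bullet> \<langle>q, s\<rangle>\<rangle> = \<sigma> b \<bullet> \<langle>\<langle>e, q\<rangle>, s\<rangle>"
  shows "extends B \<phi> S C \<beta> x y \<sigma> h"
  unfolding extends_def using assms by simp

lemma extendsD:
  assumes "extends B \<phi> S C \<beta> x y \<sigma> h"
  shows "h \<in> Arr V" "Dom V h = x \<odot> C" "Cod V h = y"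
    and "\<lbrakk>b \<in> VOb B; el e; ty e = x; el q; ty q = FOb \<phi> b; el s; ty s = FOb S b;
       e \<sharp> q; e \<sharp> s; q \<sharp> s\<rbrakk> \<Longrightarrow> h \<bullet> \<langle>e, \<beta> b \<bullet> \<langle>q, s\<rangle>\<rangle> = \<sigma> b \<bullet> \<langle>\<langle>e, q\<rangle>, s\<rangle>"
  using assms apart_sym[of e q] apart_sym[of e s] apart_sym[of q s] by (simp_all add: extends_def)

text \<open>The relation defining a tensor product over \<open>B\<close>: an arrow of
  \<open>B\<close> may be moved from one factor to the other.\<close>

definition cobalanced where
  "cobalanced B \<phi> S C \<beta> \<longleftrightarrow> C \<in> Ob V \<and>
    (\<forall>b\<in>VOb B. \<beta> b \<in> Arr V \<and> Dom V (\<beta> b) = FOb \<phi> b \<odot> FOb S b \<and> Cod V (\<beta> b) = C) \<and>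
    (\<forall>b\<in>VOb B. \<forall>c\<in>VOb B. \<forall>q f s. el q \<and> ty q = FOb \<phi> c \<and> el f \<and> ty f = VHom B b c \<and>
       el s \<and> ty s = FOb S b \<and> q \<sharp> f \<and> f \<sharp> q \<and> q \<sharp> s \<and> s \<sharp> q \<and> f \<sharp> s \<and> s \<sharp> f \<longrightarrow>
       \<beta> b \<bullet> \<langle>ev V (FOb \<phi> c) (FOb \<phi> b) \<bullet> \<langle>FHom \<phi> c b \<bullet> f, q\<rangle>, s\<rangle>
       = \<beta> c \<bullet> \<langle>q, act S b c f s\<rangle>)"

lemma cobalancedI:
  assumes "C \<in> Ob V" "\<And>b. b \<in> VOb B \<Longrightarrow> \<beta> b \<in> Arr V" "\<And>b. b \<in> VOb B \<Longrightarrow> Dom V (\<beta> b) = FOb \<phi> b \<odot> FOb S b"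
    "\<And>b. b \<in> VOb B \<Longrightarrow> Cod V (\<beta> b) = C"
    and "\<And>b c q f s. \<lbrakk>b \<in> VOb B; c \<in> VOb B; el q; ty q = FOb \<phi> c; el f; ty f = VHom B b c;
       el s; ty s = FOb S b; q \<sharp> f; f \<sharp> q; q \<sharp> s; s \<sharp> q; f \<sharp> s; s \<sharp> f\<rbrakk> \<Longrightarrow>
       \<beta> b \<bullet> \<langle>ev V (FOb \<phi> c) (FOb \<phi> b) \<bullet> \<langle>FHom \<phi> c b \<bullet> f, q\<rangle>, s\<rangle>
       = \<beta> c \<bullet> \<langle>q, act S b c f s\<rangle>"
  shows "cobalanced B \<phi> S C \<beta>"
  unfolding cobalanced_def using assms by simp

lemma cobalancedD:
  assumes "cobalanced B \<phi> S C \<beta>"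
  shows "C \<in> Ob V" and "b \<in> VOb B \<Longrightarrow> \<beta> b \<in> Arr V" "b \<in> VOb B \<Longrightarrow> Dom V (\<beta> b) = FOb \<phi> b \<odot> FOb S b"
    "b \<in> VOb B \<Longrightarrow> Cod V (\<beta> b) = C"
    and "\<lbrakk>b \<in> VOb B; c \<in> VOb B; el q; ty q = FOb \<phi> c; el f; ty f = VHom B b c;
       el s; ty s = FOb S b; q \<sharp> f; q \<sharp> s; f \<sharp> s\<rbrakk> \<Longrightarrow>
       \<beta> b \<bullet> \<langle>ev V (FOb \<phi> c) (FOb \<phi> b) \<bullet> \<langle>FHom \<phi> c b \<bullet> f, q\<rangle>, s\<rangle>
       = \<beta> c \<bullet> \<langle>q, act S b c f s\<rangle>"
  using assms apart_sym[of q f] apart_sym[of q s] apart_sym[of f s] by (simp_all add: cobalanced_def)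

text \<open>\<phi> * S in the form of a coend; the context \<open>x\<close> makes its universal
  property the enriched one.\<close>

definition colim where
  "colim B \<phi> S C \<beta> \<longleftrightarrow> cobalanced B \<phi> S C \<beta> \<and>
    (\<forall>x\<in>Ob V. \<forall>y\<in>Ob V. \<forall>\<sigma>. balanced B \<phi> S x y \<sigma> \<longrightarrow> (\<exists>!h. extends B \<phi> S C \<beta> x y \<sigma> h))"

lemma weight_typing:
  assumes \<phi>: "vfunctor V (opp V B) VV \<phi>" and "b \<in> VOb B"
  shows "FOb \<phi> b \<in> Ob V"
  and "c \<in> VOb B \<Longrightarrow> FHom \<phi> b c \<in> Arr V"
  and "c \<in> VOb B \<Longrightarrow> Dom V (FHom \<phi> b c) = VHom B c b"
  and "c \<in> VOb B \<Longrightarrow> Cod V (FHom \<phi> b c) = ihom V (FOb \<phi> b) (FOb \<phi> c)"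
  using vfunctor_rules(1-4)[OF \<phi>] assms(2) by simp_all

context
  fixes B :: "('b, 'o, 'a) vcat" and \<phi> S :: "('b, 'o, 'a) vfun"
  assumes B: "vcategory V B" and \<phi>: "vfunctor V (opp V B) VV \<phi>" and S: "vfunctor V B VV S"
begin

lemmas weight_rules = B weight_typing[OF \<phi>] vfunctor_rules[OF S] vfunctor_self_Ob[OF S]

text \<open>In \<open>opp V VV\<close> an arrow from \<open>y\<close> to \<open>S b\<close> is an
  element of \<open>[S b, y]\<close>; evaluating it on \<open>s\<close> uncurries the family, and
  naturality becomes the balancing condition.\<close>

lemma family_iff_balanced:
  assumes [simp]: "x \<in> Ob V" "y \<in> Ob V"
    and \<sigma> [simp]: "\<And>b. b \<in> VOb B \<Longrightarrow> \<sigma> b \<in> Arr V" "\<And>b. b \<in> VOb B \<Longrightarrow> Dom V (\<sigma> b) = (x \<odot> FOb \<phi> b) \<odot> FOb S b"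
      "\<And>b. b \<in> VOb B \<Longrightarrow> Cod V (\<sigma> b) = y"
  shows "family (opp V VV) (opp V B) \<phi> (op_vfun S) y x (\<lambda>b. transp V (x \<odot> FOb \<phi> b) (FOb S b) y (\<sigma> b))
    \<longleftrightarrow> balanced B \<phi> S x y \<sigma>"
proof
  note [simp] = weight_rules
  let ?t = "\<lambda>b. transp V (x \<odot> FOb \<phi> b) (FOb S b) y (\<sigma> b)"
  show "balanced B \<phi> S x y \<sigma>" if fa: "family (opp V VV) (opp V B) \<phi> (op_vfun S) y x ?t"
  proof (rule balancedI)
    fix b c e q f s
    assume [simp]: "b \<in> VOb B" "c \<in> VOb B" "el e" "ty e = x" "el q" "ty q = FOb \<phi> c" "el f" "ty f = VHom B b c"
     "el s" "ty s = FOb S b" "e \<sharp> q" "q \<sharp> e" "e \<sharp> f" "f \<sharp> e" "e \<sharp> s" "s \<sharp> e" "q \<sharp> f" "f \<sharp> q" "q \<sharp> s" "s \<sharp> q" "f \<sharp> s" "s \<sharp> f"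
    have "?t b \<bullet> \<langle>e, act \<phi> c b f q\<rangle> = cmp VV (FOb S b) (FOb S c) y (?t c \<bullet> \<langle>e, q\<rangle>) (FHom S b c \<bullet> f)"
      using familyD(4)[OF fa, of c b e f q] by simp
    then have "evl (FOb S b) y (?t b \<bullet> \<langle>e, act \<phi> c b f q\<rangle>) s
      = evl (FOb S b) y (cmp VV (FOb S b) (FOb S c) y (?t c \<bullet> \<langle>e, q\<rangle>) (FHom S b c \<bullet> f)) s"
      by (rule arg_cong)
    then show "\<sigma> b \<bullet> \<langle>\<langle>e, act \<phi> c b f q\<rangle>, s\<rangle>
       = \<sigma> c \<bullet> \<langle>\<langle>e, q\<rangle>, act S b c f s\<rangle>"
      by simp
  qed simp_all
  show "family (opp V VV) (opp V B) \<phi> (op_vfun S) y x ?t" if b: "balanced B \<phi> S x y \<sigma>"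
  proof (rule familyI)
    fix k l e u p
    assume "k \<in> VOb (opp V B)" "l \<in> VOb (opp V B)" "el e" "ty e = x" "el u" "ty u = VHom (opp V B) k l" "el p" "ty p = FOb \<phi> k"
     "e \<sharp> u" "u \<sharp> e" "e \<sharp> p" "p \<sharp> e" "u \<sharp> p" "p \<sharp> u"
    then have [simp]: "k \<in> VOb B" "l \<in> VOb B" "el e" "ty e = x" "el u" "ty u = VHom B l k" "el p" "ty p = FOb \<phi> k"
     "e \<sharp> u" "u \<sharp> e" "e \<sharp> p" "p \<sharp> e" "u \<sharp> p" "p \<sharp> u" by simp_all
    have "?t l \<bullet> \<langle>e, act \<phi> k l u p\<rangle> = cmp VV (FOb S l) (FOb S k) y (?t k \<bullet> \<langle>e, p\<rangle>) (FHom S l k \<bullet> u)"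
      by (rule eval_ext[of _ "FOb S l" y]) (simp_all add: ectx_ac balancedD(4)[OF b])
    then show "?t l \<bullet> \<langle>e, act \<phi> k l u p\<rangle>
      = cmp (opp V VV) y (FOb (op_vfun S) k) (FOb (op_vfun S) l) (FHom (op_vfun S) k l \<bullet> u) (?t k \<bullet> \<langle>e, p\<rangle>)" by simp
  qed simp_all
qed

lemma factors_iff_extends:
  assumes [simp]: "x \<in> Ob V" "y \<in> Ob V" "C \<in> Ob V"
    and \<sigma> [simp]: "\<And>b. b \<in> VOb B \<Longrightarrow> \<sigma> b \<in> Arr V" "\<And>b. b \<in> VOb B \<Longrightarrow> Dom V (\<sigma> b) = (x \<odot> FOb \<phi> b) \<odot> FOb S b"
      "\<And>b. b \<in> VOb B \<Longrightarrow> Cod V (\<sigma> b) = y"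
    and \<beta> [simp]: "\<And>b. b \<in> VOb B \<Longrightarrow> \<beta> b \<in> Arr V" "\<And>b. b \<in> VOb B \<Longrightarrow> Dom V (\<beta> b) = FOb \<phi> b \<odot> FOb S b"
      "\<And>b. b \<in> VOb B \<Longrightarrow> Cod V (\<beta> b) = C"
    and h [simp]: "h \<in> Arr V" "Dom V h = x \<odot> C" "Cod V h = y"
  shows "factors (opp V VV) (opp V B) \<phi> (op_vfun S) C (\<lambda>b. transp V (FOb \<phi> b) (FOb S b) C (\<beta> b)) y x
      (\<lambda>b. transp V (x \<odot> FOb \<phi> b) (FOb S b) y (\<sigma> b)) (transp V x C y h)
    \<longleftrightarrow> extends B \<phi> S C \<beta> x y \<sigma> h"
proof
  note [simp] = weight_rules
  let ?t = "\<lambda>b. transp V (x \<odot> FOb \<phi> b) (FOb S b) y (\<sigma> b)" and ?\<eta> = "\<lambda>b. transp V (FOb \<phi> b) (FOb S b) C (\<beta> b)"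
    and ?h = "transp V x C y h"
  show "extends B \<phi> S C \<beta> x y \<sigma> h" if fa: "factors (opp V VV) (opp V B) \<phi> (op_vfun S) C ?\<eta> y x ?t ?h"
  proof (rule extendsI)
    fix b e q s
    assume [simp]: "b \<in> VOb B" "el e" "ty e = x" "el q" "ty q = FOb \<phi> b" "el s" "ty s = FOb S b"
      "e \<sharp> q" "q \<sharp> e" "e \<sharp> s" "s \<sharp> e" "q \<sharp> s" "s \<sharp> q"
    have "cmp VV (FOb S b) C y (?h \<bullet> e) (?\<eta> b \<bullet> q) = ?t b \<bullet> \<langle>e, q\<rangle>"
      using factorsD(4)[OF fa, of b e q] by simp
    then have "evl (FOb S b) y (cmp VV (FOb S b) C y (?h \<bullet> e) (?\<eta> b \<bullet> q)) s = evl (FOb S b) y (?t b \<bullet> \<langle>e, q\<rangle>) s"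
      by (rule arg_cong)
    then show "h \<bullet> \<langle>e, \<beta> b \<bullet> \<langle>q, s\<rangle>\<rangle> = \<sigma> b \<bullet> \<langle>\<langle>e, q\<rangle>, s\<rangle>" by simp
  qed simp_all
  show "factors (opp V VV) (opp V B) \<phi> (op_vfun S) C ?\<eta> y x ?t ?h" if ex: "extends B \<phi> S C \<beta> x y \<sigma> h"
  proof (rule factorsI)
    fix k e p assume "k \<in> VOb (opp V B)" "el e" "ty e = x" "el p" "ty p = FOb \<phi> k" "e \<sharp> p" "p \<sharp> e"
    then have [simp]: "k \<in> VOb B" "el e" "ty e = x" "el p" "ty p = FOb \<phi> k" "e \<sharp> p" "p \<sharp> e" by simp_all
    have "cmp VV (FOb S k) C y (?h \<bullet> e) (?\<eta> k \<bullet> p) = ?t k \<bullet> \<langle>e, p\<rangle>"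
      by (rule eval_ext[of _ "FOb S k" y]) (simp_all add: extendsD(4)[OF ex])
    then show "cmp (opp V VV) y C (FOb (op_vfun S) k) (?\<eta> k \<bullet> p) (?h \<bullet> e) = ?t k \<bullet> \<langle>e, p\<rangle>"
      by simp
  qed simp_all
qed

lemma cylinder_iff_cobalanced:
  assumes C [simp]: "C \<in> Ob V"
    and \<beta> [simp]: "\<And>b. b \<in> VOb B \<Longrightarrow> \<beta> b \<in> Arr V" "\<And>b. b \<in> VOb B \<Longrightarrow> Dom V (\<beta> b) = FOb \<phi> b \<odot> FOb S b"
      "\<And>b. b \<in> VOb B \<Longrightarrow> Cod V (\<beta> b) = C"
  shows "cylinder (opp V VV) (opp V B) \<phi> (op_vfun S) C (\<lambda>b. transp V (FOb \<phi> b) (FOb S b) C (\<beta> b)) \<longleftrightarrow> cobalanced B \<phi> S C \<beta>"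
proof
  note [simp] = weight_rules
  let ?\<eta> = "\<lambda>b. transp V (FOb \<phi> b) (FOb S b) C (\<beta> b)"
  show "cobalanced B \<phi> S C \<beta>" if cy: "cylinder (opp V VV) (opp V B) \<phi> (op_vfun S) C ?\<eta>"
  proof (rule cobalancedI)
    fix b c q f s
    assume [simp]: "b \<in> VOb B" "c \<in> VOb B" "el q" "ty q = FOb \<phi> c" "el f" "ty f = VHom B b c"
     "el s" "ty s = FOb S b" "q \<sharp> f" "f \<sharp> q" "q \<sharp> s" "s \<sharp> q" "f \<sharp> s" "s \<sharp> f"
    have "?\<eta> b \<bullet> act \<phi> c b f q = cmp VV (FOb S b) (FOb S c) C (?\<eta> c \<bullet> q) (FHom S b c \<bullet> f)"
      using cylinderD(4)[OF cy, of c b f q] by simp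
    then have "evl (FOb S b) C (?\<eta> b \<bullet> act \<phi> c b f q) s
      = evl (FOb S b) C (cmp VV (FOb S b) (FOb S c) C (?\<eta> c \<bullet> q) (FHom S b c \<bullet> f)) s"
      by (rule arg_cong)
    then show "\<beta> b \<bullet> \<langle>ev V (FOb \<phi> c) (FOb \<phi> b) \<bullet> \<langle>FHom \<phi> c b \<bullet> f, q\<rangle>, s\<rangle>
       = \<beta> c \<bullet> \<langle>q, act S b c f s\<rangle>" by simp
  qed simp_all
  show "cylinder (opp V VV) (opp V B) \<phi> (op_vfun S) C ?\<eta>" if cb: "cobalanced B \<phi> S C \<beta>"
  proof (rule cylinderI)
    fix k l u p
    assume "k \<in> VOb (opp V B)" "l \<in> VOb (opp V B)" "el u" "ty u = VHom (opp V B) k l" "el p" "ty p = FOb \<phi> k" "u \<sharp> p" "p \<sharp> u"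
    then have [simp]: "k \<in> VOb B" "l \<in> VOb B" "el u" "ty u = VHom B l k" "el p" "ty p = FOb \<phi> k" "u \<sharp> p" "p \<sharp> u" by simp_all
    have "?\<eta> l \<bullet> act \<phi> k l u p = cmp VV (FOb S l) (FOb S k) C (?\<eta> k \<bullet> p) (FHom S l k \<bullet> u)"
      by (rule eval_ext[of _ "FOb S l" C]) (simp_all add: ectx_ac cobalancedD(5)[OF cb])
    then show "?\<eta> l \<bullet> act \<phi> k l u p
      = cmp (opp V VV) C (FOb (op_vfun S) k) (FOb (op_vfun S) l) (FHom (op_vfun S) k l \<bullet> u) (?\<eta> k \<bullet> p)" by simp
  qed simp_all
qed

text \<open>Transposition matches families with balanced families and factorisations with
  extensions. Both correspondences are bijective, so unique existence carries over.\<close>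

lemma wlim_iff_colim:
  assumes \<beta> [simp]: "\<And>b. b \<in> VOb B \<Longrightarrow> \<beta> b \<in> Arr V" "\<And>b. b \<in> VOb B \<Longrightarrow> Dom V (\<beta> b) = FOb \<phi> b \<odot> FOb S b"
      "\<And>b. b \<in> VOb B \<Longrightarrow> Cod V (\<beta> b) = C"
  shows "wlim (opp V VV) (opp V B) \<phi> (op_vfun S) C (\<lambda>b. transp V (FOb \<phi> b) (FOb S b) C (\<beta> b)) \<longleftrightarrow> colim B \<phi> S C \<beta>"
    (is "?W \<longleftrightarrow> _")
proof (cases "C \<in> Ob V")
  case C [simp]: True
  note [simp] = weight_rules
  let ?\<eta> = "\<lambda>b. transp V (FOb \<phi> b) (FOb S b) C (\<beta> b)"
  let ?t = "\<lambda>x y \<sigma> b. transp V (x \<odot> FOb \<phi> b) (FOb S b) y (\<sigma> b)"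
  have ex1: "(\<exists>!h. factors (opp V VV) (opp V B) \<phi> (op_vfun S) C ?\<eta> y x (?t x y \<sigma>) h) \<longleftrightarrow> (\<exists>!h. extends B \<phi> S C \<beta> x y \<sigma> h)"
    if [simp]: "x \<in> Ob V" "y \<in> Ob V" and \<sigma>: "\<And>b. b \<in> VOb B \<Longrightarrow> \<sigma> b \<in> Arr V" "\<And>b. b \<in> VOb B \<Longrightarrow> Dom V (\<sigma> b) = (x \<odot> FOb \<phi> b) \<odot> FOb S b"
      "\<And>b. b \<in> VOb B \<Longrightarrow> Cod V (\<sigma> b) = y" for x y \<sigma>
  proof -
    have iff: "factors (opp V VV) (opp V B) \<phi> (op_vfun S) C ?\<eta> y x (?t x y \<sigma>) (transp V x C y k) \<longleftrightarrow> extends B \<phi> S C \<beta> x y \<sigma> k"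
      if "k \<in> Arr V" "Dom V k = x \<odot> C" "Cod V k = y" for k
      by (rule factors_iff_extends) (use \<sigma> that in simp_all)
    have 1: "extends B \<phi> S C \<beta> x y \<sigma> (ev V C y \<cdot> (h \<otimes> \<one> C)) \<and> transp V x C y (ev V C y \<cdot> (h \<otimes> \<one> C)) = h"
      if h: "factors (opp V VV) (opp V B) \<phi> (op_vfun S) C ?\<eta> y x (?t x y \<sigma>) h" for h
    proof -
      have [simp]: "h \<in> Arr V" "Dom V h = x" "Cod V h = ihom V C y" using factorsD(1-3)[OF h] by simp_all
      have e: "transp V x C y (ev V C y \<cdot> (h \<otimes> \<one> C)) = h" by (rule transp_eval) simp_all
      show ?thesis using iff[of "ev V C y \<cdot> (h \<otimes> \<one> C)"] h unfolding e by simp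
    qed
    have 2: "factors (opp V VV) (opp V B) \<phi> (op_vfun S) C ?\<eta> y x (?t x y \<sigma>) (transp V x C y h) \<and> ev V C y \<cdot> (transp V x C y h \<otimes> \<one> C) = h"
      if h: "extends B \<phi> S C \<beta> x y \<sigma> h" for h
      using h extendsD(1-3)[OF h] by (simp add: iff)
    show ?thesis by (rule ex1_transfer[OF 1 2])
  qed
  show ?thesis
  proof
    assume w: ?W
    show "colim B \<phi> S C \<beta>"
      unfolding colim_def
    proof (intro conjI ballI allI impI)
      show "cobalanced B \<phi> S C \<beta>" using wlimD(2)[OF w] by (simp add: cylinder_iff_cobalanced)
      fix x y \<sigma> assume xy [simp]: "x \<in> Ob V" "y \<in> Ob V" and b: "balanced B \<phi> S x y \<sigma>"
      note \<sigma> = balancedD(1-3)[OF b]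
      have "family (opp V VV) (opp V B) \<phi> (op_vfun S) y x (?t x y \<sigma>)" using b \<sigma> by (simp add: family_iff_balanced)
      then have "\<exists>!h. factors (opp V VV) (opp V B) \<phi> (op_vfun S) C ?\<eta> y x (?t x y \<sigma>) h"
        by (intro wlimD(3)[OF w]) simp_all
      then show "\<exists>!h. extends B \<phi> S C \<beta> x y \<sigma> h"
        by (subst (asm) ex1) (use \<sigma> in simp_all)
    qed
  next
    assume c: "colim B \<phi> S C \<beta>"
    show ?W
      unfolding wlim_def
    proof (intro conjI ballI allI impI)
      show "C \<in> VOb (opp V VV)" by simp
      show "cylinder (opp V VV) (opp V B) \<phi> (op_vfun S) C ?\<eta>" using c by (simp add: cylinder_iff_cobalanced colim_def)
      fix y x \<sigma> assume "y \<in> VOb (opp V VV)" and xx: "x \<in> Ob V" and fa: "family (opp V VV) (opp V B) \<phi> (op_vfun S) y x \<sigma>"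
      then have yy: "y \<in> Ob V" by simp
      note [simp] = xx yy
      have [simp]: "\<sigma> b \<in> Arr V" "Dom V (\<sigma> b) = x \<odot> FOb \<phi> b" "Cod V (\<sigma> b) = ihom V (FOb S b) y" if "b \<in> VOb B" for b
        using familyD(1-3)[OF fa, of b] that by simp_all
      let ?s = "\<lambda>b. ev V (FOb S b) y \<cdot> (\<sigma> b \<otimes> \<one> (FOb S b))"
      have s: "\<And>b. b \<in> VOb B \<Longrightarrow> ?s b \<in> Arr V" "\<And>b. b \<in> VOb B \<Longrightarrow> Dom V (?s b) = (x \<odot> FOb \<phi> b) \<odot> FOb S b"
        "\<And>b. b \<in> VOb B \<Longrightarrow> Cod V (?s b) = y" by simp_all
      have e: "?t x y ?s b = \<sigma> b" if "b \<in> VOb B" for b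
        using that by (intro transp_eval) simp_all
      have "family (opp V VV) (opp V B) \<phi> (op_vfun S) y x (?t x y ?s)"
        by (subst family_cong[where \<sigma>' = \<sigma>]) (use fa e in simp_all)
      then have "balanced B \<phi> S x y ?s" using family_iff_balanced[OF xx yy s] by simp
      then have "\<exists>!h. extends B \<phi> S C \<beta> x y ?s h" using c by (simp add: colim_def)
      then have "\<exists>!h. factors (opp V VV) (opp V B) \<phi> (op_vfun S) C ?\<eta> y x (?t x y ?s) h"
        by (subst ex1) simp_all
      moreover have "factors (opp V VV) (opp V B) \<phi> (op_vfun S) C ?\<eta> y x (?t x y ?s) = factors (opp V VV) (opp V B) \<phi> (op_vfun S) C ?\<eta> y x \<sigma>"
        unfolding factors_def by (rule ext) (simp add: e)
      ultimately show "\<exists>!h. factors (opp V VV) (opp V B) \<phi> (op_vfun S) C ?\<eta> y x \<sigma> h" by simp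
    qed
  qed
qed (auto simp: wlim_def colim_def cobalanced_def)

lemma wlim_colim:
  assumes w: "wlim (opp V VV) (opp V B) \<phi> (op_vfun S) C \<eta>"
  shows "colim B \<phi> S C (\<lambda>b. ev V (FOb S b) C \<cdot> (\<eta> b \<otimes> \<one> (FOb S b)))"
proof -
  note [simp] = weight_rules
  have [simp]: "C \<in> Ob V" using wlimD(1)[OF w] by simp
  have [simp]: "\<eta> b \<in> Arr V" "Dom V (\<eta> b) = FOb \<phi> b" "Cod V (\<eta> b) = ihom V (FOb S b) C" if "b \<in> VOb B" for b
    using cylinderD(1-3)[OF wlimD(2)[OF w], of b] that by simp_all
  have "transp V (FOb \<phi> b) (FOb S b) C (ev V (FOb S b) C \<cdot> (\<eta> b \<otimes> \<one> (FOb S b))) = \<eta> b" if "b \<in> VOb B" for b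
    using that by (intro transp_eval) simp_all
  then have "wlim (opp V VV) (opp V B) \<phi> (op_vfun S) C (\<lambda>b. transp V (FOb \<phi> b) (FOb S b) C (ev V (FOb S b) C \<cdot> (\<eta> b \<otimes> \<one> (FOb S b))))"
    by (subst wlim_cong[where \<eta>' = \<eta>]) (use w in simp_all)
  then show ?thesis by (subst (asm) wlim_iff_colim) simp_all
qed

end

lemma colimD:
  assumes "colim B \<phi> S C \<beta>"
  shows "cobalanced B \<phi> S C \<beta>"
    and "\<lbrakk>x \<in> Ob V; y \<in> Ob V; balanced B \<phi> S x y \<sigma>\<rbrakk> \<Longrightarrow> \<exists>h. extends B \<phi> S C \<beta> x y \<sigma> h"
  using assms unfolding colim_def by blast+

lemma arrow_ext3_right:
  assumes "f \<in> Arr V" "g \<in> Arr V" "Dom V f = x \<odot> (y \<odot> z)" "Dom V g = x \<odot> (y \<odot> z)"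
    and [simp]: "x \<in> Ob V" "y \<in> Ob V" "z \<in> Ob V"
    and eq: "\<And>a b c. \<lbrakk>el a; ty a = x; el b; ty b = y; el c; ty c = z;
      a \<sharp> b; b \<sharp> a; a \<sharp> c; c \<sharp> a; b \<sharp> c; c \<sharp> b\<rbrakk> \<Longrightarrow> f \<bullet> \<langle>a, \<langle>b, c\<rangle>\<rangle> = g \<bullet> \<langle>a, \<langle>b, c\<rangle>\<rangle>"
  shows "f = g"
proof -
  have "f \<cdot> assoc V x y z = g \<cdot> assoc V x y z"
    by (rule arrow_ext3[of _ _ x y z]) (use assms in simp_all)
  then show ?thesis by - (rule assoc_cancel_right[of x y z], use assms in simp_all)
qed

lemma arrow_ext22:
  assumes "f \<in> Arr V" "g \<in> Arr V" "Dom V f = (x \<odot> y) \<odot> (z \<odot> w)" "Dom V g = (x \<odot> y) \<odot> (z \<odot> w)"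
    and [simp]: "x \<in> Ob V" "y \<in> Ob V" "z \<in> Ob V" "w \<in> Ob V"
    and eq: "\<And>a b c d. \<lbrakk>el a; ty a = x; el b; ty b = y; el c; ty c = z; el d; ty d = w;
      a \<sharp> b; b \<sharp> a; a \<sharp> c; c \<sharp> a; b \<sharp> c; c \<sharp> b; a \<sharp> d; d \<sharp> a; b \<sharp> d; d \<sharp> b; c \<sharp> d; d \<sharp> c\<rbrakk>
      \<Longrightarrow> f \<bullet> \<langle>\<langle>a, b\<rangle>, \<langle>c, d\<rangle>\<rangle> = g \<bullet> \<langle>\<langle>a, b\<rangle>, \<langle>c, d\<rangle>\<rangle>"
  shows "f = g"
proof -
  have "f \<cdot> assoc V (x \<odot> y) z w = g \<cdot> assoc V (x \<odot> y) z w"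
    by (rule arrow_ext4[of _ _ x y z w]) (use assms in simp_all)
  then show ?thesis by - (rule assoc_cancel_right[of "x \<odot> y" z w], use assms in simp_all)
qed

text \<open>Both arrows extend the same balanced family, the one obtained by composing
  \<open>h'\<close> with the coprojections.\<close>

lemma colim_cancel:
  assumes \<phi>: "vfunctor V (opp V B) VV \<phi>" and S: "vfunctor V B VV S"
    and c: "colim B \<phi> S C \<beta>" and x [simp]: "x \<in> Ob V"
    and h [simp]: "h \<in> Arr V" "Dom V h = x \<odot> C" and h' [simp]: "h' \<in> Arr V" "Dom V h' = x \<odot> C" "Cod V h = Cod V h'"
    and eq: "\<And>b. b \<in> VOb B \<Longrightarrow> h \<cdot> (\<one> x \<otimes> \<beta> b) = h' \<cdot> (\<one> x \<otimes> \<beta> b)"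
  shows "h = h'"
proof -
  note [simp] = weight_rules[OF vfunctor_vcategory(1)[OF S] \<phi> S] cobalancedD[OF colimD(1)[OF c]]
  let ?\<sigma> = "\<lambda>b. h' \<cdot> (\<one> x \<otimes> \<beta> b) \<cdot> assoc V x (FOb \<phi> b) (FOb S b)"
  have "balanced B \<phi> S x (Cod V h') ?\<sigma>" by (rule balancedI) simp_all
  then have "\<exists>!k. extends B \<phi> S C \<beta> x (Cod V h') ?\<sigma> k" using c by (simp add: colim_def)
  moreover have "extends B \<phi> S C \<beta> x (Cod V h') ?\<sigma> h'" by (rule extendsI) simp_all
  moreover have "extends B \<phi> S C \<beta> x (Cod V h') ?\<sigma> h"
  proof (rule extendsI)
    fix b e q s
    assume [simp]: "b \<in> VOb B" "el e" "ty e = x" "el q" "ty q = FOb \<phi> b" "el s" "ty s = FOb S b"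
      "e \<sharp> q" "q \<sharp> e" "e \<sharp> s" "s \<sharp> e" "q \<sharp> s" "s \<sharp> q"
    have "(h \<cdot> (\<one> x \<otimes> \<beta> b)) \<bullet> \<langle>e, \<langle>q, s\<rangle>\<rangle> = (h' \<cdot> (\<one> x \<otimes> \<beta> b)) \<bullet> \<langle>e, \<langle>q, s\<rangle>\<rangle>" by (simp only: eq \<open>b \<in> VOb B\<close>)
    then show "h \<bullet> \<langle>e, \<beta> b \<bullet> \<langle>q, s\<rangle>\<rangle> = ?\<sigma> b \<bullet> \<langle>\<langle>e, q\<rangle>, s\<rangle>" by simp
  qed simp_all
  ultimately show ?thesis by blast
qed

lemma colim_ext:
  assumes \<phi>: "vfunctor V (opp V B) VV \<phi>" and S: "vfunctor V B VV S"
    and c: "colim B \<phi> S C \<beta>" and x [simp]: "x \<in> Ob V"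
    and h [simp]: "h \<in> Arr V" "Dom V h = x \<odot> C" and h' [simp]: "h' \<in> Arr V" "Dom V h' = x \<odot> C" "Cod V h = Cod V h'"
    and eq: "\<And>b e q s. \<lbrakk>b \<in> VOb B; el e; ty e = x; el q; ty q = FOb \<phi> b; el s; ty s = FOb S b;
      e \<sharp> q; q \<sharp> e; e \<sharp> s; s \<sharp> e; q \<sharp> s; s \<sharp> q\<rbrakk> \<Longrightarrow> h \<bullet> \<langle>e, \<beta> b \<bullet> \<langle>q, s\<rangle>\<rangle> = h' \<bullet> \<langle>e, \<beta> b \<bullet> \<langle>q, s\<rangle>\<rangle>"
  shows "h = h'"
proof -
  note [simp] = weight_rules[OF vfunctor_vcategory(1)[OF S] \<phi> S] cobalancedD(1-4)[OF colimD(1)[OF c]]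
  show ?thesis
  proof (rule colim_cancel[OF \<phi> S c x h h'])
    fix b assume [simp]: "b \<in> VOb B"
    show "h \<cdot> (\<one> x \<otimes> \<beta> b) = h' \<cdot> (\<one> x \<otimes> \<beta> b)"
      by (rule arrow_ext3_right[of _ _ x "FOb \<phi> b" "FOb S b"]) (simp_all add: eq)
  qed
qed

lemma colim_ext2:
  assumes \<phi>: "vfunctor V (opp V B) VV \<phi>" and S: "vfunctor V B VV S"
    and c: "colim B \<phi> S C \<beta>" and x [simp]: "x \<in> Ob V" and y [simp]: "y \<in> Ob V"
    and h [simp]: "h \<in> Arr V" "Dom V h = (x \<odot> y) \<odot> C" and h' [simp]: "h' \<in> Arr V" "Dom V h' = (x \<odot> y) \<odot> C" "Cod V h = Cod V h'"
    and eq: "\<And>b d e q s. \<lbrakk>b \<in> VOb B; el d; ty d = x; el e; ty e = y; el q; ty q = FOb \<phi> b; el s; ty s = FOb S b;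
      d \<sharp> e; e \<sharp> d; d \<sharp> q; q \<sharp> d; d \<sharp> s; s \<sharp> d; e \<sharp> q; q \<sharp> e; e \<sharp> s; s \<sharp> e; q \<sharp> s; s \<sharp> q\<rbrakk>
      \<Longrightarrow> h \<bullet> \<langle>\<langle>d, e\<rangle>, \<beta> b \<bullet> \<langle>q, s\<rangle>\<rangle> = h' \<bullet> \<langle>\<langle>d, e\<rangle>, \<beta> b \<bullet> \<langle>q, s\<rangle>\<rangle>"
  shows "h = h'"
proof -
  note [simp] = weight_rules[OF vfunctor_vcategory(1)[OF S] \<phi> S] cobalancedD(1-4)[OF colimD(1)[OF c]]
  show ?thesis
  proof (rule colim_cancel[OF \<phi> S c _ h h'])
    fix b assume [simp]: "b \<in> VOb B"
    show "h \<cdot> (\<one> (x \<odot> y) \<otimes> \<beta> b) = h' \<cdot> (\<one> (x \<odot> y) \<otimes> \<beta> b)"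
      by (rule arrow_ext22[of _ _ x y "FOb \<phi> b" "FOb S b"]) (simp_all add: eq)
  qed simp
qed

text \<open>The context of \<open>g\<close> takes the role of \<open>x\<close>: the arrow of
  \<open>g\<close> sends the identity element \<open>i\<close> of that context to \<open>g\<close>,
  so agreement on classes becomes an equation of arrows out of a tensor product with
  \<open>C\<close>.\<close>

lemma colim_el_ext:
  assumes \<phi>: "vfunctor V (opp V B) VV \<phi>" and S: "vfunctor V B VV S"
    and c: "colim B \<phi> S C \<beta>" and y [simp]: "y \<in> Ob V"
    and g [simp]: "el g" "ty g = ihom V C y" and g' [simp]: "el g'" "ty g' = ihom V C y" and ctx: "ectx g = ectx g'"
    and eq: "\<And>b q s. \<lbrakk>b \<in> VOb B; el q; ty q = FOb \<phi> b; el s; ty s = FOb S b;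
      g \<sharp> q; q \<sharp> g; g \<sharp> s; s \<sharp> g; g' \<sharp> q; q \<sharp> g'; g' \<sharp> s; s \<sharp> g'; q \<sharp> s; s \<sharp> q\<rbrakk>
      \<Longrightarrow> evl C y g (\<beta> b \<bullet> \<langle>q, s\<rangle>) = evl C y g' (\<beta> b \<bullet> \<langle>q, s\<rangle>)"
  shows "g = g'"
proof -
  note [simp] = weight_rules[OF vfunctor_vcategory(1)[OF S] \<phi> S] cobalancedD(1-4)[OF colimD(1)[OF c]]
  let ?x = "tensor_of (ectx g)"
  define i where "i = Element (ectx g) (\<one> ?x)"
  have ok: "context_ok (ectx g)" using g(1) by (simp add: el_def)
  have i: "iso_el i" "ty i = ?x" "ectx i = ectx g"
    using ok by (auto simp: i_def iso_el_def el_def ty_def iso_arrow_ident)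
  have t: "earr g \<in> Arr V" "Dom V (earr g) = ?x" "Cod V (earr g) = ihom V C y"
    "earr g' \<in> Arr V" "Dom V (earr g') = ?x" "Cod V (earr g') = ihom V C y"
    using g g' ctx by (simp_all add: el_def ty_def)
  have gi: "earr g \<bullet> i = g" "earr g' \<bullet> i = g'"
    using t ctx by (simp_all add: app_def i_def element_eq_iff)
  have x [simp]: "?x \<in> Ob V" using ok by simp
  have "ev V C y \<cdot> (earr g \<otimes> \<one> C) = ev V C y \<cdot> (earr g' \<otimes> \<one> C)"
  proof (rule colim_cancel[OF \<phi> S c x])
    fix b assume b [simp]: "b \<in> VOb B"
    obtain q where q: "iso_el q" "ty q = FOb \<phi> b" "q \<sharp> i" "i \<sharp> q" using fresh_apart[of "FOb \<phi> b" i] i by auto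
    have iq: "iso_el \<langle>i, q\<rangle>" using iso_el_pair i q by blast
    obtain s where s: "iso_el s" "ty s = FOb S b" "s \<sharp> \<langle>i, q\<rangle>" "\<langle>i, q\<rangle> \<sharp> s"
      using fresh_apart[of "FOb S b" "\<langle>i, q\<rangle>"] iq by auto
    have ap: "i \<sharp> s" "s \<sharp> i" "q \<sharp> s" "s \<sharp> q" using s by simp_all
    have apg: "g \<sharp> q" "q \<sharp> g" "g \<sharp> s" "s \<sharp> g" "g' \<sharp> q" "q \<sharp> g'" "g' \<sharp> s" "s \<sharp> g'"
      using q ap i(3) ctx by (simp_all add: apart_def)
    have qs: "iso_el \<langle>q, s\<rangle>" using iso_el_pair q s ap by blast
    show "(ev V C y \<cdot> (earr g \<otimes> \<one> C)) \<cdot> (\<one> ?x \<otimes> \<beta> b) = (ev V C y \<cdot> (earr g' \<otimes> \<one> C)) \<cdot> (\<one> ?x \<otimes> \<beta> b)"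
    proof (rule iso_el_cancel[OF iso_el_pair[OF i(1) qs]])
      have "evl C y g (\<beta> b \<bullet> \<langle>q, s\<rangle>) = evl C y g' (\<beta> b \<bullet> \<langle>q, s\<rangle>)"
        using q s ap apg by (intro eq) simp_all
      then show "((ev V C y \<cdot> (earr g \<otimes> \<one> C)) \<cdot> (\<one> ?x \<otimes> \<beta> b)) \<bullet> \<langle>i, \<langle>q, s\<rangle>\<rangle>
        = ((ev V C y \<cdot> (earr g' \<otimes> \<one> C)) \<cdot> (\<one> ?x \<otimes> \<beta> b)) \<bullet> \<langle>i, \<langle>q, s\<rangle>\<rangle>"
        using t i q s ap gi by simp
    qed (use t i q s ap in simp_all)
  qed (use t in simp_all)
  then have "transp V ?x C y (ev V C y \<cdot> (earr g \<otimes> \<one> C)) = transp V ?x C y (ev V C y \<cdot> (earr g' \<otimes> \<one> C))" by simp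
  then have "earr g = earr g'" using t by (simp add: transp_eval)
  then show ?thesis using ctx by (simp add: element_eq_iff)
qed

lemma NT_intro:
  assumes A: "ends_exist A" and F: "vfunctor V A VV F" and G: "vfunctor V A VV G" and x [simp]: "x \<in> Ob V"
    and \<sigma> [simp]: "\<And>a. a \<in> VOb A \<Longrightarrow> \<sigma> a \<in> Arr V" "\<And>a. a \<in> VOb A \<Longrightarrow> Dom V (\<sigma> a) = x \<odot> FOb F a"
      "\<And>a. a \<in> VOb A \<Longrightarrow> Cod V (\<sigma> a) = FOb G a"
    and nat: "\<And>a b e f s. \<lbrakk>a \<in> VOb A; b \<in> VOb A; el e; ty e = x; el f; ty f = VHom A a b; el s; ty s = FOb F a;
      e \<sharp> f; f \<sharp> e; e \<sharp> s; s \<sharp> e; f \<sharp> s; s \<sharp> f\<rbrakk> \<Longrightarrow>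
      \<sigma> b \<bullet> \<langle>e, act F a b f s\<rangle> = act G a b f (\<sigma> a \<bullet> \<langle>e, s\<rangle>)"
  obtains h where "h \<in> Arr V" "Dom V h = x" "Cod V h = NT A F G"
    "\<And>a e s. \<lbrakk>a \<in> VOb A; el e; ty e = x; el s; ty s = FOb F a; e \<sharp> s\<rbrakk> \<Longrightarrow>
      cpt A F G a (h \<bullet> e) s = \<sigma> a \<bullet> \<langle>e, s\<rangle>"
proof -
  note [simp] = vfunctor_vcategory[OF F] vfunctor_rules[OF F] vfunctor_rules[OF G] vfunctor_self_Ob[OF F] vfunctor_self_Ob[OF G]
  have w: "wedge A F G x (\<lambda>a. transp V x (FOb F a) (FOb G a) (\<sigma> a))"
    by (rule wedgeI) (simp_all add: nat)
  note N = into_Nat[OF A F G w] proj_into_Nat_el[OF A F G w]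
  show ?thesis
    by (rule that[of "into_Nat V A VV F G x (\<lambda>a. transp V x (FOb F a) (FOb G a) (\<sigma> a))"]) (use N in simp_all)
qed

text \<open>An end quantifies over all elements of the context, but naturality is an equation of
  arrows, and for a context that is a tensor product it is decided on pairs.\<close>

lemma NT_intro2:
  assumes A: "ends_exist A" and F: "vfunctor V A VV F" and G: "vfunctor V A VV G" and x [simp]: "x \<in> Ob V" "y \<in> Ob V"
    and \<sigma> [simp]: "\<And>a. a \<in> VOb A \<Longrightarrow> \<sigma> a \<in> Arr V" "\<And>a. a \<in> VOb A \<Longrightarrow> Dom V (\<sigma> a) = (x \<odot> y) \<odot> FOb F a"
      "\<And>a. a \<in> VOb A \<Longrightarrow> Cod V (\<sigma> a) = FOb G a"
    and nat: "\<And>a b d e f s. \<lbrakk>a \<in> VOb A; b \<in> VOb A; el d; ty d = x; el e; ty e = y; el f; ty f = VHom A a b; el s; ty s = FOb F a;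
      d \<sharp> e; e \<sharp> d; d \<sharp> f; f \<sharp> d; d \<sharp> s; s \<sharp> d; e \<sharp> f; f \<sharp> e; e \<sharp> s; s \<sharp> e; f \<sharp> s; s \<sharp> f\<rbrakk> \<Longrightarrow>
      \<sigma> b \<bullet> \<langle>\<langle>d, e\<rangle>, act F a b f s\<rangle>
      = act G a b f (\<sigma> a \<bullet> \<langle>\<langle>d, e\<rangle>, s\<rangle>)"
  obtains h where "h \<in> Arr V" "Dom V h = x \<odot> y" "Cod V h = NT A F G"
    "\<And>a d e s. \<lbrakk>a \<in> VOb A; el d; ty d = x; el e; ty e = y; el s; ty s = FOb F a; d \<sharp> e; d \<sharp> s; e \<sharp> s\<rbrakk> \<Longrightarrow>
      cpt A F G a (h \<bullet> \<langle>d, e\<rangle>) s = \<sigma> a \<bullet> \<langle>\<langle>d, e\<rangle>, s\<rangle>"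
proof (rule NT_intro[OF A F G, of "x \<odot> y" \<sigma>])
  note [simp] = vfunctor_vcategory[OF F] vfunctor_rules[OF F] vfunctor_rules[OF G] vfunctor_self_Ob[OF F] vfunctor_self_Ob[OF G]
  fix a b z f s
  assume [simp]: "a \<in> VOb A" "b \<in> VOb A" "el z" "ty z = x \<odot> y" "el f" "ty f = VHom A a b" "el s" "ty s = FOb F a"
      "z \<sharp> f" "f \<sharp> z" "z \<sharp> s" "s \<sharp> z" "f \<sharp> s" "s \<sharp> f"
  let ?l = "\<sigma> b \<cdot> (\<one> (x \<odot> y) \<otimes> (ev V (FOb F a) (FOb F b) \<cdot> (FHom F a b \<otimes> \<one> (FOb F a))))"
  let ?r = "ev V (FOb G a) (FOb G b) \<cdot> (FHom G a b \<otimes> \<sigma> a) \<cdot> assoc V (VHom A a b) (x \<odot> y) (FOb F a)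
     \<cdot> (symm V (x \<odot> y) (VHom A a b) \<otimes> \<one> (FOb F a)) \<cdot> ainv (x \<odot> y) (VHom A a b) (FOb F a)"
  have "?l = ?r"
    by (rule arrow_ext22[of _ _ x y "VHom A a b" "FOb F a"]) (simp_all add: nat)
  then have "?l \<bullet> \<langle>z, \<langle>f, s\<rangle>\<rangle> = ?r \<bullet> \<langle>z, \<langle>f, s\<rangle>\<rangle>" by simp
  then show "\<sigma> b \<bullet> \<langle>z, act F a b f s\<rangle> = act G a b f (\<sigma> a \<bullet> \<langle>z, s\<rangle>)"
    by simp
next
  fix h assume h: "h \<in> Arr V" "Dom V h = x \<odot> y" "Cod V h = NT A F G"
    "\<And>a e s. \<lbrakk>a \<in> VOb A; el e; ty e = x \<odot> y; el s; ty s = FOb F a; e \<sharp> s\<rbrakk> \<Longrightarrow>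
      cpt A F G a (h \<bullet> e) s = \<sigma> a \<bullet> \<langle>e, s\<rangle>"
  show ?thesis by (rule that[OF h(1-3)]) (simp add: h(4))
qed simp_all

text \<open>An element of type \<open>\<I>\<close> acts as a scalar and can be moved inside an
  evaluation. The equation of arrows behind this has to be tested only at
  \<open>star\<close>.\<close>

lemma lunit_eval:
  assumes "el e" "ty e = \<I>" "el h" "ty h = ihom V x y" "el a" "ty a = x" "e \<sharp> h" "e \<sharp> a" "h \<sharp> a" "y \<in> Ob V"
  shows "lunit V y \<bullet> \<langle>e, evl x y h a\<rangle> = evl x y h (lunit V x \<bullet> \<langle>e, a\<rangle>)"
proof -
  have x [simp]: "x \<in> Ob V" using assms by auto
  note [simp] = assms apart_sym[OF assms(7)] apart_sym[OF assms(8)] apart_sym[OF assms(9)]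
  let ?H = "ihom V x y"
  let ?r = "ev V x y \<cdot> (\<one> ?H \<otimes> lunit V x) \<cdot> assoc V ?H \<I> x \<cdot> (symm V \<I> ?H \<otimes> \<one> x) \<cdot> ainv \<I> ?H x"
  have "lunit V y \<cdot> (\<one> \<I> \<otimes> ev V x y) = ?r"
  proof (rule arrow_ext_unit[of _ _ "?H \<odot> x"])
    have "lunit V y \<cdot> (\<one> \<I> \<otimes> ev V x y) \<cdot> linv (?H \<odot> x) = ?r \<cdot> linv (?H \<odot> x)"
      by (rule arrow_ext2[of _ _ ?H x]) simp_all
    then have *: "(lunit V y \<cdot> (\<one> \<I> \<otimes> ev V x y) \<cdot> linv (?H \<odot> x)) \<bullet> c = (?r \<cdot> linv (?H \<odot> x)) \<bullet> c" for c by simp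
    fix c assume "el c" "ty c = ?H \<odot> x"
    then show "(lunit V y \<cdot> (\<one> \<I> \<otimes> ev V x y)) \<bullet> \<langle>star, c\<rangle> = ?r \<bullet> \<langle>star, c\<rangle>" using *[of c] by simp
  qed simp_all
  then have "(lunit V y \<cdot> (\<one> \<I> \<otimes> ev V x y)) \<bullet> \<langle>e, \<langle>h, a\<rangle>\<rangle> = ?r \<bullet> \<langle>e, \<langle>h, a\<rangle>\<rangle>" by simp
  then show ?thesis by simp
qed

text \<open>The universal property in the unit context with the unitors composed away;
  \<open>lunit_eval\<close> is what makes the resulting family balanced.\<close>

lemma colim_desc:
  assumes \<phi>: "vfunctor V (opp V B) VV \<phi>" and S: "vfunctor V B VV S" and c: "colim B \<phi> S C \<beta>" and y: "cobalanced B \<phi> S y \<sigma>"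
  obtains h where "h \<in> Arr V" "Dom V h = C" "Cod V h = y"
    "\<And>b q s. \<lbrakk>b \<in> VOb B; el q; ty q = FOb \<phi> b; el s; ty s = FOb S b; q \<sharp> s\<rbrakk> \<Longrightarrow> h \<bullet> \<beta> b \<bullet> \<langle>q, s\<rangle> = \<sigma> b \<bullet> \<langle>q, s\<rangle>"
proof -
  note [simp] = weight_rules[OF vfunctor_vcategory(1)[OF S] \<phi> S] cobalancedD(1-4)[OF colimD(1)[OF c]] cobalancedD(1-4)[OF y]
  let ?\<sigma> = "\<lambda>b. \<sigma> b \<cdot> (lunit V (FOb \<phi> b) \<otimes> \<one> (FOb S b))"
  have "balanced B \<phi> S \<I> y ?\<sigma>"
    by (rule balancedI) (simp_all add: lunit_eval cobalancedD(5)[OF y])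
  then obtain h where h: "extends B \<phi> S C \<beta> \<I> y ?\<sigma> h" using colimD(2)[OF c, of \<I> y] by auto
  note [simp] = extendsD(1-3)[OF h]
  show ?thesis
  proof (rule that[of "h \<cdot> linv C"])
    fix b q s assume "b \<in> VOb B" "el q" "ty q = FOb \<phi> b" "el s" "ty s = FOb S b" "q \<sharp> s"
    then show "(h \<cdot> linv C) \<bullet> \<beta> b \<bullet> \<langle>q, s\<rangle> = \<sigma> b \<bullet> \<langle>q, s\<rangle>"
      using extendsD(4)[OF h, of b star q s] by simp
  qed simp_all
qed

lemma colim_ext0:
  assumes \<phi>: "vfunctor V (opp V B) VV \<phi>" and S: "vfunctor V B VV S" and c: "colim B \<phi> S C \<beta>"
    and h [simp]: "h \<in> Arr V" "Dom V h = C" and h' [simp]: "h' \<in> Arr V" "Dom V h' = C" "Cod V h = Cod V h'"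
    and eq: "\<And>b q s. \<lbrakk>b \<in> VOb B; el q; ty q = FOb \<phi> b; el s; ty s = FOb S b; q \<sharp> s; s \<sharp> q\<rbrakk> \<Longrightarrow> h \<bullet> \<beta> b \<bullet> \<langle>q, s\<rangle> = h' \<bullet> \<beta> b \<bullet> \<langle>q, s\<rangle>"
  shows "h = h'"
proof -
  note [simp] = weight_rules[OF vfunctor_vcategory(1)[OF S] \<phi> S] cobalancedD(1-4)[OF colimD(1)[OF c]]
  have "h \<cdot> \<beta> b = h' \<cdot> \<beta> b" if "b \<in> VOb B" for b
    by (rule arrow_ext2[of _ _ "FOb \<phi> b" "FOb S b"]) (use that in \<open>simp_all add: eq\<close>)
  then have e: "(h \<cdot> lunit V C) \<cdot> (\<one> \<I> \<otimes> \<beta> b) = (h' \<cdot> lunit V C) \<cdot> (\<one> \<I> \<otimes> \<beta> b)" if "b \<in> VOb B" for b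
    using that lunit_nat[of "\<beta> b"] comp_reassoc[of h "\<beta> b" "h' \<cdot> \<beta> b" "lunit V (FOb \<phi> b \<odot> FOb S b)"] by simp
  have "h \<cdot> lunit V C = h' \<cdot> lunit V C"
    by (rule colim_cancel[OF \<phi> S c _ _ _ _ _ _ e]) simp_all
  then show ?thesis by - (rule retraction_cancel[of "lunit V C" "linv C"], simp_all)
qed

lemma id_vfun_simps [simp]:
  "a \<in> VOb A \<Longrightarrow> FOb (id_vfun V A) a = a"
  "\<lbrakk>a \<in> VOb A; b \<in> VOb A\<rbrakk> \<Longrightarrow> FHom (id_vfun V A) a b = \<one> (VHom A a b)"
  by (simp_all add: id_vfun_def)

end

section \<open>The functor \<open>\<phi> * -\<close>\<close>

text \<open>Collects what smallness of \<open>B\<close> and completeness and cocompleteness of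
  \<open>V\<close> provide. Statements about another indexing category \<open>K\<close> add ends
  over \<open>opp V K\<close>.\<close>

locale small_weight = smcc V for V :: "('o, 'a) smc" (structure) +
  fixes B :: "('b, 'o, 'a) vcat" and \<phi> :: "('b, 'o, 'a) vfun"
  assumes EB: "ends_exist B" and EBo: "ends_exist (opp V B)" and \<phi>: "vfunctor V (opp V B) VV \<phi>"
    and colims: "\<And>S. vfunctor V B VV S \<Longrightarrow> \<exists>C \<beta>. colim B \<phi> S C \<beta>"
begin

abbreviation W where "W \<equiv> wcolim V B \<phi>"
abbreviation WF where "WF \<equiv> wcolim_functor V B \<phi>"

text \<open>\<open>coc S b \<bullet> \<langle>q, s\<rangle>\<close> is the class of \<open>q \<otimes> s\<close> in \<open>\<phi> * S\<close>.\<close>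

definition coc where
  "coc S b = ev V (FOb S b) (W S) \<cdot> (wcolim_unit V B \<phi> S b \<otimes> \<one> (FOb S b))"

text \<open>\<open>colims\<close> supplies a colimit in coend form, which is translated back to a
  representing isomorphism; hence the choice in \<open>chosen_wcolimit\<close> is made from a
  nonempty collection.\<close>

lemma wcolim_wlim:
  assumes S: "vfunctor V B VV S"
  shows "wlim (opp V VV) (opp V B) \<phi> (op_vfun S) (W S) (wcolim_unit V B \<phi> S)"
proof -
  note B = vfunctor_vcategory(1)[OF S] and So = vfunctor_op[OF S]
  obtain C \<beta> where c: "colim B \<phi> S C \<beta>" using colims[OF S] by blast
  note cb = cobalancedD(2-4)[OF colimD(1)[OF c]]
  have w: "wlim (opp V VV) (opp V B) \<phi> (op_vfun S) C (\<lambda>b. transp V (FOb \<phi> b) (FOb S b) C (\<beta> b))"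
    using c wlim_iff_colim[OF B \<phi> S cb] by simp
  have "\<exists>\<theta>. is_wcolimit V VV B \<phi> S C \<theta>"
    using wlim_is_wlimit[OF refl So \<phi> EBo w] unfolding is_wcolimit_eq[OF S] by metis
  then have ex: "\<exists>p. case p of (C, \<theta>) \<Rightarrow> is_wcolimit V VV B \<phi> S C \<theta>" by auto
  from someI_ex[OF ex] have "case chosen_wcolimit V VV B \<phi> S of (C, \<theta>) \<Rightarrow> is_wcolimit V VV B \<phi> S C \<theta>"
    unfolding chosen_wcolimit_def .
  then have "is_wcolimit V VV B \<phi> S (W S) (snd (chosen_wcolimit V VV B \<phi> S))"
    by (simp add: wcolim_def case_prod_beta)
  from is_wlimit_wlim[OF refl So \<phi> EBo this[unfolded is_wcolimit_eq[OF S]]] show ?thesis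
    unfolding wcolim_unit_def wcolimit_unit_eq .
qed

lemma wcolim_colim:
  assumes S: "vfunctor V B VV S"
  shows "colim B \<phi> S (W S) (coc S)"
proof -
  have "coc S = (\<lambda>b. ev V (FOb S b) (W S) \<cdot> (wcolim_unit V B \<phi> S b \<otimes> \<one> (FOb S b)))"
    by (rule ext) (simp add: coc_def)
  then show ?thesis
    using wlim_colim[OF vfunctor_vcategory(1)[OF S] \<phi> S wcolim_wlim[OF S]] by simp
qed

lemma wcolim_rules:
  assumes S: "vfunctor V B VV S"
  shows "W S \<in> Ob V"
    and "b \<in> VOb B \<Longrightarrow> wcolim_unit V B \<phi> S b \<in> Arr V"
    and "b \<in> VOb B \<Longrightarrow> Dom V (wcolim_unit V B \<phi> S b) = FOb \<phi> b"
    and "b \<in> VOb B \<Longrightarrow> Cod V (wcolim_unit V B \<phi> S b) = ihom V (FOb S b) (W S)"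
    and "b \<in> VOb B \<Longrightarrow> coc S b \<in> Arr V"
    and "b \<in> VOb B \<Longrightarrow> Dom V (coc S b) = FOb \<phi> b \<odot> FOb S b"
    and "b \<in> VOb B \<Longrightarrow> Cod V (coc S b) = W S"
    and "\<lbrakk>b \<in> VOb B; el q; ty q = FOb \<phi> b; el s; ty s = FOb S b; q \<sharp> s\<rbrakk> \<Longrightarrow>
      evl (FOb S b) (W S) (wcolim_unit V B \<phi> S b \<bullet> q) s = coc S b \<bullet> \<langle>q, s\<rangle>"
proof -
  note c = wcolim_colim[OF S] and w = wcolim_wlim[OF S]
  note [simp] = vfunctor_self_Ob[OF S]
  show W [simp]: "W S \<in> Ob V" using wlimD(1)[OF w] by simp
  show u [simp]: "wcolim_unit V B \<phi> S b \<in> Arr V" "Dom V (wcolim_unit V B \<phi> S b) = FOb \<phi> b"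
    "Cod V (wcolim_unit V B \<phi> S b) = ihom V (FOb S b) (W S)" if "b \<in> VOb B" for b
    using cylinderD(1-3)[OF wlimD(2)[OF w], of b] that by simp_all
  show "coc S b \<in> Arr V" "Dom V (coc S b) = FOb \<phi> b \<odot> FOb S b" "Cod V (coc S b) = W S" if "b \<in> VOb B"
    using cobalancedD(2-4)[OF colimD(1)[OF c] that] by simp_all
  show "\<lbrakk>b \<in> VOb B; el q; ty q = FOb \<phi> b; el s; ty s = FOb S b; q \<sharp> s\<rbrakk> \<Longrightarrow>
      evl (FOb S b) (W S) (wcolim_unit V B \<phi> S b \<bullet> q) s = coc S b \<bullet> \<langle>q, s\<rangle>"
    by (simp add: coc_def)
qed

lemmas B_rules = ends_exist_vcategory[OF EB] EB EBo \<phi>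

text \<open>The description in \<open>wcolim_functor\<close> is proper because transposing its
  equation turns it into \<open>extends\<close> for one balanced family, which has exactly one
  solution.\<close>

lemma FHom_WF:
  assumes S: "vfunctor V B VV S" and S': "vfunctor V B VV S'"
  shows "FHom WF S S' \<in> Arr V" "Dom V (FHom WF S S') = NT B S S'" "Cod V (FHom WF S S') = ihom V (W S) (W S')"
    and "\<lbrakk>b \<in> VOb B; el t; ty t = NT B S S'; el q; ty q = FOb \<phi> b; el s; ty s = FOb S b; t \<sharp> q; t \<sharp> s; q \<sharp> s\<rbrakk> \<Longrightarrow>
      evl (W S) (W S') (FHom WF S S' \<bullet> t) (coc S b \<bullet> \<langle>q, s\<rangle>)
      = coc S' b \<bullet> \<langle>q, cpt B S S' b t s\<rangle>"
proof -
  note [simp] = B_rules S S' weight_rules[OF ends_exist_vcategory[OF EB] \<phi> S] weight_rules[OF ends_exist_vcategory[OF EB] \<phi> S']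
    wcolim_rules[OF S] wcolim_rules[OF S']
  note c = wcolim_colim[OF S] and c' = wcolim_colim[OF S']
  let ?N = "NT B S S'"
  \<comment> \<open>Sends \<open>t \<otimes> q \<otimes> s\<close> to the class of
    \<open>q \<otimes> t s\<close>.\<close>
  let ?\<sigma> = "\<lambda>b. coc S' b \<cdot> (\<one> (FOb \<phi> b) \<otimes> (ev V (FOb S b) (FOb S' b) \<cdot> (pr B S S' b \<otimes> \<one> (FOb S b))))
    \<cdot> assoc V (FOb \<phi> b) ?N (FOb S b) \<cdot> (symm V ?N (FOb \<phi> b) \<otimes> \<one> (FOb S b))"
  have bal: "balanced B \<phi> S ?N (W S') ?\<sigma>"
    by (rule balancedI) (simp_all add: cobalancedD(5)[OF colimD(1)[OF c']])
  let ?P = "\<lambda>g. g \<in> hom V (NT B S S') (ihom V (W S) (W S')) \<and>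
        (\<forall>b\<in>VOb B. VComp VV (FOb S b) (W S) (W S') \<cdot> (g \<otimes> wcolim_unit V B \<phi> S b)
         = VComp VV (FOb S b) (FOb S' b) (W S') \<cdot> (wcolim_unit V B \<phi> S' b \<otimes> pr B S S' b) \<cdot> symm V ?N (FOb \<phi> b))"
  have P_iff: "?P g \<longleftrightarrow> g \<in> hom V ?N (ihom V (W S) (W S')) \<and> extends B \<phi> S (W S) (coc S) ?N (W S') ?\<sigma> (ev V (W S) (W S') \<cdot> (g \<otimes> \<one> (W S)))" for g
  proof (cases "g \<in> hom V ?N (ihom V (W S) (W S'))")
    case True
    then have [simp]: "g \<in> Arr V" "Dom V g = ?N" "Cod V g = ihom V (W S) (W S')" by (simp_all add: hom_iff)
    have "extends B \<phi> S (W S) (coc S) ?N (W S') ?\<sigma> (ev V (W S) (W S') \<cdot> (g \<otimes> \<one> (W S)))" if p: "?P g"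
    proof (rule extendsI)
      fix b e q s
      assume [simp]: "b \<in> VOb B" "el e" "ty e = ?N" "el q" "ty q = FOb \<phi> b" "el s" "ty s = FOb S b"
        "e \<sharp> q" "q \<sharp> e" "e \<sharp> s" "s \<sharp> e" "q \<sharp> s" "s \<sharp> q"
      have "evl (FOb S b) (W S') ((VComp VV (FOb S b) (W S) (W S') \<cdot> (g \<otimes> wcolim_unit V B \<phi> S b)) \<bullet> \<langle>e, q\<rangle>) s
        = evl (FOb S b) (W S') ((VComp VV (FOb S b) (FOb S' b) (W S') \<cdot> (wcolim_unit V B \<phi> S' b \<otimes> pr B S S' b) \<cdot> symm V ?N (FOb \<phi> b)) \<bullet> \<langle>e, q\<rangle>) s"
        using p by simp
      then show "(ev V (W S) (W S') \<cdot> (g \<otimes> \<one> (W S))) \<bullet> \<langle>e, coc S b \<bullet> \<langle>q, s\<rangle>\<rangle> = ?\<sigma> b \<bullet> \<langle>\<langle>e, q\<rangle>, s\<rangle>"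
        by simp
    qed simp_all
    moreover have "?P g" if ex: "extends B \<phi> S (W S) (coc S) ?N (W S') ?\<sigma> (ev V (W S) (W S') \<cdot> (g \<otimes> \<one> (W S)))"
    proof (intro conjI ballI True)
      fix b assume [simp]: "b \<in> VOb B"
      show "VComp VV (FOb S b) (W S) (W S') \<cdot> (g \<otimes> wcolim_unit V B \<phi> S b)
         = VComp VV (FOb S b) (FOb S' b) (W S') \<cdot> (wcolim_unit V B \<phi> S' b \<otimes> pr B S S' b) \<cdot> symm V ?N (FOb \<phi> b)"
      proof (rule arrow_ext2[of _ _ ?N "FOb \<phi> b"])
        fix e q assume [simp]: "el e" "ty e = ?N" "el q" "ty q = FOb \<phi> b" "e \<sharp> q" "q \<sharp> e"
        have "cmp VV (FOb S b) (W S) (W S') (g \<bullet> e) (wcolim_unit V B \<phi> S b \<bullet> q)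
          = cmp VV (FOb S b) (FOb S' b) (W S') (wcolim_unit V B \<phi> S' b \<bullet> q) (pr B S S' b \<bullet> e)"
        proof (rule eval_ext[of _ "FOb S b" "W S'"])
          fix s assume "el s" "ty s = FOb S b"
            "cmp VV (FOb S b) (W S) (W S') (g \<bullet> e) (wcolim_unit V B \<phi> S b \<bullet> q) \<sharp> s"
            "s \<sharp> cmp VV (FOb S b) (W S) (W S') (g \<bullet> e) (wcolim_unit V B \<phi> S b \<bullet> q)"
          then have [simp]: "el s" "ty s = FOb S b" "e \<sharp> s" "q \<sharp> s" "s \<sharp> e" "s \<sharp> q" by simp_all
          show "evl (FOb S b) (W S') (cmp VV (FOb S b) (W S) (W S') (g \<bullet> e) (wcolim_unit V B \<phi> S b \<bullet> q)) s
            = evl (FOb S b) (W S') (cmp VV (FOb S b) (FOb S' b) (W S') (wcolim_unit V B \<phi> S' b \<bullet> q) (pr B S S' b \<bullet> e)) s"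
            using extendsD(4)[OF ex, of b e q s] by simp
        qed (simp_all add: ectx_ac)
        then show "(VComp VV (FOb S b) (W S) (W S') \<cdot> (g \<otimes> wcolim_unit V B \<phi> S b)) \<bullet> \<langle>e, q\<rangle>
         = (VComp VV (FOb S b) (FOb S' b) (W S') \<cdot> (wcolim_unit V B \<phi> S' b \<otimes> pr B S S' b) \<cdot> symm V ?N (FOb \<phi> b)) \<bullet> \<langle>e, q\<rangle>"
          by simp
      qed simp_all
    qed
    ultimately show ?thesis using True by blast
  next
    case False
    then show ?thesis by blast
  qed
  have ex1: "\<exists>!k. extends B \<phi> S (W S) (coc S) ?N (W S') ?\<sigma> k"
    using c bal by (simp add: colim_def)
  have "\<exists>!g. ?P g"
    unfolding P_iff
  proof (rule iffD2[OF ex1_transfer[OF _ _] ex1])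
    fix g assume "g \<in> hom V ?N (ihom V (W S) (W S')) \<and> extends B \<phi> S (W S) (coc S) ?N (W S') ?\<sigma> (ev V (W S) (W S') \<cdot> (g \<otimes> \<one> (W S)))"
    then show "extends B \<phi> S (W S) (coc S) ?N (W S') ?\<sigma> (ev V (W S) (W S') \<cdot> (g \<otimes> \<one> (W S))) \<and>
        transp V ?N (W S) (W S') (ev V (W S) (W S') \<cdot> (g \<otimes> \<one> (W S))) = g"
      by (auto simp: hom_iff intro!: transp_eval)
  next
    fix k assume k: "extends B \<phi> S (W S) (coc S) ?N (W S') ?\<sigma> k"
    note [simp] = extendsD(1-3)[OF k]
    show "(transp V ?N (W S) (W S') k \<in> hom V ?N (ihom V (W S) (W S')) \<and>
        extends B \<phi> S (W S) (coc S) ?N (W S') ?\<sigma> (ev V (W S) (W S') \<cdot> (transp V ?N (W S) (W S') k \<otimes> \<one> (W S)))) \<and>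
        ev V (W S) (W S') \<cdot> (transp V ?N (W S) (W S') k \<otimes> \<one> (W S)) = k"
      using k by (simp add: hom_iff)
  qed
  from theI'[OF this] have "?P (FHom WF S S')"
    by (simp add: wcolim_functor_def)
  then have g: "FHom WF S S' \<in> hom V ?N (ihom V (W S) (W S'))"
    and ex: "extends B \<phi> S (W S) (coc S) ?N (W S') ?\<sigma> (ev V (W S) (W S') \<cdot> (FHom WF S S' \<otimes> \<one> (W S)))"
    unfolding P_iff by blast+
  show gt [simp]: "FHom WF S S' \<in> Arr V" "Dom V (FHom WF S S') = NT B S S'" "Cod V (FHom WF S S') = ihom V (W S) (W S')"
    using g by (simp_all add: hom_iff)
  assume "b \<in> VOb B" "el t" "ty t = NT B S S'" "el q" "ty q = FOb \<phi> b" "el s" "ty s = FOb S b" "t \<sharp> q" "t \<sharp> s" "q \<sharp> s"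
  then show "evl (W S) (W S') (FHom WF S S' \<bullet> t) (coc S b \<bullet> \<langle>q, s\<rangle>)
      = coc S' b \<bullet> \<langle>q, cpt B S S' b t s\<rangle>"
    using extendsD(4)[OF ex, of b t q s] apart_sym[of t q] by simp
qed

lemma FOb_WF [simp]: "vfunctor V B VV S \<Longrightarrow> FOb WF S = W S"
  by (simp add: wcolim_functor_def)

text \<open>Each functor law is an equation of elements of an internal hom out of \<phi> * S, so it
  is enough to check it on classes of \<open>q \<otimes> s\<close>.\<close>

lemma vfunctor_WF: "vfunctor V (Fun B) VV WF"
proof (rule vfunctorI)
  note [simp] = B_rules FHom_WF
  show "vcategory V (Fun B)" "vcategory V VV" by simp_all
  fix S assume "S \<in> VOb (Fun B)"
  then have S: "vfunctor V B VV S" by simp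
  note [simp] = S weight_rules[OF ends_exist_vcategory[OF EB] \<phi> S] wcolim_rules[OF S]
  show "FOb WF S \<in> VOb VV" by simp
  show "FHom WF S S \<bullet> VId (Fun B) S \<bullet> star = VId VV (FOb WF S) \<bullet> star"
    by (rule colim_el_ext[OF \<phi> S wcolim_colim[OF S], of "W S"]) simp_all
  fix S' assume "S' \<in> VOb (Fun B)"
  then have S': "vfunctor V B VV S'" by simp
  note [simp] = S' weight_rules[OF ends_exist_vcategory[OF EB] \<phi> S'] wcolim_rules[OF S']
  show "FHom WF S S' \<in> Arr V" "Dom V (FHom WF S S') = VHom (Fun B) S S'"
    "Cod V (FHom WF S S') = VHom VV (FOb WF S) (FOb WF S')" by simp_all
  fix S'' g f assume "S'' \<in> VOb (Fun B)" "el g" "ty g = VHom (Fun B) S' S''" "el f" "ty f = VHom (Fun B) S S'" "g \<sharp> f" "f \<sharp> g"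
  then have S'': "vfunctor V B VV S''" and [simp]: "el g" "ty g = NT B S' S''" "el f" "ty f = NT B S S'" "g \<sharp> f" "f \<sharp> g" by simp_all
  note [simp] = S'' weight_rules[OF ends_exist_vcategory[OF EB] \<phi> S''] wcolim_rules[OF S'']
  show "FHom WF S S'' \<bullet> cmp (Fun B) S S' S'' g f
    = cmp VV (FOb WF S) (FOb WF S') (FOb WF S'') (FHom WF S' S'' \<bullet> g) (FHom WF S S' \<bullet> f)"
    by (rule colim_el_ext[OF \<phi> S wcolim_colim[OF S], of "W S''"]) simp_all
qed (simp_all add: wcolim_functor_def mk_vfun_undefined)

end

section \<open>Dual points\<close>

context small_weight
begin

lemmas base_rules = ends_exist_vcategory[OF EB] EB EBo \<phi> weight_typing[OF \<phi>]

lemma weight_comp: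
  assumes "b \<in> VOb B" "c \<in> VOb B" "d \<in> VOb B" "el f" "ty f = VHom B c d" "el g" "ty g = VHom B b c" "f \<sharp> g"
  shows "FHom \<phi> d b \<bullet> cmp B b c d f g
    = cmp VV (FOb \<phi> d) (FOb \<phi> c) (FOb \<phi> b) (FHom \<phi> c b \<bullet> g) (FHom \<phi> d c \<bullet> f)"
  using FHom_VComp_el[OF \<phi>, of d c b g f] assms apart_sym[OF assms(8)] base_rules by simp

lemma weight_id:
  assumes "b \<in> VOb B"
  shows "FHom \<phi> b b \<bullet> VId B b \<bullet> star = VId VV (FOb \<phi> b) \<bullet> star"
  using FHom_VId_el[OF \<phi>, of b] assms by simp

text \<open>\<open>\<psi>\<close> is the functor \<open>c \<mapsto> [B\<^sup>o\<^sup>p,V](\<phi>, B(-,c))\<close>, i.e. the limit of the Yoneda embedding weighted by \<open>\<phi>\<close>.\<close>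

definition yo where "yo = hom_into V (opp V B) (opp V B) (id_vfun V (opp V B))"

definition \<psi> where "\<psi> = limit_functor (opp V B) (opp V B) \<phi> (id_vfun V (opp V B))"

abbreviation "PC c \<equiv> NT (opp V B) \<phi> (yo c)"
abbreviation "pc c \<equiv> pr (opp V B) \<phi> (yo c)"
abbreviation "pcv c k r p \<equiv> ev V (FOb \<phi> k) (VHom B k c) \<bullet> \<langle>pc c k \<bullet> r, p\<rangle>"

lemma vfunctor_id_opp: "vfunctor V (opp V B) (opp V B) (id_vfun V (opp V B))"
  by (rule vfunctor_id) (simp add: base_rules)

lemma yo_rules:
  assumes "c \<in> VOb B"
  shows "vfunctor V (opp V B) VV (yo c)"
    and "b \<in> VOb B \<Longrightarrow> FOb (yo c) b = VHom B b c"
    and "\<lbrakk>b \<in> VOb B; d \<in> VOb B\<rbrakk> \<Longrightarrow> FHom (yo c) b d \<in> Arr V"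
    and "\<lbrakk>b \<in> VOb B; d \<in> VOb B\<rbrakk> \<Longrightarrow> Dom V (FHom (yo c) b d) = VHom B d b"
    and "\<lbrakk>b \<in> VOb B; d \<in> VOb B\<rbrakk> \<Longrightarrow> Cod V (FHom (yo c) b d) = ihom V (VHom B b c) (VHom B d c)"
    and "\<lbrakk>b \<in> VOb B; d \<in> VOb B; el u; ty u = VHom B d b; el f; ty f = VHom B b c; u \<sharp> f\<rbrakk> \<Longrightarrow>
      evl (VHom B b c) (VHom B d c) (FHom (yo c) b d \<bullet> u) f = cmp B d b c f u"
  using assms hom_into_rules[OF vfunctor_id_opp, of c] base_rules by (simp_all add: yo_def)

lemma \<psi>_rules:
  shows "vfunctor V B VV \<psi>"
    and "c \<in> VOb B \<Longrightarrow> FOb \<psi> c = PC c"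
    and "\<lbrakk>c \<in> VOb B; d \<in> VOb B\<rbrakk> \<Longrightarrow> FHom \<psi> c d \<in> Arr V"
    and "\<lbrakk>c \<in> VOb B; d \<in> VOb B\<rbrakk> \<Longrightarrow> Dom V (FHom \<psi> c d) = VHom B c d"
    and "\<lbrakk>c \<in> VOb B; d \<in> VOb B\<rbrakk> \<Longrightarrow> Cod V (FHom \<psi> c d) = ihom V (PC c) (PC d)"
    and "\<lbrakk>c \<in> VOb B; d \<in> VOb B; k \<in> VOb B; el f; ty f = VHom B c d; el r; ty r = PC c; el p; ty p = FOb \<phi> k;
        f \<sharp> r; f \<sharp> p; r \<sharp> p\<rbrakk> \<Longrightarrow>
      pcv d k (evl (PC c) (PC d) (FHom \<psi> c d \<bullet> f) r) p
      = cmp B k c d f (pcv c k r p)"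
proof -
  note L = limit_functor_rules[OF vfunctor_id_opp \<phi> EBo, folded \<psi>_def yo_def]
  note [simp] = base_rules yo_rules
  \<comment> \<open>\<open>limit_functor\<close> yields a functor on the opposite of
    \<open>opp V B\<close>, which is not literally \<open>B\<close>.\<close>
  show "vfunctor V B VV \<psi>"
    using L(1) by - (rule vfunctor_opp_oppD, simp_all)
  show "c \<in> VOb B \<Longrightarrow> FOb \<psi> c = PC c" using L(2)[of c] by simp
  show [simp]: "FHom \<psi> c d \<in> Arr V" "Dom V (FHom \<psi> c d) = VHom B c d"
    "Cod V (FHom \<psi> c d) = ihom V (PC c) (PC d)" if "c \<in> VOb B" "d \<in> VOb B" for c d
    using L(3-5)[of c d] that by simp_all
  assume a [simp]: "c \<in> VOb B" "d \<in> VOb B" "k \<in> VOb B" "el f" "ty f = VHom B c d" "el r" "ty r = PC c" "el p" "ty p = FOb \<phi> k"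
        "f \<sharp> r" "f \<sharp> p" "r \<sharp> p"
  show "pcv d k (evl (PC c) (PC d) (FHom \<psi> c d \<bullet> f) r) p
      = cmp B k c d f (pcv c k r p)"
    using L(6)[of c d k f r p] apart_sym[OF a(10)] apart_sym[OF a(11)] by simp
qed

lemma PC_rules:
  assumes "c \<in> VOb B"
  shows "PC c \<in> Ob V"
    and "k \<in> VOb B \<Longrightarrow> pc c k \<in> Arr V" and "k \<in> VOb B \<Longrightarrow> Dom V (pc c k) = PC c"
    and "k \<in> VOb B \<Longrightarrow> Cod V (pc c k) = ihom V (FOb \<phi> k) (VHom B k c)"
    and "\<lbrakk>k \<in> VOb B; l \<in> VOb B; el r; ty r = PC c; el u; ty u = VHom B l k; el p; ty p = FOb \<phi> k; r \<sharp> u; r \<sharp> p; u \<sharp> p\<rbrakk> \<Longrightarrow>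
      pcv c l r (act \<phi> k l u p)
      = cmp B l k c (pcv c k r p) u"
proof -
  note [simp] = base_rules yo_rules[OF assms] assms
  show "PC c \<in> Ob V" "k \<in> VOb B \<Longrightarrow> pc c k \<in> Arr V" "k \<in> VOb B \<Longrightarrow> Dom V (pc c k) = PC c"
    "k \<in> VOb B \<Longrightarrow> Cod V (pc c k) = ihom V (FOb \<phi> k) (VHom B k c)" by simp_all
  assume a [simp]: "k \<in> VOb B" "l \<in> VOb B" "el r" "ty r = PC c" "el u" "ty u = VHom B l k" "el p" "ty p = FOb \<phi> k" "r \<sharp> u" "r \<sharp> p" "u \<sharp> p"
  show "pcv c l r (act \<phi> k l u p)
      = cmp B l k c (pcv c k r p) u"
    using Nat_natural[OF EBo \<phi> yo_rules(1)[OF assms], of k l r u p] apart_sym[OF a(9)] by simp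
qed

lemmas psi_rules = base_rules yo_rules PC_rules \<psi>_rules(2-) wcolim_rules[OF \<psi>_rules(1)] weight_comp weight_id

lemma PC_ext:
  assumes c: "c \<in> VOb B" and "el r" "ty r = PC c" "el r'" "ty r' = PC c" "ectx r = ectx r'"
    and "\<And>k p. \<lbrakk>k \<in> VOb B; el p; ty p = FOb \<phi> k; r \<sharp> p; p \<sharp> r; r' \<sharp> p; p \<sharp> r'\<rbrakk> \<Longrightarrow>
      pcv c k r p = pcv c k r' p"
  shows "r = r'"
  by (rule Nat_el_ext[OF EBo \<phi> yo_rules(1)[OF c]]) (use assms yo_rules[OF c] in simp_all)

text \<open>
  \<open>kap b\<close> sends \<open>p\<close> and the class of \<open>q \<otimes> r\<close> to \<open>q \<cdot> (r\<^sub>b p)\<close>: the transpose of the comparison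
  \<open>\<phi> * \<psi> \<rightarrow> [B\<^sup>o\<^sup>p,V](\<phi>, \<phi>)\<close>.
\<close>

lemma kap_exists:
  assumes b [simp]: "b \<in> VOb B"
  shows "\<exists>k. k \<in> Arr V \<and> Dom V k = FOb \<phi> b \<odot> W \<psi> \<and> Cod V k = FOb \<phi> b \<and>
    (\<forall>c\<in>VOb B. \<forall>p q r. el p \<and> ty p = FOb \<phi> b \<and> el q \<and> ty q = FOb \<phi> c \<and> el r \<and> ty r = PC c \<and> p \<sharp> q \<and> p \<sharp> r \<and> q \<sharp> r \<longrightarrow>
      k \<bullet> \<langle>p, coc \<psi> c \<bullet> \<langle>q, r\<rangle>\<rangle>
       = act \<phi> c b (pcv c b r p) q)"
proof -
  note [simp] = psi_rules
  note c = wcolim_colim[OF \<psi>_rules(1)]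
  let ?\<sigma> = "\<lambda>c. ev V (FOb \<phi> c) (FOb \<phi> b) \<cdot> ((FHom \<phi> c b \<cdot> ev V (FOb \<phi> b) (VHom B b c) \<cdot> (pc c b \<otimes> \<one> (FOb \<phi> b))) \<otimes> \<one> (FOb \<phi> c))
     \<cdot> ainv (PC c) (FOb \<phi> b) (FOb \<phi> c) \<cdot> symm V (FOb \<phi> b \<odot> FOb \<phi> c) (PC c)"
  have "balanced B \<phi> \<psi> (FOb \<phi> b) (FOb \<phi> b) ?\<sigma>"
    by (rule balancedI) simp_all
  then obtain k where k: "extends B \<phi> \<psi> (W \<psi>) (coc \<psi>) (FOb \<phi> b) (FOb \<phi> b) ?\<sigma> k"
    using colimD(2)[OF c, of "FOb \<phi> b" "FOb \<phi> b"] by auto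
  note [simp] = extendsD(1-3)[OF k]
  show ?thesis
  proof (intro exI[of _ k] conjI ballI allI impI)
    fix c p q r assume [simp]: "c \<in> VOb B"
      and "el p \<and> ty p = FOb \<phi> b \<and> el q \<and> ty q = FOb \<phi> c \<and> el r \<and> ty r = PC c \<and> p \<sharp> q \<and> p \<sharp> r \<and> q \<sharp> r"
    then have [simp]: "el p" "ty p = FOb \<phi> b" "el q" "ty q = FOb \<phi> c" "el r" "ty r = PC c" "p \<sharp> q" "p \<sharp> r" "q \<sharp> r"
      by simp_all
    note [simp] = apart_sym[OF \<open>p \<sharp> q\<close>] apart_sym[OF \<open>p \<sharp> r\<close>] apart_sym[OF \<open>q \<sharp> r\<close>]
    show "k \<bullet> \<langle>p, coc \<psi> c \<bullet> \<langle>q, r\<rangle>\<rangle>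
       = act \<phi> c b (pcv c b r p) q"
      using extendsD(4)[OF k, of c p q r] by simp
  qed simp_all
qed

definition kap where
  "kap b = (SOME k. k \<in> Arr V \<and> Dom V k = FOb \<phi> b \<odot> W \<psi> \<and> Cod V k = FOb \<phi> b \<and>
    (\<forall>c\<in>VOb B. \<forall>p q r. el p \<and> ty p = FOb \<phi> b \<and> el q \<and> ty q = FOb \<phi> c \<and> el r \<and> ty r = PC c \<and> p \<sharp> q \<and> p \<sharp> r \<and> q \<sharp> r \<longrightarrow>
      k \<bullet> \<langle>p, coc \<psi> c \<bullet> \<langle>q, r\<rangle>\<rangle>
       = act \<phi> c b (pcv c b r p) q))"

lemma kap_rules:
  assumes b: "b \<in> VOb B"
  shows "kap b \<in> Arr V" "Dom V (kap b) = FOb \<phi> b \<odot> W \<psi>" "Cod V (kap b) = FOb \<phi> b"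
    and "\<lbrakk>c \<in> VOb B; el p; ty p = FOb \<phi> b; el q; ty q = FOb \<phi> c; el r; ty r = PC c; p \<sharp> q; p \<sharp> r; q \<sharp> r\<rbrakk> \<Longrightarrow>
      kap b \<bullet> \<langle>p, coc \<psi> c \<bullet> \<langle>q, r\<rangle>\<rangle>
       = act \<phi> c b (pcv c b r p) q"
  using someI_ex[OF kap_exists[OF b], folded kap_def] by simp_all

text \<open>Both sides come from arrows out of a tensor product with \<phi> * \<psi>, so
  \<open>z\<close> may be taken to be the class of \<open>q \<otimes> r\<close>; there the claim is
  naturality of \<open>r\<close> together with functoriality of \<phi>.\<close>

lemma kap_natural:
  assumes k [simp]: "k \<in> VOb B" and l [simp]: "l \<in> VOb B"
    and e [simp]: "el u" "ty u = VHom B l k" "el p" "ty p = FOb \<phi> k" "el z" "ty z = W \<psi>" "u \<sharp> p" "u \<sharp> z" "p \<sharp> z"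
  shows "kap l \<bullet> \<langle>ev V (FOb \<phi> k) (FOb \<phi> l) \<bullet> \<langle>FHom \<phi> k l \<bullet> u, p\<rangle>, z\<rangle>
    = act \<phi> k l u (kap k \<bullet> \<langle>p, z\<rangle>)"
proof -
  note [simp] = psi_rules kap_rules
  note c = wcolim_colim[OF \<psi>_rules(1)]
  let ?l = "kap l \<cdot> ((ev V (FOb \<phi> k) (FOb \<phi> l) \<cdot> (FHom \<phi> k l \<otimes> \<one> (FOb \<phi> k))) \<otimes> \<one> (W \<psi>))"
  let ?r = "ev V (FOb \<phi> k) (FOb \<phi> l) \<cdot> (FHom \<phi> k l \<otimes> kap k) \<cdot> assoc V (VHom B l k) (FOb \<phi> k) (W \<psi>)"
  have "?l = ?r"
    by (rule colim_ext2[OF \<phi> \<psi>_rules(1) c, of "VHom B l k" "FOb \<phi> k"]) simp_all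
  then have "?l \<bullet> \<langle>\<langle>u, p\<rangle>, z\<rangle> = ?r \<bullet> \<langle>\<langle>u, p\<rangle>, z\<rangle>" by simp
  then show ?thesis by simp
qed

text \<open>The equation is the triangle identity on \<phi>: through \<open>kap\<close> the point
  acts as the identity transformation.\<close>

definition dual_point where
  "dual_point u \<longleftrightarrow> u \<in> Arr V \<and> Dom V u = \<I> \<and> Cod V u = W \<psi> \<and>
    (\<forall>b\<in>VOb B. \<forall>p. el p \<and> ty p = FOb \<phi> b \<longrightarrow> kap b \<bullet> \<langle>p, u \<bullet> star\<rangle> = p)"

lemma dual_pointD:
  assumes "dual_point u"
  shows "u \<in> Arr V" "Dom V u = \<I>" "Cod V u = W \<psi>"
    and "\<lbrakk>b \<in> VOb B; el p; ty p = FOb \<phi> b\<rbrakk> \<Longrightarrow> kap b \<bullet> \<langle>p, u \<bullet> star\<rangle> = p"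
  using assms by (auto simp: dual_point_def)

text \<open>The second triangle identity; it follows from the first because \<open>\<psi>\<close> is a right lifting.\<close>

lemma right_triangle:
  assumes c [simp]: "c \<in> VOb B"
  obtains w where "w \<in> Arr V" "Dom V w = W \<psi> \<odot> PC c" "Cod V w = PC c"
    "\<And>k z r p. \<lbrakk>k \<in> VOb B; el z; ty z = W \<psi>; el r; ty r = PC c; el p; ty p = FOb \<phi> k; z \<sharp> r; z \<sharp> p; r \<sharp> p\<rbrakk> \<Longrightarrow>
      pcv c k (w \<bullet> \<langle>z, r\<rangle>) p
      = pcv c k r (kap k \<bullet> \<langle>p, z\<rangle>)"
    "\<And>b q r r'. \<lbrakk>b \<in> VOb B; el q; ty q = FOb \<phi> b; el r; ty r = PC b; el r'; ty r' = PC c; q \<sharp> r; q \<sharp> r'; r \<sharp> r'\<rbrakk> \<Longrightarrow>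
      w \<bullet> \<langle>coc \<psi> b \<bullet> \<langle>q, r\<rangle>, r'\<rangle>
      = evl (PC b) (PC c) (FHom \<psi> b c \<bullet> pcv c b r' q) r"
    "\<And>u r. \<lbrakk>dual_point u; el r; ty r = PC c\<rbrakk> \<Longrightarrow> w \<bullet> \<langle>u \<bullet> star, r\<rangle> = r"
proof -
  note [simp] = psi_rules kap_rules kap_natural
  \<comment> \<open>\<open>w\<close> lets \<phi> * \<psi> act on \<psi> c by precomposition with
    \<open>kap\<close>; a dual point then acts trivially.\<close>
  let ?\<sigma> = "\<lambda>k. ev V (FOb \<phi> k) (VHom B k c) \<cdot> (pc c k \<otimes> (kap k \<cdot> symm V (W \<psi>) (FOb \<phi> k)))
    \<cdot> assoc V (PC c) (W \<psi>) (FOb \<phi> k) \<cdot> (symm V (W \<psi>) (PC c) \<otimes> \<one> (FOb \<phi> k))"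
  obtain w where w [simp]: "w \<in> Arr V" "Dom V w = W \<psi> \<odot> PC c" "Cod V w = PC c"
    and "\<And>a d e s. \<lbrakk>a \<in> VOb (opp V B); el d; ty d = W \<psi>; el e; ty e = PC c; el s; ty s = FOb \<phi> a; d \<sharp> e; d \<sharp> s; e \<sharp> s\<rbrakk> \<Longrightarrow>
      evl (FOb \<phi> a) (FOb (yo c) a) (pc c a \<bullet> w \<bullet> \<langle>d, e\<rangle>) s = ?\<sigma> a \<bullet> \<langle>\<langle>d, e\<rangle>, s\<rangle>"
    by (rule NT_intro2[OF EBo \<phi> yo_rules(1)[OF c], of "W \<psi>" "PC c" ?\<sigma>]) simp_all
  then have w_el: "pcv c k (w \<bullet> \<langle>z, r\<rangle>) p
      = pcv c k r (kap k \<bullet> \<langle>p, z\<rangle>)"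
    if "k \<in> VOb B" "el z" "ty z = W \<psi>" "el r" "ty r = PC c" "el p" "ty p = FOb \<phi> k" "z \<sharp> r" "z \<sharp> p" "r \<sharp> p" for k z r p
    using that apart_sym[OF that(8)] apart_sym[OF that(9)] apart_sym[OF that(10)] by simp
  show ?thesis
  proof (rule that[OF w w_el])
    fix b q r r' assume h [simp]: "b \<in> VOb B" "el q" "ty q = FOb \<phi> b" "el r" "ty r = PC b" "el r'" "ty r' = PC c" "q \<sharp> r" "q \<sharp> r'" "r \<sharp> r'"
    note [simp] = apart_sym[OF h(8)] apart_sym[OF h(9)] apart_sym[OF h(10)]
    show "w \<bullet> \<langle>coc \<psi> b \<bullet> \<langle>q, r\<rangle>, r'\<rangle>
      = evl (PC b) (PC c) (FHom \<psi> b c \<bullet> pcv c b r' q) r"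
      by (rule PC_ext[OF c]) (simp_all add: w_el ectx_ac)
  next
    fix u r assume u: "dual_point u" and r [simp]: "el r" "ty r = PC c"
    note [simp] = dual_pointD[OF u]
    show "w \<bullet> \<langle>u \<bullet> star, r\<rangle> = r"
      by (rule PC_ext[OF c]) (simp_all add: w_el)
  qed
qed

end

section \<open>Representability and continuity\<close>

context smcc
begin

lemma swap_last_rules [simp]:
  assumes "x \<in> Ob V" "y \<in> Ob V" "z \<in> Ob V"
  shows "swap_last x y z \<in> Arr V" "Dom V (swap_last x y z) = (x \<odot> y) \<odot> z" "Cod V (swap_last x y z) = (x \<odot> z) \<odot> y"
  using assms by (simp_all add: swap_last_def)

lemma swap_last_el [simp]:
  assumes "el a" "el b" "el c" "ty a = x" "ty b = y" "ty c = z" "a \<sharp> b" "a \<sharp> c" "b \<sharp> c"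
  shows "swap_last x y z \<bullet> \<langle>\<langle>a, b\<rangle>, c\<rangle> = \<langle>\<langle>a, c\<rangle>, b\<rangle>"
proof -
  have "x \<in> Ob V" "y \<in> Ob V" "z \<in> Ob V" using assms by auto
  then show ?thesis using assms apart_sym[OF assms(9)] by (simp add: swap_last_def)
qed

text \<open>The rules for \<open>cov_hom\<close>, restated with the hom-objects of a functor
  category already rewritten to ends.\<close>

lemma Fun_cov_hom:
  assumes A: "ends_exist A" and F: "vfunctor V A VV F" and G: "vfunctor V A VV G"
  shows "FOb (cov_hom V (Fun A) F) G = NT A F G"
    and "vfunctor V A VV H \<Longrightarrow> FHom (cov_hom V (Fun A) F) G H \<in> Arr V"
    and "vfunctor V A VV H \<Longrightarrow> Dom V (FHom (cov_hom V (Fun A) F) G H) = NT A G H"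
    and "vfunctor V A VV H \<Longrightarrow> Cod V (FHom (cov_hom V (Fun A) F) G H) = ihom V (NT A F G) (NT A F H)"
    and "\<lbrakk>vfunctor V A VV H; el g; ty g = NT A G H; el f; ty f = NT A F G; g \<sharp> f\<rbrakk> \<Longrightarrow>
      evl (NT A F G) (NT A F H) (FHom (cov_hom V (Fun A) F) G H \<bullet> g) f = cmp (Fun A) F G H g f"
  using cov_hom_typing(1)[OF vcategory_Fun[OF A], of F G] cov_hom_typing(2-4)[OF vcategory_Fun[OF A], of F G H] cov_hom_eval[OF vcategory_Fun[OF A], of F G H g f] F G
  by simp_all

lemma familyI2:
  assumes T: "vfunctor V X A T" and \<phi>: "vfunctor V X VV \<phi>" and [simp]: "a \<in> VOb A" "x \<in> Ob V" "y \<in> Ob V"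
    and \<sigma> [simp]: "\<And>k. k \<in> VOb X \<Longrightarrow> \<sigma> k \<in> Arr V" "\<And>k. k \<in> VOb X \<Longrightarrow> Dom V (\<sigma> k) = (x \<odot> y) \<odot> FOb \<phi> k"
      "\<And>k. k \<in> VOb X \<Longrightarrow> Cod V (\<sigma> k) = VHom A a (FOb T k)"
    and nat: "\<And>k l d e u p. \<lbrakk>k \<in> VOb X; l \<in> VOb X; el d; ty d = x; el e; ty e = y; el u; ty u = VHom X k l; el p; ty p = FOb \<phi> k;
       d \<sharp> e; e \<sharp> d; d \<sharp> u; u \<sharp> d; d \<sharp> p; p \<sharp> d; e \<sharp> u; u \<sharp> e; e \<sharp> p; p \<sharp> e; u \<sharp> p; p \<sharp> u\<rbrakk> \<Longrightarrow>
       \<sigma> l \<bullet> \<langle>\<langle>d, e\<rangle>, act \<phi> k l u p\<rangle>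
       = cmp A a (FOb T k) (FOb T l) (FHom T k l \<bullet> u) (\<sigma> k \<bullet> \<langle>\<langle>d, e\<rangle>, p\<rangle>)"
  shows "family A X \<phi> T a (x \<odot> y) \<sigma>"
proof (rule familyI)
  note [simp] = vfunctor_vcategory[OF T] vfunctor_rules[OF T] vfunctor_rules[OF \<phi>] vfunctor_self_Ob[OF \<phi>]
  fix k l z u p
  assume [simp]: "k \<in> VOb X" "l \<in> VOb X" "el z" "ty z = x \<odot> y" "el u" "ty u = VHom X k l" "el p" "ty p = FOb \<phi> k"
    "z \<sharp> u" "u \<sharp> z" "z \<sharp> p" "p \<sharp> z" "u \<sharp> p" "p \<sharp> u"
  let ?l = "\<sigma> l \<cdot> (\<one> (x \<odot> y) \<otimes> (ev V (FOb \<phi> k) (FOb \<phi> l) \<cdot> (FHom \<phi> k l \<otimes> \<one> (FOb \<phi> k))))"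
  let ?r = "VComp A a (FOb T k) (FOb T l) \<cdot> (FHom T k l \<otimes> \<sigma> k) \<cdot> assoc V (VHom X k l) (x \<odot> y) (FOb \<phi> k)
     \<cdot> (symm V (x \<odot> y) (VHom X k l) \<otimes> \<one> (FOb \<phi> k)) \<cdot> ainv (x \<odot> y) (VHom X k l) (FOb \<phi> k)"
  have "?l = ?r"
    by (rule arrow_ext22[of _ _ x y "VHom X k l" "FOb \<phi> k"]) (simp_all add: nat)
  then have "?l \<bullet> \<langle>z, \<langle>u, p\<rangle>\<rangle> = ?r \<bullet> \<langle>z, \<langle>u, p\<rangle>\<rangle>" by simp
  then show "\<sigma> l \<bullet> \<langle>z, act \<phi> k l u p\<rangle>
       = cmp A a (FOb T k) (FOb T l) (FHom T k l \<bullet> u) (\<sigma> k \<bullet> \<langle>z, p\<rangle>)"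
    by simp
qed simp_all

lemma wlim_ext2:
  assumes w: "wlim A X \<phi> T L \<eta>" and T: "vfunctor V X A T" and \<phi>: "vfunctor V X VV \<phi>"
    and a [simp]: "a \<in> VOb A" and [simp]: "x \<in> Ob V" "y \<in> Ob V"
    and h [simp]: "h \<in> Arr V" "Dom V h = x \<odot> y" "Cod V h = VHom A a L"
    and h' [simp]: "h' \<in> Arr V" "Dom V h' = x \<odot> y" "Cod V h' = VHom A a L"
    and eq: "\<And>k d e p. \<lbrakk>k \<in> VOb X; el d; ty d = x; el e; ty e = y; el p; ty p = FOb \<phi> k; d \<sharp> e; e \<sharp> d; d \<sharp> p; p \<sharp> d; e \<sharp> p; p \<sharp> e\<rbrakk> \<Longrightarrow>
       cmp A a L (FOb T k) (\<eta> k \<bullet> p) (h \<bullet> \<langle>d, e\<rangle>) = cmp A a L (FOb T k) (\<eta> k \<bullet> p) (h' \<bullet> \<langle>d, e\<rangle>)"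
  shows "h = h'"
proof (rule wlim_ext[OF w T \<phi> a h(1,3) h'(1,3)])
  note [simp] = vfunctor_vcategory[OF T] vfunctor_rules[OF T] vfunctor_rules[OF \<phi>] vfunctor_self_Ob[OF \<phi>]
    wlimD(1)[OF w] cylinderD(1-3)[OF wlimD(2)[OF w]]
  show "Dom V h = Dom V h'" by simp
  fix k z p
  assume "k \<in> VOb X" "el z" "ty z = Dom V h'" "el p" "ty p = FOb \<phi> k" "z \<sharp> p" "p \<sharp> z"
  then have [simp]: "k \<in> VOb X" "el z" "ty z = x \<odot> y" "el p" "ty p = FOb \<phi> k" "z \<sharp> p" "p \<sharp> z" by simp_all
  have "VComp A a L (FOb T k) \<cdot> (\<eta> k \<otimes> h) \<cdot> symm V (x \<odot> y) (FOb \<phi> k) = VComp A a L (FOb T k) \<cdot> (\<eta> k \<otimes> h') \<cdot> symm V (x \<odot> y) (FOb \<phi> k)"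
    by (rule arrow_ext3[of _ _ x y "FOb \<phi> k"]) (simp_all add: eq)
  then have "(VComp A a L (FOb T k) \<cdot> (\<eta> k \<otimes> h) \<cdot> symm V (x \<odot> y) (FOb \<phi> k)) \<bullet> \<langle>z, p\<rangle>
    = (VComp A a L (FOb T k) \<cdot> (\<eta> k \<otimes> h') \<cdot> symm V (x \<odot> y) (FOb \<phi> k)) \<bullet> \<langle>z, p\<rangle>" by simp
  then show "cmp A a L (FOb T k) (\<eta> k \<bullet> p) (h \<bullet> z) = cmp A a L (FOb T k) (\<eta> k \<bullet> p) (h' \<bullet> z)" by simp
qed

lemma app_inverse_cancel:
  assumes "iso_arrow V x y f" "el a"
  shows "ty a = x \<Longrightarrow> inverse_of V f \<bullet> f \<bullet> a = a" "ty a = y \<Longrightarrow> f \<bullet> inverse_of V f \<bullet> a = a"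
proof -
  note i = iso_arrow_inverse[OF assms(1)]
  show "inverse_of V f \<bullet> f \<bullet> a = a" if "ty a = x"
    using app_left_inverse[OF assms(1,2) that refl] .
  show "f \<bullet> inverse_of V f \<bullet> a = a" if "ty a = y"
    using i assms that by (subst app_comp[symmetric]) simp_all
qed

text \<open>Through the representation, a family of maps from \<open>y\<close> to \<open>F T\<close>
  in context \<open>x\<close> is a family of arrows from \<open>a\<close> to \<open>T\<close> in
  context \<open>x \<odot> y\<close>. The universal property in \<open>A\<close> for that larger
  context gives the one in the base.\<close>

theorem representable_preserves_wlimit:
  assumes T: "vfunctor V (opp V K) A T" and w: "is_weight V K \<phi>" and F: "vfunctor V A VV F"
    and X: "ends_exist (opp V K)" and rep: "v_representable V A F"
  shows "preserves_wlimit V A VV F K \<phi> T"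
  unfolding preserves_wlimit_iff[OF T w F X]
proof (intro allI impI)
  note \<phi> = w[unfolded is_weight_def] and A = vfunctor_vcategory(1)[OF F]
  obtain a \<theta> where a [simp]: "a \<in> VOb A" and \<theta>: "vnat_iso V A VV (cov_hom V A a) F \<theta>"
    using rep by (auto simp: v_representable_def)
  let ?X = "opp V K"
  note [simp] = A vfunctor_rules[OF F] vfunctor_self_Ob[OF F] vfunctor_rules[OF T] vfunctor_rules[OF \<phi>] vfunctor_self_Ob[OF \<phi>]
  have VX [simp]: "vcategory V (opp V K)" using vfunctor_vcategory[OF T] by simp
  define t where "t = (\<lambda>c. unname V (FOb (cov_hom V A a) c) (FOb F c) (\<theta> c))"
  have nat: "natural A (cov_hom V A a) F t" and tiso: "\<And>c. c \<in> VOb A \<Longrightarrow> iso_arrow V (VHom A a c) (FOb F c) (t c)"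
    using \<theta> unfolding vnat_iso_iff[OF vfunctor_cov_hom[OF A a] F] by (simp_all add: t_def)
  note ti = iso_arrow_inverse[OF tiso] and cancel = app_inverse_cancel[OF tiso]
  have t_comp: "t d \<bullet> cmp A a c d f s = act F c d f (t c \<bullet> s)"
    if "c \<in> VOb A" "d \<in> VOb A" "el f" "ty f = VHom A c d" "el s" "ty s = VHom A a c" "f \<sharp> s" for c d f s
    using naturalD(4)[OF nat, of c d f s] that by simp
  have ti_comp: "inverse_of V (t d) \<bullet> act F c d f z = cmp A a c d f (inverse_of V (t c) \<bullet> z)"
    if h [simp]: "c \<in> VOb A" "d \<in> VOb A" "el f" "ty f = VHom A c d" "el z" "ty z = FOb F c" "f \<sharp> z" for c d f z
  proof -
    have "act F c d f z = t d \<bullet> cmp A a c d f (inverse_of V (t c) \<bullet> z)"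
      using ti by (simp add: t_comp cancel)
    then show ?thesis using ti by (simp add: cancel)
  qed
  fix L \<eta> assume lim: "wlim A ?X \<phi> T L \<eta>"
  note L [simp] = wlimD(1)[OF lim]
  note [simp] = cylinderD[OF wlimD(2)[OF lim]]
  show "wlim VV ?X \<phi> (comp_vfun V ?X F T) (FOb F L) (\<lambda>k. FHom F L (FOb T k) \<cdot> \<eta> k)"
  proof (rule wlimI)
    show "FOb F L \<in> VOb VV" by simp
    show "cylinder VV ?X \<phi> (comp_vfun V ?X F T) (FOb F L) (\<lambda>k. FHom F L (FOb T k) \<cdot> \<eta> k)"
      by (rule cylinderI) (simp_all del: opp_simps)
  next
    fix y x \<sigma> assume "y \<in> VOb VV" and x [simp]: "x \<in> Ob V" and fam: "family VV ?X \<phi> (comp_vfun V ?X F T) y x \<sigma>"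
    then have y [simp]: "y \<in> Ob V" by simp
    have \<sigma> [simp]: "\<sigma> k \<in> Arr V" "Dom V (\<sigma> k) = x \<odot> FOb \<phi> k" "Cod V (\<sigma> k) = ihom V y (FOb F (FOb T k))" if "k \<in> VOb ?X" for k
      using familyD(1-3)[OF fam that] that by (simp_all del: opp_simps)
    have \<sigma>_nat: "\<sigma> l \<bullet> \<langle>e, act \<phi> k l u p\<rangle>
       = cmp VV y (FOb F (FOb T k)) (FOb F (FOb T l)) (FHom F (FOb T k) (FOb T l) \<bullet> FHom T k l \<bullet> u) (\<sigma> k \<bullet> \<langle>e, p\<rangle>)"
      if "k \<in> VOb ?X" "l \<in> VOb ?X" "el e" "ty e = x" "el u" "ty u = VHom ?X k l" "el p" "ty p = FOb \<phi> k" "e \<sharp> u" "e \<sharp> p" "u \<sharp> p" for k l e u p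
      using familyD(4)[OF fam that(1-11)] that by (simp del: opp_simps)
    let ?\<tau> = "\<lambda>k. inverse_of V (t (FOb T k)) \<cdot> ev V y (FOb F (FOb T k)) \<cdot> (\<sigma> k \<otimes> \<one> y) \<cdot> swap_last x y (FOb \<phi> k)"
    have "family A ?X \<phi> T a (x \<odot> y) ?\<tau>"
      by (rule familyI2[OF T \<phi>]) (use ti in \<open>simp_all add: \<sigma>_nat ti_comp del: opp_simps\<close>)
    then obtain h where h: "factors A ?X \<phi> T L \<eta> a (x \<odot> y) ?\<tau> h"
      using wlimD(3)[OF lim a _, of "x \<odot> y" ?\<tau>] by auto
    note [simp] = factorsD(1-3)[OF h]
    have h_el: "cmp A a L (FOb T k) (\<eta> k \<bullet> p) (h \<bullet> \<langle>e, v\<rangle>) = inverse_of V (t (FOb T k)) \<bullet> evl y (FOb F (FOb T k)) (\<sigma> k \<bullet> \<langle>e, p\<rangle>) v"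
      if h' [simp]: "k \<in> VOb ?X" "el e" "ty e = x" "el v" "ty v = y" "el p" "ty p = FOb \<phi> k" "e \<sharp> v" "e \<sharp> p" "v \<sharp> p" for k e v p
      using factorsD(4)[OF h, of k "\<langle>e, v\<rangle>" p] ti apart_sym[OF h'(10)] by (simp del: opp_simps)
    have "factors VV ?X \<phi> (comp_vfun V ?X F T) (FOb F L) (\<lambda>k. FHom F L (FOb T k) \<cdot> \<eta> k) y x \<sigma> (transp V x y (FOb F L) (t L \<cdot> h))"
    proof (rule factorsI)
      fix k e p assume [simp]: "k \<in> VOb ?X" "el e" "ty e = x" "el p" "ty p = FOb \<phi> k" "e \<sharp> p" "p \<sharp> e"
      show "cmp VV y (FOb F L) (FOb (comp_vfun V ?X F T) k) ((FHom F L (FOb T k) \<cdot> \<eta> k) \<bullet> p) (transp V x y (FOb F L) (t L \<cdot> h) \<bullet> e) = \<sigma> k \<bullet> \<langle>e, p\<rangle>"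
        by (rule eval_ext[of _ y "FOb F (FOb T k)"])
          (use ti in \<open>simp_all add: t_comp[symmetric] h_el cancel ectx_ac del: opp_simps\<close>)
    qed (use ti in \<open>simp_all del: opp_simps\<close>)
    then show "\<exists>h. factors VV ?X \<phi> (comp_vfun V ?X F T) (FOb F L) (\<lambda>k. FHom F L (FOb T k) \<cdot> \<eta> k) y x \<sigma> h" ..
  next
    fix y x \<sigma> h h' assume "y \<in> VOb VV" and x [simp]: "x \<in> Ob V"
      and h: "factors VV ?X \<phi> (comp_vfun V ?X F T) (FOb F L) (\<lambda>k. FHom F L (FOb T k) \<cdot> \<eta> k) y x \<sigma> h"
      and h': "factors VV ?X \<phi> (comp_vfun V ?X F T) (FOb F L) (\<lambda>k. FHom F L (FOb T k) \<cdot> \<eta> k) y x \<sigma> h'"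
    then have y [simp]: "y \<in> Ob V" by simp
    have [simp]: "h \<in> Arr V" "Dom V h = x" "Cod V h = ihom V y (FOb F L)" "h' \<in> Arr V" "Dom V h' = x" "Cod V h' = ihom V y (FOb F L)"
      using factorsD(1-3)[OF h] factorsD(1-3)[OF h'] by simp_all
    let ?g = "\<lambda>h. inverse_of V (t L) \<cdot> ev V y (FOb F L) \<cdot> (h \<otimes> \<one> y)"
    have "?g h = ?g h'"
    proof (rule wlim_ext2[OF lim T \<phi> a x y])
      fix k d e p
      assume [simp]: "k \<in> VOb ?X" "el d" "ty d = x" "el e" "ty e = y" "el p" "ty p = FOb \<phi> k" "d \<sharp> e" "e \<sharp> d" "d \<sharp> p" "p \<sharp> d" "e \<sharp> p" "p \<sharp> e"
      have "cmp VV y (FOb F L) (FOb F (FOb T k)) (FHom F L (FOb T k) \<bullet> \<eta> k \<bullet> p) (h \<bullet> d) = cmp VV y (FOb F L) (FOb F (FOb T k)) (FHom F L (FOb T k) \<bullet> \<eta> k \<bullet> p) (h' \<bullet> d)"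
        using factorsD(4)[OF h, of k d p] factorsD(4)[OF h', of k d p] by (simp del: opp_simps)
      then have "evl y (FOb F (FOb T k)) (cmp VV y (FOb F L) (FOb F (FOb T k)) (FHom F L (FOb T k) \<bullet> \<eta> k \<bullet> p) (h \<bullet> d)) e = evl y (FOb F (FOb T k)) (cmp VV y (FOb F L) (FOb F (FOb T k)) (FHom F L (FOb T k) \<bullet> \<eta> k \<bullet> p) (h' \<bullet> d)) e"
        by (rule arg_cong)
      then show "cmp A a L (FOb T k) (\<eta> k \<bullet> p) (?g h \<bullet> \<langle>d, e\<rangle>) = cmp A a L (FOb T k) (\<eta> k \<bullet> p) (?g h' \<bullet> \<langle>d, e\<rangle>)"
        using ti by (simp add: ti_comp[symmetric] del: opp_simps)
    qed (use ti in simp_all)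
    then have *: "t L \<bullet> ?g h \<bullet> c = t L \<bullet> ?g h' \<bullet> c" for c by simp
    show "h = h'"
    proof (rule app_transp_ext[of _ _ x y "FOb F L"])
      fix e v assume "el e" "ty e = x" "el v" "ty v = y" "e \<sharp> v" "v \<sharp> e"
      then show "evl y (FOb F L) (h \<bullet> e) v = evl y (FOb F L) (h' \<bullet> e) v"
        using *[of "\<langle>e, v\<rangle>"] ti by (simp add: cancel)
    qed simp_all
  qed
qed

end

section \<open>A dual point makes \<psi> a representing object\<close>

context small_weight
begin

text \<open>The inverse \<open>M\<close> of \<open>t S\<close> sends the class of
  \<open>p \<otimes> s\<close> to the transformation \<open>r \<mapsto> S (r p) s\<close>. One
  composite is the identity by the triangle identity on \<phi>, the other by the one on
  \<psi>.\<close>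

theorem dual_point_representable:
  assumes u: "dual_point u"
  shows "v_representable V (Fun B) WF"
proof -
  note [simp] = psi_rules \<psi>_rules(1) kap_rules dual_pointD[OF u] FHom_WF Fun_cov_hom[OF EB \<psi>_rules(1)]
  note c\<psi> = wcolim_colim[OF \<psi>_rules(1)]
  have cov: "vfunctor V (Fun B) VV (cov_hom V (Fun B) \<psi>)"
    by (rule vfunctor_cov_hom) simp_all
  define t where "t S = ev V (W \<psi>) (W S) \<cdot> (FHom WF \<psi> S \<otimes> u) \<cdot> rinv (NT B \<psi> S)" for S
  have t: "t S \<in> Arr V" "Dom V (t S) = NT B \<psi> S" "Cod V (t S) = W S"
    "\<And>r. el r \<Longrightarrow> ty r = NT B \<psi> S \<Longrightarrow> t S \<bullet> r = evl (W \<psi>) (W S) (FHom WF \<psi> S \<bullet> r) (u \<bullet> star)"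
    if S [simp]: "vfunctor V B VV S" for S
    using wcolim_rules(1)[OF S] by (simp_all add: t_def)
  have nat: "natural (Fun B) (cov_hom V (Fun B) \<psi>) WF t"
  proof (rule naturalI)
    fix S S' f s
    assume "S \<in> VOb (Fun B)" "S' \<in> VOb (Fun B)" "el f" "ty f = VHom (Fun B) S S'" "el s" "ty s = FOb (cov_hom V (Fun B) \<psi>) S" "f \<sharp> s" "s \<sharp> f"
    then have S [simp]: "vfunctor V B VV S" and S' [simp]: "vfunctor V B VV S'" and
      [simp]: "el f" "ty f = NT B S S'" "el s" "ty s = NT B \<psi> S" "f \<sharp> s" "s \<sharp> f" by simp_all
    have "FHom WF \<psi> S' \<bullet> cmp (Fun B) \<psi> S S' f s = cmp VV (W \<psi>) (W S) (W S') (FHom WF S S' \<bullet> f) (FHom WF \<psi> S \<bullet> s)"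
      using FHom_VComp_el[OF vfunctor_WF, of \<psi> S S' f s] by simp
    then show "t S' \<bullet> act (cov_hom V (Fun B) \<psi>) S S' f s
      = act WF S S' f (t S \<bullet> s)"
      using wcolim_rules(1)[OF S] wcolim_rules(1)[OF S'] by (simp add: t)
  qed (simp_all add: t)
  have iso: "iso_arrow V (NT B \<psi> S) (W S) (t S)" if S: "vfunctor V B VV S" for S
  proof -
    note [simp] = S vfunctor_rules[OF S] vfunctor_self_Ob[OF S] wcolim_rules[OF S] t[OF S]
    note cS = wcolim_colim[OF S]
    let ?P = "\<lambda>b h. h \<in> Arr V \<and> Dom V h = FOb \<phi> b \<odot> FOb S b \<and> Cod V h = NT B \<psi> S \<and>
       (\<forall>c p s r. c \<in> VOb B \<longrightarrow> el p \<longrightarrow> ty p = FOb \<phi> b \<longrightarrow> el s \<longrightarrow> ty s = FOb S b \<longrightarrow> el r \<longrightarrow> ty r = PC c \<longrightarrow> p \<sharp> s \<longrightarrow> p \<sharp> r \<longrightarrow> s \<sharp> r \<longrightarrow>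
         evl (PC c) (FOb S c) (pr B \<psi> S c \<bullet> h \<bullet> \<langle>p, s\<rangle>) r
         = act S b c (pcv c b r p) s)"
    have ex: "\<exists>h. ?P b h"
      if b [simp]: "b \<in> VOb B" for b
    proof -
      let ?\<sigma> = "\<lambda>c. ev V (FOb S b) (FOb S c) \<cdot> ((FHom S b c \<cdot> ev V (FOb \<phi> b) (VHom B b c) \<cdot> (pc c b \<otimes> \<one> (FOb \<phi> b))) \<otimes> \<one> (FOb S b))
        \<cdot> ainv (PC c) (FOb \<phi> b) (FOb S b) \<cdot> symm V (FOb \<phi> b \<odot> FOb S b) (PC c)"
      obtain h where h: "h \<in> Arr V" "Dom V h = FOb \<phi> b \<odot> FOb S b" "Cod V h = NT B \<psi> S"
        "\<And>c p s r. \<lbrakk>c \<in> VOb B; el p; ty p = FOb \<phi> b; el s; ty s = FOb S b; el r; ty r = FOb \<psi> c; p \<sharp> s; p \<sharp> r; s \<sharp> r\<rbrakk> \<Longrightarrow>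
           cpt B \<psi> S c (h \<bullet> \<langle>p, s\<rangle>) r = ?\<sigma> c \<bullet> \<langle>\<langle>p, s\<rangle>, r\<rangle>"
        by (rule NT_intro2[OF EB \<psi>_rules(1) S, of "FOb \<phi> b" "FOb S b" ?\<sigma>]) simp_all
      show ?thesis
      proof (intro exI[of _ h] conjI allI impI)
        fix c p s r assume a [simp]: "c \<in> VOb B" "el p" "ty p = FOb \<phi> b" "el s" "ty s = FOb S b" "el r" "ty r = PC c" "p \<sharp> s" "p \<sharp> r" "s \<sharp> r"
        show "evl (PC c) (FOb S c) (pr B \<psi> S c \<bullet> h \<bullet> \<langle>p, s\<rangle>) r
         = act S b c (pcv c b r p) s"
          using h(4)[of c p s r] apart_sym[OF a(9)] apart_sym[OF a(10)] by simp
      qed (use h in simp_all)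
    qed
    define m where "m = (\<lambda>b. SOME h. ?P b h)"
    have mP: "?P b (m b)" if "b \<in> VOb B" for b
      unfolding m_def by (rule someI_ex[OF ex[OF that]])
    have m [simp]: "\<And>b. b \<in> VOb B \<Longrightarrow> m b \<in> Arr V" "\<And>b. b \<in> VOb B \<Longrightarrow> Dom V (m b) = FOb \<phi> b \<odot> FOb S b"
        "\<And>b. b \<in> VOb B \<Longrightarrow> Cod V (m b) = NT B \<psi> S"
      and m_el [simp]: "\<And>b c p s r. \<lbrakk>b \<in> VOb B; c \<in> VOb B; el p; ty p = FOb \<phi> b; el s; ty s = FOb S b; el r; ty r = PC c; p \<sharp> s; p \<sharp> r; s \<sharp> r\<rbrakk> \<Longrightarrow>
         evl (PC c) (FOb S c) (pr B \<psi> S c \<bullet> m b \<bullet> \<langle>p, s\<rangle>) r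
         = act S b c (pcv c b r p) s"
      using mP by simp_all
    have cob: "cobalanced B \<phi> S (NT B \<psi> S) m"
    proof (rule cobalancedI)
      fix b c q f s
      assume [simp]: "b \<in> VOb B" "c \<in> VOb B" "el q" "ty q = FOb \<phi> c" "el f" "ty f = VHom B b c" "el s" "ty s = FOb S b"
        "q \<sharp> f" "f \<sharp> q" "q \<sharp> s" "s \<sharp> q" "f \<sharp> s" "s \<sharp> f"
      show "m b \<bullet> \<langle>ev V (FOb \<phi> c) (FOb \<phi> b) \<bullet> \<langle>FHom \<phi> c b \<bullet> f, q\<rangle>, s\<rangle> = m c \<bullet> \<langle>q, act S b c f s\<rangle>"
        by (rule Nat_el_ext[OF EB \<psi>_rules(1) S]) (simp_all add: ectx_ac)
    qed simp_all
    obtain M where M [simp]: "M \<in> Arr V" "Dom V M = W S" "Cod V M = NT B \<psi> S"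
      and M_el [simp]: "\<And>b q s. \<lbrakk>b \<in> VOb B; el q; ty q = FOb \<phi> b; el s; ty s = FOb S b; q \<sharp> s\<rbrakk> \<Longrightarrow> M \<bullet> coc S b \<bullet> \<langle>q, s\<rangle> = m b \<bullet> \<langle>q, s\<rangle>"
      by (rule colim_desc[OF \<phi> S cS cob], rule that)
    \<comment> \<open>If \<open>z\<close> is the class of \<open>q \<otimes> r\<close>, the two
      sides differ by moving the arrow \<open>r p\<close> of \<open>B\<close> across the tensor
      product.\<close>
    have tm: "evl (W \<psi>) (W S) (FHom WF \<psi> S \<bullet> m b \<bullet> \<langle>p, s\<rangle>) z = coc S b \<bullet> \<langle>kap b \<bullet> \<langle>p, z\<rangle>, s\<rangle>"
      if h [simp]: "b \<in> VOb B" "el p" "ty p = FOb \<phi> b" "el s" "ty s = FOb S b" "el z" "ty z = W \<psi>" "p \<sharp> s" "p \<sharp> z" "s \<sharp> z" for b p s z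
    proof -
      let ?l = "ev V (W \<psi>) (W S) \<cdot> ((FHom WF \<psi> S \<cdot> m b) \<otimes> \<one> (W \<psi>))"
      let ?r = "coc S b \<cdot> (kap b \<otimes> \<one> (FOb S b)) \<cdot> swap_last (FOb \<phi> b) (FOb S b) (W \<psi>)"
      have "?l = ?r"
        by (rule colim_ext2[OF \<phi> \<psi>_rules(1) c\<psi>, of "FOb \<phi> b" "FOb S b"])
          (simp_all add: cobalancedD(5)[OF colimD(1)[OF cS]])
      then have "?l \<bullet> \<langle>\<langle>p, s\<rangle>, z\<rangle> = ?r \<bullet> \<langle>\<langle>p, s\<rangle>, z\<rangle>" by simp
      then show ?thesis using apart_sym[OF h(10)] by simp
    qed
    have "t S \<cdot> M = \<one> (W S)"
      by (rule colim_ext0[OF \<phi> S cS]) (simp_all add: tm)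
    moreover have "M \<cdot> t S = \<one> (NT B \<psi> S)"
    proof (rule arrow_ext[of _ _ "NT B \<psi> S"])
      fix e assume e [simp]: "el e" "ty e = NT B \<psi> S"
      show "(M \<cdot> t S) \<bullet> e = \<one> (NT B \<psi> S) \<bullet> e"
      proof (rule Nat_el_ext[OF EB \<psi>_rules(1) S])
        fix c r assume "c \<in> VOb B" "el r" "ty r = FOb \<psi> c" "(M \<cdot> t S) \<bullet> e \<sharp> r" "r \<sharp> (M \<cdot> t S) \<bullet> e"
        then have c [simp]: "c \<in> VOb B" and [simp]: "el r" "ty r = PC c" "e \<sharp> r" "r \<sharp> e" by simp_all
        obtain w where w [simp]: "w \<in> Arr V" "Dom V w = W \<psi> \<odot> PC c" "Cod V w = PC c"
          and "\<And>k z r p. \<lbrakk>k \<in> VOb B; el z; ty z = W \<psi>; el r; ty r = PC c; el p; ty p = FOb \<phi> k; z \<sharp> r; z \<sharp> p; r \<sharp> p\<rbrakk> \<Longrightarrow>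
            pcv c k (w \<bullet> \<langle>z, r\<rangle>) p = pcv c k r (kap k \<bullet> \<langle>p, z\<rangle>)"
          and w_coc [simp]: "\<And>b q r r'. \<lbrakk>b \<in> VOb B; el q; ty q = FOb \<phi> b; el r; ty r = PC b; el r'; ty r' = PC c; q \<sharp> r; q \<sharp> r'; r \<sharp> r'\<rbrakk> \<Longrightarrow>
            w \<bullet> \<langle>coc \<psi> b \<bullet> \<langle>q, r\<rangle>, r'\<rangle> = evl (PC b) (PC c) (FHom \<psi> b c \<bullet> pcv c b r' q) r"
          and w_u: "\<And>u r. \<lbrakk>dual_point u; el r; ty r = PC c\<rbrakk> \<Longrightarrow> w \<bullet> \<langle>u \<bullet> star, r\<rangle> = r"
          by (rule right_triangle[OF c], rule that)
        let ?l = "ev V (PC c) (FOb S c) \<cdot> ((pr B \<psi> S c \<cdot> M \<cdot> ev V (W \<psi>) (W S) \<cdot> (FHom WF \<psi> S \<otimes> \<one> (W \<psi>))) \<otimes> \<one> (PC c))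
          \<cdot> swap_last (NT B \<psi> S) (PC c) (W \<psi>)"
        let ?r = "ev V (PC c) (FOb S c) \<cdot> (pr B \<psi> S c \<otimes> (w \<cdot> symm V (PC c) (W \<psi>))) \<cdot> assoc V (NT B \<psi> S) (PC c) (W \<psi>)"
        have nat\<psi>: "evl (PC d) (FOb S d) (pr B \<psi> S d \<bullet> n) (evl (PC b) (PC d) (FHom \<psi> b d \<bullet> f) r')
          = act S b d f (evl (PC b) (FOb S b) (pr B \<psi> S b \<bullet> n) r')"
          if "b \<in> VOb B" "d \<in> VOb B" "el n" "ty n = NT B \<psi> S" "el f" "ty f = VHom B b d" "el r'" "ty r' = PC b" "n \<sharp> f" "n \<sharp> r'" "f \<sharp> r'" for b d n f r'
          using Nat_natural[OF EB \<psi>_rules(1) S, of b d n f r'] that by simp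
        \<comment> \<open>Proved with a variable element of \<phi> * \<psi> in place of
          \<open>u\<close>, since \<open>u\<close> itself need not be the class of a pair;
          \<open>u\<close> is substituted afterwards and \<open>w_u\<close> removes it.\<close>
        have "?l = ?r"
          by (rule colim_ext2[OF \<phi> \<psi>_rules(1) c\<psi>, of "NT B \<psi> S" "PC c"]) (simp_all add: nat\<psi>)
        then have "?l \<bullet> \<langle>\<langle>e, r\<rangle>, u \<bullet> star\<rangle> = ?r \<bullet> \<langle>\<langle>e, r\<rangle>, u \<bullet> star\<rangle>" by simp
        then show "cpt B \<psi> S c ((M \<cdot> t S) \<bullet> e) r = cpt B \<psi> S c (\<one> (NT B \<psi> S) \<bullet> e) r"
          by (simp add: w_u[OF u])
      qed simp_all
    qed simp_all
    ultimately show ?thesis by (auto simp: iso_arrow_def inverse_arrows_def hom_iff intro!: exI[of _ M])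
  qed
  let ?\<theta> = "\<lambda>S. name (NT B \<psi> S) (W S) (t S)"
  have un: "unname V (FOb (cov_hom V (Fun B) \<psi>) S) (FOb WF S) (?\<theta> S) = t S" if "vfunctor V B VV S" for S
    using that by (simp add: t)
  have "vnat_iso V (Fun B) VV (cov_hom V (Fun B) \<psi>) WF ?\<theta>"
    unfolding vnat_iso_iff[OF cov vfunctor_WF]
  proof (intro conjI ballI)
    show "natural (Fun B) (cov_hom V (Fun B) \<psi>) WF (\<lambda>S. unname V (FOb (cov_hom V (Fun B) \<psi>) S) (FOb WF S) (?\<theta> S))"
      using nat un unfolding natural_def by simp
  qed (simp_all add: hom_iff t iso un)
  then show ?thesis
    unfolding v_representable_def by (intro bexI[of _ \<psi>] exI[of _ ?\<theta>]) simp_all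
qed

end

section \<open>Small projectivity\<close>

context small_weight
begin

abbreviation "PP \<equiv> Fun (opp V B)"
abbreviation "NP \<equiv> NT (opp V B)"
abbreviation "pp \<equiv> pr (opp V B)"
abbreviation "pcpt \<equiv> cpt (opp V B)"

lemma presheaf_comp:
  assumes "vfunctor V (opp V B) VV \<chi>" "b \<in> VOb B" "c \<in> VOb B" "d \<in> VOb B" "el f" "ty f = VHom B c d" "el g" "ty g = VHom B b c" "f \<sharp> g"
  shows "FHom \<chi> d b \<bullet> cmp B b c d f g
    = cmp VV (FOb \<chi> d) (FOb \<chi> c) (FOb \<chi> b) (FHom \<chi> c b \<bullet> g) (FHom \<chi> d c \<bullet> f)"
  using FHom_VComp_el[OF assms(1), of d c b g f] assms apart_sym[OF assms(9)] base_rules by simp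

lemma presheaf_natural:
  assumes "vfunctor V (opp V B) VV \<chi>" "vfunctor V (opp V B) VV \<chi>'" "a \<in> VOb B" "b \<in> VOb B"
    "el e" "ty e = NP \<chi> \<chi>'" "el f" "ty f = VHom B b a" "el s" "ty s = FOb \<chi> a" "e \<sharp> f" "e \<sharp> s" "f \<sharp> s"
  shows "pcpt \<chi> \<chi>' b e (act \<chi> a b f s)
      = act \<chi>' a b f (pcpt \<chi> \<chi>' a e s)"
  using Nat_natural[OF EBo assms(1,2), of a b e f s] assms by simp

lemma NP_intro2:
  assumes \<chi>: "vfunctor V (opp V B) VV \<chi>" and \<chi>': "vfunctor V (opp V B) VV \<chi>'" and x: "x \<in> Ob V" "y \<in> Ob V"
    and \<sigma>: "\<And>a. a \<in> VOb B \<Longrightarrow> \<sigma> a \<in> Arr V" "\<And>a. a \<in> VOb B \<Longrightarrow> Dom V (\<sigma> a) = (x \<odot> y) \<odot> FOb \<chi> a"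
      "\<And>a. a \<in> VOb B \<Longrightarrow> Cod V (\<sigma> a) = FOb \<chi>' a"
    and nat: "\<And>a b d e f s. \<lbrakk>a \<in> VOb B; b \<in> VOb B; el d; ty d = x; el e; ty e = y; el f; ty f = VHom B b a; el s; ty s = FOb \<chi> a;
      d \<sharp> e; e \<sharp> d; d \<sharp> f; f \<sharp> d; d \<sharp> s; s \<sharp> d; e \<sharp> f; f \<sharp> e; e \<sharp> s; s \<sharp> e; f \<sharp> s; s \<sharp> f\<rbrakk> \<Longrightarrow>
      \<sigma> b \<bullet> \<langle>\<langle>d, e\<rangle>, act \<chi> a b f s\<rangle>
      = act \<chi>' a b f (\<sigma> a \<bullet> \<langle>\<langle>d, e\<rangle>, s\<rangle>)"
  shows "\<exists>h. h \<in> Arr V \<and> Dom V h = x \<odot> y \<and> Cod V h = NP \<chi> \<chi>' \<and>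
    (\<forall>a d e s. a \<in> VOb B \<longrightarrow> el d \<longrightarrow> ty d = x \<longrightarrow> el e \<longrightarrow> ty e = y \<longrightarrow> el s \<longrightarrow> ty s = FOb \<chi> a \<longrightarrow> d \<sharp> e \<longrightarrow> d \<sharp> s \<longrightarrow> e \<sharp> s \<longrightarrow>
      pcpt \<chi> \<chi>' a (h \<bullet> \<langle>d, e\<rangle>) s = \<sigma> a \<bullet> \<langle>\<langle>d, e\<rangle>, s\<rangle>)"
proof (rule NT_intro2[OF EBo \<chi> \<chi>' x, of \<sigma>])
  fix h assume h: "h \<in> Arr V" "Dom V h = x \<odot> y" "Cod V h = NP \<chi> \<chi>'"
    "\<And>a d e s. \<lbrakk>a \<in> VOb (opp V B); el d; ty d = x; el e; ty e = y; el s; ty s = FOb \<chi> a; d \<sharp> e; d \<sharp> s; e \<sharp> s\<rbrakk> \<Longrightarrow>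
      pcpt \<chi> \<chi>' a (h \<bullet> \<langle>d, e\<rangle>) s = \<sigma> a \<bullet> \<langle>\<langle>d, e\<rangle>, s\<rangle>"
  show ?thesis by (rule exI[of _ h]) (simp add: h)
qed (simp_all add: \<sigma> nat)

text \<open>\<open>rank_one \<chi> b\<close> sends \<open>s \<otimes> r \<in> \<chi> b \<otimes> \<psi> b\<close> to the transformation \<open>q \<mapsto> s \<cdot> (r q)\<close> from \<open>\<phi>\<close> to \<open>\<chi>\<close>.\<close>

definition rank_one where
  "rank_one \<chi> b = (SOME h. h \<in> Arr V \<and> Dom V h = FOb \<chi> b \<odot> PC b \<and> Cod V h = NP \<phi> \<chi> \<and>
    (\<forall>a s r q. a \<in> VOb B \<longrightarrow> el s \<longrightarrow> ty s = FOb \<chi> b \<longrightarrow> el r \<longrightarrow> ty r = PC b \<longrightarrow> el q \<longrightarrow> ty q = FOb \<phi> a \<longrightarrow> s \<sharp> r \<longrightarrow> s \<sharp> q \<longrightarrow> r \<sharp> q \<longrightarrow>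
      pcpt \<phi> \<chi> a (h \<bullet> \<langle>s, r\<rangle>) q
      = (ev V (FOb \<chi> b) (FOb \<chi> a) \<cdot> ((FHom \<chi> b a \<cdot> ev V (FOb \<phi> a) (VHom B a b) \<cdot> (pc b a \<otimes> \<one> (FOb \<phi> a))) \<otimes> \<one> (FOb \<chi> b))
        \<cdot> symm V (FOb \<chi> b) (PC b \<odot> FOb \<phi> a) \<cdot> assoc V (FOb \<chi> b) (PC b) (FOb \<phi> a)) \<bullet> \<langle>\<langle>s, r\<rangle>, q\<rangle>))"

lemma rank_one_rules:
  assumes \<chi>: "vfunctor V (opp V B) VV \<chi>" and b: "b \<in> VOb B"
  shows "rank_one \<chi> b \<in> Arr V" "Dom V (rank_one \<chi> b) = FOb \<chi> b \<odot> PC b" "Cod V (rank_one \<chi> b) = NP \<phi> \<chi>"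
    and "\<lbrakk>a \<in> VOb B; el s; ty s = FOb \<chi> b; el r; ty r = PC b; el q; ty q = FOb \<phi> a; s \<sharp> r; s \<sharp> q; r \<sharp> q\<rbrakk> \<Longrightarrow>
      pcpt \<phi> \<chi> a (rank_one \<chi> b \<bullet> \<langle>s, r\<rangle>) q
      = act \<chi> b a (pcv b a r q) s"
proof -
  note [simp] = psi_rules \<chi> weight_typing[OF \<chi>] b presheaf_comp[OF \<chi>]
  let ?\<sigma> = "\<lambda>a. ev V (FOb \<chi> b) (FOb \<chi> a) \<cdot> ((FHom \<chi> b a \<cdot> ev V (FOb \<phi> a) (VHom B a b) \<cdot> (pc b a \<otimes> \<one> (FOb \<phi> a))) \<otimes> \<one> (FOb \<chi> b))
        \<cdot> symm V (FOb \<chi> b) (PC b \<odot> FOb \<phi> a) \<cdot> assoc V (FOb \<chi> b) (PC b) (FOb \<phi> a)"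
  have ex: "\<exists>h. h \<in> Arr V \<and> Dom V h = FOb \<chi> b \<odot> PC b \<and> Cod V h = NP \<phi> \<chi> \<and>
    (\<forall>a s r q. a \<in> VOb B \<longrightarrow> el s \<longrightarrow> ty s = FOb \<chi> b \<longrightarrow> el r \<longrightarrow> ty r = PC b \<longrightarrow> el q \<longrightarrow> ty q = FOb \<phi> a \<longrightarrow> s \<sharp> r \<longrightarrow> s \<sharp> q \<longrightarrow> r \<sharp> q \<longrightarrow>
      pcpt \<phi> \<chi> a (h \<bullet> \<langle>s, r\<rangle>) q = ?\<sigma> a \<bullet> \<langle>\<langle>s, r\<rangle>, q\<rangle>)"
    by (rule NP_intro2[OF \<phi> \<chi>]) simp_all
  note n = someI_ex[OF ex, folded rank_one_def]
  show "rank_one \<chi> b \<in> Arr V" "Dom V (rank_one \<chi> b) = FOb \<chi> b \<odot> PC b" "Cod V (rank_one \<chi> b) = NP \<phi> \<chi>" using n by blast+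
  assume a [simp]: "a \<in> VOb B" "el s" "ty s = FOb \<chi> b" "el r" "ty r = PC b" "el q" "ty q = FOb \<phi> a" "s \<sharp> r" "s \<sharp> q" "r \<sharp> q"
  have "pcpt \<phi> \<chi> a (rank_one \<chi> b \<bullet> \<langle>s, r\<rangle>) q = ?\<sigma> a \<bullet> \<langle>\<langle>s, r\<rangle>, q\<rangle>"
    using n a by blast
  then show "pcpt \<phi> \<chi> a (rank_one \<chi> b \<bullet> \<langle>s, r\<rangle>) q
      = act \<chi> b a (pcv b a r q) s"
    using apart_sym[OF a(8)] apart_sym[OF a(9)] by simp
qed

lemma NP_ext:
  assumes "vfunctor V (opp V B) VV \<chi>" "vfunctor V (opp V B) VV \<chi>'" "el t" "ty t = NP \<chi> \<chi>'" "el t'" "ty t' = NP \<chi> \<chi>'" "ectx t = ectx t'"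
    and "\<And>a s. \<lbrakk>a \<in> VOb B; el s; ty s = FOb \<chi> a; t \<sharp> s; s \<sharp> t; t' \<sharp> s; s \<sharp> t'\<rbrakk>
       \<Longrightarrow> pcpt \<chi> \<chi>' a t s = pcpt \<chi> \<chi>' a t' s"
  shows "t = t'"
  by (rule Nat_el_ext[OF EBo assms(1,2)]) (use assms in simp_all)

text \<open>At \<open>q\<close>, both transformations let the composite of \<open>f\<close> with
  \<open>r q\<close> act on \<open>s\<close>.\<close>

lemma rank_one_natural:
  assumes \<chi>: "vfunctor V (opp V B) VV \<chi>" and h [simp]: "b \<in> VOb B" "d \<in> VOb B"
    "el f" "ty f = VHom B b d" "el s" "ty s = FOb \<chi> d" "el r" "ty r = PC b" "f \<sharp> s" "f \<sharp> r" "s \<sharp> r"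
  shows "rank_one \<chi> b \<bullet> \<langle>ev V (FOb \<chi> d) (FOb \<chi> b) \<bullet> \<langle>FHom \<chi> d b \<bullet> f, s\<rangle>, r\<rangle> = rank_one \<chi> d \<bullet> \<langle>s, evl (PC b) (PC d) (FHom \<psi> b d \<bullet> f) r\<rangle>"
proof -
  note [simp] = psi_rules \<chi> weight_typing[OF \<chi>] presheaf_comp[OF \<chi>] rank_one_rules[OF \<chi>]
    apart_sym[OF h(9)] apart_sym[OF h(10)] apart_sym[OF h(11)]
  show ?thesis by (rule NP_ext[OF \<phi> \<chi>]) (simp_all add: ectx_ac)
qed

lemma rank_one_comp:
  assumes \<chi>: "vfunctor V (opp V B) VV \<chi>" and \<chi>': "vfunctor V (opp V B) VV \<chi>'" and h [simp]: "b \<in> VOb B"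
    "el t" "ty t = NP \<chi> \<chi>'" "el s" "ty s = FOb \<chi> b" "el r" "ty r = PC b" "t \<sharp> s" "t \<sharp> r" "s \<sharp> r"
  shows "cmp PP \<phi> \<chi> \<chi>' t (rank_one \<chi> b \<bullet> \<langle>s, r\<rangle>) = rank_one \<chi>' b \<bullet> \<langle>ev V (FOb \<chi> b) (FOb \<chi>' b) \<bullet> \<langle>pp \<chi> \<chi>' b \<bullet> t, s\<rangle>, r\<rangle>"
proof -
  note [simp] = psi_rules \<chi> \<chi>' weight_typing[OF \<chi>] weight_typing[OF \<chi>'] rank_one_rules[OF \<chi>] rank_one_rules[OF \<chi>']
    presheaf_natural[OF \<chi> \<chi>'] apart_sym[OF h(8)] apart_sym[OF h(9)] apart_sym[OF h(10)]
  show ?thesis by (rule NP_ext[OF \<phi> \<chi>']) (simp_all add: ectx_ac)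
qed

text \<open>The action of \<open>\<phi> * \<psi>\<close>, through \<open>kap\<close>, on transformations \<open>\<phi> \<rightarrow> \<chi>\<close>.\<close>

lemma precompose_kap:
  assumes \<chi>: "vfunctor V (opp V B) VV \<chi>"
  shows "\<exists>w. w \<in> Arr V \<and> Dom V w = NP \<phi> \<chi> \<odot> W \<psi> \<and> Cod V w = NP \<phi> \<chi> \<and>
    (\<forall>b t q r. b \<in> VOb B \<longrightarrow> el t \<longrightarrow> ty t = NP \<phi> \<chi> \<longrightarrow> el q \<longrightarrow> ty q = FOb \<phi> b \<longrightarrow> el r \<longrightarrow> ty r = PC b \<longrightarrow> t \<sharp> q \<longrightarrow> t \<sharp> r \<longrightarrow> q \<sharp> r \<longrightarrow>
      w \<bullet> \<langle>t, coc \<psi> b \<bullet> \<langle>q, r\<rangle>\<rangle> = rank_one \<chi> b \<bullet> \<langle>ev V (FOb \<phi> b) (FOb \<chi> b) \<bullet> \<langle>pp \<phi> \<chi> b \<bullet> t, q\<rangle>, r\<rangle>) \<and>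
    (\<forall>u t. dual_point u \<longrightarrow> el t \<longrightarrow> ty t = NP \<phi> \<chi> \<longrightarrow> w \<bullet> \<langle>t, u \<bullet> star\<rangle> = t)"
proof -
  note [simp] = psi_rules \<chi> weight_typing[OF \<chi>] rank_one_rules[OF \<chi>] kap_rules kap_natural presheaf_natural[OF \<phi> \<chi>]
  let ?\<sigma> = "\<lambda>a. ev V (FOb \<phi> a) (FOb \<chi> a) \<cdot> (pp \<phi> \<chi> a \<otimes> (kap a \<cdot> symm V (W \<psi>) (FOb \<phi> a))) \<cdot> assoc V (NP \<phi> \<chi>) (W \<psi>) (FOb \<phi> a)"
  have "\<exists>h. h \<in> Arr V \<and> Dom V h = NP \<phi> \<chi> \<odot> W \<psi> \<and> Cod V h = NP \<phi> \<chi> \<and>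
    (\<forall>a d e s. a \<in> VOb B \<longrightarrow> el d \<longrightarrow> ty d = NP \<phi> \<chi> \<longrightarrow> el e \<longrightarrow> ty e = W \<psi> \<longrightarrow> el s \<longrightarrow> ty s = FOb \<phi> a \<longrightarrow> d \<sharp> e \<longrightarrow> d \<sharp> s \<longrightarrow> e \<sharp> s \<longrightarrow>
      pcpt \<phi> \<chi> a (h \<bullet> \<langle>d, e\<rangle>) s = ?\<sigma> a \<bullet> \<langle>\<langle>d, e\<rangle>, s\<rangle>)"
    by (rule NP_intro2[OF \<phi> \<chi>]) simp_all
  then obtain w where w [simp]: "w \<in> Arr V" "Dom V w = NP \<phi> \<chi> \<odot> W \<psi>" "Cod V w = NP \<phi> \<chi>"
    and w_el: "\<And>a d e s. \<lbrakk>a \<in> VOb B; el d; ty d = NP \<phi> \<chi>; el e; ty e = W \<psi>; el s; ty s = FOb \<phi> a; d \<sharp> e; d \<sharp> s; e \<sharp> s\<rbrakk> \<Longrightarrow>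
      pcpt \<phi> \<chi> a (w \<bullet> \<langle>d, e\<rangle>) s = ?\<sigma> a \<bullet> \<langle>\<langle>d, e\<rangle>, s\<rangle>"
    by blast
  show ?thesis
  proof (intro exI[of _ w] conjI allI impI)
    fix b t q r assume h [simp]: "b \<in> VOb B" "el t" "ty t = NP \<phi> \<chi>" "el q" "ty q = FOb \<phi> b" "el r" "ty r = PC b" "t \<sharp> q" "t \<sharp> r" "q \<sharp> r"
    note [simp] = apart_sym[OF h(8)] apart_sym[OF h(9)] apart_sym[OF h(10)]
    show "w \<bullet> \<langle>t, coc \<psi> b \<bullet> \<langle>q, r\<rangle>\<rangle> = rank_one \<chi> b \<bullet> \<langle>ev V (FOb \<phi> b) (FOb \<chi> b) \<bullet> \<langle>pp \<phi> \<chi> b \<bullet> t, q\<rangle>, r\<rangle>"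
      by (rule NP_ext[OF \<phi> \<chi>]) (simp_all add: w_el ectx_ac)
  next
    fix u t assume u: "dual_point u" and [simp]: "el t" "ty t = NP \<phi> \<chi>"
    note [simp] = dual_pointD[OF u]
    show "w \<bullet> \<langle>t, u \<bullet> star\<rangle> = t"
      by (rule NP_ext[OF \<phi> \<chi>]) (simp_all add: w_el)
  qed simp_all
qed

section \<open>A right adjoint of the functor represented by \<phi>, built from \<psi>\<close>

definition dual where "dual y = comp_vfun V (opp V B) (contra_hom V VV y) (op_vfun \<psi>)"

lemma dual_rules:
  assumes y: "y \<in> Ob V"
  shows "vfunctor V (opp V B) VV (dual y)"
    and "b \<in> VOb B \<Longrightarrow> FOb (dual y) b = ihom V (PC b) y"
    and "\<lbrakk>b \<in> VOb B; d \<in> VOb B; el f; ty f = VHom B b d; el g; ty g = ihom V (PC d) y; el r; ty r = PC b; f \<sharp> g; f \<sharp> r; g \<sharp> r\<rbrakk> \<Longrightarrow>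
      evl (PC b) y (evl (ihom V (PC d) y) (ihom V (PC b) y) (FHom (dual y) d b \<bullet> f) g) r
      = evl (PC d) y g (evl (PC b) (PC d) (FHom \<psi> b d \<bullet> f) r)"
proof -
  note [simp] = psi_rules y
  have [simp]: "vcategory V VV" by simp
  have c: "vfunctor V (opp V VV) VV (contra_hom V VV y)" by (rule vfunctor_contra_hom) simp_all
  show "vfunctor V (opp V B) VV (dual y)"
    unfolding dual_def by (rule vfunctor_comp[OF vfunctor_op[OF \<psi>_rules(1)] c])
  show [simp]: "b \<in> VOb B \<Longrightarrow> FOb (dual y) b = ihom V (PC b) y" for b by (simp add: dual_def)
  assume a [simp]: "b \<in> VOb B" "d \<in> VOb B" "el f" "ty f = VHom B b d" "el g" "ty g = ihom V (PC d) y" "el r" "ty r = PC b" "f \<sharp> g" "f \<sharp> r" "g \<sharp> r"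
  show "evl (PC b) y (evl (ihom V (PC d) y) (ihom V (PC b) y) (FHom (dual y) d b \<bullet> f) g) r
      = evl (PC d) y g (evl (PC b) (PC d) (FHom \<psi> b d \<bullet> f) r)"
    using contra_hom_eval[of VV y "PC d" "PC b" "FHom \<psi> b d \<bullet> f" g] apart_sym[OF a(9)] by (simp add: dual_def)
qed

text \<open>The adjunction comparison from \<open>[[\<phi>,\<chi>], y]\<close> to
  \<open>[\<chi>, dual y]\<close>: it sends \<open>m\<close> to
  \<open>s \<mapsto> (r \<mapsto> m (rank_one (s, r)))\<close>. The comparison is there for every
  weight; a dual point is what provides its retraction.\<close>

lemma shift_exists:
  assumes \<chi>: "vfunctor V (opp V B) VV \<chi>" and y [simp]: "y \<in> Ob V"
  shows "\<exists>T. T \<in> Arr V \<and> Dom V T = ihom V (NP \<phi> \<chi>) y \<and> Cod V T = NP \<chi> (dual y) \<and>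
    (\<forall>a m s r. a \<in> VOb B \<longrightarrow> el m \<longrightarrow> ty m = ihom V (NP \<phi> \<chi>) y \<longrightarrow> el s \<longrightarrow> ty s = FOb \<chi> a \<longrightarrow> el r \<longrightarrow> ty r = PC a \<longrightarrow>
      m \<sharp> s \<longrightarrow> m \<sharp> r \<longrightarrow> s \<sharp> r \<longrightarrow>
      evl (PC a) y (evl (FOb \<chi> a) (ihom V (PC a) y) (pp \<chi> (dual y) a \<bullet> T \<bullet> m) s) r
      = evl (NP \<phi> \<chi>) y m (rank_one \<chi> a \<bullet> \<langle>s, r\<rangle>))"
proof -
  note [simp] = psi_rules \<chi> weight_typing[OF \<chi>] rank_one_rules[OF \<chi>] dual_rules(2,3)[OF y]
  note D [simp] = dual_rules(1)[OF y] and [simp] = vfunctor_typing[OF dual_rules(1)[OF y]]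
  let ?M = "ihom V (NP \<phi> \<chi>) y"
  let ?\<sigma> = "\<lambda>a. transp V (?M \<odot> FOb \<chi> a) (PC a) y (ev V (NP \<phi> \<chi>) y \<cdot> (\<one> ?M \<otimes> rank_one \<chi> a) \<cdot> assoc V ?M (FOb \<chi> a) (PC a))"
  have nat: "?\<sigma> b \<bullet> \<langle>e, act \<chi> a b f s\<rangle>
      = act (dual y) a b f (?\<sigma> a \<bullet> \<langle>e, s\<rangle>)"
    if [simp]: "a \<in> VOb B" "b \<in> VOb B" "el e" "ty e = ?M" "el f" "ty f = VHom B b a" "el s" "ty s = FOb \<chi> a"
      "e \<sharp> f" "f \<sharp> e" "e \<sharp> s" "s \<sharp> e" "f \<sharp> s" "s \<sharp> f" for a b e f s
    by (rule eval_ext[of _ "PC b" y]) (simp_all add: ectx_ac rank_one_natural[OF \<chi>])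
  obtain T where T [simp]: "T \<in> Arr V" "Dom V T = ?M" "Cod V T = NP \<chi> (dual y)"
    and T_el: "\<And>a e s. \<lbrakk>a \<in> VOb (opp V B); el e; ty e = ?M; el s; ty s = FOb \<chi> a; e \<sharp> s\<rbrakk> \<Longrightarrow>
      pcpt \<chi> (dual y) a (T \<bullet> e) s = ?\<sigma> a \<bullet> \<langle>e, s\<rangle>"
    by (rule NT_intro[OF EBo \<chi> D, of ?M ?\<sigma>]; (rule that)?) (simp_all add: nat)
  show ?thesis
    by (intro exI[of _ T] conjI allI impI) (use T_el in simp_all)
qed

definition shift where
  "shift \<chi> y = (SOME T. T \<in> Arr V \<and> Dom V T = ihom V (NP \<phi> \<chi>) y \<and> Cod V T = NP \<chi> (dual y) \<and>
    (\<forall>a m s r. a \<in> VOb B \<longrightarrow> el m \<longrightarrow> ty m = ihom V (NP \<phi> \<chi>) y \<longrightarrow> el s \<longrightarrow> ty s = FOb \<chi> a \<longrightarrow> el r \<longrightarrow> ty r = PC a \<longrightarrow>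
      m \<sharp> s \<longrightarrow> m \<sharp> r \<longrightarrow> s \<sharp> r \<longrightarrow>
      evl (PC a) y (evl (FOb \<chi> a) (ihom V (PC a) y) (pp \<chi> (dual y) a \<bullet> T \<bullet> m) s) r
      = evl (NP \<phi> \<chi>) y m (rank_one \<chi> a \<bullet> \<langle>s, r\<rangle>)))"

lemma shift_rules:
  assumes \<chi>: "vfunctor V (opp V B) VV \<chi>" and y: "y \<in> Ob V"
  shows "shift \<chi> y \<in> Arr V" "Dom V (shift \<chi> y) = ihom V (NP \<phi> \<chi>) y" "Cod V (shift \<chi> y) = NP \<chi> (dual y)"
    and "\<lbrakk>a \<in> VOb B; el m; ty m = ihom V (NP \<phi> \<chi>) y; el s; ty s = FOb \<chi> a; el r; ty r = PC a; m \<sharp> s; m \<sharp> r; s \<sharp> r\<rbrakk> \<Longrightarrow>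
      evl (PC a) y (evl (FOb \<chi> a) (ihom V (PC a) y) (pp \<chi> (dual y) a \<bullet> shift \<chi> y \<bullet> m) s) r
      = evl (NP \<phi> \<chi>) y m (rank_one \<chi> a \<bullet> \<langle>s, r\<rangle>)"
  using someI_ex[OF shift_exists[OF assms], folded shift_def] by simp_all

text \<open>Naturality of the comparison in \<chi>: composing a rank one transformation with
  \<open>t\<close> gives the rank one transformation with \<open>t\<close> applied to its first
  argument.\<close>

lemma shift_comp:
  assumes \<chi>: "vfunctor V (opp V B) VV \<chi>" and \<chi>': "vfunctor V (opp V B) VV \<chi>'" and y [simp]: "y \<in> Ob V"
    and h [simp]: "el m" "ty m = ihom V (NP \<phi> \<chi>) y" "el t" "ty t = NP \<chi>' \<chi>" "m \<sharp> t"
  shows "shift \<chi>' y \<bullet> cmp VV (NP \<phi> \<chi>') (NP \<phi> \<chi>) y m (FHom (cov_hom V PP \<phi>) \<chi>' \<chi> \<bullet> t)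
    = cmp PP \<chi>' \<chi> (dual y) (shift \<chi> y \<bullet> m) t"
proof -
  note [simp] = psi_rules \<chi> \<chi>' weight_typing[OF \<chi>] weight_typing[OF \<chi>'] rank_one_rules[OF \<chi>] rank_one_rules[OF \<chi>'] dual_rules(2)[OF y]
    shift_rules[OF \<chi> y] shift_rules[OF \<chi>' y] Fun_cov_hom[OF EBo \<phi>] rank_one_comp[OF \<chi>' \<chi>] apart_sym[OF h(5)]
  note D [simp] = dual_rules(1)[OF y] and [simp] = vfunctor_typing[OF dual_rules(1)[OF y]]
  show ?thesis
  proof (rule NP_ext[OF \<chi>' D])
    fix a s
    let ?l = "shift \<chi>' y \<bullet> cmp VV (NP \<phi> \<chi>') (NP \<phi> \<chi>) y m (FHom (cov_hom V PP \<phi>) \<chi>' \<chi> \<bullet> t)"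
    let ?r = "cmp PP \<chi>' \<chi> (dual y) (shift \<chi> y \<bullet> m) t"
    assume "a \<in> VOb B" "el s" "ty s = FOb \<chi>' a" "?l \<sharp> s" "s \<sharp> ?l" "?r \<sharp> s" "s \<sharp> ?r"
    then have [simp]: "a \<in> VOb B" "el s" "ty s = FOb \<chi>' a" "m \<sharp> s" "s \<sharp> m" "t \<sharp> s" "s \<sharp> t" by simp_all
    show "pcpt \<chi>' (dual y) a ?l s = pcpt \<chi>' (dual y) a ?r s"
      by (rule eval_ext[of _ "PC a" y]) (simp_all add: ectx_ac)
  qed (simp_all add: ectx_ac)
qed

text \<open>The pairing of \<open>g\<close> with the class of \<open>q \<otimes> r\<close> is
  \<open>g q r\<close>. With a dual point in the second place it becomes a map from
  \<open>[\<phi>, dual y]\<close> to \<open>y\<close>, the counit of the adjunction.\<close>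

lemma dual_eval_exists:
  assumes y [simp]: "y \<in> Ob V"
  shows "\<exists>z. z \<in> Arr V \<and> Dom V z = NP \<phi> (dual y) \<odot> W \<psi> \<and> Cod V z = y \<and>
    (\<forall>b g q r. b \<in> VOb B \<longrightarrow> el g \<longrightarrow> ty g = NP \<phi> (dual y) \<longrightarrow> el q \<longrightarrow> ty q = FOb \<phi> b \<longrightarrow> el r \<longrightarrow> ty r = PC b \<longrightarrow>
      g \<sharp> q \<longrightarrow> g \<sharp> r \<longrightarrow> q \<sharp> r \<longrightarrow>
      z \<bullet> \<langle>g, coc \<psi> b \<bullet> \<langle>q, r\<rangle>\<rangle>
      = evl (PC b) y (evl (FOb \<phi> b) (ihom V (PC b) y) (pp \<phi> (dual y) b \<bullet> g) q) r)"
proof -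
  note [simp] = psi_rules dual_rules(2,3)[OF y]
  note D [simp] = dual_rules(1)[OF y] and [simp] = vfunctor_typing[OF dual_rules(1)[OF y]]
  note nat = presheaf_natural[OF \<phi> D]
  let ?x = "NP \<phi> (dual y)"
  let ?\<sigma> = "\<lambda>b. ev V (PC b) y \<cdot> ((ev V (FOb \<phi> b) (ihom V (PC b) y) \<cdot> (pp \<phi> (dual y) b \<otimes> \<one> (FOb \<phi> b))) \<otimes> \<one> (PC b))"
  have "balanced B \<phi> \<psi> ?x y ?\<sigma>"
  proof (rule balancedI)
    fix b c e q f s
    assume [simp]: "b \<in> VOb B" "c \<in> VOb B" "el e" "ty e = ?x" "el q" "ty q = FOb \<phi> c" "el f" "ty f = VHom B b c"
      and "el s" "ty s = FOb \<psi> b" and [simp]: "e \<sharp> q" "q \<sharp> e" "e \<sharp> f" "f \<sharp> e" "e \<sharp> s" "s \<sharp> e" "q \<sharp> f" "f \<sharp> q" "q \<sharp> s" "s \<sharp> q" "f \<sharp> s" "s \<sharp> f"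
    then have [simp]: "el s" "ty s = PC b" by simp_all
    show "?\<sigma> b \<bullet> \<langle>\<langle>e, act \<phi> c b f q\<rangle>, s\<rangle>
      = ?\<sigma> c \<bullet> \<langle>\<langle>e, q\<rangle>, act \<psi> b c f s\<rangle>"
      using nat[of c b e f q] by simp
  qed simp_all
  then obtain z where z: "extends B \<phi> \<psi> (W \<psi>) (coc \<psi>) ?x y ?\<sigma> z"
    using colimD(2)[OF wcolim_colim[OF \<psi>_rules(1)], of ?x y] by auto
  note [simp] = extendsD(1-3)[OF z]
  show ?thesis
    by (intro exI[of _ z] conjI allI impI) (simp_all add: extendsD(4)[OF z])
qed

text \<open>\<open>dual y\<close> is the value at \<open>y\<close> of a right adjoint of \<open>[B\<^sup>o\<^sup>p,V](\<phi>, -)\<close>; only a retraction of \<open>shift\<close> is needed.\<close>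

lemma shift_retraction:
  assumes u: "dual_point u" and y [simp]: "y \<in> Ob V"
  obtains R where "\<And>\<chi>. vfunctor V (opp V B) VV \<chi> \<Longrightarrow> R \<chi> \<in> Arr V" "\<And>\<chi>. vfunctor V (opp V B) VV \<chi> \<Longrightarrow> Dom V (R \<chi>) = NP \<chi> (dual y)"
    "\<And>\<chi>. vfunctor V (opp V B) VV \<chi> \<Longrightarrow> Cod V (R \<chi>) = ihom V (NP \<phi> \<chi>) y"
    "\<And>\<chi> m. \<lbrakk>vfunctor V (opp V B) VV \<chi>; el m; ty m = ihom V (NP \<phi> \<chi>) y\<rbrakk> \<Longrightarrow> R \<chi> \<bullet> shift \<chi> y \<bullet> m = m"
    "\<And>\<chi> \<chi>' g t. \<lbrakk>vfunctor V (opp V B) VV \<chi>; vfunctor V (opp V B) VV \<chi>'; el g; ty g = NP \<chi> (dual y); el t; ty t = NP \<chi>' \<chi>; g \<sharp> t\<rbrakk> \<Longrightarrow>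
      R \<chi>' \<bullet> cmp PP \<chi>' \<chi> (dual y) g t = cmp VV (NP \<phi> \<chi>') (NP \<phi> \<chi>) y (R \<chi> \<bullet> g) (FHom (cov_hom V PP \<phi>) \<chi>' \<chi> \<bullet> t)"
proof -
  note [simp] = psi_rules dual_pointD(1-3)[OF u] dual_rules(2)[OF y] Fun_cov_hom[OF EBo \<phi>]
  note D [simp] = dual_rules(1)[OF y] and [simp] = vfunctor_typing[OF dual_rules(1)[OF y]]
  obtain z where z [simp]: "z \<in> Arr V" "Dom V z = NP \<phi> (dual y) \<odot> W \<psi>" "Cod V z = y"
    and z_el: "\<And>b g q r. \<lbrakk>b \<in> VOb B; el g; ty g = NP \<phi> (dual y); el q; ty q = FOb \<phi> b; el r; ty r = PC b; g \<sharp> q; g \<sharp> r; q \<sharp> r\<rbrakk> \<Longrightarrow>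
      z \<bullet> \<langle>g, coc \<psi> b \<bullet> \<langle>q, r\<rangle>\<rangle> = evl (PC b) y (evl (FOb \<phi> b) (ihom V (PC b) y) (pp \<phi> (dual y) b \<bullet> g) q) r"
    using dual_eval_exists[OF y] by blast
  \<comment> \<open>The adjunct of a transformation into \<open>dual y\<close>: compose it with an
    element of \<open>[\<phi>, \<chi>]\<close> and pair the result with \<open>u\<close>.\<close>
  define R where "R = (\<lambda>\<chi>. transp V (NP \<chi> (dual y)) (NP \<phi> \<chi>) y (z \<cdot> (VComp PP \<phi> \<chi> (dual y) \<otimes> u) \<cdot> rinv (NP \<chi> (dual y) \<odot> NP \<phi> \<chi>)))"
  have R [simp]: "R \<chi> \<in> Arr V" "Dom V (R \<chi>) = NP \<chi> (dual y)" "Cod V (R \<chi>) = ihom V (NP \<phi> \<chi>) y" if "vfunctor V (opp V B) VV \<chi>" for \<chi>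
    unfolding R_def using that by simp_all
  have R_el [simp]: "evl (NP \<phi> \<chi>) y (R \<chi> \<bullet> g) t = z \<bullet> \<langle>VComp PP \<phi> \<chi> (dual y) \<bullet> \<langle>g, t\<rangle>, u \<bullet> star\<rangle>"
    if "vfunctor V (opp V B) VV \<chi>" "el g" "ty g = NP \<chi> (dual y)" "el t" "ty t = NP \<phi> \<chi>" "g \<sharp> t" for \<chi> g t
    unfolding R_def using that by simp
  show ?thesis
  proof (rule that[of R], fact R(1), fact R(2), fact R(3))
    fix \<chi> m assume \<chi>: "vfunctor V (opp V B) VV \<chi>" and [simp]: "el m" "ty m = ihom V (NP \<phi> \<chi>) y"
    note [simp] = \<chi> weight_typing[OF \<chi>] rank_one_rules[OF \<chi>] shift_rules[OF \<chi> y]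
    obtain w where w [simp]: "w \<in> Arr V" "Dom V w = NP \<phi> \<chi> \<odot> W \<psi>" "Cod V w = NP \<phi> \<chi>"
      and w_el: "\<And>b t q r. \<lbrakk>b \<in> VOb B; el t; ty t = NP \<phi> \<chi>; el q; ty q = FOb \<phi> b; el r; ty r = PC b; t \<sharp> q; t \<sharp> r; q \<sharp> r\<rbrakk> \<Longrightarrow>
        w \<bullet> \<langle>t, coc \<psi> b \<bullet> \<langle>q, r\<rangle>\<rangle> = rank_one \<chi> b \<bullet> \<langle>ev V (FOb \<phi> b) (FOb \<chi> b) \<bullet> \<langle>pp \<phi> \<chi> b \<bullet> t, q\<rangle>, r\<rangle>"
      and w_u: "\<And>t. \<lbrakk>el t; ty t = NP \<phi> \<chi>\<rbrakk> \<Longrightarrow> w \<bullet> \<langle>t, u \<bullet> star\<rangle> = t"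
      using precompose_kap[OF \<chi>] u by blast
    let ?M = "ihom V (NP \<phi> \<chi>) y"
    let ?l = "z \<cdot> ((VComp PP \<phi> \<chi> (dual y) \<cdot> (shift \<chi> y \<otimes> \<one> (NP \<phi> \<chi>))) \<otimes> \<one> (W \<psi>))"
    let ?r = "ev V (NP \<phi> \<chi>) y \<cdot> (\<one> ?M \<otimes> w) \<cdot> assoc V ?M (NP \<phi> \<chi>) (W \<psi>)"
    \<comment> \<open>Again a variable stands for \<open>u\<close>: on the class of
      \<open>q \<otimes> r\<close> both sides are \<open>m\<close> at the rank one transformation of
      \<open>t q\<close> and \<open>r\<close>.\<close>
    have eq: "?l = ?r"
      by (rule colim_ext2[OF \<phi> \<psi>_rules(1) wcolim_colim[OF \<psi>_rules(1)], of ?M "NP \<phi> \<chi>"]) (simp_all add: z_el w_el)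
    show "R \<chi> \<bullet> shift \<chi> y \<bullet> m = m"
    proof (rule eval_ext[of _ "NP \<phi> \<chi>" y])
      fix t assume "el t" "ty t = NP \<phi> \<chi>" "R \<chi> \<bullet> shift \<chi> y \<bullet> m \<sharp> t" "t \<sharp> R \<chi> \<bullet> shift \<chi> y \<bullet> m"
      then have [simp]: "el t" "ty t = NP \<phi> \<chi>" "m \<sharp> t" "t \<sharp> m" by simp_all
      have "?l \<bullet> \<langle>\<langle>m, t\<rangle>, u \<bullet> star\<rangle> = ?r \<bullet> \<langle>\<langle>m, t\<rangle>, u \<bullet> star\<rangle>" unfolding eq ..
      then show "evl (NP \<phi> \<chi>) y (R \<chi> \<bullet> shift \<chi> y \<bullet> m) t = evl (NP \<phi> \<chi>) y m t"
        by (simp add: w_u)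
    qed simp_all
  next
    fix \<chi> \<chi>' g t
    assume \<chi>: "vfunctor V (opp V B) VV \<chi>" and \<chi>': "vfunctor V (opp V B) VV \<chi>'" and h [simp]: "el g" "ty g = NP \<chi> (dual y)" "el t" "ty t = NP \<chi>' \<chi>" "g \<sharp> t"
    note [simp] = \<chi> \<chi>' weight_typing[OF \<chi>] weight_typing[OF \<chi>'] apart_sym[OF h(5)]
    show "R \<chi>' \<bullet> cmp PP \<chi>' \<chi> (dual y) g t = cmp VV (NP \<phi> \<chi>') (NP \<phi> \<chi>) y (R \<chi> \<bullet> g) (FHom (cov_hom V PP \<phi>) \<chi>' \<chi> \<bullet> t)"
      by (rule eval_ext[of _ "NP \<phi> \<chi>'" y]) (simp_all add: ectx_ac)
  qed
qed

text \<open>A cocone from \<open>[\<phi>, S k]\<close> to \<open>y\<close> is carried by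
  \<open>shift\<close> to a cocone from \<open>S k\<close> to \<open>dual y\<close>, factored
  through the colimit \<open>C\<close>, and carried back by the retraction. Uniqueness holds because
  \<open>shift\<close> is a split monomorphism.\<close>

theorem dual_point_small_projective:
  assumes u: "dual_point u" and S: "vfunctor V K PP S" and w: "is_weight V K w" and K: "ends_exist (opp V K)"
  shows "preserves_wcolimit V PP VV (cov_hom V PP \<phi>) K w S"
proof -
  let ?F = "cov_hom V PP \<phi>"
  have [simp]: "vcategory V PP" "\<phi> \<in> VOb PP" by (simp_all add: base_rules)
  have F: "vfunctor V PP VV ?F" by (rule vfunctor_cov_hom) (simp_all add: \<phi>)
  note So = vfunctor_op[OF S] and Fo = vfunctor_op[OF F] and wt = w[unfolded is_weight_def]
  let ?G = "comp_vfun V (opp V K) (op_vfun ?F) (op_vfun S)"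
  have G: "vfunctor V (opp V K) (opp V VV) ?G" by (rule vfunctor_comp[OF So Fo])
  have kv: "vcategory V K" using vfunctor_vcategory[OF S] by simp
  have SP: "vfunctor V (opp V B) VV (FOb S k)" if "k \<in> VOb K" for k
    using vfunctor_typing(1)[OF S that] by simp
  note [simp] = base_rules kv weight_typing[OF wt] Fun_cov_hom[OF EBo \<phi>] SP
  have S_hom [simp]: "FHom S k l \<in> Arr V" "Dom V (FHom S k l) = VHom K k l" "Cod V (FHom S k l) = NP (FOb S k) (FOb S l)"
    if "k \<in> VOb K" "l \<in> VOb K" for k l
    using vfunctor_typing(2-4)[OF S, of k l] that by simp_all
  show ?thesis
    unfolding preserves_wcolimit_eq[OF S F] preserves_wlimit_iff[OF So w Fo K]
  proof (intro allI impI)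
    fix C \<eta> assume lim: "wlim (opp V PP) (opp V K) w (op_vfun S) C \<eta>"
    have C [simp]: "vfunctor V (opp V B) VV C" using wlimD(1)[OF lim] by simp
    have \<eta> [simp]: "\<eta> k \<in> Arr V" "Dom V (\<eta> k) = FOb w k" "Cod V (\<eta> k) = NP (FOb S k) C" if "k \<in> VOb K" for k
      using cylinderD(1-3)[OF wlimD(2)[OF lim], of k] that by simp_all
    have \<eta>_nat: "\<eta> l \<bullet> act w k l v p
       = cmp PP (FOb S l) (FOb S k) C (\<eta> k \<bullet> p) (FHom S l k \<bullet> v)"
      if "k \<in> VOb K" "l \<in> VOb K" "el v" "ty v = VHom K l k" "el p" "ty p = FOb w k" "v \<sharp> p" for k l v p
      using cylinderD(4)[OF wlimD(2)[OF lim], of k l v p] that by simp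
    show "wlim (opp V VV) (opp V K) w ?G (FOb (op_vfun ?F) C) (\<lambda>k. FHom (op_vfun ?F) C (FOb (op_vfun S) k) \<cdot> \<eta> k)"
    proof (rule wlimI)
      show "FOb (op_vfun ?F) C \<in> VOb (opp V VV)" by simp
      show "cylinder (opp V VV) (opp V K) w ?G (FOb (op_vfun ?F) C) (\<lambda>k. FHom (op_vfun ?F) C (FOb (op_vfun S) k) \<cdot> \<eta> k)"
      proof (rule cylinderI)
        fix k l v p assume "k \<in> VOb (opp V K)" "l \<in> VOb (opp V K)" "el v" "ty v = VHom (opp V K) k l" "el p" "ty p = FOb w k" "v \<sharp> p" "p \<sharp> v"
        then have [simp]: "k \<in> VOb K" "l \<in> VOb K" "el v" "ty v = VHom K l k" "el p" "ty p = FOb w k" "v \<sharp> p" "p \<sharp> v" by simp_all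
        show "(FHom (op_vfun ?F) C (FOb (op_vfun S) l) \<cdot> \<eta> l) \<bullet> act w k l v p
          = cmp (opp V VV) (FOb (op_vfun ?F) C) (FOb ?G k) (FOb ?G l) (FHom ?G k l \<bullet> v) ((FHom (op_vfun ?F) C (FOb (op_vfun S) k) \<cdot> \<eta> k) \<bullet> p)"
          using FHom_VComp_el[OF F, of "FOb S l" "FOb S k" C "\<eta> k \<bullet> p" "FHom S l k \<bullet> v"] by (simp add: \<eta>_nat)
      qed simp_all
    next
      fix y x \<sigma> assume "y \<in> VOb (opp V VV)" and x [simp]: "x \<in> Ob V" and fam: "family (opp V VV) (opp V K) w ?G y x \<sigma>"
      then have y [simp]: "y \<in> Ob V" by simp
      obtain R where "\<And>\<chi>. vfunctor V (opp V B) VV \<chi> \<Longrightarrow> R \<chi> \<in> Arr V" "\<And>\<chi>. vfunctor V (opp V B) VV \<chi> \<Longrightarrow> Dom V (R \<chi>) = NP \<chi> (dual y)"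
    "\<And>\<chi>. vfunctor V (opp V B) VV \<chi> \<Longrightarrow> Cod V (R \<chi>) = ihom V (NP \<phi> \<chi>) y"
    and R: "\<And>\<chi> m. \<lbrakk>vfunctor V (opp V B) VV \<chi>; el m; ty m = ihom V (NP \<phi> \<chi>) y\<rbrakk> \<Longrightarrow> R \<chi> \<bullet> shift \<chi> y \<bullet> m = m"
    and R_nat: "\<And>\<chi> \<chi>' g t. \<lbrakk>vfunctor V (opp V B) VV \<chi>; vfunctor V (opp V B) VV \<chi>'; el g; ty g = NP \<chi> (dual y); el t; ty t = NP \<chi>' \<chi>; g \<sharp> t\<rbrakk> \<Longrightarrow>
      R \<chi>' \<bullet> cmp PP \<chi>' \<chi> (dual y) g t = cmp VV (NP \<phi> \<chi>') (NP \<phi> \<chi>) y (R \<chi> \<bullet> g) (FHom (cov_hom V PP \<phi>) \<chi>' \<chi> \<bullet> t)"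
        by (rule shift_retraction[OF u y], rule that)
      note [simp] = this(1-3) and [simp] = dual_rules(1)[OF y] shift_rules(1-3)[OF _ y]
      have \<sigma> [simp]: "\<sigma> k \<in> Arr V" "Dom V (\<sigma> k) = x \<odot> FOb w k" "Cod V (\<sigma> k) = ihom V (NP \<phi> (FOb S k)) y" if "k \<in> VOb K" for k
        using familyD(1-3)[OF fam, of k] that by simp_all
      have \<sigma>_nat: "\<sigma> l \<bullet> \<langle>e, act w k l v p\<rangle>
       = cmp VV (NP \<phi> (FOb S l)) (NP \<phi> (FOb S k)) y (\<sigma> k \<bullet> \<langle>e, p\<rangle>) (FHom ?F (FOb S l) (FOb S k) \<bullet> FHom S l k \<bullet> v)"
        if "k \<in> VOb K" "l \<in> VOb K" "el e" "ty e = x" "el v" "ty v = VHom K l k" "el p" "ty p = FOb w k" "e \<sharp> v" "e \<sharp> p" "v \<sharp> p" for k l e v p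
        using familyD(4)[OF fam, of k l e v p] that apart_sym[OF that(9)] apart_sym[OF that(10)] apart_sym[OF that(11)] by simp
      let ?\<tau> = "\<lambda>k. shift (FOb S k) y \<cdot> \<sigma> k"
      have "family (opp V PP) (opp V K) w (op_vfun S) (dual y) x ?\<tau>"
      proof (rule familyI)
        fix k l e v p assume "k \<in> VOb (opp V K)" "l \<in> VOb (opp V K)" "el e" "ty e = x" "el v" "ty v = VHom (opp V K) k l" "el p" "ty p = FOb w k"
          "e \<sharp> v" "v \<sharp> e" "e \<sharp> p" "p \<sharp> e" "v \<sharp> p" "p \<sharp> v"
        then have [simp]: "k \<in> VOb K" "l \<in> VOb K" "el e" "ty e = x" "el v" "ty v = VHom K l k" "el p" "ty p = FOb w k"
          "e \<sharp> v" "v \<sharp> e" "e \<sharp> p" "p \<sharp> e" "v \<sharp> p" "p \<sharp> v" by simp_all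
        show "?\<tau> l \<bullet> \<langle>e, act w k l v p\<rangle>
          = cmp (opp V PP) (dual y) (FOb (op_vfun S) k) (FOb (op_vfun S) l) (FHom (op_vfun S) k l \<bullet> v) (?\<tau> k \<bullet> \<langle>e, p\<rangle>)"
          by (simp add: \<sigma>_nat shift_comp)
      qed simp_all
      then obtain h where h: "factors (opp V PP) (opp V K) w (op_vfun S) C \<eta> (dual y) x ?\<tau> h"
        using wlimD(3)[OF lim, of "dual y" x ?\<tau>] by auto
      have [simp]: "h \<in> Arr V" "Dom V h = x" "Cod V h = NP C (dual y)" using factorsD(1-3)[OF h] by simp_all
      have h_el: "cmp PP (FOb S k) C (dual y) (h \<bullet> e) (\<eta> k \<bullet> p) = shift (FOb S k) y \<bullet> \<sigma> k \<bullet> \<langle>e, p\<rangle>"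
        if "k \<in> VOb K" "el e" "ty e = x" "el p" "ty p = FOb w k" "e \<sharp> p" for k e p
        using factorsD(4)[OF h, of k e p] that apart_sym[OF that(6)] by simp
      have "factors (opp V VV) (opp V K) w ?G (FOb (op_vfun ?F) C) (\<lambda>k. FHom (op_vfun ?F) C (FOb (op_vfun S) k) \<cdot> \<eta> k) y x \<sigma> (R C \<cdot> h)"
      proof (rule factorsI)
        fix k e p assume "k \<in> VOb (opp V K)" and [simp]: "el e" "ty e = x" "el p" "ty p = FOb w k" "e \<sharp> p" "p \<sharp> e"
        then have [simp]: "k \<in> VOb K" by simp
        show "cmp (opp V VV) y (FOb (op_vfun ?F) C) (FOb ?G k) ((FHom (op_vfun ?F) C (FOb (op_vfun S) k) \<cdot> \<eta> k) \<bullet> p) ((R C \<cdot> h) \<bullet> e) = \<sigma> k \<bullet> \<langle>e, p\<rangle>"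
          using R_nat[of C "FOb S k" "h \<bullet> e" "\<eta> k \<bullet> p"] by (simp add: h_el R)
      qed simp_all
      then show "\<exists>h. factors (opp V VV) (opp V K) w ?G (FOb (op_vfun ?F) C) (\<lambda>k. FHom (op_vfun ?F) C (FOb (op_vfun S) k) \<cdot> \<eta> k) y x \<sigma> h" ..
    next
      fix y x \<sigma> h h' assume "y \<in> VOb (opp V VV)" and x [simp]: "x \<in> Ob V"
        and h: "factors (opp V VV) (opp V K) w ?G (FOb (op_vfun ?F) C) (\<lambda>k. FHom (op_vfun ?F) C (FOb (op_vfun S) k) \<cdot> \<eta> k) y x \<sigma> h"
        and h': "factors (opp V VV) (opp V K) w ?G (FOb (op_vfun ?F) C) (\<lambda>k. FHom (op_vfun ?F) C (FOb (op_vfun S) k) \<cdot> \<eta> k) y x \<sigma> h'"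
      then have y [simp]: "y \<in> Ob V" by simp
      note [simp] = dual_rules(1)[OF y] shift_rules(1-3)[OF _ y]
      have [simp]: "h \<in> Arr V" "Dom V h = x" "Cod V h = ihom V (NP \<phi> C) y" "h' \<in> Arr V" "Dom V h' = x" "Cod V h' = ihom V (NP \<phi> C) y"
        using factorsD(1-3)[OF h] factorsD(1-3)[OF h'] by simp_all
      have eq: "shift C y \<cdot> h = shift C y \<cdot> h'"
      proof (rule wlim_ext[OF lim So wt, of "dual y"])
        fix k e p assume "k \<in> VOb (opp V K)" "el e" "ty e = Dom V (shift C y \<cdot> h')" and [simp]: "el p" "ty p = FOb w k" "e \<sharp> p" "p \<sharp> e"
        then have [simp]: "k \<in> VOb K" "el e" "ty e = x" by simp_all
        have "cmp VV (NP \<phi> (FOb S k)) (NP \<phi> C) y (h \<bullet> e) (FHom ?F (FOb S k) C \<bullet> \<eta> k \<bullet> p)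
          = cmp VV (NP \<phi> (FOb S k)) (NP \<phi> C) y (h' \<bullet> e) (FHom ?F (FOb S k) C \<bullet> \<eta> k \<bullet> p)"
          using factorsD(4)[OF h, of k e p] factorsD(4)[OF h', of k e p] by simp
        then have "shift (FOb S k) y \<bullet> cmp VV (NP \<phi> (FOb S k)) (NP \<phi> C) y (h \<bullet> e) (FHom ?F (FOb S k) C \<bullet> \<eta> k \<bullet> p)
          = shift (FOb S k) y \<bullet> cmp VV (NP \<phi> (FOb S k)) (NP \<phi> C) y (h' \<bullet> e) (FHom ?F (FOb S k) C \<bullet> \<eta> k \<bullet> p)"
          by (rule arg_cong)
        then show "cmp (opp V PP) (dual y) C (FOb (op_vfun S) k) (\<eta> k \<bullet> p) ((shift C y \<cdot> h) \<bullet> e)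
          = cmp (opp V PP) (dual y) C (FOb (op_vfun S) k) (\<eta> k \<bullet> p) ((shift C y \<cdot> h') \<bullet> e)"
          by (simp add: shift_comp)
      qed simp_all
      obtain R where R: "\<And>m. \<lbrakk>el m; ty m = ihom V (NP \<phi> C) y\<rbrakk> \<Longrightarrow> R \<bullet> shift C y \<bullet> m = m"
      proof (rule shift_retraction[OF u y])
        fix R assume R: "\<And>\<chi> m. \<lbrakk>vfunctor V (opp V B) VV \<chi>; el m; ty m = ihom V (NP \<phi> \<chi>) y\<rbrakk> \<Longrightarrow> R \<chi> \<bullet> shift \<chi> y \<bullet> m = m"
        show thesis by (rule that[of "R C"]) (rule R[OF C])
      qed
      show "h = h'"
      proof (rule arrow_ext)
        fix e assume [simp]: "el e" "ty e = Dom V h"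
        have "R \<bullet> (shift C y \<cdot> h) \<bullet> e = R \<bullet> (shift C y \<cdot> h') \<bullet> e" unfolding eq ..
        then show "h \<bullet> e = h' \<bullet> e" by (simp add: R)
      qed simp_all
    qed
  qed
qed

end

section \<open>Points of a weighted limit in the base\<close>

context smcc
begin

text \<open>A point of \<open>L\<close> is a factorisation with the unit both as context and as
  vertex; the unitors in \<open>?\<sigma>\<close> account for these two units.\<close>

lemma wlim_point:
  assumes w: "wlim VV X \<phi> T L \<eta>" and T: "vfunctor V X VV T" and \<phi>: "vfunctor V X VV \<phi>"
    and \<gamma> [simp]: "\<And>k. k \<in> VOb X \<Longrightarrow> \<gamma> k \<in> Arr V" "\<And>k. k \<in> VOb X \<Longrightarrow> Dom V (\<gamma> k) = FOb \<phi> k" "\<And>k. k \<in> VOb X \<Longrightarrow> Cod V (\<gamma> k) = FOb T k"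
    and nat: "\<And>k l v p. \<lbrakk>k \<in> VOb X; l \<in> VOb X; el v; ty v = VHom X k l; el p; ty p = FOb \<phi> k; v \<sharp> p; p \<sharp> v\<rbrakk> \<Longrightarrow>
      \<gamma> l \<bullet> act \<phi> k l v p = act T k l v (\<gamma> k \<bullet> p)"
  obtains u where "u \<in> Arr V" "Dom V u = \<I>" "Cod V u = L"
    "\<And>k p. \<lbrakk>k \<in> VOb X; el p; ty p = FOb \<phi> k\<rbrakk> \<Longrightarrow> evl L (FOb T k) (\<eta> k \<bullet> p) (u \<bullet> star) = \<gamma> k \<bullet> p"
proof -
  note [simp] = vfunctor_vcategory[OF T] vfunctor_rules[OF T] vfunctor_self_Ob[OF T] vfunctor_rules[OF \<phi>] vfunctor_self_Ob[OF \<phi>]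
    cylinderD(1-3)[OF wlimD(2)[OF w]]
  have L [simp]: "L \<in> Ob V" using wlimD(1)[OF w] by simp
  let ?\<sigma> = "\<lambda>k. transp V (\<I> \<odot> FOb \<phi> k) \<I> (FOb T k) (\<gamma> k \<cdot> lunit V (FOb \<phi> k) \<cdot> (\<one> \<I> \<otimes> lunit V (FOb \<phi> k)) \<cdot> symm V (\<I> \<odot> FOb \<phi> k) \<I>)"
  have "family VV X \<phi> T \<I> \<I> ?\<sigma>"
  proof (rule familyI)
    fix k l e v p
    assume [simp]: "k \<in> VOb X" "l \<in> VOb X" "el e" "ty e = \<I>" "el v" "ty v = VHom X k l" "el p" "ty p = FOb \<phi> k"
      "e \<sharp> v" "v \<sharp> e" "e \<sharp> p" "p \<sharp> e" "v \<sharp> p" "p \<sharp> v"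
    show "?\<sigma> l \<bullet> \<langle>e, act \<phi> k l v p\<rangle> = cmp VV \<I> (FOb T k) (FOb T l) (FHom T k l \<bullet> v) (?\<sigma> k \<bullet> \<langle>e, p\<rangle>)"
      by (rule eval_ext[of _ \<I> "FOb T l"]) (simp_all add: ectx_ac lunit_eval nat)
  qed simp_all
  then obtain h where h: "factors VV X \<phi> T L \<eta> \<I> \<I> ?\<sigma> h"
    using wlimD(3)[OF w, of \<I> \<I> ?\<sigma>] by auto
  note [simp] = factorsD(1-3)[OF h]
  show ?thesis
  proof (rule that[of "ev V \<I> L \<cdot> (h \<otimes> \<one> \<I>) \<cdot> linv \<I>"])
    fix k p assume [simp]: "k \<in> VOb X" "el p" "ty p = FOb \<phi> k"
    have "evl \<I> (FOb T k) (cmp VV \<I> L (FOb T k) (\<eta> k \<bullet> p) (h \<bullet> star)) star = evl \<I> (FOb T k) (?\<sigma> k \<bullet> \<langle>star, p\<rangle>) star"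
      using factorsD(4)[OF h, of k star p] by simp
    then show "evl L (FOb T k) (\<eta> k \<bullet> p) ((ev V \<I> L \<cdot> (h \<otimes> \<one> \<I>) \<cdot> linv \<I>) \<bullet> star) = \<gamma> k \<bullet> p"
      by simp
  qed simp_all
qed

end

section \<open>The weighted limit and colimit of the Yoneda embeddings\<close>

context small_weight
begin

abbreviation co where "co k \<equiv> hom_into V B B (id_vfun V B) k"

lemma co_rules:
  assumes "k \<in> VOb B"
  shows "vfunctor V B VV (co k)"
    and "c \<in> VOb B \<Longrightarrow> FOb (co k) c = VHom B k c"
    and "\<lbrakk>c \<in> VOb B; d \<in> VOb B\<rbrakk> \<Longrightarrow> FHom (co k) c d \<in> Arr V"
    and "\<lbrakk>c \<in> VOb B; d \<in> VOb B\<rbrakk> \<Longrightarrow> Dom V (FHom (co k) c d) = VHom B c d"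
    and "\<lbrakk>c \<in> VOb B; d \<in> VOb B\<rbrakk> \<Longrightarrow> Cod V (FHom (co k) c d) = ihom V (VHom B k c) (VHom B k d)"
    and "\<lbrakk>c \<in> VOb B; d \<in> VOb B; el f; ty f = VHom B c d; el g; ty g = VHom B k c; f \<sharp> g\<rbrakk> \<Longrightarrow>
      evl (VHom B k c) (VHom B k d) (FHom (co k) c d \<bullet> f) g = cmp B k c d f g"
  using assms hom_into_rules[OF vfunctor_id, of B k] base_rules by simp_all

lemma yoneda'_rules:
  shows "vfunctor V (opp V B) (Fun B) (yoneda' V B)"
    and "k \<in> VOb B \<Longrightarrow> FOb (yoneda' V B) k = co k"
    and "\<lbrakk>k \<in> VOb B; l \<in> VOb B\<rbrakk> \<Longrightarrow> FHom (yoneda' V B) k l \<in> Arr V"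
    and "\<lbrakk>k \<in> VOb B; l \<in> VOb B\<rbrakk> \<Longrightarrow> Dom V (FHom (yoneda' V B) k l) = VHom B l k"
    and "\<lbrakk>k \<in> VOb B; l \<in> VOb B\<rbrakk> \<Longrightarrow> Cod V (FHom (yoneda' V B) k l) = NT B (co k) (co l)"
    and "\<lbrakk>k \<in> VOb B; l \<in> VOb B; c \<in> VOb B; el g; ty g = VHom B l k; el f; ty f = VHom B k c; g \<sharp> f\<rbrakk> \<Longrightarrow>
      evl (VHom B k c) (VHom B l c) (pr B (co k) (co l) c \<bullet> FHom (yoneda' V B) k l \<bullet> g) f = cmp B l k c f g"
  using vfunctor_hom_into_functor[OF vfunctor_id EB] hom_into_functor_typing[OF vfunctor_id EB, of k, folded yoneda'_def] base_rules
  by (simp_all add: yoneda'_def)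

text \<open>The unit of the limit \<open>\<psi>\<close> of \<open>yoneda'\<close> sends \<open>q\<close> to the evaluation \<open>r \<mapsto> r q\<close>.\<close>

lemma limit_unit_exists:
  assumes k [simp]: "k \<in> VOb B"
  shows "\<exists>h. h \<in> Arr V \<and> Dom V h = FOb \<phi> k \<and> Cod V h = NT B \<psi> (co k) \<and>
    (\<forall>c q r. c \<in> VOb B \<longrightarrow> el q \<longrightarrow> ty q = FOb \<phi> k \<longrightarrow> el r \<longrightarrow> ty r = PC c \<longrightarrow> q \<sharp> r \<longrightarrow>
      evl (PC c) (VHom B k c) (pr B \<psi> (co k) c \<bullet> h \<bullet> q) r = pcv c k r q)"
proof -
  note [simp] = psi_rules \<psi>_rules(1) co_rules[OF k]
  let ?\<sigma> = "\<lambda>c. ev V (FOb \<phi> k) (VHom B k c) \<cdot> (pc c k \<otimes> \<one> (FOb \<phi> k)) \<cdot> symm V (FOb \<phi> k) (PC c)"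
  have nat: "?\<sigma> d \<bullet> \<langle>e, act \<psi> c d f s\<rangle> = act (co k) c d f (?\<sigma> c \<bullet> \<langle>e, s\<rangle>)"
    if [simp]: "c \<in> VOb B" "d \<in> VOb B" "el e" "ty e = FOb \<phi> k" "el f" "ty f = VHom B c d" and s: "el s" "ty s = FOb \<psi> c"
      and [simp]: "e \<sharp> f" "f \<sharp> e" "e \<sharp> s" "s \<sharp> e" "f \<sharp> s" "s \<sharp> f" for c d e f s
  proof -
    have [simp]: "el s" "ty s = PC c" using s by simp_all
    show ?thesis by simp
  qed
  obtain h where h: "h \<in> Arr V" "Dom V h = FOb \<phi> k" "Cod V h = NT B \<psi> (co k)"
    "\<And>c e s. \<lbrakk>c \<in> VOb B; el e; ty e = FOb \<phi> k; el s; ty s = FOb \<psi> c; e \<sharp> s\<rbrakk> \<Longrightarrow>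
      cpt B \<psi> (co k) c (h \<bullet> e) s = ?\<sigma> c \<bullet> \<langle>e, s\<rangle>"
    by (rule NT_intro[OF EB \<psi>_rules(1) co_rules(1)[OF k], of "FOb \<phi> k" ?\<sigma>]; (rule that)?) (simp_all add: nat)
  show ?thesis
  proof (intro exI[of _ h] conjI allI impI)
    fix c q r assume [simp]: "c \<in> VOb B" "el q" "ty q = FOb \<phi> k" "el r" "ty r = PC c" and ap [simp]: "q \<sharp> r"
    show "evl (PC c) (VHom B k c) (pr B \<psi> (co k) c \<bullet> h \<bullet> q) r = pcv c k r q"
      using h(4)[of c q r] apart_sym[OF ap] by simp
  qed (simp_all add: h)
qed

definition limit_unit where
  "limit_unit k = (SOME h. h \<in> Arr V \<and> Dom V h = FOb \<phi> k \<and> Cod V h = NT B \<psi> (co k) \<and>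
    (\<forall>c q r. c \<in> VOb B \<longrightarrow> el q \<longrightarrow> ty q = FOb \<phi> k \<longrightarrow> el r \<longrightarrow> ty r = PC c \<longrightarrow> q \<sharp> r \<longrightarrow>
      evl (PC c) (VHom B k c) (pr B \<psi> (co k) c \<bullet> h \<bullet> q) r = pcv c k r q))"

lemma limit_unit_rules:
  assumes k: "k \<in> VOb B"
  shows "limit_unit k \<in> Arr V" "Dom V (limit_unit k) = FOb \<phi> k" "Cod V (limit_unit k) = NT B \<psi> (co k)"
    and "\<lbrakk>c \<in> VOb B; el q; ty q = FOb \<phi> k; el r; ty r = PC c; q \<sharp> r\<rbrakk> \<Longrightarrow>
      evl (PC c) (VHom B k c) (pr B \<psi> (co k) c \<bullet> limit_unit k \<bullet> q) r = pcv c k r q"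
  using someI_ex[OF limit_unit_exists[OF k], folded limit_unit_def] by simp_all

text \<open>Exchange of arguments: a family
  \<open>x \<otimes> \<phi> k \<rightarrow> [F, B(k,-)]\<close> is the same as a natural family
  \<open>x \<otimes> F c \<rightarrow> [\<phi>, B(-,c)]\<close>, and that is a map from
  \<open>x\<close> to \<open>[F, \<psi>]\<close>.\<close>

lemma limit_of_yoneda:
  "wlim (Fun B) (opp V B) \<phi> (yoneda' V B) \<psi> limit_unit"
proof (rule wlimI)
  note [simp] = psi_rules \<psi>_rules(1) co_rules yoneda'_rules limit_unit_rules
  show "\<psi> \<in> VOb (Fun B)" by simp
  show "cylinder (Fun B) (opp V B) \<phi> (yoneda' V B) \<psi> limit_unit"
  proof (rule cylinderI)
    fix k l v p assume "k \<in> VOb (opp V B)" "l \<in> VOb (opp V B)" "el v" "ty v = VHom (opp V B) k l" "el p" "ty p = FOb \<phi> k" "v \<sharp> p" "p \<sharp> v"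
    then have [simp]: "k \<in> VOb B" "l \<in> VOb B" "el v" "ty v = VHom B l k" "el p" "ty p = FOb \<phi> k" "v \<sharp> p" "p \<sharp> v" by simp_all
    let ?l = "limit_unit l \<bullet> act \<phi> k l v p"
    let ?r = "cmp (Fun B) \<psi> (FOb (yoneda' V B) k) (FOb (yoneda' V B) l) (FHom (yoneda' V B) k l \<bullet> v) (limit_unit k \<bullet> p)"
    show "?l = ?r"
    proof (rule Nat_el_ext[OF EB \<psi>_rules(1) co_rules(1), of l])
      fix c r assume "c \<in> VOb B" "el r" "ty r = FOb \<psi> c" "?l \<sharp> r" "r \<sharp> ?l" "?r \<sharp> r" "r \<sharp> ?r"
      then have [simp]: "c \<in> VOb B" "el r" "ty r = PC c" "v \<sharp> r" "r \<sharp> v" "p \<sharp> r" "r \<sharp> p" by simp_all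
      show "cpt B \<psi> (co l) c ?l r = cpt B \<psi> (co l) c ?r r"
        by simp
    qed (simp_all add: ectx_ac)
  qed simp_all
next
  note [simp] = psi_rules \<psi>_rules(1) co_rules yoneda'_rules limit_unit_rules
  fix F x \<sigma> assume "F \<in> VOb (Fun B)" and x [simp]: "x \<in> Ob V" and fam: "family (Fun B) (opp V B) \<phi> (yoneda' V B) F x \<sigma>"
  then have F: "vfunctor V B VV F" by simp
  note [simp] = F vfunctor_rules[OF F] vfunctor_self_Ob[OF F]
  have \<sigma> [simp]: "\<sigma> k \<in> Arr V" "Dom V (\<sigma> k) = x \<odot> FOb \<phi> k" "Cod V (\<sigma> k) = NT B F (co k)" if "k \<in> VOb B" for k
    using familyD(1-3)[OF fam, of k] that by simp_all
  have \<sigma>_nat: "\<sigma> l \<bullet> \<langle>e, act \<phi> k l v p\<rangle>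
      = cmp (Fun B) F (co k) (co l) (FHom (yoneda' V B) k l \<bullet> v) (\<sigma> k \<bullet> \<langle>e, p\<rangle>)"
    if "k \<in> VOb B" "l \<in> VOb B" "el e" "ty e = x" "el v" "ty v = VHom B l k" "el p" "ty p = FOb \<phi> k" "e \<sharp> v" "e \<sharp> p" "v \<sharp> p" for k l e v p
    using familyD(4)[OF fam, of k l e v p] that by simp
  have \<sigma>_Nat: "evl (FOb F d) (VHom B k d) (pr B F (co k) d \<bullet> \<sigma> k \<bullet> \<langle>e, p\<rangle>) (act F c d f s)
      = cmp B k c d f (evl (FOb F c) (VHom B k c) (pr B F (co k) c \<bullet> \<sigma> k \<bullet> \<langle>e, p\<rangle>) s)"
    if h [simp]: "k \<in> VOb B" "c \<in> VOb B" "d \<in> VOb B" "el e" "ty e = x" "el p" "ty p = FOb \<phi> k" "el f" "ty f = VHom B c d" "el s" "ty s = FOb F c"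
      "e \<sharp> p" "e \<sharp> f" "p \<sharp> f" "e \<sharp> s" "p \<sharp> s" "f \<sharp> s" for k c d e p f s
    using Nat_natural[OF EB F co_rules(1)[OF h(1)], of c d "\<sigma> k \<bullet> \<langle>e, p\<rangle>" f s] apart_sym[OF h(13)] apart_sym[OF h(14)] by simp
  let ?P = "\<lambda>c h. h \<in> Arr V \<and> Dom V h = x \<odot> FOb F c \<and> Cod V h = PC c \<and>
     (\<forall>k e s p. k \<in> VOb B \<longrightarrow> el e \<longrightarrow> ty e = x \<longrightarrow> el s \<longrightarrow> ty s = FOb F c \<longrightarrow> el p \<longrightarrow> ty p = FOb \<phi> k \<longrightarrow> e \<sharp> s \<longrightarrow> e \<sharp> p \<longrightarrow> s \<sharp> p \<longrightarrow>
       pcv c k (h \<bullet> \<langle>e, s\<rangle>) p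
       = evl (FOb F c) (VHom B k c) (pr B F (co k) c \<bullet> \<sigma> k \<bullet> \<langle>e, p\<rangle>) s)"
  have ex: "\<exists>h. ?P c h" if c [simp]: "c \<in> VOb B" for c
  proof -
    let ?\<tau> = "\<lambda>k. ev V (FOb F c) (VHom B k c) \<cdot> ((pr B F (co k) c \<cdot> \<sigma> k) \<otimes> \<one> (FOb F c)) \<cdot> swap_last x (FOb F c) (FOb \<phi> k)"
    obtain h where h: "h \<in> Arr V" "Dom V h = x \<odot> FOb F c" "Cod V h = PC c"
      "\<And>k e s p. \<lbrakk>k \<in> VOb (opp V B); el e; ty e = x; el s; ty s = FOb F c; el p; ty p = FOb \<phi> k; e \<sharp> s; e \<sharp> p; s \<sharp> p\<rbrakk> \<Longrightarrow>
         evl (FOb \<phi> k) (FOb (yo c) k) (pc c k \<bullet> h \<bullet> \<langle>e, s\<rangle>) p = ?\<tau> k \<bullet> \<langle>\<langle>e, s\<rangle>, p\<rangle>"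
      by (rule NT_intro2[OF EBo \<phi> yo_rules(1)[OF c], of x "FOb F c" ?\<tau>]; (rule that)?) (simp_all add: \<sigma>_nat)
    show ?thesis
    proof (intro exI[of _ h] conjI allI impI)
      fix k e s p assume a [simp]: "k \<in> VOb B" "el e" "ty e = x" "el s" "ty s = FOb F c" "el p" "ty p = FOb \<phi> k" "e \<sharp> s" "e \<sharp> p" "s \<sharp> p"
      show "pcv c k (h \<bullet> \<langle>e, s\<rangle>) p
        = evl (FOb F c) (VHom B k c) (pr B F (co k) c \<bullet> \<sigma> k \<bullet> \<langle>e, p\<rangle>) s"
        using h(4)[of k e s p] apart_sym[OF a(10)] by simp
    qed (simp_all add: h)
  qed
  define m where "m = (\<lambda>c. SOME h. ?P c h)"
  have mP: "?P c (m c)" if "c \<in> VOb B" for c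
    unfolding m_def by (rule someI_ex[OF ex[OF that]])
  have m [simp]: "m c \<in> Arr V" "Dom V (m c) = x \<odot> FOb F c" "Cod V (m c) = PC c" if "c \<in> VOb B" for c
    using mP[OF that] by blast+
  have m_el [simp]: "pcv c k (m c \<bullet> \<langle>e, s\<rangle>) p = evl (FOb F c) (VHom B k c) (pr B F (co k) c \<bullet> \<sigma> k \<bullet> \<langle>e, p\<rangle>) s"
    if "c \<in> VOb B" "k \<in> VOb B" "el e" "ty e = x" "el s" "ty s = FOb F c" "el p" "ty p = FOb \<phi> k" "e \<sharp> s" "e \<sharp> p" "s \<sharp> p" for c k e s p
    using mP[OF that(1)] that by blast
  have nat: "m d \<bullet> \<langle>e, act F c d f s\<rangle> = act \<psi> c d f (m c \<bullet> \<langle>e, s\<rangle>)"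
    if [simp]: "c \<in> VOb B" "d \<in> VOb B" "el e" "ty e = x" "el f" "ty f = VHom B c d" "el s" "ty s = FOb F c"
      "e \<sharp> f" "f \<sharp> e" "e \<sharp> s" "s \<sharp> e" "f \<sharp> s" "s \<sharp> f" for c d e f s
    by (rule PC_ext[of d]) (simp_all add: ectx_ac \<sigma>_Nat)
  obtain h where h [simp]: "h \<in> Arr V" "Dom V h = x" "Cod V h = NT B F \<psi>"
    and h_el: "\<And>c e s. \<lbrakk>c \<in> VOb B; el e; ty e = x; el s; ty s = FOb F c; e \<sharp> s\<rbrakk> \<Longrightarrow>
      cpt B F \<psi> c (h \<bullet> e) s = m c \<bullet> \<langle>e, s\<rangle>"
    by (rule NT_intro[OF EB F \<psi>_rules(1), of x m]; (rule that)?) (simp_all add: nat)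
  have h_el' [simp]: "evl (FOb F c) (PC c) (pr B F \<psi> c \<bullet> h \<bullet> e) s = m c \<bullet> \<langle>e, s\<rangle>"
    if "c \<in> VOb B" "el e" "ty e = x" "el s" "ty s = FOb F c" "e \<sharp> s" for c e s
    using h_el[OF that] that by simp
  have "factors (Fun B) (opp V B) \<phi> (yoneda' V B) \<psi> limit_unit F x \<sigma> h"
  proof (rule factorsI)
    fix k e p assume "k \<in> VOb (opp V B)" and [simp]: "el e" "ty e = x" "el p" "ty p = FOb \<phi> k" "e \<sharp> p" "p \<sharp> e"
    then have k [simp]: "k \<in> VOb B" by simp
    let ?l = "cmp (Fun B) F \<psi> (FOb (yoneda' V B) k) (limit_unit k \<bullet> p) (h \<bullet> e)"
    show "?l = \<sigma> k \<bullet> \<langle>e, p\<rangle>"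
      by (rule Nat_el_ext[OF EB F co_rules(1)[OF k]]) (simp_all add: ectx_ac)
  qed simp_all
  then show "\<exists>h. factors (Fun B) (opp V B) \<phi> (yoneda' V B) \<psi> limit_unit F x \<sigma> h" ..
next
  note [simp] = psi_rules \<psi>_rules(1) co_rules yoneda'_rules limit_unit_rules
  fix F x \<sigma> h h' assume "F \<in> VOb (Fun B)" and x [simp]: "x \<in> Ob V"
    and h: "factors (Fun B) (opp V B) \<phi> (yoneda' V B) \<psi> limit_unit F x \<sigma> h" and h': "factors (Fun B) (opp V B) \<phi> (yoneda' V B) \<psi> limit_unit F x \<sigma> h'"
  then have F: "vfunctor V B VV F" by simp
  note [simp] = F vfunctor_rules[OF F] vfunctor_self_Ob[OF F]
  have [simp]: "h \<in> Arr V" "Dom V h = x" "Cod V h = NT B F \<psi>" "h' \<in> Arr V" "Dom V h' = x" "Cod V h' = NT B F \<psi>"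
    using factorsD(1-3)[OF h] factorsD(1-3)[OF h'] by simp_all
  show "h = h'"
  proof (rule arrow_ext)
    fix e assume "el e" "ty e = Dom V h"
    then have [simp]: "el e" "ty e = x" by simp_all
    show "h \<bullet> e = h' \<bullet> e"
    proof (rule Nat_el_ext[OF EB F \<psi>_rules(1)])
      fix c s assume "c \<in> VOb B" "el s" "ty s = FOb F c" "h \<bullet> e \<sharp> s" "s \<sharp> h \<bullet> e" "h' \<bullet> e \<sharp> s" "s \<sharp> h' \<bullet> e"
      then have c [simp]: "c \<in> VOb B" and [simp]: "el s" "ty s = FOb F c" "e \<sharp> s" "s \<sharp> e" by simp_all
      let ?l = "\<lambda>h. evl (FOb F c) (PC c) (pr B F \<psi> c \<bullet> h \<bullet> e) s"
      have "?l h = ?l h'"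
      proof (rule PC_ext[OF c])
        fix k p assume "k \<in> VOb B" "el p" "ty p = FOb \<phi> k" "?l h \<sharp> p" "p \<sharp> ?l h" "?l h' \<sharp> p" "p \<sharp> ?l h'"
        then have [simp]: "k \<in> VOb B" "el p" "ty p = FOb \<phi> k" "e \<sharp> p" "p \<sharp> e" "s \<sharp> p" "p \<sharp> s" by simp_all
        have "cmp (Fun B) F \<psi> (co k) (limit_unit k \<bullet> p) (h \<bullet> e) = cmp (Fun B) F \<psi> (co k) (limit_unit k \<bullet> p) (h' \<bullet> e)"
          using factorsD(4)[OF h, of k e p] factorsD(4)[OF h', of k e p] by simp
        then have "evl (FOb F c) (VHom B k c) (pr B F (co k) c \<bullet> cmp (Fun B) F \<psi> (co k) (limit_unit k \<bullet> p) (h \<bullet> e)) s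
          = evl (FOb F c) (VHom B k c) (pr B F (co k) c \<bullet> cmp (Fun B) F \<psi> (co k) (limit_unit k \<bullet> p) (h' \<bullet> e)) s"
          by (simp only:)
        then show "pcv c k (?l h) p = pcv c k (?l h') p"
          by simp
      qed simp_all
      then show "cpt B F \<psi> c (h \<bullet> e) s = cpt B F \<psi> c (h' \<bullet> e) s" by simp
    qed simp_all
  qed simp_all
qed

theorem preserves_yoneda_limit_dual_point:
  assumes "preserves_wlimit V (Fun B) VV WF B \<phi> (yoneda' V B)"
  shows "\<exists>u. dual_point u"
proof -
  note [simp] = psi_rules \<psi>_rules(1) co_rules yoneda'_rules limit_unit_rules kap_rules FHom_WF vfunctor_rules[OF vfunctor_WF]
    wcolim_rules[OF co_rules(1)]
  have w: "is_weight V B \<phi>" unfolding is_weight_def by (rule \<phi>)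
  let ?T = "comp_vfun V (opp V B) WF (yoneda' V B)"
  have T: "vfunctor V (opp V B) VV ?T" by (rule vfunctor_comp[OF yoneda'_rules(1) vfunctor_WF])
  have lim: "wlim VV (opp V B) \<phi> ?T (W \<psi>) (\<lambda>k. FHom WF \<psi> (FOb (yoneda' V B) k) \<cdot> limit_unit k)"
  proof -
    have "wlim VV (opp V B) \<phi> ?T (FOb WF \<psi>) (\<lambda>k. FHom WF \<psi> (FOb (yoneda' V B) k) \<cdot> limit_unit k)"
      using assms limit_of_yoneda unfolding preserves_wlimit_iff[OF yoneda'_rules(1) w vfunctor_WF EBo] by blast
    then show ?thesis by (simp only: FOb_WF[OF \<psi>_rules(1)])
  qed
  let ?\<gamma> = "\<lambda>k. coc (co k) k \<cdot> (\<one> (FOb \<phi> k) \<otimes> VId B k) \<cdot> rinv (FOb \<phi> k)"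
  \<comment> \<open>Moving \<open>v\<close> across the tensor product identifies the class of
    \<open>\<phi> v p \<otimes> 1\<close> with that of \<open>p \<otimes> v\<close>.\<close>
  have \<gamma>_nat: "?\<gamma> l \<bullet> act \<phi> k l v p = act ?T k l v (?\<gamma> k \<bullet> p)"
    if h [simp]: "k \<in> VOb B" "l \<in> VOb B" "el v" "ty v = VHom B l k" "el p" "ty p = FOb \<phi> k" "v \<sharp> p" "p \<sharp> v" for k l v p
    using cobalancedD(5)[OF colimD(1)[OF wcolim_colim[OF co_rules(1)[OF h(2)]]], of l k p v "VId B l \<bullet> star"] by simp
  obtain u where u [simp]: "u \<in> Arr V" "Dom V u = \<I>" "Cod V u = W \<psi>"
    and u_el: "\<And>k p. \<lbrakk>k \<in> VOb (opp V B); el p; ty p = FOb \<phi> k\<rbrakk> \<Longrightarrow>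
      evl (W \<psi>) (FOb ?T k) ((FHom WF \<psi> (FOb (yoneda' V B) k) \<cdot> limit_unit k) \<bullet> p) (u \<bullet> star) = ?\<gamma> k \<bullet> p"
    by (rule wlim_point[OF lim T \<phi>, of ?\<gamma>]; (rule that)?) (simp_all del: app_comp add: \<gamma>_nat)
  have "kap b \<bullet> \<langle>p, u \<bullet> star\<rangle> = p" if b [simp]: "b \<in> VOb B" and [simp]: "el p" "ty p = FOb \<phi> b" for b p
  proof -
    \<comment> \<open>The action \<open>q \<otimes> f \<mapsto> \<phi> f q\<close>. The map
      \<open>l\<close> that it induces from \<phi> * B(b,-) to \<phi> b recovers \<open>p\<close>
      from the class of \<open>p \<otimes> 1\<close>.\<close>
    let ?\<sigma> = "\<lambda>c. ev V (FOb \<phi> c) (FOb \<phi> b) \<cdot> (FHom \<phi> c b \<otimes> \<one> (FOb \<phi> c)) \<cdot> symm V (FOb \<phi> c) (VHom B b c)"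
    have cob: "cobalanced B \<phi> (co b) (FOb \<phi> b) ?\<sigma>"
      by (rule cobalancedI) simp_all
    obtain l where l [simp]: "l \<in> Arr V" "Dom V l = W (co b)" "Cod V l = FOb \<phi> b"
      and l_el: "\<And>c q s. \<lbrakk>c \<in> VOb B; el q; ty q = FOb \<phi> c; el s; ty s = FOb (co b) c; q \<sharp> s\<rbrakk> \<Longrightarrow> l \<bullet> coc (co b) c \<bullet> \<langle>q, s\<rangle> = ?\<sigma> c \<bullet> \<langle>q, s\<rangle>"
      by (rule colim_desc[OF \<phi> co_rules(1)[OF b] wcolim_colim[OF co_rules(1)[OF b]] cob], rule that)
    have l_el' [simp]: "l \<bullet> coc (co b) c \<bullet> \<langle>q, s\<rangle> = act \<phi> c b s q"
      if "c \<in> VOb B" "el q" "ty q = FOb \<phi> c" "el s" "ty s = VHom B b c" "q \<sharp> s" for c q s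
      using l_el[of c q s] that apart_sym[OF that(6)] by simp
    let ?r = "l \<cdot> ev V (W \<psi>) (W (co b)) \<cdot> ((FHom WF \<psi> (co b) \<cdot> limit_unit b) \<otimes> \<one> (W \<psi>))"
    \<comment> \<open>For fixed \<open>p\<close>, \<open>kap b\<close> is \<phi> * - applied to the
      evaluation \<open>r \<mapsto> r p\<close> from \<psi> to \<open>B(b,-)\<close>, followed by
      \<open>l\<close>.\<close>
    have eq: "kap b = ?r"
      by (rule colim_ext[OF \<phi> \<psi>_rules(1) wcolim_colim[OF \<psi>_rules(1)], of "FOb \<phi> b"]) simp_all
    have "kap b \<bullet> \<langle>p, u \<bullet> star\<rangle> = l \<bullet> evl (W \<psi>) (W (co b)) (FHom WF \<psi> (co b) \<bullet> limit_unit b \<bullet> p) (u \<bullet> star)"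
      unfolding eq by simp
    also have "evl (W \<psi>) (W (co b)) (FHom WF \<psi> (co b) \<bullet> limit_unit b \<bullet> p) (u \<bullet> star) = coc (co b) b \<bullet> \<langle>p, VId B b \<bullet> star\<rangle>"
      using u_el[of b p] by simp
    finally show ?thesis by simp
  qed
  then have "dual_point u" by (simp add: dual_point_def)
  then show ?thesis ..
qed

section \<open>The weight as a colimit of representables\<close>

abbreviation Y where "Y \<equiv> yoneda' V (opp V B)"

lemma Y_rules:
  shows "vfunctor V B PP Y"
    and "k \<in> VOb B \<Longrightarrow> FOb Y k = yo k"
    and "\<lbrakk>k \<in> VOb B; l \<in> VOb B\<rbrakk> \<Longrightarrow> FHom Y k l \<in> Arr V"
    and "\<lbrakk>k \<in> VOb B; l \<in> VOb B\<rbrakk> \<Longrightarrow> Dom V (FHom Y k l) = VHom B k l"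
    and "\<lbrakk>k \<in> VOb B; l \<in> VOb B\<rbrakk> \<Longrightarrow> Cod V (FHom Y k l) = NP (yo k) (yo l)"
    and "\<lbrakk>k \<in> VOb B; l \<in> VOb B; c \<in> VOb B; el g; ty g = VHom B k l; el f; ty f = VHom B c k; g \<sharp> f\<rbrakk> \<Longrightarrow>
      evl (VHom B c k) (VHom B c l) (pp (yo k) (yo l) c \<bullet> FHom Y k l \<bullet> g) f = cmp B c k l g f"
proof -
  note F = vfunctor_hom_into_functor[OF vfunctor_id_opp EBo] and t = hom_into_functor_typing[OF vfunctor_id_opp EBo, of k, folded yo_def]
  show "vfunctor V B PP Y" using F base_rules unfolding yoneda'_def by - (rule vfunctor_opp_oppD, simp_all)
  show "k \<in> VOb B \<Longrightarrow> FOb Y k = yo k" using t(1) by (simp add: yoneda'_def yo_def)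
  show "\<lbrakk>k \<in> VOb B; l \<in> VOb B\<rbrakk> \<Longrightarrow> FHom Y k l \<in> Arr V" "\<lbrakk>k \<in> VOb B; l \<in> VOb B\<rbrakk> \<Longrightarrow> Dom V (FHom Y k l) = VHom B k l"
    "\<lbrakk>k \<in> VOb B; l \<in> VOb B\<rbrakk> \<Longrightarrow> Cod V (FHom Y k l) = NP (yo k) (yo l)"
    using t(2-4)[of l] by (simp_all add: yoneda'_def yo_def)
  show "\<lbrakk>k \<in> VOb B; l \<in> VOb B; c \<in> VOb B; el g; ty g = VHom B k l; el f; ty f = VHom B c k; g \<sharp> f\<rbrakk> \<Longrightarrow>
      evl (VHom B c k) (VHom B c l) (pp (yo k) (yo l) c \<bullet> FHom Y k l \<bullet> g) f = cmp B c k l g f"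
    using t(5)[of l c g f] base_rules apart_sym[of g f] by (simp add: yoneda'_def yo_def)
qed

text \<open>The Yoneda correspondence: \<open>p\<close> gives the transformation
  \<open>f \<mapsto> \<phi> f p\<close> out of the representable at \<open>b\<close>.\<close>

lemma coyoneda_unit_exists:
  assumes b [simp]: "b \<in> VOb B"
  shows "\<exists>h. h \<in> Arr V \<and> Dom V h = FOb \<phi> b \<and> Cod V h = NP (yo b) \<phi> \<and>
    (\<forall>a p f. a \<in> VOb B \<longrightarrow> el p \<longrightarrow> ty p = FOb \<phi> b \<longrightarrow> el f \<longrightarrow> ty f = VHom B a b \<longrightarrow> p \<sharp> f \<longrightarrow>
      evl (VHom B a b) (FOb \<phi> a) (pp (yo b) \<phi> a \<bullet> h \<bullet> p) f = act \<phi> b a f p)"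
proof -
  note [simp] = psi_rules
  let ?\<sigma> = "\<lambda>a. ev V (FOb \<phi> b) (FOb \<phi> a) \<cdot> (FHom \<phi> b a \<otimes> \<one> (FOb \<phi> b)) \<cdot> symm V (FOb \<phi> b) (VHom B a b)"
  obtain h where h: "h \<in> Arr V" "Dom V h = FOb \<phi> b" "Cod V h = NP (yo b) \<phi>"
    "\<And>a e s. \<lbrakk>a \<in> VOb (opp V B); el e; ty e = FOb \<phi> b; el s; ty s = FOb (yo b) a; e \<sharp> s\<rbrakk> \<Longrightarrow>
      pcpt (yo b) \<phi> a (h \<bullet> e) s = ?\<sigma> a \<bullet> \<langle>e, s\<rangle>"
    by (rule NT_intro[OF EBo yo_rules(1)[OF b] \<phi>, of "FOb \<phi> b" ?\<sigma>]; (rule that)?) simp_all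
  show ?thesis
  proof (intro exI[of _ h] conjI allI impI)
    fix a p f assume [simp]: "a \<in> VOb B" "el p" "ty p = FOb \<phi> b" "el f" "ty f = VHom B a b" and ap [simp]: "p \<sharp> f"
    show "evl (VHom B a b) (FOb \<phi> a) (pp (yo b) \<phi> a \<bullet> h \<bullet> p) f = act \<phi> b a f p"
      using h(4)[of a p f] apart_sym[OF ap] by simp
  qed (simp_all add: h)
qed

definition coyoneda_unit where
  "coyoneda_unit b = (SOME h. h \<in> Arr V \<and> Dom V h = FOb \<phi> b \<and> Cod V h = NP (yo b) \<phi> \<and>
    (\<forall>a p f. a \<in> VOb B \<longrightarrow> el p \<longrightarrow> ty p = FOb \<phi> b \<longrightarrow> el f \<longrightarrow> ty f = VHom B a b \<longrightarrow> p \<sharp> f \<longrightarrow>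
      evl (VHom B a b) (FOb \<phi> a) (pp (yo b) \<phi> a \<bullet> h \<bullet> p) f = act \<phi> b a f p))"

lemma coyoneda_unit_rules:
  assumes b: "b \<in> VOb B"
  shows "coyoneda_unit b \<in> Arr V" "Dom V (coyoneda_unit b) = FOb \<phi> b" "Cod V (coyoneda_unit b) = NP (yo b) \<phi>"
    and "\<lbrakk>a \<in> VOb B; el p; ty p = FOb \<phi> b; el f; ty f = VHom B a b; p \<sharp> f\<rbrakk> \<Longrightarrow>
      evl (VHom B a b) (FOb \<phi> a) (pp (yo b) \<phi> a \<bullet> coyoneda_unit b \<bullet> p) f = act \<phi> b a f p"
  using someI_ex[OF coyoneda_unit_exists[OF b], folded coyoneda_unit_def] by simp_all

text \<open>A transformation out of a representable is determined by its value at the identity, so a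
  cocone under the representables weighted by \<phi> amounts to a transformation out of
  \<phi>.\<close>

lemma coyoneda:
  "wlim (opp V PP) (opp V B) \<phi> (op_vfun Y) \<phi> coyoneda_unit"
proof (rule wlimI)
  note [simp] = psi_rules Y_rules coyoneda_unit_rules
  show "\<phi> \<in> VOb (opp V PP)" by simp
  show "cylinder (opp V PP) (opp V B) \<phi> (op_vfun Y) \<phi> coyoneda_unit"
  proof (rule cylinderI)
    fix k l v p assume "k \<in> VOb (opp V B)" "l \<in> VOb (opp V B)" "el v" "ty v = VHom (opp V B) k l" "el p" "ty p = FOb \<phi> k" "v \<sharp> p" "p \<sharp> v"
    then have [simp]: "k \<in> VOb B" "el v" "ty v = VHom B l k" "el p" "ty p = FOb \<phi> k" "v \<sharp> p" "p \<sharp> v" and l [simp]: "l \<in> VOb B" by simp_all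
    let ?l = "coyoneda_unit l \<bullet> act \<phi> k l v p"
    let ?r = "cmp PP (yo l) (yo k) \<phi> (coyoneda_unit k \<bullet> p) (FHom Y l k \<bullet> v)"
    have "?l = ?r"
    proof (rule NP_ext[OF yo_rules(1)[OF l] \<phi>])
      fix c r assume "c \<in> VOb B" "el r" "ty r = FOb (yo l) c" "?l \<sharp> r" "r \<sharp> ?l" "?r \<sharp> r" "r \<sharp> ?r"
      then have [simp]: "c \<in> VOb B" "el r" "ty r = VHom B c l" "v \<sharp> r" "r \<sharp> v" "p \<sharp> r" "r \<sharp> p" by simp_all
      show "pcpt (yo l) \<phi> c ?l r = pcpt (yo l) \<phi> c ?r r"
        by simp
    qed (simp_all add: ectx_ac)
    then show "?l = cmp (opp V PP) \<phi> (FOb (op_vfun Y) k) (FOb (op_vfun Y) l) (FHom (op_vfun Y) k l \<bullet> v) (coyoneda_unit k \<bullet> p)"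
      by simp
  qed simp_all
next
  note [simp] = psi_rules Y_rules coyoneda_unit_rules
  fix \<chi> x \<sigma> assume "\<chi> \<in> VOb (opp V PP)" and x [simp]: "x \<in> Ob V" and fam: "family (opp V PP) (opp V B) \<phi> (op_vfun Y) \<chi> x \<sigma>"
  then have \<chi>: "vfunctor V (opp V B) VV \<chi>" by simp
  note [simp] = \<chi> weight_typing[OF \<chi>]
  have \<sigma> [simp]: "\<sigma> k \<in> Arr V" "Dom V (\<sigma> k) = x \<odot> FOb \<phi> k" "Cod V (\<sigma> k) = NP (yo k) \<chi>" if "k \<in> VOb B" for k
    using familyD(1-3)[OF fam, of k] that by simp_all
  have \<sigma>_nat: "\<sigma> l \<bullet> \<langle>e, act \<phi> k l v p\<rangle>
      = cmp PP (yo l) (yo k) \<chi> (\<sigma> k \<bullet> \<langle>e, p\<rangle>) (FHom Y l k \<bullet> v)"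
    if "k \<in> VOb B" "l \<in> VOb B" "el e" "ty e = x" "el v" "ty v = VHom B l k" "el p" "ty p = FOb \<phi> k" "e \<sharp> v" "e \<sharp> p" "v \<sharp> p" for k l e v p
    using familyD(4)[OF fam, of k l e v p] that apart_sym[OF that(9)] apart_sym[OF that(10)] apart_sym[OF that(11)] by simp
  have \<sigma>_Nat: "act \<chi> k c f (evl (VHom B k k) (FOb \<chi> k) (pp (yo k) \<chi> k \<bullet> \<sigma> k \<bullet> \<langle>e, p\<rangle>) (VId B k \<bullet> star))
      = evl (VHom B c k) (FOb \<chi> c) (pp (yo k) \<chi> c \<bullet> \<sigma> k \<bullet> \<langle>e, p\<rangle>) f"
    if h [simp]: "k \<in> VOb B" "c \<in> VOb B" "el e" "ty e = x" "el p" "ty p = FOb \<phi> k" "el f" "ty f = VHom B c k"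
      "e \<sharp> p" "e \<sharp> f" "p \<sharp> f" for k c e p f
    using presheaf_natural[OF yo_rules(1)[OF h(1)] \<chi>, of k c "\<sigma> k \<bullet> \<langle>e, p\<rangle>" f "VId B k \<bullet> star"] apart_sym[OF h(10)] apart_sym[OF h(11)] by simp
  let ?\<tau> = "\<lambda>a. ev V (VHom B a a) (FOb \<chi> a) \<cdot> ((pp (yo a) \<chi> a \<cdot> \<sigma> a) \<otimes> VId B a) \<cdot> rinv (x \<odot> FOb \<phi> a)"
  obtain h where h [simp]: "h \<in> Arr V" "Dom V h = x" "Cod V h = NP \<phi> \<chi>"
    and h_el: "\<And>a e s. \<lbrakk>a \<in> VOb (opp V B); el e; ty e = x; el s; ty s = FOb \<phi> a; e \<sharp> s\<rbrakk> \<Longrightarrow>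
      pcpt \<phi> \<chi> a (h \<bullet> e) s = ?\<tau> a \<bullet> \<langle>e, s\<rangle>"
    by (rule NT_intro[OF EBo \<phi> \<chi>, of x ?\<tau>]; (rule that)?) (simp_all add: \<sigma>_nat \<sigma>_Nat)
  have "factors (opp V PP) (opp V B) \<phi> (op_vfun Y) \<phi> coyoneda_unit \<chi> x \<sigma> h"
  proof (rule factorsI)
    fix k e p assume "k \<in> VOb (opp V B)" and [simp]: "el e" "ty e = x" "el p" "ty p = FOb \<phi> k" "e \<sharp> p" "p \<sharp> e"
    then have k [simp]: "k \<in> VOb B" by simp
    have "cmp PP (yo k) \<phi> \<chi> (h \<bullet> e) (coyoneda_unit k \<bullet> p) = \<sigma> k \<bullet> \<langle>e, p\<rangle>" (is "?l = ?r")
    proof (rule NP_ext[OF yo_rules(1)[OF k] \<chi>])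
      fix c f assume "c \<in> VOb B" "el f" "ty f = FOb (yo k) c" "?l \<sharp> f" "f \<sharp> ?l" "?r \<sharp> f" "f \<sharp> ?r"
      then have [simp]: "c \<in> VOb B" "el f" "ty f = VHom B c k" "e \<sharp> f" "f \<sharp> e" "p \<sharp> f" "f \<sharp> p" by simp_all
      show "pcpt (yo k) \<chi> c ?l f = pcpt (yo k) \<chi> c ?r f"
        by (simp add: h_el \<sigma>_nat \<sigma>_Nat)
    qed (simp_all add: ectx_ac)
    then show "cmp (opp V PP) \<chi> \<phi> (FOb (op_vfun Y) k) (coyoneda_unit k \<bullet> p) (h \<bullet> e) = \<sigma> k \<bullet> \<langle>e, p\<rangle>" by simp
  qed simp_all
  then show "\<exists>h. factors (opp V PP) (opp V B) \<phi> (op_vfun Y) \<phi> coyoneda_unit \<chi> x \<sigma> h" ..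
next
  note [simp] = psi_rules Y_rules coyoneda_unit_rules
  fix \<chi> x \<sigma> h h' assume "\<chi> \<in> VOb (opp V PP)" and x [simp]: "x \<in> Ob V"
    and h: "factors (opp V PP) (opp V B) \<phi> (op_vfun Y) \<phi> coyoneda_unit \<chi> x \<sigma> h" and h': "factors (opp V PP) (opp V B) \<phi> (op_vfun Y) \<phi> coyoneda_unit \<chi> x \<sigma> h'"
  then have \<chi>: "vfunctor V (opp V B) VV \<chi>" by simp
  note [simp] = \<chi> weight_typing[OF \<chi>]
  have [simp]: "h \<in> Arr V" "Dom V h = x" "Cod V h = NP \<phi> \<chi>" "h' \<in> Arr V" "Dom V h' = x" "Cod V h' = NP \<phi> \<chi>"
    using factorsD(1-3)[OF h] factorsD(1-3)[OF h'] by simp_all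
  show "h = h'"
  proof (rule arrow_ext)
    fix e assume "el e" "ty e = Dom V h"
    then have [simp]: "el e" "ty e = x" by simp_all
    show "h \<bullet> e = h' \<bullet> e"
    proof (rule NP_ext[OF \<phi> \<chi>])
      fix k p assume "k \<in> VOb B" "el p" "ty p = FOb \<phi> k" "h \<bullet> e \<sharp> p" "p \<sharp> h \<bullet> e" "h' \<bullet> e \<sharp> p" "p \<sharp> h' \<bullet> e"
      then have k [simp]: "k \<in> VOb B" and [simp]: "el p" "ty p = FOb \<phi> k" "e \<sharp> p" "p \<sharp> e" by simp_all
      have "cmp PP (yo k) \<phi> \<chi> (h \<bullet> e) (coyoneda_unit k \<bullet> p) = cmp PP (yo k) \<phi> \<chi> (h' \<bullet> e) (coyoneda_unit k \<bullet> p)"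
        using factorsD(4)[OF h, of k e p] factorsD(4)[OF h', of k e p] by simp
      then have "evl (VHom B k k) (FOb \<chi> k) (pp (yo k) \<chi> k \<bullet> cmp PP (yo k) \<phi> \<chi> (h \<bullet> e) (coyoneda_unit k \<bullet> p)) (VId B k \<bullet> star)
        = evl (VHom B k k) (FOb \<chi> k) (pp (yo k) \<chi> k \<bullet> cmp PP (yo k) \<phi> \<chi> (h' \<bullet> e) (coyoneda_unit k \<bullet> p)) (VId B k \<bullet> star)"
        by (simp only:)
      then show "pcpt \<phi> \<chi> k (h \<bullet> e) p = pcpt \<phi> \<chi> k (h' \<bullet> e) p" by simp
    qed simp_all
  qed simp_all
qed

text \<open>This is why preserving the colimit \<phi> * Y produces a colimit whose diagram is
  \<psi>.\<close>

lemma \<psi>_eq: "comp_vfun V B (cov_hom V PP \<phi>) Y = \<psi>"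
  unfolding \<psi>_def limit_functor_def yoneda'_def comp_vfun_def by (rule mk_vfun_cong) simp_all

theorem preserves_coyoneda_dual_point:
  assumes "preserves_wcolimit V PP VV (cov_hom V PP \<phi>) B \<phi> Y"
  shows "\<exists>u. dual_point u"
proof -
  note [simp] = psi_rules \<psi>_rules(1) Y_rules coyoneda_unit_rules kap_rules
  let ?F = "cov_hom V PP \<phi>"
  have F: "vfunctor V PP VV ?F" by (rule vfunctor_cov_hom) simp_all
  have w: "is_weight V B \<phi>" unfolding is_weight_def by (rule \<phi>)
  note [simp] = Fun_cov_hom[OF EBo \<phi>]
  let ?\<beta> = "\<lambda>b. ev V (FOb \<psi> b) (NP \<phi> \<phi>) \<cdot> ((FHom ?F (yo b) \<phi> \<cdot> coyoneda_unit b) \<otimes> \<one> (FOb \<psi> b))"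
  have "wlim (opp V VV) (opp V B) \<phi> (op_vfun \<psi>) (FOb (op_vfun ?F) \<phi>)
      (\<lambda>b. FHom (op_vfun ?F) \<phi> (FOb (op_vfun Y) b) \<cdot> coyoneda_unit b)"
    using assms coyoneda
    unfolding preserves_wcolimit_eq[OF Y_rules(1) F] preserves_wlimit_iff[OF vfunctor_op[OF Y_rules(1)] w vfunctor_op[OF F] EBo] comp_op_vfun \<psi>_eq
    by blast
  then have "wlim (opp V VV) (opp V B) \<phi> (op_vfun \<psi>) (NP \<phi> \<phi>) (\<lambda>b. FHom ?F (FOb Y b) \<phi> \<cdot> coyoneda_unit b)"
    by (simp only: op_vfun_simps Fun_cov_hom(1)[OF EBo \<phi> \<phi>])
  then have "wlim (opp V VV) (opp V B) \<phi> (op_vfun \<psi>) (NP \<phi> \<phi>) (\<lambda>b. FHom ?F (yo b) \<phi> \<cdot> coyoneda_unit b)"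
    by (subst wlim_cong[where \<eta>' = "\<lambda>b. FHom ?F (FOb Y b) \<phi> \<cdot> coyoneda_unit b"]) simp_all
  then have c: "colim B \<phi> \<psi> (NP \<phi> \<phi>) ?\<beta>"
    by (rule wlim_colim[OF ends_exist_vcategory[OF EB] \<phi> \<psi>_rules(1)])
  \<comment> \<open>\<open>[\<phi>,\<phi>]\<close> is now itself a colimit of \<psi> weighted by
    \<phi>, so the coprojections of the chosen colimit descend to it.\<close>
  obtain v where v [simp]: "v \<in> Arr V" "Dom V v = NP \<phi> \<phi>" "Cod V v = W \<psi>"
    and v_el: "\<And>b q s. \<lbrakk>b \<in> VOb B; el q; ty q = FOb \<phi> b; el s; ty s = FOb \<psi> b; q \<sharp> s\<rbrakk> \<Longrightarrow> v \<bullet> ?\<beta> b \<bullet> \<langle>q, s\<rangle> = coc \<psi> b \<bullet> \<langle>q, s\<rangle>"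
    by (rule colim_desc[OF \<phi> \<psi>_rules(1) c colimD(1)[OF wcolim_colim[OF \<psi>_rules(1)]]], rule that)
  have "kap b \<bullet> \<langle>p, v \<bullet> VId PP \<phi> \<bullet> star\<rangle> = p" if b [simp]: "b \<in> VOb B" and [simp]: "el p" "ty p = FOb \<phi> b" for b p
  proof -
    let ?l = "kap b \<cdot> (\<one> (FOb \<phi> b) \<otimes> v)"
    let ?r = "ev V (FOb \<phi> b) (FOb \<phi> b) \<cdot> (pp \<phi> \<phi> b \<otimes> \<one> (FOb \<phi> b)) \<cdot> symm V (FOb \<phi> b) (NP \<phi> \<phi>)"
    \<comment> \<open>After \<open>v\<close>, the pairing \<open>kap\<close> is evaluation of a
      transformation; at the identity of \<phi> this is the triangle identity.\<close>
    have eq: "?l = ?r"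
    proof (rule colim_ext[OF \<phi> \<psi>_rules(1) c, of "FOb \<phi> b"])
      fix d e q s assume d [simp]: "d \<in> VOb B" and [simp]: "el e" "ty e = FOb \<phi> b" "el q" "ty q = FOb \<phi> d" and s: "el s" "ty s = FOb \<psi> d"
        and [simp]: "e \<sharp> q" "q \<sharp> e" "e \<sharp> s" "s \<sharp> e" "q \<sharp> s" "s \<sharp> q"
      have [simp]: "el s" "ty s = PC d" using s by simp_all
      have *: "v \<bullet> cmp PP \<phi> (yo d) \<phi> (coyoneda_unit d \<bullet> q) s = coc \<psi> d \<bullet> \<langle>q, s\<rangle>"
        using v_el[of d q s] by simp
      show "?l \<bullet> \<langle>e, ?\<beta> d \<bullet> \<langle>q, s\<rangle>\<rangle> = ?r \<bullet> \<langle>e, ?\<beta> d \<bullet> \<langle>q, s\<rangle>\<rangle>"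
        by (simp add: *)
    qed simp_all
    have "?l \<bullet> \<langle>p, VId PP \<phi> \<bullet> star\<rangle> = ?r \<bullet> \<langle>p, VId PP \<phi> \<bullet> star\<rangle>" unfolding eq ..
    then show ?thesis by simp
  qed
  then have "dual_point (v \<cdot> VId PP \<phi>)" by (simp add: dual_point_def)
  then show ?thesis ..
qed

end

section \<open>Limits of cospans over a small set\<close>

text \<open>Diagram shapes must have their objects and arrows in \<open>'u\<close>, so the triples
  labelling the cospan shape are coded in that type. An infinite \<open>S\<close> satisfies
  \<open>S \<times> S \<approx> S\<close>; a finite one gives a finite set, smaller than the
  infinite \<open>U\<close>.\<close>

lemma smallness_universe_code:
  fixes U S :: "'u set"
  assumes U: "smallness_universe U" and S: "S \<prec> U"
  obtains code :: "nat \<times> 'u \<times> 'u \<Rightarrow> 'u" where "inj_on code ({..<4} \<times> S \<times> S)" "code ` ({..<4} \<times> S \<times> S) \<prec> U"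
proof -
  have inf: "infinite U" using U by (simp add: smallness_universe_def)
  have small: "{..<4::nat} \<times> S \<times> S \<prec> U"
  proof (cases "finite S")
    case True
    then show ?thesis using inf by (intro finite_lesspoll_infinite) simp_all
  next
    case False
    then have S2: "S \<times> S \<approx> S" by (simp add: card_of_Times_same_infinite eqpoll_iff_card_of_ordIso)
    have "{..<4::nat} \<times> S \<times> S \<lesssim> S \<times> S"
      using False S2 by (intro times_lepoll_mono finite_lepoll_infinite eqpoll_imp_lepoll) simp_all
    then have "{..<4::nat} \<times> S \<times> S \<lesssim> S" using S2 by (rule lepoll_trans2)
    then show ?thesis using S by (rule lesspoll_trans1)
  qed
  obtain code :: "nat \<times> 'u \<times> 'u \<Rightarrow> 'u" where code: "inj_on code ({..<4} \<times> S \<times> S)"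
    using lesspoll_imp_lepoll[OF small] by (auto simp: lepoll_def)
  show ?thesis by (rule that[OF code]) (use code small in simp)
qed

text \<open>
  The shape of the cospans \<open>X a \<rightarrow> Z a b \<leftarrow> X b\<close>. The arrow \<open>(n, a, b)\<close> is the identity of \<open>X a\<close> for
  \<open>n = 0\<close>, the identity of \<open>Z a b\<close> for \<open>n = 1\<close>, and the left or right leg for \<open>n = 2, 3\<close>; objects are
  identified with their identities.
\<close>

definition cospan_arrows where
  "cospan_arrows S = {(n, a, b). n < (4 :: nat) \<and> a \<in> S \<and> b \<in> S \<and> (n = 0 \<longrightarrow> a = b)}"

fun cospan_dom where
  "cospan_dom (n :: nat, a, b) = (if n < 2 then (n, a, b) else if n = 2 then (0, a, a) else (0, b, b))"

fun cospan_cod where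
  "cospan_cod (n :: nat, a, b) = (if n = 0 then (n, a, b) else (1, a, b))"

text \<open>In a composable pair at least one arrow is an identity, so \<open>comp\<close> only has
  to drop one of the two; a label below 2 marks an identity.\<close>

definition cospan_category where
  "cospan_category code S = \<lparr>
    Ob = code ` {t \<in> cospan_arrows S. fst t < 2},
    Arr = code ` cospan_arrows S,
    Dom = (\<lambda>f. code (cospan_dom (inv_into (cospan_arrows S) code f))),
    Cod = (\<lambda>f. code (cospan_cod (inv_into (cospan_arrows S) code f))),
    ident = (\<lambda>x. x),
    comp = (\<lambda>g f. if fst (inv_into (cospan_arrows S) code g) < 2 then f else g)\<rparr>"

declare cospan_dom.simps [simp del] cospan_cod.simps [simp del]

text \<open>The last clause is what makes composition land in the right hom-set: legs start at some
  \<open>X a\<close> and end at some \<open>Z a b\<close>, so an arrow that ends where a leg starts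
  is an identity.\<close>

lemma cospan_simps:
  assumes code: "inj_on code ({..<4} \<times> S \<times> S)"
  shows "t \<in> cospan_arrows S \<Longrightarrow> inv_into (cospan_arrows S) code (code t) = t"
    and "\<lbrakk>t \<in> cospan_arrows S; t' \<in> cospan_arrows S\<rbrakk> \<Longrightarrow> code t = code t' \<longleftrightarrow> t = t'"
    and "t \<in> cospan_arrows S \<Longrightarrow> cospan_dom t \<in> cospan_arrows S"
    and "t \<in> cospan_arrows S \<Longrightarrow> cospan_cod t \<in> cospan_arrows S"
    and "fst (cospan_dom t) < 2" "fst (cospan_cod t) < 2"
    and "fst t < 2 \<Longrightarrow> cospan_dom t = t"
    and "fst t < 2 \<Longrightarrow> cospan_cod t = t"
    and "\<not> fst t < 2 \<Longrightarrow> cospan_cod t' = cospan_dom t \<Longrightarrow> fst t' < 2"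
proof -
  have "cospan_arrows S \<subseteq> {..<4} \<times> S \<times> S" by (auto simp: cospan_arrows_def)
  then have i: "inj_on code (cospan_arrows S)" by (rule inj_on_subset[OF code])
  show "t \<in> cospan_arrows S \<Longrightarrow> inv_into (cospan_arrows S) code (code t) = t" by (rule inv_into_f_f[OF i])
  show "\<lbrakk>t \<in> cospan_arrows S; t' \<in> cospan_arrows S\<rbrakk> \<Longrightarrow> code t = code t' \<longleftrightarrow> t = t'" by (rule inj_on_eq_iff[OF i])
qed (cases t; cases t'; auto simp: cospan_arrows_def cospan_dom.simps cospan_cod.simps split: if_splits)+

lemma hom_cospan:
  assumes code: "inj_on code ({..<4} \<times> S \<times> S)"
  shows "f \<in> hom (cospan_category code S) x y \<longleftrightarrow>
    (\<exists>t\<in>cospan_arrows S. f = code t \<and> x = code (cospan_dom t) \<and> y = code (cospan_cod t))"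
  by (auto simp: cospan_category_def hom_def cospan_simps[OF code])

lemma category_cospan:
  assumes code: "inj_on code ({..<4} \<times> S \<times> S)"
  shows "category (cospan_category code S)"
proof -
  let ?J = "cospan_category code S"
  note [simp] = cospan_simps(1-8)[OF code] and hom = hom_cospan[OF code]
  have comp [simp]: "comp ?J (code t) f = (if fst t < 2 then f else code t)" if "t \<in> cospan_arrows S" for t f
    using that by (simp add: cospan_category_def)
  have id [simp]: "ident ?J x = x" for x by (simp add: cospan_category_def)
  show ?thesis
  proof
    fix f x y g z assume "f \<in> hom ?J x y" "g \<in> hom ?J y z"
    then obtain s t where s: "s \<in> cospan_arrows S" "f = code s" "x = code (cospan_dom s)" "y = code (cospan_cod s)"
      and t: "t \<in> cospan_arrows S" "g = code t" "y = code (cospan_dom t)" "z = code (cospan_cod t)"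
      unfolding hom by auto
    have y: "cospan_cod s = cospan_dom t" using s t by simp
    show "comp ?J g f \<in> hom ?J x z"
    proof (cases "fst t < 2")
      case True
      then show ?thesis using s t y unfolding hom by (intro bexI[of _ s]) simp_all
    next
      case False
      then have "fst s < 2" by (rule cospan_simps(9)[OF code _ y])
      with False show ?thesis using s t y unfolding hom by (intro bexI[of _ t]) simp_all
    qed
  next
    fix w x y z f g h
    assume "f \<in> hom ?J w x" "g \<in> hom ?J x y" "h \<in> hom ?J y z"
    then show "comp ?J (comp ?J h g) f = comp ?J h (comp ?J g f)" unfolding hom by auto
  next
    fix f x y
    assume "f \<in> hom ?J x y"
    then obtain s where s: "s \<in> cospan_arrows S" "f = code s" "x = code (cospan_dom s)" "y = code (cospan_cod s)"
      unfolding hom by auto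
    show "comp ?J f (ident ?J x) = f" using s by simp
    show "comp ?J (ident ?J y) f = f" using s by simp
  next
    fix x assume "x \<in> Ob ?J"
    then show "ident ?J x \<in> hom ?J x x" unfolding hom by (auto simp: cospan_category_def)
  qed (auto simp: cospan_category_def)
qed

text \<open>A cone over all the cospans is given by its components at the \<open>X a\<close>: those
  at \<open>Z a b\<close> are forced by the left legs, and the right legs then impose the pairwise
  equations.\<close>

lemma (in category) cospan_limit:
  fixes U S :: "'u set"
  assumes U: "smallness_universe U" and complete: "small_complete U C" and S: "S \<prec> U"
    and X: "\<And>a. a \<in> S \<Longrightarrow> X a \<in> Ob C" and Z: "\<And>a b. \<lbrakk>a \<in> S; b \<in> S\<rbrakk> \<Longrightarrow> Z a b \<in> Ob C"
    and l: "\<And>a b. \<lbrakk>a \<in> S; b \<in> S\<rbrakk> \<Longrightarrow> l a b \<in> hom C (X a) (Z a b)"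
    and r: "\<And>a b. \<lbrakk>a \<in> S; b \<in> S\<rbrakk> \<Longrightarrow> r a b \<in> hom C (X b) (Z a b)"
  obtains e \<pi> where "e \<in> Ob C" "\<And>a. a \<in> S \<Longrightarrow> \<pi> a \<in> hom C e (X a)"
    "\<And>a b. \<lbrakk>a \<in> S; b \<in> S\<rbrakk> \<Longrightarrow> l a b \<cdot> \<pi> a = r a b \<cdot> \<pi> b"
    "\<And>x \<tau>. \<lbrakk>x \<in> Ob C; \<And>a. a \<in> S \<Longrightarrow> \<tau> a \<in> hom C x (X a); \<And>a b. \<lbrakk>a \<in> S; b \<in> S\<rbrakk> \<Longrightarrow> l a b \<cdot> \<tau> a = r a b \<cdot> \<tau> b\<rbrakk>
      \<Longrightarrow> \<exists>!h. h \<in> hom C x e \<and> (\<forall>a\<in>S. \<pi> a \<cdot> h = \<tau> a)"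
proof -
  obtain code :: "nat \<times> 'u \<times> 'u \<Rightarrow> 'u" where code: "inj_on code ({..<4} \<times> S \<times> S)" and small: "code ` ({..<4} \<times> S \<times> S) \<prec> U"
    by (rule smallness_universe_code[OF U S])
  note cs [simp] = cospan_simps[OF code]
  let ?J = "cospan_category code S"
  let ?dec = "inv_into (cospan_arrows S) code"
  define D where "D x = (case ?dec x of (n, a, b) \<Rightarrow> if n = 0 then X a else Z a b)" for x
  define E where "E f = (case ?dec f of (n, a, b) \<Rightarrow> if n = 0 then \<one> (X a) else if n = 1 then \<one> (Z a b) else if n = 2 then l a b else r a b)" for f
  have sub: "Ob ?J \<subseteq> code ` ({..<4} \<times> S \<times> S)" "Arr ?J \<subseteq> code ` ({..<4} \<times> S \<times> S)"
    by (auto simp: cospan_category_def cospan_arrows_def)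
  have small_J: "Ob ?J \<prec> U" "Arr ?J \<prec> U"
    using sub small by (meson lesspoll_trans1 subset_imp_lepoll)+
  have D [simp]: "D (code (n, a, b)) = (if n = 0 then X a else Z a b)" if "(n, a, b) \<in> cospan_arrows S" for n a b
    using that by (simp add: D_def)
  have E [simp]: "E (code (n, a, b)) = (if n = 0 then \<one> (X a) else if n = 1 then \<one> (Z a b) else if n = 2 then l a b else r a b)"
    if "(n, a, b) \<in> cospan_arrows S" for n a b
    using that by (simp add: E_def)
  have cases: "P t" if "t \<in> cospan_arrows S" "\<And>a. a \<in> S \<Longrightarrow> P (0, a, a)"
    "\<And>a b. \<lbrakk>a \<in> S; b \<in> S\<rbrakk> \<Longrightarrow> P (1, a, b)" "\<And>a b. \<lbrakk>a \<in> S; b \<in> S\<rbrakk> \<Longrightarrow> P (2, a, b)" "\<And>a b. \<lbrakk>a \<in> S; b \<in> S\<rbrakk> \<Longrightarrow> P (3, a, b)" for t P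
  proof -
    obtain n a b where t: "t = (n, a, b)" by (cases t)
    then have "n < 4" "a \<in> S" "b \<in> S" "n = 0 \<Longrightarrow> a = b" using that(1) by (auto simp: cospan_arrows_def)
    then have "n = 0 \<and> a = b \<or> n = 1 \<or> n = 2 \<or> n = 3" by linarith
    then show ?thesis using that(2-) \<open>a \<in> S\<close> \<open>b \<in> S\<close> t by auto
  qed
  have arrs [simp]: "(0, a, a) \<in> cospan_arrows S" "(Suc 0, a, b) \<in> cospan_arrows S" "(2, a, b) \<in> cospan_arrows S" "(3, a, b) \<in> cospan_arrows S"
    if "a \<in> S" "b \<in> S" for a b
    using that by (simp_all add: cospan_arrows_def)
  have arr0 [simp]: "(0, a, a) \<in> cospan_arrows S" if "a \<in> S" for a using that by (simp add: cospan_arrows_def)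
  have E_hom: "E (code t) \<in> hom C (D (code (cospan_dom t))) (D (code (cospan_cod t)))" if "t \<in> cospan_arrows S" for t
    using that by (rule cases) (simp_all add: cospan_dom.simps cospan_cod.simps ident_hom X Z l r)
  have E_id: "E (code t) = \<one> (D (code t))" if "fst t < 2" "t \<in> cospan_arrows S" for t
  proof -
    have "fst t < 2 \<longrightarrow> E (code t) = \<one> (D (code t))" using that(2) by (rule cases) simp_all
    then show ?thesis using that(1) by simp
  qed
  have ob: "x \<in> Ob ?J \<longleftrightarrow> (\<exists>t\<in>cospan_arrows S. fst t < 2 \<and> x = code t)" for x
    by (auto simp: cospan_category_def)
  have comp: "comp ?J (code t) f = (if fst t < 2 then f else code t)" if "t \<in> cospan_arrows S" for t f
    using that by (simp add: cospan_category_def)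
  have D_Ob: "D (code t) \<in> Ob C" if "t \<in> cospan_arrows S" for t
    using that by (rule cases) (simp_all add: X Z)
  note hom = hom_cospan[OF code]
  have func: "is_functor ?J C D E"
    unfolding is_functor_def
  proof (intro conjI ballI)
    show "D j \<in> Ob C" if "j \<in> Ob ?J" for j using that D_Ob unfolding ob by auto
    show "E u \<in> hom C (D i) (D j)" if "u \<in> hom ?J i j" for u i j using that E_hom unfolding hom by auto
    show "E (ident ?J j) = \<one> (D j)" if "j \<in> Ob ?J" for j
      using that E_id unfolding ob by (auto simp: cospan_category_def)
    fix i j k u v assume "u \<in> hom ?J i j" "v \<in> hom ?J j k"
    then obtain s t where s: "s \<in> cospan_arrows S" "u = code s" "j = code (cospan_cod s)"
      and t: "t \<in> cospan_arrows S" "v = code t" "j = code (cospan_dom t)"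
      unfolding hom by auto
    have y: "cospan_cod s = cospan_dom t" using s t by simp
    show "E (comp ?J v u) = E v \<cdot> E u"
    proof (cases "fst t < 2")
      case True
      then show ?thesis using s t y E_hom[OF s(1)] E_id[OF True t(1)] comp_ident_left by (simp add: comp)
    next
      case False
      then have 2: "fst s < 2" by (rule cospan_simps(9)[OF code _ y])
      then have d: "cospan_dom t = s" using y cospan_simps(8)[OF code] by simp
      have "comp ?J v u = v" using False t(1,2) by (simp add: comp)
      moreover have "E v \<in> hom C (D (code s)) (D (code (cospan_cod t)))" using E_hom[OF t(1)] t(2) d by simp
      ultimately show ?thesis using E_id[OF 2 s(1)] s(2) comp_ident_right by simp
    qed
  qed
  have "has_ordinary_limit ?J C D E"
    using complete category_cospan[OF code] small_J func unfolding small_complete_def by blast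
  then obtain e p where p: "is_cone ?J C D E e p"
    and univ: "\<And>y q. is_cone ?J C D E y q \<Longrightarrow> \<exists>!h. h \<in> hom C y e \<and> (\<forall>j\<in>Ob ?J. p j \<cdot> h = q j)"
    unfolding has_ordinary_limit_def by blast
  have cone: "is_cone ?J C D E x q \<longleftrightarrow> x \<in> Ob C \<and> (\<forall>a\<in>S. q (code (0, a, a)) \<in> hom C x (X a)) \<and>
    (\<forall>a\<in>S. \<forall>b\<in>S. q (code (1, a, b)) = l a b \<cdot> q (code (0, a, a)) \<and> q (code (1, a, b)) = r a b \<cdot> q (code (0, b, b)))" (is "_ \<longleftrightarrow> ?R") for x q
  proof
    assume c: "is_cone ?J C D E x q"
    have 1: "q (code t) \<in> hom C x (D (code t))" if "t \<in> cospan_arrows S" "fst t < 2" for t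
    proof -
      have "code t \<in> Ob ?J" using that unfolding ob by blast
      then show ?thesis using c unfolding is_cone_def by blast
    qed
    have 2: "E (code t) \<cdot> q (code (cospan_dom t)) = q (code (cospan_cod t))" if "t \<in> cospan_arrows S" for t
      using c that unfolding is_cone_def by (auto simp: cospan_category_def)
    show ?R
      using c 1[of "(0, a, a)" for a] 2[of "(2, a, b)" for a b] 2[of "(3, a, b)" for a b]
      by (auto simp: is_cone_def cospan_dom.simps cospan_cod.simps)
  next
    assume R: ?R
    then have R1: "q (code (1, a, b)) = l a b \<cdot> q (code (0, a, a))" and R2: "l a b \<cdot> q (code (0, a, a)) = r a b \<cdot> q (code (0, b, b))"
      if "a \<in> S" "b \<in> S" for a b using that by metis+
    have 1: "q (code t) \<in> hom C x (D (code t)) \<or> \<not> fst t < 2" if "t \<in> cospan_arrows S" for t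
      using that
    proof (rule cases)
      fix a b assume ab: "a \<in> S" "b \<in> S"
      then have "q (code (1, a, b)) = l a b \<cdot> q (code (0, a, a))" "q (code (0, a, a)) \<in> hom C x (X a)" using R by blast+
      then show "q (code (1, a, b)) \<in> hom C x (D (code (1, a, b))) \<or> \<not> fst (1 :: nat, a, b) < 2"
        using comp_hom[OF _ l[OF ab]] ab by simp
    qed (use R in simp_all)
    have 2: "E (code t) \<cdot> q (code (cospan_dom t)) = q (code (cospan_cod t))" if t: "t \<in> cospan_arrows S" for t
    proof (cases "fst t < 2")
      case True
      then have "q (code t) \<in> hom C x (D (code t))" using 1[OF t] by simp
      then show ?thesis using True t E_id comp_ident_left by simp
    next
      case False
      have "\<not> fst t < 2 \<longrightarrow> ?thesis"
        using t by (rule cases) (use R1 R2 in \<open>simp_all add: cospan_dom.simps cospan_cod.simps\<close>)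
      then show ?thesis using False by simp
    qed
    show "is_cone ?J C D E x q"
      unfolding is_cone_def
    proof (intro conjI ballI)
      show "x \<in> Ob C" using R by simp
      show "q j \<in> hom C x (D j)" if "j \<in> Ob ?J" for j using that 1 unfolding ob by blast
      show "E u \<cdot> q (Dom ?J u) = q (Cod ?J u)" if "u \<in> Arr ?J" for u
        using that 2 by (auto simp: cospan_category_def)
    qed
  qed
  let ?\<pi> = "\<lambda>a. p (code (0, a, a))"
  have p': "e \<in> Ob C" "\<And>a. a \<in> S \<Longrightarrow> ?\<pi> a \<in> hom C e (X a)"
    "\<And>a b. \<lbrakk>a \<in> S; b \<in> S\<rbrakk> \<Longrightarrow> p (code (1, a, b)) = l a b \<cdot> ?\<pi> a" "\<And>a b. \<lbrakk>a \<in> S; b \<in> S\<rbrakk> \<Longrightarrow> p (code (1, a, b)) = r a b \<cdot> ?\<pi> b"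
    using p unfolding cone by blast+
  show ?thesis
  proof (rule that[of e ?\<pi>])
    show "l a b \<cdot> ?\<pi> a = r a b \<cdot> ?\<pi> b" if "a \<in> S" "b \<in> S" for a b using p'(3,4)[OF that] by simp
    fix x \<tau> assume x: "x \<in> Ob C" and \<tau>: "\<And>a. a \<in> S \<Longrightarrow> \<tau> a \<in> hom C x (X a)" and eq: "\<And>a b. \<lbrakk>a \<in> S; b \<in> S\<rbrakk> \<Longrightarrow> l a b \<cdot> \<tau> a = r a b \<cdot> \<tau> b"
    define q where "q j = (case ?dec j of (n, a, b) \<Rightarrow> if n = 0 then \<tau> a else l a b \<cdot> \<tau> a)" for j
    have q [simp]: "q (code (n, a, b)) = (if n = 0 then \<tau> a else l a b \<cdot> \<tau> a)" if "(n, a, b) \<in> cospan_arrows S" for n a b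
      using that by (simp add: q_def)
    have "is_cone ?J C D E x q" unfolding cone using x \<tau> eq by simp
    moreover have "(\<forall>j\<in>Ob ?J. p j \<cdot> h = q j) \<longleftrightarrow> (\<forall>a\<in>S. ?\<pi> a \<cdot> h = \<tau> a)" if h: "h \<in> hom C x e" for h
    proof
      assume h': "\<forall>j\<in>Ob ?J. p j \<cdot> h = q j"
      show "\<forall>a\<in>S. ?\<pi> a \<cdot> h = \<tau> a"
      proof
        fix a assume a: "a \<in> S"
        then have "code (0, a, a) \<in> Ob ?J" unfolding ob by (intro bexI[of _ "(0, a, a)"]) simp_all
        then show "?\<pi> a \<cdot> h = \<tau> a" using h' a by simp
      qed
    next
      assume h': "\<forall>a\<in>S. ?\<pi> a \<cdot> h = \<tau> a"
      have *: "fst t < 2 \<longrightarrow> p (code t) \<cdot> h = q (code t)" if "t \<in> cospan_arrows S" for t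
        using that
      proof (rule cases)
        fix a b assume ab: "a \<in> S" "b \<in> S"
        have "(l a b \<cdot> ?\<pi> a) \<cdot> h = l a b \<cdot> (?\<pi> a \<cdot> h)"
          by (rule comp_assoc[OF h p'(2)[OF ab(1)] l[OF ab]])
        then show "fst (1 :: nat, a, b) < 2 \<longrightarrow> p (code (1, a, b)) \<cdot> h = q (code (1, a, b))"
          using h' ab p'(3)[OF ab] by simp
      qed (use h' in simp_all)
      show "\<forall>j\<in>Ob ?J. p j \<cdot> h = q j"
      proof
        fix j assume "j \<in> Ob ?J"
        then obtain t where "t \<in> cospan_arrows S" "fst t < 2" "j = code t" unfolding ob by blast
        then show "p j \<cdot> h = q j" using * by blast
      qed
    qed
    ultimately show "\<exists>!h. h \<in> hom C x e \<and> (\<forall>a\<in>S. ?\<pi> a \<cdot> h = \<tau> a)"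
      using univ[of x q] by (simp cong: conj_cong)
  qed (use p' in simp_all)
qed

section \<open>Colimits of spans by duality\<close>

definition opposite :: "('o, 'a, 'm) category_scheme \<Rightarrow> ('o, 'a) category" where
  "opposite C = \<lparr>Ob = Ob C, Arr = Arr C, Dom = Cod C, Cod = Dom C, ident = ident C, comp = (\<lambda>g f. comp C f g)\<rparr>"

lemma opposite_simps [simp]:
  "Ob (opposite C) = Ob C" "Arr (opposite C) = Arr C" "Dom (opposite C) = Cod C" "Cod (opposite C) = Dom C"
  "ident (opposite C) = ident C" "comp (opposite C) g f = comp C f g" "hom (opposite C) x y = hom C y x"
  by (auto simp: opposite_def hom_def)

lemma category_opposite:
  assumes "category C"
  shows "category (opposite C)"
proof -
  interpret category C by fact
  show ?thesis
    by unfold_locales (auto simp: Dom_Ob Cod_Ob ident_hom comp_hom comp_ident_right comp_ident_left comp_assoc)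
qed

text \<open>A diagram in the opposite category is a diagram over the opposite shape, which is just
  as small, and its cones are cocones of that diagram.\<close>

lemma small_complete_opposite:
  assumes "small_cocomplete U C"
  shows "small_complete U (opposite C)"
  unfolding small_complete_def
proof (intro allI impI, elim conjE)
  fix J :: "('a, 'a) category" and D E
  assume J: "category J" "Ob J \<prec> U" "Arr J \<prec> U" and f: "is_functor J (opposite C) D E"
  have "is_functor (opposite J) C D E" using f by (auto simp: is_functor_def)
  then have "has_ordinary_colimit (opposite J) C D E"
    using assms J category_opposite[OF J(1)] by (auto simp: small_cocomplete_def)
  moreover have "is_cocone (opposite J) C D E x p \<longleftrightarrow> is_cone J (opposite C) D E x p" for x p
    by (simp add: is_cocone_def is_cone_def)
  ultimately show "has_ordinary_limit J (opposite C) D E"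
    by (simp add: has_ordinary_limit_def has_ordinary_colimit_def)
qed

lemma (in category) span_colimit:
  fixes U S :: "'u set"
  assumes U: "smallness_universe U" and cocomplete: "small_cocomplete U C" and S: "S \<prec> U"
    and X: "\<And>a. a \<in> S \<Longrightarrow> X a \<in> Ob C" and Z: "\<And>a b. \<lbrakk>a \<in> S; b \<in> S\<rbrakk> \<Longrightarrow> Z a b \<in> Ob C"
    and l: "\<And>a b. \<lbrakk>a \<in> S; b \<in> S\<rbrakk> \<Longrightarrow> l a b \<in> hom C (Z a b) (X a)"
    and r: "\<And>a b. \<lbrakk>a \<in> S; b \<in> S\<rbrakk> \<Longrightarrow> r a b \<in> hom C (Z a b) (X b)"
  obtains e \<pi> where "e \<in> Ob C" "\<And>a. a \<in> S \<Longrightarrow> \<pi> a \<in> hom C (X a) e"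
    "\<And>a b. \<lbrakk>a \<in> S; b \<in> S\<rbrakk> \<Longrightarrow> \<pi> a \<cdot> l a b = \<pi> b \<cdot> r a b"
    "\<And>x \<tau>. \<lbrakk>x \<in> Ob C; \<And>a. a \<in> S \<Longrightarrow> \<tau> a \<in> hom C (X a) x; \<And>a b. \<lbrakk>a \<in> S; b \<in> S\<rbrakk> \<Longrightarrow> \<tau> a \<cdot> l a b = \<tau> b \<cdot> r a b\<rbrakk>
      \<Longrightarrow> \<exists>!h. h \<in> hom C e x \<and> (\<forall>a\<in>S. h \<cdot> \<pi> a = \<tau> a)"
proof -
  have c: "category (opposite C)" by (rule category_opposite) unfold_locales
  show ?thesis
  proof (rule category.cospan_limit[OF c U small_complete_opposite[OF cocomplete] S, of X Z l r, simplified, OF X Z l r])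
    fix e \<pi>
    assume *: "e \<in> Ob C" "\<And>a. a \<in> S \<Longrightarrow> \<pi> a \<in> hom C (X a) e" "\<And>a b. \<lbrakk>a \<in> S; b \<in> S\<rbrakk> \<Longrightarrow> \<pi> a \<cdot> l a b = \<pi> b \<cdot> r a b"
      and **: "\<And>x \<tau>. \<lbrakk>x \<in> Ob C; \<And>a. a \<in> S \<Longrightarrow> \<tau> a \<in> hom C (X a) x; \<And>a b. \<lbrakk>a \<in> S; b \<in> S\<rbrakk> \<Longrightarrow> \<tau> a \<cdot> l a b = \<tau> b \<cdot> r a b\<rbrakk>
        \<Longrightarrow> \<exists>!h. h \<in> hom C e x \<and> (\<forall>a\<in>S. h \<cdot> \<pi> a = \<tau> a)"
    show thesis by (rule that[OF * **])
  qed
qed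

section \<open>Ends and colimits over small categories\<close>

context smcc
begin

text \<open>Used instead of a skeleton because it is visibly self-dual.\<close>

definition retract_basis where
  "retract_basis A S \<rho> i j \<longleftrightarrow> vcategory V A \<and> S \<subseteq> VOb A \<and> (\<forall>a\<in>VOb A. \<rho> a \<in> S \<and>
     i a \<in> Arr V \<and> Dom V (i a) = \<I> \<and> Cod V (i a) = VHom A a (\<rho> a) \<and>
     j a \<in> Arr V \<and> Dom V (j a) = \<I> \<and> Cod V (j a) = VHom A (\<rho> a) a \<and>
     cmp A a (\<rho> a) a (j a \<bullet> star) (i a \<bullet> star) = VId A a \<bullet> star)"

lemma retract_basisD:
  assumes "retract_basis A S \<rho> i j"
  shows "vcategory V A" "a \<in> S \<Longrightarrow> a \<in> VOb A"
    and "a \<in> VOb A \<Longrightarrow> \<rho> a \<in> S" "a \<in> VOb A \<Longrightarrow> \<rho> a \<in> VOb A"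
    and "a \<in> VOb A \<Longrightarrow> i a \<in> Arr V" "a \<in> VOb A \<Longrightarrow> Dom V (i a) = \<I>" "a \<in> VOb A \<Longrightarrow> Cod V (i a) = VHom A a (\<rho> a)"
    and "a \<in> VOb A \<Longrightarrow> j a \<in> Arr V" "a \<in> VOb A \<Longrightarrow> Dom V (j a) = \<I>" "a \<in> VOb A \<Longrightarrow> Cod V (j a) = VHom A (\<rho> a) a"
    and "a \<in> VOb A \<Longrightarrow> cmp A a (\<rho> a) a (j a \<bullet> star) (i a \<bullet> star) = VId A a \<bullet> star"
  using assms by (auto simp: retract_basis_def)

lemma retract_basis_opp:
  assumes r: "retract_basis A S \<rho> i j"
  shows "retract_basis (opp V A) S \<rho> j i"
proof -
  note [simp] = retract_basisD[OF r]
  show ?thesis unfolding retract_basis_def by auto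
qed

lemma ucomp_el:
  assumes "vcategory V A" "a \<in> VOb A" "b \<in> VOb A" "c \<in> VOb A" "f \<in> hom V \<I> (VHom A a b)" "g \<in> hom V \<I> (VHom A b c)"
  shows "ucomp V A a b c g f \<bullet> star = cmp A a b c (g \<bullet> star) (f \<bullet> star)"
    and "ucomp V A a b c g f \<in> Arr V" "Dom V (ucomp V A a b c g f) = \<I>" "Cod V (ucomp V A a b c g f) = VHom A a c"
  using assms by (simp_all add: ucomp_def hom_iff)

lemma viso_VId:
  assumes A: "vcategory V A" and a: "a \<in> VOb A"
  shows "viso V A a a (VId A a)"
proof -
  have i: "VId A a \<in> hom V \<I> (VHom A a a)" using A a by (simp add: hom_iff)
  note u = ucomp_el[OF A a a a i i]
  have "ucomp V A a a a (VId A a) (VId A a) = VId A a"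
    by (rule unit_ext) (use A a u in simp_all)
  then show ?thesis using i by (auto simp: viso_def)
qed

text \<open>\<open>\<rho> a\<close> is chosen from the isomorphism class alone, so \<rho> takes no
  more values than there are classes. Of each isomorphism, the equation for the composite that
  returns to \<open>a\<close> is kept.\<close>

lemma small_retract_basis:
  assumes A: "vcategory V A" and s: "small_vcat U V A"
  obtains S \<rho> i j where "S \<prec> U" "retract_basis A S \<rho> i j"
proof -
  define \<rho> where "\<rho> a = (SOME b. b \<in> iso_class V A a)" for a
  have "\<rho> a \<in> iso_class V A a" if a: "a \<in> VOb A" for a
    unfolding \<rho>_def by (rule someI[of _ a]) (use viso_VId[OF A a] a in \<open>auto simp: iso_class_def\<close>)
  then have \<rho>: "\<rho> a \<in> VOb A" "\<exists>f. viso V A a (\<rho> a) f" if "a \<in> VOb A" for a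
    using that by (auto simp: iso_class_def)
  let ?P = "\<lambda>a f g. f \<in> hom V \<I> (VHom A a (\<rho> a)) \<and> g \<in> hom V \<I> (VHom A (\<rho> a) a) \<and> ucomp V A a (\<rho> a) a g f = VId A a"
  define i where "i a = (SOME f. \<exists>g. ?P a f g)" for a
  define j where "j a = (SOME g. ?P a (i a) g)" for a
  have P: "?P a (i a) (j a)" if a: "a \<in> VOb A" for a
  proof -
    have "\<exists>f g. ?P a f g" using \<rho>(2)[OF a] by (auto simp: viso_def)
    then have "\<exists>g. ?P a (i a) g" unfolding i_def by (rule someI_ex)
    then show ?thesis unfolding j_def by (rule someI_ex)
  qed
  have "\<rho> ` VOb A = (\<lambda>X. SOME b. b \<in> X) ` (iso_class V A ` VOb A)" by (auto simp: \<rho>_def)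
  then have "\<rho> ` VOb A \<lesssim> iso_class V A ` VOb A" by (simp only: image_lepoll)
  then have "\<rho> ` VOb A \<prec> U" using s unfolding small_vcat_def by (rule lesspoll_trans1)
  moreover have "retract_basis A (\<rho> ` VOb A) \<rho> i j"
    unfolding retract_basis_def
  proof (intro conjI ballI)
    fix a assume a: "a \<in> VOb A"
    note P = P[OF a]
    show "cmp A a (\<rho> a) a (j a \<bullet> star) (i a \<bullet> star) = VId A a \<bullet> star"
      using ucomp_el(1)[OF A a \<rho>(1)[OF a] a, of "i a" "j a"] P by simp
  qed (use A P \<rho> in \<open>auto simp: hom_iff\<close>)
  ultimately show ?thesis by (rule that)
qed

section \<open>Functors and a basis of retracts\<close>

lemma retract_cancel:
  assumes r: "retract_basis A S \<rho> i j" and F: "vfunctor V A VV F" and h [simp]: "a \<in> VOb A" "el s" "ty s = FOb F a"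
  shows "act F (\<rho> a) a (j a \<bullet> star) (act F a (\<rho> a) (i a \<bullet> star) s) = s"
proof -
  note [simp] = retract_basisD(1-10)[OF r] vfunctor_rules[OF F] vfunctor_self_Ob[OF F]
  have "act F a a (cmp A a (\<rho> a) a (j a \<bullet> star) (i a \<bullet> star)) s = s"
    unfolding retract_basisD(11)[OF r h(1)] by simp
  then show ?thesis by simp
qed

lemma functor_comp_el:
  assumes F: "vfunctor V A VV F" and h [simp]: "a \<in> VOb A" "b \<in> VOb A" "c \<in> VOb A"
    "el g" "ty g = VHom A b c" "el f" "ty f = VHom A a b" "el s" "ty s = FOb F a" "g \<sharp> f" "g \<sharp> s" "f \<sharp> s"
  shows "act F a c (cmp A a b c g f) s
    = act F b c g (act F a b f s)"
proof -
  note [simp] = vfunctor_vcategory[OF F] vfunctor_rules[OF F] vfunctor_self_Ob[OF F]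
  show ?thesis by simp
qed

text \<open>\<open>f'\<close> is \<open>f\<close> conjugated to \<open>S\<close>, namely
  \<open>i b \<cdot> f \<cdot> j a\<close>, and \<open>j\<close> after \<open>i\<close> is an
  identity. The two equations reduce naturality at arbitrary arrows to naturality inside
  \<open>S\<close>.\<close>

lemma retract_slide:
  assumes r: "retract_basis A S \<rho> i j" and [simp]: "a \<in> VOb A" "b \<in> VOb A" "el f" "ty f = VHom A a b"
  defines "f' \<equiv> VComp A (\<rho> a) a (\<rho> b) \<bullet> \<langle>VComp A a b (\<rho> b) \<bullet> \<langle>i b \<bullet> star, f\<rangle>, j a \<bullet> star\<rangle>"
  shows "cmp A a (\<rho> a) (\<rho> b) f' (i a \<bullet> star) = cmp A a b (\<rho> b) (i b \<bullet> star) f"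
    and "cmp A (\<rho> a) (\<rho> b) b (j b \<bullet> star) f' = cmp A (\<rho> a) a b f (j a \<bullet> star)"
proof -
  note [simp] = retract_basisD(1-10)[OF r] and id = retract_basisD(11)[OF r]
  show "cmp A a (\<rho> a) (\<rho> b) f' (i a \<bullet> star) = cmp A a b (\<rho> b) (i b \<bullet> star) f"
    by (simp add: f'_def id)
  have "cmp A (\<rho> a) (\<rho> b) b (j b \<bullet> star) f'
    = cmp A (\<rho> a) a b (cmp A a b b (cmp A b (\<rho> b) b (j b \<bullet> star) (i b \<bullet> star)) f) (j a \<bullet> star)"
    unfolding f'_def by simp
  then show "cmp A (\<rho> a) (\<rho> b) b (j b \<bullet> star) f' = cmp A (\<rho> a) a b f (j a \<bullet> star)"
    by (simp add: id)
qed

text \<open>Curried twice, the wedge condition equates two maps into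
  \<open>Z a b = [A(a,b), [F a, G b]]\<close>, one out of \<open>X a = [F a, G a]\<close> and one
  out of \<open>X b\<close>; an end over \<open>S\<close> is thus a limit of cospans.\<close>

lemma end_over_basis:
  fixes U S :: "'u set"
  assumes F: "vfunctor V A VV F" and G: "vfunctor V A VV G" and SA [simp]: "\<And>a. a \<in> S \<Longrightarrow> a \<in> VOb A"
    and U: "smallness_universe U" and S: "S \<prec> U" and complete: "small_complete U V"
  obtains e \<pi> where "wedge (A\<lparr>VOb := S\<rparr>) F G e \<pi>"
    "\<And>x \<tau>. wedge (A\<lparr>VOb := S\<rparr>) F G x \<tau> \<Longrightarrow> \<exists>!h. h \<in> hom V x e \<and> (\<forall>a\<in>S. \<pi> a \<cdot> h = \<tau> a)"
proof -
  note FG [simp] = vfunctor_vcategory(1)[OF F] vfunctor_typing[OF F] vfunctor_self_Ob[OF F] vfunctor_typing[OF G] vfunctor_self_Ob[OF G]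
  define X where "X a = ihom V (FOb F a) (FOb G a)" for a
  define Z where "Z a b = ihom V (VHom A a b) (ihom V (FOb F a) (FOb G b))" for a b
  define l' where "l' a b = ev V (FOb G a) (FOb G b) \<cdot> (FHom G a b \<otimes> ev V (FOb F a) (FOb G a)) \<cdot> assoc V (VHom A a b) (X a) (FOb F a)
    \<cdot> (symm V (X a) (VHom A a b) \<otimes> \<one> (FOb F a))" for a b
  define r' where "r' a b = ev V (FOb F b) (FOb G b) \<cdot> (\<one> (X b) \<otimes> (ev V (FOb F a) (FOb F b) \<cdot> (FHom F a b \<otimes> \<one> (FOb F a)))) \<cdot> assoc V (X b) (VHom A a b) (FOb F a)" for a b
  define l where "l a b = transp V (X a) (VHom A a b) (ihom V (FOb F a) (FOb G b)) (transp V (X a \<odot> VHom A a b) (FOb F a) (FOb G b) (l' a b))" for a b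
  define r where "r a b = transp V (X b) (VHom A a b) (ihom V (FOb F a) (FOb G b)) (transp V (X b \<odot> VHom A a b) (FOb F a) (FOb G b) (r' a b))" for a b
  have X [simp]: "X a \<in> Ob V" and Z [simp]: "b \<in> S \<Longrightarrow> Z a b \<in> Ob V" if "a \<in> S" for a b using that by (simp_all add: X_def Z_def)
  have l't [simp]: "l' a b \<in> Arr V" "Dom V (l' a b) = (X a \<odot> VHom A a b) \<odot> FOb F a" "Cod V (l' a b) = FOb G b" if "a \<in> S" "b \<in> S" for a b
    using that by (simp_all add: l'_def X_def)
  have r't [simp]: "r' a b \<in> Arr V" "Dom V (r' a b) = (X b \<odot> VHom A a b) \<odot> FOb F a" "Cod V (r' a b) = FOb G b" if "a \<in> S" "b \<in> S" for a b
    using that by (simp_all add: r'_def X_def)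
  have lt [simp]: "l a b \<in> Arr V" "Dom V (l a b) = X a" "Cod V (l a b) = Z a b" if "a \<in> S" "b \<in> S" for a b
    using that by (simp_all add: l_def Z_def)
  have rt [simp]: "r a b \<in> Arr V" "Dom V (r a b) = X b" "Cod V (r a b) = Z a b" if "a \<in> S" "b \<in> S" for a b
    using that by (simp_all add: r_def Z_def)
  have l_el [simp]: "evl (FOb F a) (FOb G b) (evl (VHom A a b) (ihom V (FOb F a) (FOb G b)) (l a b \<bullet> t) f) s
      = act G a b f (evl (FOb F a) (FOb G a) t s)"
    if "a \<in> S" "b \<in> S" "el t" "ty t = X a" "el f" "ty f = VHom A a b" "el s" "ty s = FOb F a" "t \<sharp> f" "f \<sharp> t" "t \<sharp> s" "f \<sharp> s" for a b t f s
  proof -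
    have "l' a b \<bullet> \<langle>\<langle>t, f\<rangle>, s\<rangle> = act G a b f (evl (FOb F a) (FOb G a) t s)"
      using that by (simp add: l'_def X_def)
    then show ?thesis using that by (simp add: l_def)
  qed
  have r_el [simp]: "evl (FOb F a) (FOb G b) (evl (VHom A a b) (ihom V (FOb F a) (FOb G b)) (r a b \<bullet> t) f) s
      = evl (FOb F b) (FOb G b) t (act F a b f s)"
    if "a \<in> S" "b \<in> S" "el t" "ty t = X b" "el f" "ty f = VHom A a b" "el s" "ty s = FOb F a" "t \<sharp> f" "f \<sharp> t" "t \<sharp> s" "f \<sharp> s" for a b t f s
  proof -
    have "r' a b \<bullet> \<langle>\<langle>t, f\<rangle>, s\<rangle> = evl (FOb F b) (FOb G b) t (act F a b f s)"
      using that by (simp add: r'_def X_def)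
    then show ?thesis using that by (simp add: r_def)
  qed
  have wedge: "wedge (A\<lparr>VOb := S\<rparr>) F G x \<tau> \<longleftrightarrow> x \<in> Ob V \<and> (\<forall>a\<in>S. \<tau> a \<in> hom V x (X a)) \<and> (\<forall>a\<in>S. \<forall>b\<in>S. l a b \<cdot> \<tau> a = r a b \<cdot> \<tau> b)" for x \<tau>
  proof
    assume w: "wedge (A\<lparr>VOb := S\<rparr>) F G x \<tau>"
    then have t [simp]: "x \<in> Ob V" "a \<in> S \<Longrightarrow> \<tau> a \<in> Arr V" "a \<in> S \<Longrightarrow> Dom V (\<tau> a) = x" "a \<in> S \<Longrightarrow> Cod V (\<tau> a) = X a" for a
      by (simp_all add: wedge_def X_def)
    have "l a b \<cdot> \<tau> a = r a b \<cdot> \<tau> b" if [simp]: "a \<in> S" "b \<in> S" for a b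
    proof (rule arrow_ext)
      fix e assume [simp]: "el e" "ty e = x"
      have "l a b \<bullet> \<tau> a \<bullet> e = r a b \<bullet> \<tau> b \<bullet> e"
      proof (rule eval_ext[of _ "VHom A a b" "ihom V (FOb F a) (FOb G b)"])
        fix f assume "el f" "ty f = VHom A a b" "l a b \<bullet> \<tau> a \<bullet> e \<sharp> f" "f \<sharp> l a b \<bullet> \<tau> a \<bullet> e"
        then have [simp]: "el f" "ty f = VHom A a b" "e \<sharp> f" "f \<sharp> e" by simp_all
        let ?L = "evl (VHom A a b) (ihom V (FOb F a) (FOb G b)) (l a b \<bullet> \<tau> a \<bullet> e) f"
        let ?R = "evl (VHom A a b) (ihom V (FOb F a) (FOb G b)) (r a b \<bullet> \<tau> b \<bullet> e) f"
        have [simp]: "Z a b = ihom V (VHom A a b) (ihom V (FOb F a) (FOb G b))" by (simp add: Z_def)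
        show "?L = ?R"
        proof (rule eval_ext[of _ "FOb F a" "FOb G b"])
          fix s assume "el s" "ty s = FOb F a" "?L \<sharp> s" "s \<sharp> ?L"
          then have [simp]: "el s" "ty s = FOb F a" "e \<sharp> s" "s \<sharp> e" "f \<sharp> s" "s \<sharp> f" by simp_all
          show "evl (FOb F a) (FOb G b) ?L s = evl (FOb F a) (FOb G b) ?R s"
            using w by (simp add: wedge_def)
        qed simp_all
      qed (simp_all add: Z_def)
      then show "(l a b \<cdot> \<tau> a) \<bullet> e = (r a b \<cdot> \<tau> b) \<bullet> e" by simp
    qed simp_all
    then show "x \<in> Ob V \<and> (\<forall>a\<in>S. \<tau> a \<in> hom V x (X a)) \<and> (\<forall>a\<in>S. \<forall>b\<in>S. l a b \<cdot> \<tau> a = r a b \<cdot> \<tau> b)" by (simp add: hom_iff)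
  next
    assume w: "x \<in> Ob V \<and> (\<forall>a\<in>S. \<tau> a \<in> hom V x (X a)) \<and> (\<forall>a\<in>S. \<forall>b\<in>S. l a b \<cdot> \<tau> a = r a b \<cdot> \<tau> b)"
    then have t [simp]: "x \<in> Ob V" "a \<in> S \<Longrightarrow> \<tau> a \<in> Arr V" "a \<in> S \<Longrightarrow> Dom V (\<tau> a) = x" "a \<in> S \<Longrightarrow> Cod V (\<tau> a) = X a" for a
      by (simp_all add: hom_iff)
    show "wedge (A\<lparr>VOb := S\<rparr>) F G x \<tau>"
    proof (rule wedgeI)
      fix a b e f s
      assume "a \<in> VOb (A\<lparr>VOb := S\<rparr>)" "b \<in> VOb (A\<lparr>VOb := S\<rparr>)" "el e" "ty e = x" "el f" "ty f = VHom (A\<lparr>VOb := S\<rparr>) a b" "el s" "ty s = FOb F a"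
        "e \<sharp> f" "f \<sharp> e" "e \<sharp> s" "s \<sharp> e" "f \<sharp> s" "s \<sharp> f"
      then have [simp]: "a \<in> S" "b \<in> S" "el e" "ty e = x" "el f" "ty f = VHom A a b" "el s" "ty s = FOb F a"
        "e \<sharp> f" "f \<sharp> e" "e \<sharp> s" "s \<sharp> e" "f \<sharp> s" "s \<sharp> f" by simp_all
      have "l a b \<cdot> \<tau> a = r a b \<cdot> \<tau> b" using w by simp
      then have "(l a b \<cdot> \<tau> a) \<bullet> e = (r a b \<cdot> \<tau> b) \<bullet> e" by (rule arg_cong)
      then have "l a b \<bullet> \<tau> a \<bullet> e = r a b \<bullet> \<tau> b \<bullet> e" by simp
      then have "evl (FOb F a) (FOb G b) (evl (VHom A a b) (ihom V (FOb F a) (FOb G b)) (l a b \<bullet> \<tau> a \<bullet> e) f) s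
        = evl (FOb F a) (FOb G b) (evl (VHom A a b) (ihom V (FOb F a) (FOb G b)) (r a b \<bullet> \<tau> b \<bullet> e) f) s"
        by (rule arg_cong)
      then show "evl (FOb F b) (FOb G b) (\<tau> b \<bullet> e) (act F a b f s)
        = act G a b f (evl (FOb F a) (FOb G a) (\<tau> a \<bullet> e) s)"
        by simp
    qed (simp_all add: X_def[symmetric])
  qed
  show ?thesis
  proof (rule cospan_limit[OF U complete S, of X Z l r])
    fix e \<pi>
    assume "e \<in> Ob V" "\<And>a. a \<in> S \<Longrightarrow> \<pi> a \<in> hom V e (X a)" "\<And>a b. \<lbrakk>a \<in> S; b \<in> S\<rbrakk> \<Longrightarrow> l a b \<cdot> \<pi> a = r a b \<cdot> \<pi> b"
      and univ: "\<And>x \<tau>. \<lbrakk>x \<in> Ob V; \<And>a. a \<in> S \<Longrightarrow> \<tau> a \<in> hom V x (X a); \<And>a b. \<lbrakk>a \<in> S; b \<in> S\<rbrakk> \<Longrightarrow> l a b \<cdot> \<tau> a = r a b \<cdot> \<tau> b\<rbrakk>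
      \<Longrightarrow> \<exists>!h. h \<in> hom V x e \<and> (\<forall>a\<in>S. \<pi> a \<cdot> h = \<tau> a)"
    then have w: "wedge (A\<lparr>VOb := S\<rparr>) F G e \<pi>" unfolding wedge by simp
    show thesis
      by (rule that[OF w]) (rule univ, simp_all add: wedge)
  qed (simp_all add: hom_iff)
qed

lemma ends_exist_small:
  fixes U S :: "'u set"
  assumes r: "retract_basis A S \<rho> i j" and U: "smallness_universe U" and S: "S \<prec> U" and complete: "small_complete U V"
  shows "ends_exist A"
  unfolding ends_exist_def
proof (intro conjI allI impI)
  note R [simp] = retract_basisD(1-10)[OF r]
  show A: "vcategory V A" by simp
  fix F G assume F: "vfunctor V A VV F" and G: "vfunctor V A VV G"
  note FG [simp] = vfunctor_typing[OF F] vfunctor_self_Ob[OF F] vfunctor_typing[OF G] vfunctor_self_Ob[OF G]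
  obtain x \<pi> where w: "wedge (A\<lparr>VOb := S\<rparr>) F G x \<pi>"
    and univ: "\<And>y \<tau>. wedge (A\<lparr>VOb := S\<rparr>) F G y \<tau> \<Longrightarrow> \<exists>!h. h \<in> hom V y x \<and> (\<forall>a\<in>S. \<pi> a \<cdot> h = \<tau> a)"
    by (rule end_over_basis[OF F G R(2) U S complete], assumption, rule that)
  have x [simp]: "x \<in> Ob V" and \<pi> [simp]: "a \<in> S \<Longrightarrow> \<pi> a \<in> Arr V" "a \<in> S \<Longrightarrow> Dom V (\<pi> a) = x" "a \<in> S \<Longrightarrow> Cod V (\<pi> a) = ihom V (FOb F a) (FOb G a)" for a
    using w by (simp_all add: wedge_def)
  have \<pi>_nat: "evl (FOb F b) (FOb G b) (\<pi> b \<bullet> e) (act F a b f s)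
      = act G a b f (evl (FOb F a) (FOb G a) (\<pi> a \<bullet> e) s)"
    if "a \<in> S" "b \<in> S" "el e" "ty e = x" "el f" "ty f = VHom A a b" "el s" "ty s = FOb F a" "e \<sharp> f" "e \<sharp> s" "f \<sharp> s" for a b e f s
    using w that apart_sym[OF that(9)] apart_sym[OF that(10)] apart_sym[OF that(11)] by (simp add: wedge_def)
  \<comment> \<open>An object outside \<open>S\<close> is reached through its retract:
    \<open>\<pi>' a\<close> conjugates \<open>\<pi> (\<rho> a)\<close> by the actions of
    \<open>i a\<close> and \<open>j a\<close>. The inverse unitors only insert these points.\<close>
  define \<pi>' where "\<pi>' a = transp V x (FOb F a) (FOb G a) (ev V (FOb G (\<rho> a)) (FOb G a) \<cdot> ((FHom G (\<rho> a) a \<cdot> j a) \<otimes>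
    (ev V (FOb F (\<rho> a)) (FOb G (\<rho> a)) \<cdot> (\<pi> (\<rho> a) \<otimes> (ev V (FOb F a) (FOb F (\<rho> a)) \<cdot> ((FHom F a (\<rho> a) \<cdot> i a) \<otimes> \<one> (FOb F a)) \<cdot> linv (FOb F a)))))
    \<cdot> linv (x \<odot> FOb F a))" for a
  have \<pi>' [simp]: "\<pi>' a \<in> Arr V" "Dom V (\<pi>' a) = x" "Cod V (\<pi>' a) = ihom V (FOb F a) (FOb G a)" if "a \<in> VOb A" for a
    using that by (simp_all add: \<pi>'_def)
  have \<pi>'_el [simp]: "evl (FOb F a) (FOb G a) (\<pi>' a \<bullet> e) s = act G (\<rho> a) a (j a \<bullet> star) (evl (FOb F (\<rho> a)) (FOb G (\<rho> a)) (\<pi> (\<rho> a) \<bullet> e) (act F a (\<rho> a) (i a \<bullet> star) s))"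
    if "a \<in> VOb A" "el e" "ty e = x" "el s" "ty s = FOb F a" "e \<sharp> s" for a e s
    using that by (simp add: \<pi>'_def)
  \<comment> \<open>Inside \<open>S\<close> naturality moves \<open>i a\<close> to the other side,
    where \<open>j a\<close> cancels it.\<close>
  have \<pi>'_\<pi>: "\<pi>' a = \<pi> a" if a [simp]: "a \<in> S" for a
  proof (rule app_transp_ext[of _ _ x "FOb F a" "FOb G a"])
    fix e s assume [simp]: "el e" "ty e = x" "el s" "ty s = FOb F a" "e \<sharp> s" "s \<sharp> e"
    show "evl (FOb F a) (FOb G a) (\<pi>' a \<bullet> e) s = evl (FOb F a) (FOb G a) (\<pi> a \<bullet> e) s"
      by (simp add: \<pi>_nat retract_cancel[OF r G])
  qed simp_all
  have w': "wedge A F G x \<pi>'"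
  proof (rule wedgeI)
    fix a b e f s
    assume [simp]: "a \<in> VOb A" "b \<in> VOb A" "el e" "ty e = x" "el f" "ty f = VHom A a b" "el s" "ty s = FOb F a"
        "e \<sharp> f" "f \<sharp> e" "e \<sharp> s" "s \<sharp> e" "f \<sharp> s" "s \<sharp> f"
    define f' where "f' = cmp A (\<rho> a) a (\<rho> b) (cmp A a b (\<rho> b) (i b \<bullet> star) f) (j a \<bullet> star)"
    have f' [simp]: "el f'" "ty f' = VHom A (\<rho> a) (\<rho> b)" "f' \<sharp> e" "f' \<sharp> s" "e \<sharp> f'" "s \<sharp> f'"
      by (simp_all add: f'_def)
    note sl = retract_slide[OF r \<open>a \<in> VOb A\<close> \<open>b \<in> VOb A\<close> \<open>el f\<close> \<open>ty f = VHom A a b\<close>, folded f'_def]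
    have "act F b (\<rho> b) (i b \<bullet> star) (act F a b f s)
      = act F (\<rho> a) (\<rho> b) f' (act F a (\<rho> a) (i a \<bullet> star) s)"
      using functor_comp_el[OF F, of a "\<rho> a" "\<rho> b" f' "i a \<bullet> star" s] functor_comp_el[OF F, of a b "\<rho> b" "i b \<bullet> star" f s] sl(1) by simp
    moreover have "act G (\<rho> b) b (j b \<bullet> star) (act G (\<rho> a) (\<rho> b) f' t)
      = act G a b f (act G (\<rho> a) a (j a \<bullet> star) t)"
      if "el t" "ty t = FOb G (\<rho> a)" "f' \<sharp> t" "f \<sharp> t" for t
      using functor_comp_el[OF G, of "\<rho> a" "\<rho> b" b "j b \<bullet> star" f' t] functor_comp_el[OF G, of "\<rho> a" a b f "j a \<bullet> star" t] sl(2) that by simp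
    ultimately show "evl (FOb F b) (FOb G b) (\<pi>' b \<bullet> e) (act F a b f s)
      = act G a b f (evl (FOb F a) (FOb G a) (\<pi>' a \<bullet> e) s)"
      by (simp add: \<pi>_nat)
  qed simp_all
  \<comment> \<open>A wedge over \<open>A\<close> is fixed by its components on \<open>S\<close> for
    the same reason, so the two universal properties impose the same condition on
    \<open>h\<close>.\<close>
  have determined: "(\<forall>a\<in>VOb A. \<pi>' a \<cdot> h = \<tau> a) \<longleftrightarrow> (\<forall>a\<in>S. \<pi> a \<cdot> h = \<tau> a)" if \<tau>: "wedge A F G y \<tau>" and h: "h \<in> hom V y x" for y \<tau> h
  proof
    have [simp]: "y \<in> Ob V" "h \<in> Arr V" "Dom V h = y" "Cod V h = x" using \<tau> h by (auto simp: wedge_def hom_iff)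
    have \<tau>t [simp]: "\<tau> a \<in> Arr V" "Dom V (\<tau> a) = y" "Cod V (\<tau> a) = ihom V (FOb F a) (FOb G a)" if "a \<in> VOb A" for a
      using \<tau> that by (simp_all add: wedge_def)
    show "\<forall>a\<in>S. \<pi> a \<cdot> h = \<tau> a" if "\<forall>a\<in>VOb A. \<pi>' a \<cdot> h = \<tau> a" using that \<pi>'_\<pi> R(2) by metis
    show "\<forall>a\<in>VOb A. \<pi>' a \<cdot> h = \<tau> a" if eq: "\<forall>a\<in>S. \<pi> a \<cdot> h = \<tau> a"
    proof
      fix a assume a [simp]: "a \<in> VOb A"
      show "\<pi>' a \<cdot> h = \<tau> a"
      proof (rule app_transp_ext[of _ _ y "FOb F a" "FOb G a"])
        fix e s assume [simp]: "el e" "ty e = y" "el s" "ty s = FOb F a" "e \<sharp> s" "s \<sharp> e"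
        have "(\<pi> (\<rho> a) \<cdot> h) \<bullet> e = \<tau> (\<rho> a) \<bullet> e" using eq by simp
        then have "\<pi> (\<rho> a) \<bullet> h \<bullet> e = \<tau> (\<rho> a) \<bullet> e" by simp
        moreover have "evl (FOb F (\<rho> a)) (FOb G (\<rho> a)) (\<tau> (\<rho> a) \<bullet> e) (act F a (\<rho> a) (i a \<bullet> star) s)
          = act G a (\<rho> a) (i a \<bullet> star) (evl (FOb F a) (FOb G a) (\<tau> a \<bullet> e) s)"
          using \<tau> by (simp add: wedge_def)
        ultimately show "evl (FOb F a) (FOb G a) ((\<pi>' a \<cdot> h) \<bullet> e) s = evl (FOb F a) (FOb G a) (\<tau> a \<bullet> e) s"
          by (simp add: retract_cancel[OF r G])
      qed simp_all
    qed
  qed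
  show "\<exists>e \<pi>. is_end V A VV F G e \<pi>"
    unfolding is_end_def wedge_iff[OF F G]
  proof (intro exI[of _ x] exI[of _ \<pi>'] conjI allI impI)
    show "wedge A F G x \<pi>'" by (rule w')
    fix y \<tau> assume \<tau>: "wedge A F G y \<tau>"
    have "wedge (A\<lparr>VOb := S\<rparr>) F G y \<tau>"
      by (rule wedgeI) (use \<tau> in \<open>simp_all add: wedge_def\<close>)
    then show "\<exists>!h. h \<in> hom V y x \<and> (\<forall>a\<in>VOb A. \<pi>' a \<cdot> h = \<tau> a)"
      using univ determined[OF \<tau>] by (simp cong: conj_cong)
  qed
qed

text \<open>Dually to ends, \<open>Z b c = \<phi> c \<otimes> (B(b,c) \<otimes> T b)\<close> is the
  top of a span: the arrow acts on \<phi> along \<open>l\<close> and on \<open>T\<close> along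
  \<open>r\<close>, and the balancing condition equates the two composites.\<close>

lemma colim_over_basis:
  fixes U S :: "'u set"
  assumes B: "vcategory V B" and \<phi>: "vfunctor V (opp V B) VV \<phi>" and T: "vfunctor V B VV T" and SB [simp]: "\<And>b. b \<in> S \<Longrightarrow> b \<in> VOb B"
    and U: "smallness_universe U" and S: "S \<prec> U" and cocomplete: "small_cocomplete U V"
  obtains C \<beta> where "cobalanced (B\<lparr>VOb := S\<rparr>) \<phi> T C \<beta>"
    "\<And>y \<sigma>. cobalanced (B\<lparr>VOb := S\<rparr>) \<phi> T y \<sigma> \<Longrightarrow> \<exists>!h. h \<in> hom V C y \<and> (\<forall>b\<in>S. h \<cdot> \<beta> b = \<sigma> b)"
proof -
  note [simp] = weight_rules[OF B \<phi> T]
  define X where "X b = FOb \<phi> b \<odot> FOb T b" for b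
  define Z where "Z b c = FOb \<phi> c \<odot> (VHom B b c \<odot> FOb T b)" for b c
  define l where "l b c = ((ev V (FOb \<phi> c) (FOb \<phi> b) \<cdot> (FHom \<phi> c b \<otimes> \<one> (FOb \<phi> c)) \<cdot> symm V (FOb \<phi> c) (VHom B b c)) \<otimes> \<one> (FOb T b))
    \<cdot> ainv (FOb \<phi> c) (VHom B b c) (FOb T b)" for b c
  define r where "r b c = \<one> (FOb \<phi> c) \<otimes> (ev V (FOb T b) (FOb T c) \<cdot> (FHom T b c \<otimes> \<one> (FOb T b)))" for b c
  have lr [simp]: "l b c \<in> Arr V" "Dom V (l b c) = Z b c" "Cod V (l b c) = X b" "r b c \<in> Arr V" "Dom V (r b c) = Z b c" "Cod V (r b c) = X c"
    if "b \<in> S" "c \<in> S" for b c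
    using that by (simp_all add: l_def r_def X_def Z_def)
  have lr_el [simp]: "l b c \<bullet> \<langle>q, \<langle>f, s\<rangle>\<rangle> = \<langle>ev V (FOb \<phi> c) (FOb \<phi> b) \<bullet> \<langle>FHom \<phi> c b \<bullet> f, q\<rangle>, s\<rangle>"
      "r b c \<bullet> \<langle>q, \<langle>f, s\<rangle>\<rangle> = \<langle>q, act T b c f s\<rangle>"
    if "b \<in> S" "c \<in> S" "el q" "ty q = FOb \<phi> c" "el f" "ty f = VHom B b c" "el s" "ty s = FOb T b" "q \<sharp> f" "f \<sharp> q" "q \<sharp> s" "f \<sharp> s" for b c q f s
    using that by (simp_all add: l_def r_def)
  have cobal: "cobalanced (B\<lparr>VOb := S\<rparr>) \<phi> T y \<sigma> \<longleftrightarrow> y \<in> Ob V \<and> (\<forall>b\<in>S. \<sigma> b \<in> hom V (X b) y) \<and> (\<forall>b\<in>S. \<forall>c\<in>S. \<sigma> b \<cdot> l b c = \<sigma> c \<cdot> r b c)" for y \<sigma>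
  proof
    assume w: "cobalanced (B\<lparr>VOb := S\<rparr>) \<phi> T y \<sigma>"
    then have [simp]: "y \<in> Ob V" "b \<in> S \<Longrightarrow> \<sigma> b \<in> Arr V" "b \<in> S \<Longrightarrow> Dom V (\<sigma> b) = X b" "b \<in> S \<Longrightarrow> Cod V (\<sigma> b) = y" for b
      by (simp_all add: cobalanced_def X_def)
    have "\<sigma> b \<cdot> l b c = \<sigma> c \<cdot> r b c" if [simp]: "b \<in> S" "c \<in> S" for b c
      by (rule arrow_ext3_right[of _ _ "FOb \<phi> c" "VHom B b c" "FOb T b"]) (use w in \<open>simp_all add: cobalanced_def Z_def\<close>)
    then show "y \<in> Ob V \<and> (\<forall>b\<in>S. \<sigma> b \<in> hom V (X b) y) \<and> (\<forall>b\<in>S. \<forall>c\<in>S. \<sigma> b \<cdot> l b c = \<sigma> c \<cdot> r b c)" by (simp add: hom_iff)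
  next
    assume w: "y \<in> Ob V \<and> (\<forall>b\<in>S. \<sigma> b \<in> hom V (X b) y) \<and> (\<forall>b\<in>S. \<forall>c\<in>S. \<sigma> b \<cdot> l b c = \<sigma> c \<cdot> r b c)"
    then have t [simp]: "y \<in> Ob V" "b \<in> S \<Longrightarrow> \<sigma> b \<in> Arr V" "b \<in> S \<Longrightarrow> Dom V (\<sigma> b) = X b" "b \<in> S \<Longrightarrow> Cod V (\<sigma> b) = y" for b
      by (simp_all add: hom_iff)
    show "cobalanced (B\<lparr>VOb := S\<rparr>) \<phi> T y \<sigma>"
    proof (rule cobalancedI)
      fix b c q f s
      assume "b \<in> VOb (B\<lparr>VOb := S\<rparr>)" "c \<in> VOb (B\<lparr>VOb := S\<rparr>)" "el q" "ty q = FOb \<phi> c" "el f" "ty f = VHom (B\<lparr>VOb := S\<rparr>) b c" "el s" "ty s = FOb T b"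
        "q \<sharp> f" "f \<sharp> q" "q \<sharp> s" "s \<sharp> q" "f \<sharp> s" "s \<sharp> f"
      then have [simp]: "b \<in> S" "c \<in> S" "el q" "ty q = FOb \<phi> c" "el f" "ty f = VHom B b c" "el s" "ty s = FOb T b"
        "q \<sharp> f" "f \<sharp> q" "q \<sharp> s" "s \<sharp> q" "f \<sharp> s" "s \<sharp> f" by simp_all
      have "\<sigma> b \<cdot> l b c = \<sigma> c \<cdot> r b c" using w by simp
      then have "(\<sigma> b \<cdot> l b c) \<bullet> \<langle>q, \<langle>f, s\<rangle>\<rangle> = (\<sigma> c \<cdot> r b c) \<bullet> \<langle>q, \<langle>f, s\<rangle>\<rangle>" by (rule arg_cong)
      then show "\<sigma> b \<bullet> \<langle>ev V (FOb \<phi> c) (FOb \<phi> b) \<bullet> \<langle>FHom \<phi> c b \<bullet> f, q\<rangle>, s\<rangle> = \<sigma> c \<bullet> \<langle>q, act T b c f s\<rangle>"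
        by (simp add: Z_def)
    qed (simp_all add: X_def[symmetric])
  qed
  show ?thesis
  proof (rule span_colimit[OF U cocomplete S, of X Z l r])
    fix C \<beta>
    assume "C \<in> Ob V" "\<And>b. b \<in> S \<Longrightarrow> \<beta> b \<in> hom V (X b) C" "\<And>b c. \<lbrakk>b \<in> S; c \<in> S\<rbrakk> \<Longrightarrow> \<beta> b \<cdot> l b c = \<beta> c \<cdot> r b c"
      and univ: "\<And>x \<tau>. \<lbrakk>x \<in> Ob V; \<And>a. a \<in> S \<Longrightarrow> \<tau> a \<in> hom V (X a) x; \<And>a b. \<lbrakk>a \<in> S; b \<in> S\<rbrakk> \<Longrightarrow> \<tau> a \<cdot> l a b = \<tau> b \<cdot> r a b\<rbrakk>
      \<Longrightarrow> \<exists>!h. h \<in> hom V C x \<and> (\<forall>a\<in>S. h \<cdot> \<beta> a = \<tau> a)"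
    then have w: "cobalanced (B\<lparr>VOb := S\<rparr>) \<phi> T C \<beta>" unfolding cobal by simp
    show thesis
      by (rule that[OF w]) (rule univ, simp_all add: cobal)
  qed (simp_all add: hom_iff X_def Z_def l_def r_def)
qed

lemma cobalanced_colim_exists:
  fixes U S :: "'u set"
  assumes r: "retract_basis B S \<rho> i j" and \<phi>: "vfunctor V (opp V B) VV \<phi>" and T: "vfunctor V B VV T"
    and U: "smallness_universe U" and S: "S \<prec> U" and cocomplete: "small_cocomplete U V"
  obtains C \<beta> where "cobalanced B \<phi> T C \<beta>"
    "\<And>y \<sigma>. cobalanced B \<phi> T y \<sigma> \<Longrightarrow> \<exists>!h. h \<in> hom V C y \<and> (\<forall>b\<in>VOb B. h \<cdot> \<beta> b = \<sigma> b)"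
proof -
  note R [simp] = retract_basisD(1-10)[OF r]
  have B: "vcategory V B" by simp
  note FG [simp] = weight_typing[OF \<phi>] vfunctor_typing[OF T] vfunctor_self_Ob[OF T]
  obtain C \<beta> where w: "cobalanced (B\<lparr>VOb := S\<rparr>) \<phi> T C \<beta>"
    and univ: "\<And>y \<sigma>. cobalanced (B\<lparr>VOb := S\<rparr>) \<phi> T y \<sigma> \<Longrightarrow> \<exists>!h. h \<in> hom V C y \<and> (\<forall>b\<in>S. h \<cdot> \<beta> b = \<sigma> b)"
    by (rule colim_over_basis[OF B \<phi> T R(2) U S cocomplete], assumption, rule that)
  have C [simp]: "C \<in> Ob V" and \<beta> [simp]: "b \<in> S \<Longrightarrow> \<beta> b \<in> Arr V" "b \<in> S \<Longrightarrow> Dom V (\<beta> b) = FOb \<phi> b \<odot> FOb T b" "b \<in> S \<Longrightarrow> Cod V (\<beta> b) = C" for b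
    using cobalancedD(1-4)[OF w] by simp_all
  have \<beta>_bal: "\<beta> b \<bullet> \<langle>ev V (FOb \<phi> c) (FOb \<phi> b) \<bullet> \<langle>FHom \<phi> c b \<bullet> f, q\<rangle>, s\<rangle> = \<beta> c \<bullet> \<langle>q, act T b c f s\<rangle>"
    if "b \<in> S" "c \<in> S" "el q" "ty q = FOb \<phi> c" "el f" "ty f = VHom B b c" "el s" "ty s = FOb T b" "q \<sharp> f" "q \<sharp> s" "f \<sharp> s" for b c q f s
    using cobalancedD(5)[OF w, of b c q f s] that by simp
  have T_cancel: "act T (\<rho> b) b (j b \<bullet> star) (act T b (\<rho> b) (i b \<bullet> star) s) = s"
    if "b \<in> VOb B" "el s" "ty s = FOb T b" for b s
    using retract_cancel[OF r T] that by simp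
  have \<phi>_cancel: "act \<phi> (\<rho> b) b (i b \<bullet> star) (act \<phi> b (\<rho> b) (j b \<bullet> star) q) = q"
    if "b \<in> VOb B" "el q" "ty q = FOb \<phi> b" for b q
    using retract_cancel[OF retract_basis_opp[OF r] \<phi>] that by simp
  \<comment> \<open>Over an object outside \<open>S\<close>, \<open>q\<close> is carried to the
    retract along \<open>j b\<close> and \<open>s\<close> along \<open>i b\<close>. Moving
    \<open>i b\<close> back across the tensor product cancels it against \<open>j b\<close>.\<close>
  define \<beta>' where "\<beta>' b = \<beta> (\<rho> b) \<cdot> ((ev V (FOb \<phi> b) (FOb \<phi> (\<rho> b)) \<cdot> ((FHom \<phi> b (\<rho> b) \<cdot> j b) \<otimes> \<one> (FOb \<phi> b)) \<cdot> linv (FOb \<phi> b))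
    \<otimes> (ev V (FOb T b) (FOb T (\<rho> b)) \<cdot> ((FHom T b (\<rho> b) \<cdot> i b) \<otimes> \<one> (FOb T b)) \<cdot> linv (FOb T b)))" for b
  have \<beta>' [simp]: "\<beta>' b \<in> Arr V" "Dom V (\<beta>' b) = FOb \<phi> b \<odot> FOb T b" "Cod V (\<beta>' b) = C" if "b \<in> VOb B" for b
    using that by (simp_all add: \<beta>'_def)
  have \<beta>'_el [simp]: "\<beta>' b \<bullet> \<langle>q, s\<rangle> = \<beta> (\<rho> b) \<bullet> \<langle>ev V (FOb \<phi> b) (FOb \<phi> (\<rho> b)) \<bullet> \<langle>FHom \<phi> b (\<rho> b) \<bullet> j b \<bullet> star, q\<rangle>,
      act T b (\<rho> b) (i b \<bullet> star) s\<rangle>"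
    if "b \<in> VOb B" "el q" "ty q = FOb \<phi> b" "el s" "ty s = FOb T b" "q \<sharp> s" for b q s
    using that by (simp add: \<beta>'_def)
  have \<beta>'_\<beta>: "\<beta>' b = \<beta> b" if b [simp]: "b \<in> S" for b
  proof (rule arrow_ext2[of _ _ "FOb \<phi> b" "FOb T b"])
    fix q s assume [simp]: "el q" "ty q = FOb \<phi> b" "el s" "ty s = FOb T b" "q \<sharp> s" "s \<sharp> q"
    show "\<beta>' b \<bullet> \<langle>q, s\<rangle> = \<beta> b \<bullet> \<langle>q, s\<rangle>"
      by (simp add: \<beta>_bal[symmetric] \<phi>_cancel)
  qed simp_all
  have w': "cobalanced B \<phi> T C \<beta>'"
  proof (rule cobalancedI)
    fix b c q f s
    assume [simp]: "b \<in> VOb B" "c \<in> VOb B" "el q" "ty q = FOb \<phi> c" "el f" "ty f = VHom B b c" "el s" "ty s = FOb T b"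
        "q \<sharp> f" "f \<sharp> q" "q \<sharp> s" "s \<sharp> q" "f \<sharp> s" "s \<sharp> f"
    define f' where "f' = cmp B (\<rho> b) b (\<rho> c) (cmp B b c (\<rho> c) (i c \<bullet> star) f) (j b \<bullet> star)"
    have f' [simp]: "el f'" "ty f' = VHom B (\<rho> b) (\<rho> c)" "f' \<sharp> q" "f' \<sharp> s" "q \<sharp> f'" "s \<sharp> f'"
      by (simp_all add: f'_def)
    note sl = retract_slide[OF r \<open>b \<in> VOb B\<close> \<open>c \<in> VOb B\<close> \<open>el f\<close> \<open>ty f = VHom B b c\<close>, folded f'_def]
    have 1: "act \<phi> b (\<rho> b) (j b \<bullet> star) (act \<phi> c b f q)
      = act \<phi> (\<rho> c) (\<rho> b) f' (act \<phi> c (\<rho> c) (j c \<bullet> star) q)"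
      using functor_comp_el[OF \<phi>, of c b "\<rho> b" "j b \<bullet> star" f q] functor_comp_el[OF \<phi>, of c "\<rho> c" "\<rho> b" f' "j c \<bullet> star" q] sl(2) by simp
    have 2: "act T (\<rho> b) (\<rho> c) f' (act T b (\<rho> b) (i b \<bullet> star) s)
      = act T c (\<rho> c) (i c \<bullet> star) (act T b c f s)"
      using functor_comp_el[OF T, of b "\<rho> b" "\<rho> c" f' "i b \<bullet> star" s] functor_comp_el[OF T, of b c "\<rho> c" "i c \<bullet> star" f s] sl(1) by simp
    show "\<beta>' b \<bullet> \<langle>ev V (FOb \<phi> c) (FOb \<phi> b) \<bullet> \<langle>FHom \<phi> c b \<bullet> f, q\<rangle>, s\<rangle> = \<beta>' c \<bullet> \<langle>q, act T b c f s\<rangle>"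
      by (simp add: 1 \<beta>_bal 2)
  qed simp_all
  have determined: "(\<forall>b\<in>VOb B. h \<cdot> \<beta>' b = \<sigma> b) \<longleftrightarrow> (\<forall>b\<in>S. h \<cdot> \<beta> b = \<sigma> b)" if \<sigma>: "cobalanced B \<phi> T y \<sigma>" and h: "h \<in> hom V C y" for y \<sigma> h
  proof
    note \<sigma>t [simp] = cobalancedD(1-4)[OF \<sigma>]
    have [simp]: "h \<in> Arr V" "Dom V h = C" "Cod V h = y" using h by (auto simp: hom_iff)
    show "\<forall>b\<in>S. h \<cdot> \<beta> b = \<sigma> b" if "\<forall>b\<in>VOb B. h \<cdot> \<beta>' b = \<sigma> b" using that \<beta>'_\<beta> R(2) by metis
    show "\<forall>b\<in>VOb B. h \<cdot> \<beta>' b = \<sigma> b" if eq: "\<forall>b\<in>S. h \<cdot> \<beta> b = \<sigma> b"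
    proof
      fix b assume b [simp]: "b \<in> VOb B"
      show "h \<cdot> \<beta>' b = \<sigma> b"
      proof (rule arrow_ext2[of _ _ "FOb \<phi> b" "FOb T b"])
        fix q s assume [simp]: "el q" "ty q = FOb \<phi> b" "el s" "ty s = FOb T b" "q \<sharp> s" "s \<sharp> q"
        let ?q = "act \<phi> b (\<rho> b) (j b \<bullet> star) q"
        let ?s = "act T b (\<rho> b) (i b \<bullet> star) s"
        have "(h \<cdot> \<beta> (\<rho> b)) \<bullet> \<langle>?q, ?s\<rangle> = \<sigma> (\<rho> b) \<bullet> \<langle>?q, ?s\<rangle>" using eq by simp
        then have "h \<bullet> \<beta> (\<rho> b) \<bullet> \<langle>?q, ?s\<rangle> = \<sigma> (\<rho> b) \<bullet> \<langle>?q, ?s\<rangle>" by simp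
        also have "\<dots> = \<sigma> b \<bullet> \<langle>q, s\<rangle>"
          using cobalancedD(5)[OF \<sigma>, of b "\<rho> b" ?q "i b \<bullet> star" s] by (simp add: \<phi>_cancel)
        finally show "(h \<cdot> \<beta>' b) \<bullet> \<langle>q, s\<rangle> = \<sigma> b \<bullet> \<langle>q, s\<rangle>" by simp
      qed simp_all
    qed
  qed
  show ?thesis
  proof (rule that[OF w'])
    fix y \<sigma> assume \<sigma>: "cobalanced B \<phi> T y \<sigma>"
    have "cobalanced (B\<lparr>VOb := S\<rparr>) \<phi> T y \<sigma>"
      by (rule cobalancedI) (simp_all add: cobalancedD[OF \<sigma>])
    then show "\<exists>!h. h \<in> hom V C y \<and> (\<forall>b\<in>VOb B. h \<cdot> \<beta>' b = \<sigma> b)"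
      using univ determined[OF \<sigma>] by (simp cong: conj_cong)
  qed
qed

text \<open>\<open>cobalanced_colim_exists\<close> gives the universal property without a context.
  Closedness supplies the context: a balanced family in context \<open>x\<close> with values in
  \<open>y\<close> is one without context and with values in \<open>[x,y]\<close>.\<close>

lemma colim_exists_small:
  fixes U S :: "'u set"
  assumes r: "retract_basis B S \<rho> i j" and \<phi>: "vfunctor V (opp V B) VV \<phi>" and T: "vfunctor V B VV T"
    and U: "smallness_universe U" and S: "S \<prec> U" and cocomplete: "small_cocomplete U V"
  shows "\<exists>C \<beta>. colim B \<phi> T C \<beta>"
proof -
  note [simp] = weight_rules[OF retract_basisD(1)[OF r] \<phi> T]
  obtain C \<beta> where w: "cobalanced B \<phi> T C \<beta>"
    and univ: "\<And>y \<sigma>. cobalanced B \<phi> T y \<sigma> \<Longrightarrow> \<exists>!h. h \<in> hom V C y \<and> (\<forall>b\<in>VOb B. h \<cdot> \<beta> b = \<sigma> b)"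
    by (rule cobalanced_colim_exists[OF r \<phi> T U S cocomplete], rule that)
  note [simp] = cobalancedD(1-4)[OF w]
  have "\<exists>!h. extends B \<phi> T C \<beta> x y \<sigma> h" if x [simp]: "x \<in> Ob V" and y [simp]: "y \<in> Ob V" and \<sigma>: "balanced B \<phi> T x y \<sigma>" for x y \<sigma>
  proof -
    note [simp] = balancedD(1-3)[OF \<sigma>]
    let ?\<sigma> = "\<lambda>b. transp V (FOb \<phi> b \<odot> FOb T b) x y (\<sigma> b \<cdot> ainv x (FOb \<phi> b) (FOb T b) \<cdot> symm V (FOb \<phi> b \<odot> FOb T b) x)"
    have \<sigma>': "cobalanced B \<phi> T (ihom V x y) ?\<sigma>"
    proof (rule cobalancedI)
      fix b c q f s
      assume [simp]: "b \<in> VOb B" "c \<in> VOb B" "el q" "ty q = FOb \<phi> c" "el f" "ty f = VHom B b c" "el s" "ty s = FOb T b"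
          "q \<sharp> f" "f \<sharp> q" "q \<sharp> s" "s \<sharp> q" "f \<sharp> s" "s \<sharp> f"
      show "?\<sigma> b \<bullet> \<langle>ev V (FOb \<phi> c) (FOb \<phi> b) \<bullet> \<langle>FHom \<phi> c b \<bullet> f, q\<rangle>, s\<rangle> = ?\<sigma> c \<bullet> \<langle>q, act T b c f s\<rangle>"
        by (rule eval_ext[of _ x y]) (simp_all add: ectx_ac balancedD(4)[OF \<sigma>])
    qed simp_all
    have ext: "transp V C x y (h \<cdot> symm V C x) \<in> hom V C (ihom V x y) \<and> (\<forall>b\<in>VOb B. transp V C x y (h \<cdot> symm V C x) \<cdot> \<beta> b = ?\<sigma> b)"
      if h: "extends B \<phi> T C \<beta> x y \<sigma> h" for h
    proof (intro conjI ballI)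
      note [simp] = extendsD(1-3)[OF h]
      show "transp V C x y (h \<cdot> symm V C x) \<in> hom V C (ihom V x y)" by (simp add: hom_iff)
      fix b assume [simp]: "b \<in> VOb B"
      show "transp V C x y (h \<cdot> symm V C x) \<cdot> \<beta> b = ?\<sigma> b"
      proof (rule arrow_ext2[of _ _ "FOb \<phi> b" "FOb T b"])
        fix q s assume [simp]: "el q" "ty q = FOb \<phi> b" "el s" "ty s = FOb T b" "q \<sharp> s" "s \<sharp> q"
        have "transp V C x y (h \<cdot> symm V C x) \<bullet> \<beta> b \<bullet> \<langle>q, s\<rangle> = ?\<sigma> b \<bullet> \<langle>q, s\<rangle>"
          by (rule eval_ext[of _ x y]) (simp_all add: extendsD(4)[OF h])
        then show "(transp V C x y (h \<cdot> symm V C x) \<cdot> \<beta> b) \<bullet> \<langle>q, s\<rangle> = ?\<sigma> b \<bullet> \<langle>q, s\<rangle>" by simp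
      qed simp_all
    qed
    obtain k where k: "k \<in> hom V C (ihom V x y)" "\<forall>b\<in>VOb B. k \<cdot> \<beta> b = ?\<sigma> b" using univ[OF \<sigma>'] by blast
    have [simp]: "k \<in> Arr V" "Dom V k = C" "Cod V k = ihom V x y" using k(1) by (simp_all add: hom_iff)
    have k_el: "k \<bullet> \<beta> b \<bullet> \<langle>q, s\<rangle> = ?\<sigma> b \<bullet> \<langle>q, s\<rangle>" if [simp]: "b \<in> VOb B" "el q" "ty q = FOb \<phi> b" "el s" "ty s = FOb T b" "q \<sharp> s" for b q s
    proof -
      have "(k \<cdot> \<beta> b) \<bullet> \<langle>q, s\<rangle> = ?\<sigma> b \<bullet> \<langle>q, s\<rangle>" using k(2) by simp
      then show ?thesis by simp
    qed
    show ?thesis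
    proof (rule ex1I)
      show "extends B \<phi> T C \<beta> x y \<sigma> (ev V x y \<cdot> (k \<otimes> \<one> x) \<cdot> symm V x C)"
        by (rule extendsI) (simp_all add: k_el)
      fix h assume h: "extends B \<phi> T C \<beta> x y \<sigma> h"
      note [simp] = extendsD(1-3)[OF h]
      have eq: "transp V C x y (h \<cdot> symm V C x) = k" using univ[OF \<sigma>'] ext[OF h] k by blast
      show "h = ev V x y \<cdot> (k \<otimes> \<one> x) \<cdot> symm V x C"
        by (rule arrow_ext2[of _ _ x C]) (simp_all add: eq[symmetric])
    qed
  qed
  then show ?thesis using w unfolding colim_def by blast
qed

end

theorem proposition6p20:
  fixes U :: "'u set" and V :: "('o, 'a) smc"
    and B :: "('u, 'o, 'a) vcat" and \<phi> :: "('u, 'o, 'a) vfun"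
  assumes "smallness_universe U"
    and "smcc V" and "locally_small U V" and "small_complete U V" and "small_cocomplete U V"
    and "vcategory V B" and "small_vcat U V B"
    and "is_weight V B \<phi>"
  shows "(small_projective U V B \<phi>
            \<longleftrightarrow> v_representable V (functor_cat V B (self_enriched V)) (wcolim_functor V B \<phi>))
       \<and> (v_representable V (functor_cat V B (self_enriched V)) (wcolim_functor V B \<phi>)
            \<longleftrightarrow> v_continuous U V (functor_cat V B (self_enriched V)) (self_enriched V) (wcolim_functor V B \<phi>))
       \<and> (v_continuous U V (functor_cat V B (self_enriched V)) (self_enriched V) (wcolim_functor V B \<phi>)
            \<longleftrightarrow> preserves_wlimit V (functor_cat V B (self_enriched V)) (self_enriched V) (wcolim_functor V B \<phi>)
                  B \<phi> (yoneda' V B))"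
proof -
  interpret smcc V by fact
  note U = \<open>smallness_universe U\<close> and complete = \<open>small_complete U V\<close> and w = \<open>is_weight V B \<phi>\<close>
  \<comment> \<open>The same basis serves \<open>K\<close> and its opposite, with the roles of
    \<open>i\<close> and \<open>j\<close> exchanged.\<close>
  have ends: "ends_exist K" "ends_exist (opp V K)" if K: "vcategory V K" "small_vcat U V K" for K :: "('u, 'o, 'a) vcat"
  proof -
    obtain S \<rho> i j where S: "S \<prec> U" "retract_basis K S \<rho> i j" by (rule small_retract_basis[OF K])
    show "ends_exist K" by (rule ends_exist_small[OF S(2) U S(1) complete])
    show "ends_exist (opp V K)" by (rule ends_exist_small[OF retract_basis_opp[OF S(2)] U S(1) complete])
  qed
  note B = \<open>vcategory V B\<close> \<open>small_vcat U V B\<close> and \<phi> = w[unfolded is_weight_def]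
  obtain S \<rho> i j where S: "S \<prec> U" "retract_basis B S \<rho> i j" by (rule small_retract_basis[OF B])
  have "\<exists>C \<beta>. colim B \<phi> T C \<beta>" if "vfunctor V B VV T" for T
    by (rule colim_exists_small[OF S(2) \<phi> that U S(1) \<open>small_cocomplete U V\<close>])
  then interpret small_weight V B \<phi>
    by (rule small_weight.intro[OF smcc_axioms small_weight_axioms.intro[OF ends[OF B] \<phi>]])
  have "small_projective U V B \<phi> \<longleftrightarrow> (\<exists>u. dual_point u)"
  proof
    assume "small_projective U V B \<phi>"
    \<comment> \<open>The quantified indexing category and weight are instantiated with
      \<open>B\<close> and \<phi> themselves; the types permit this because the objects of
      \<open>B\<close> lie in \<open>'u\<close>.\<close>
    then have "preserves_wcolimit V PP VV (cov_hom V PP \<phi>) B \<phi> Y"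
      unfolding small_projective_def v_cocontinuous_def using B w Y_rules(1) by blast
    then show "\<exists>u. dual_point u" by (rule preserves_coyoneda_dual_point)
  next
    assume "\<exists>u. dual_point u"
    then obtain u where u: "dual_point u" ..
    show "small_projective U V B \<phi>"
      unfolding small_projective_def v_cocontinuous_def
    proof (intro allI impI, elim conjE)
      fix K :: "('u, 'o, 'a) vcat" and \<chi> T
      assume K: "vcategory V K" "small_vcat U V K" and \<chi>: "is_weight V K \<chi>" and T: "vfunctor V K PP T"
      show "preserves_wcolimit V PP VV (cov_hom V PP \<phi>) K \<chi> T"
        by (rule dual_point_small_projective[OF u T \<chi> ends(2)[OF K]])
    qed
  qed
  moreover have "v_representable V (Fun B) WF" if "\<exists>u. dual_point u"
    using that dual_point_representable by blast
  moreover have "v_continuous U V (Fun B) VV WF" if rep: "v_representable V (Fun B) WF"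
    unfolding v_continuous_def
  proof (intro allI impI, elim conjE)
    fix K :: "('u, 'o, 'a) vcat" and \<chi> T
    assume K: "vcategory V K" "small_vcat U V K" and \<chi>: "is_weight V K \<chi>" and T: "vfunctor V (opp V K) (Fun B) T"
    show "preserves_wlimit V (Fun B) VV WF K \<chi> T"
      by (rule representable_preserves_wlimit[OF T \<chi> vfunctor_WF ends(2)[OF K] rep])
  qed
  moreover have "preserves_wlimit V (Fun B) VV WF B \<phi> (yoneda' V B)" if "v_continuous U V (Fun B) VV WF"
    using that B w yoneda'_rules(1) unfolding v_continuous_def by blast
  moreover have "\<exists>u. dual_point u" if "preserves_wlimit V (Fun B) VV WF B \<phi> (yoneda' V B)"
    using that by (rule preserves_yoneda_limit_dual_point)
  ultimately show ?thesis by blast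
qed

end
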